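(* Let $T>0$ and let $G\subset[0,T]\times[0,2\pi]$ be a measurable set. Then the following are equivalent: (1) (Observability on $G$) there exists a constant $C>0$ such that for every $(u_0,u_1)\in H^1(\mathbb{T})\times L^2(\mathbb{T})$ the solution $u$ of $(\partial_t^2-\partial_x^2)u=0$, $(u,\partial_t u)|_{t=0}=(u_0,u_1)$, satisfies $$\|\partial_x u_0\|_{L^2(\mathbb{T})}^2+\|u_1\|_{L^2(\mathbb{T})}^2\le C\iint_G|\partial_t u(t,x)|^2\,dx\,dt;$$ (2) $G$ satisfies both (OSC) and (GCC).
   Context: $\mathbb{T}=\mathbb{R}/2\pi\mathbb{Z}$, and functions on $\mathbb{T}$ are identified with $2\pi$-periodic functions on $\mathbb{R}$. Functions are real-valued. The solution $u$ is the unique one with $(u,\partial_t u)\in C([0,T];H^1(\mathbb{T})\times L^2(\mathbb{T}))$. Points $(t,x)$ have time coordinate $t$ first. $|A|$ is Lebesgue measure of $A\subset\mathbb{R}$; $\mathrm{meas}_{\mathbb{R}}$ of a subset of lines in the plane is one-dimensional Lebesgue (arclength) measure; $\mathrm{meas}_{\mathbb{R}^2}$ is planar Lebesgue measure. (GCC): a measurable $G\subset[0,T]\times[0,2\pi]$ satisfies (GCC) if there exists $c_0>0$ such that for almost every $x\in[0,2\pi]$, $$\mathrm{meas}_{\mathbb{R}}\big(G\cap\{(s,x+s):s\in[0,T]\}\big)\ge c_0,\qquad \mathrm{meas}_{\mathbb{R}}\big(G\cap\{(s,x-s):s\in[0,T]\}\big)\ge c_0,$$ where $(t,x+2k\pi)$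 is identified with $(t,x)$ for all $k\in\mathbb{Z}$. For measurable $A,B\subset[0,2\pi]$ and $T\geq 0$ set $$L_{\xi\in A}^T=\{(t,x)\in[0,T]\times\mathbb{R}:\ x+t\in A+2\pi\mathbb{Z}\},\qquad L_{\eta\in B}^T=\{(t,x)\in[0,T]\times\mathbb{R}:\ x-t\in B+2\pi\mathbb{Z}\}.$$ $G$ is $(A,B;T)$-observable symmetric if $\mathrm{meas}_{\mathbb{R}^2}\big([G\cap L_{\xi\in A}^T]\,\Delta\,[G\cap L_{\eta\in B}^T]\big)=0$, where $\Delta$ is the symmetric difference. A pair $(A,B)$ is trivial if $|A|=|B|=0$ or $|A|=|B|=2\pi$, and non-trivial otherwise. (OSC): $G$ satisfies (OSC) if for every non-trivial pair $(A,B)$ of measurable subsets of $[0,2\pi]$, $G$ is not $(A,B;T)$-observable symmetric. *)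

theory Defs
  imports "HOL-Analysis.Analysis"
begin

section \<open>Function spaces on the torus \<open>\<real>/2\<pi>\<int>\<close>\<close>

text \<open>
  Functions on the torus are \<open>2\<pi>\<close>-periodic functions on the line. Elements of \<open>L\<^sup>2\<close> and \<open>H\<^sup>1\<close>
  are represented by individual functions instead of classes modulo equality almost everywhere.
\<close>

definition periodic :: "(real \<Rightarrow> real) \<Rightarrow> bool" where
  "periodic f \<longleftrightarrow> (\<forall>x. f (x + 2 * pi) = f x)"

definition L2_torus :: "(real \<Rightarrow> real) set" where
  "L2_torus = {f. periodic f \<and> f \<in> borel_measurable lebesgue \<and>
                  set_integrable lebesgue {0..2 * pi} (\<lambda>x. (f x)\<^sup>2)}"

definition L2_norm :: "(real \<Rightarrow> real) \<Rightarrow> real" where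
  "L2_norm f = sqrt (LINT x:{0..2 * pi}|lebesgue. (f x)\<^sup>2)"

definition smooth_torus :: "(real \<Rightarrow> real) \<Rightarrow> bool" where
  "smooth_torus \<phi> \<longleftrightarrow> periodic \<phi> \<and> (\<forall>n x. (deriv ^^ n) \<phi> differentiable at x)"

definition has_weak_deriv :: "(real \<Rightarrow> real) \<Rightarrow> (real \<Rightarrow> real) \<Rightarrow> bool" where
  "has_weak_deriv f g \<longleftrightarrow> g \<in> L2_torus \<and>
     (\<forall>\<phi>. smooth_torus \<phi> \<longrightarrow>
        (LINT x:{0..2 * pi}|lebesgue. f x * deriv \<phi> x) =
        - (LINT x:{0..2 * pi}|lebesgue. g x * \<phi> x))"

definition H1_torus :: "(real \<Rightarrow> real) set" where
  "H1_torus = {f \<in> L2_torus. \<exists>g. has_weak_deriv f g}"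

text \<open>A weak derivative is unique almost everywhere, so its \<open>L\<^sup>2\<close> norm does not depend on the choice.\<close>

definition weak_deriv :: "(real \<Rightarrow> real) \<Rightarrow> real \<Rightarrow> real" where
  "weak_deriv f = (SOME g. has_weak_deriv f g)"

definition H1_norm :: "(real \<Rightarrow> real) \<Rightarrow> real" where
  "H1_norm f = sqrt ((L2_norm f)\<^sup>2 + (L2_norm (weak_deriv f))\<^sup>2)"

text \<open>
  \<open>C_curve T X N w\<close>: the curve \<open>t \<mapsto> w t\<close> belongs to \<open>C([0,T]; X)\<close>, where \<open>X\<close> carries the norm \<open>N\<close>.
\<close>

definition C_curve ::
  "real \<Rightarrow> (real \<Rightarrow> real) set \<Rightarrow> ((real \<Rightarrow> real) \<Rightarrow> real) \<Rightarrow> (real \<Rightarrow> real \<Rightarrow> real) \<Rightarrow> bool" where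
  "C_curve T X N w \<longleftrightarrow> (\<forall>s\<in>{0..T}. w s \<in> X \<and>
     ((\<lambda>t. N (\<lambda>x. w t x - w s x)) \<longlongrightarrow> 0) (at s within {0..T}))"

section \<open>The wave equation\<close>

text \<open>Functions of time and space are curried, time first.\<close>

definition dt :: "(real \<Rightarrow> real \<Rightarrow> real) \<Rightarrow> real \<Rightarrow> real \<Rightarrow> real" where
  "dt \<phi> = (\<lambda>t x. deriv (\<lambda>s. \<phi> s x) t)"

definition dx :: "(real \<Rightarrow> real \<Rightarrow> real) \<Rightarrow> real \<Rightarrow> real \<Rightarrow> real" where
  "dx \<phi> = (\<lambda>t x. deriv (\<lambda>y. \<phi> t y) x)"

primrec C_k :: "nat \<Rightarrow> (real \<Rightarrow> real \<Rightarrow> real) \<Rightarrow> bool" where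
  "C_k 0 \<phi> \<longleftrightarrow> continuous_on UNIV (\<lambda>(t, x). \<phi> t x)"
| "C_k (Suc k) \<phi> \<longleftrightarrow> continuous_on UNIV (\<lambda>(t, x). \<phi> t x) \<and>
     (\<forall>t x. (\<lambda>s. \<phi> s x) differentiable at t \<and> (\<lambda>y. \<phi> t y) differentiable at x) \<and>
     C_k k (dt \<phi>) \<and> C_k k (dx \<phi>)"

text \<open>The test functions \<open>C\<^sub>c\<^sup>\<infinity>((0,T) \<times> \<real>/2\<pi>\<int>)\<close>, extended by zero to all times.\<close>

definition test_function :: "real \<Rightarrow> (real \<Rightarrow> real \<Rightarrow> real) \<Rightarrow> bool" where
  "test_function T \<phi> \<longleftrightarrow> (\<forall>k. C_k k \<phi>) \<and> (\<forall>t. periodic (\<phi> t)) \<and>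
     (\<exists>a b. 0 < a \<and> b < T \<and> (\<forall>t x. \<phi> t x \<noteq> 0 \<longrightarrow> a \<le> t \<and> t \<le> b))"

text \<open>
  \<open>wave_solution T u0 u1 u v\<close>: \<open>u\<close> is the solution with initial data \<open>(u0, u1)\<close> and \<open>v\<close> is its time
  derivative. The equalities \<open>v = \<partial>\<^sub>t u\<close> and \<open>\<partial>\<^sub>t\<^sup>2 u = \<partial>\<^sub>x\<^sup>2 u\<close> hold in the sense of distributions on
  \<open>(0,T) \<times> \<real>/2\<pi>\<int>\<close>. A curve in \<open>L\<^sup>2\<close> determines each \<open>v t\<close> only up to a null set, so joint
  measurability depends on the choice of representatives and has to be required.
\<close>

definition wave_solution ::
  "real \<Rightarrow> (real \<Rightarrow> real) \<Rightarrow> (real \<Rightarrow> real) \<Rightarrow>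
   (real \<Rightarrow> real \<Rightarrow> real) \<Rightarrow> (real \<Rightarrow> real \<Rightarrow> real) \<Rightarrow> bool" where
  "wave_solution T u0 u1 u v \<longleftrightarrow>
     C_curve T H1_torus H1_norm u \<and> C_curve T L2_torus L2_norm v \<and>
     set_borel_measurable lebesgue ({0..T} \<times> UNIV) (\<lambda>(t, x). u t x) \<and>
     set_borel_measurable lebesgue ({0..T} \<times> UNIV) (\<lambda>(t, x). v t x) \<and>
     (\<forall>\<phi>. test_function T \<phi> \<longrightarrow>
        set_lebesgue_integral lebesgue ({0..T} \<times> {0..2 * pi}) (\<lambda>(t, x). u t x * dt \<phi> t x) =
        - set_lebesgue_integral lebesgue ({0..T} \<times> {0..2 * pi}) (\<lambda>(t, x). v t x * \<phi> t x)) \<and>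
     (\<forall>\<phi>. test_function T \<phi> \<longrightarrow>
        set_lebesgue_integral lebesgue ({0..T} \<times> {0..2 * pi})
          (\<lambda>(t, x). u t x * (dt (dt \<phi>) t x - dx (dx \<phi>) t x)) = 0) \<and>
     (AE x in lebesgue. u 0 x = u0 x) \<and> (AE x in lebesgue. v 0 x = u1 x)"

definition observable :: "real \<Rightarrow> (real \<times> real) set \<Rightarrow> bool" where
  "observable T G \<longleftrightarrow> (\<exists>C>0. \<forall>u0\<in>H1_torus. \<forall>u1\<in>L2_torus. \<forall>u v. wave_solution T u0 u1 u v \<longrightarrow>
     (L2_norm (weak_deriv u0))\<^sup>2 + (L2_norm u1)\<^sup>2 \<le>
       C * set_lebesgue_integral lebesgue G (\<lambda>(t, x). (v t x)\<^sup>2))"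

section \<open>The geometric conditions\<close>

definition periodize :: "(real \<times> real) set \<Rightarrow> (real \<times> real) set" where
  "periodize G = {(t, x). \<exists>k::int. (t, x + 2 * pi * of_int k) \<in> G}"

text \<open>
  The arclength measure of \<open>G \<inter> {(s, x + \<sigma>s) : s \<in> [0,T]}\<close> for a slope \<open>\<sigma> = \<plusminus>1\<close>: the parametrisation
  by \<open>s\<close> has speed \<open>sqrt 2\<close>.
\<close>

definition char_meas :: "real \<Rightarrow> (real \<times> real) set \<Rightarrow> real \<Rightarrow> real \<Rightarrow> real" where
  "char_meas T G \<sigma> x = sqrt 2 * measure lebesgue {s \<in> {0..T}. (s, x + \<sigma> * s) \<in> periodize G}"

definition GCC :: "real \<Rightarrow> (real \<times> real) set \<Rightarrow> bool" where
  "GCC T G \<longleftrightarrow> (\<exists>c0>0. AE x in lebesgue. x \<in> {0..2 * pi} \<longrightarrow>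
     char_meas T G 1 x \<ge> c0 \<and> char_meas T G (-1) x \<ge> c0)"

definition L_xi :: "real \<Rightarrow> real set \<Rightarrow> (real \<times> real) set" where
  "L_xi T A = {(t, x). t \<in> {0..T} \<and> (\<exists>a\<in>A. \<exists>k::int. x + t = a + 2 * pi * of_int k)}"

definition L_eta :: "real \<Rightarrow> real set \<Rightarrow> (real \<times> real) set" where
  "L_eta T B = {(t, x). t \<in> {0..T} \<and> (\<exists>b\<in>B. \<exists>k::int. x - t = b + 2 * pi * of_int k)}"

definition observable_symmetric ::
  "real \<Rightarrow> (real \<times> real) set \<Rightarrow> real set \<Rightarrow> real set \<Rightarrow> bool" where
  "observable_symmetric T G A B \<longleftrightarrow>
     sym_diff (G \<inter> L_xi T A) (G \<inter> L_eta T B) \<in> null_sets lebesgue"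

definition trivial_pair :: "real set \<Rightarrow> real set \<Rightarrow> bool" where
  "trivial_pair A B \<longleftrightarrow>
     (measure lebesgue A = 0 \<and> measure lebesgue B = 0) \<or>
     (measure lebesgue A = 2 * pi \<and> measure lebesgue B = 2 * pi)"

definition OSC :: "real \<Rightarrow> (real \<times> real) set \<Rightarrow> bool" where
  "OSC T G \<longleftrightarrow> (\<forall>A B. A \<in> sets lebesgue \<and> B \<in> sets lebesgue \<and>
     A \<subseteq> {0..2 * pi} \<and> B \<subseteq> {0..2 * pi} \<and> \<not> trivial_pair A B \<longrightarrow>
     \<not> observable_symmetric T G A B)"

end

theory Submission
  imports Defs
begin

text \<open>
  By d'Alembert's formula \<open>\<partial>\<^sub>t u = f(x + t) + g(x - t)\<close> with \<open>f = (u\<^sub>1 + \<partial>\<^sub>x u\<^sub>0)/2\<close> and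
  \<open>g = (u\<^sub>1 - \<partial>\<^sub>x u\<^sub>0)/2\<close>, which are arbitrary periodic \<open>L\<^sup>2\<close> functions with equal means. So
  observability says that \<open>Q(f,g)\<close>, the integral over \<open>G\<close> of \<open>(f(x + t) + g(x - t))\<^sup>2\<close>, controls
  \<open>\<parallel>f\<parallel>\<^sup>2 + \<parallel>g\<parallel>\<^sup>2\<close>.

  If it does not, take normalised \<open>f\<^sub>n, g\<^sub>n\<close> with \<open>Q(f\<^sub>n,g\<^sub>n) \<rightarrow> 0\<close>. In characteristic coordinates the
  cross term of \<open>Q\<close> has the indicator of a bounded set as kernel, so it is compact, while (GCC) bounds
  the two diagonal terms from below; hence a subsequence converges strongly. The limit satisfies
  \<open>f(x + t) + g(x - t) = 0\<close> on \<open>G\<close>, so \<open>({f > 0}, {g < 0})\<close> is an observable symmetric pair. By (OSC)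
  it is trivial, and then equality of the means forces \<open>f = g = 0\<close>, contradicting the normalisation.

  Conversely, an observable symmetric pair \<open>(A, B)\<close> gives \<open>f = 1\<^sub>A - c\<close> and \<open>g = c - 1\<^sub>B\<close> with
  \<open>c = (|A| + |B|)/4\<pi>\<close>, for which \<open>Q(f,g) = 0\<close>; and if the characteristics through a set \<open>E\<close> of small
  positive measure meet \<open>G\<close> in short sets, then \<open>g = 1\<^sub>E\<close> and the constant \<open>f = |E|/2\<pi>\<close> violate
  observability.
\<close>

section \<open>Square-integrable functions\<close>

text \<open>Two obstacles shape the proof. First, the solution in (1) is an arbitrary distributional
  one, so d'Alembert's formula has to be derived for every such pair \<open>u\<close>,
  \<open>v\<close>: testing with a time cutoff times a trigonometric polynomial that moves along a
  characteristic shows that the moments of \<open>v - \<sigma>\<partial>\<^sub>x u\<close> in the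
  moving frame are constant in time. Solutions have to be constructed only for the converse, where
  the data are indicators and constants; so bounded \<open>f\<close> and \<open>g\<close> suffice
  there. Second, no weak limits are taken: the indicator kernel is approximated in L2 by finite sums
  of rectangles, a subsequence makes finitely many numbers converge, and the remaining error is a
  small multiple of the squared norms, which the diagonal terms absorb. The strong limit then comes
  from completeness. Equality of the means expresses the periodicity of \<open>u\<close>; without it
  the pair \<open>f = 1\<close>, \<open>g = -1\<close> would be invisible on every \<open>G\<close>.
  Lebesgue measurable data are replaced by Borel representatives, so that composition with the
  characteristic coordinates is measurable at once.\<close>

definition sqint :: "'a measure \<Rightarrow> ('a \<Rightarrow> real) \<Rightarrow> bool" where
  "sqint M f \<longleftrightarrow> f \<in> borel_measurable M \<and> integrable M (\<lambda>x. (f x)\<^sup>2)"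

lemma sqint_integrable_square: "sqint M f \<Longrightarrow> integrable M (\<lambda>x. (f x)\<^sup>2)"
  by (simp add: sqint_def)

lemma two_abs_mult_le: "2 * \<bar>a * b\<bar> \<le> a\<^sup>2 + (b::real)\<^sup>2"
proof -
  have "0 \<le> (\<bar>a\<bar> - \<bar>b\<bar>)\<^sup>2" by simp
  then show ?thesis by (simp add: power2_diff abs_mult)
qed

lemma sqint_mult:
  assumes "sqint M f" "sqint M g"
  shows "integrable M (\<lambda>x. f x * g x)"
proof (rule Bochner_Integration.integrable_bound)
  show "integrable M (\<lambda>x. (f x)\<^sup>2 + (g x)\<^sup>2)"
    using assms by (simp add: sqint_def)
  show "(\<lambda>x. f x * g x) \<in> borel_measurable M"
    using assms by (auto simp: sqint_def)
  show "AE x in M. norm (f x * g x) \<le> norm ((f x)\<^sup>2 + (g x)\<^sup>2)"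
  proof (rule AE_I2)
    fix x
    have "\<bar>f x * g x\<bar> \<ge> 0" by simp
    then show "norm (f x * g x) \<le> norm ((f x)\<^sup>2 + (g x)\<^sup>2)"
      using two_abs_mult_le[of "f x" "g x"] unfolding real_norm_def by linarith
  qed
qed

lemma sqint_cmult: "sqint M f \<Longrightarrow> sqint M (\<lambda>x. c * f x)"
  by (auto simp: sqint_def power_mult_distrib)

lemma sqint_add:
  assumes "sqint M f" "sqint M g"
  shows "sqint M (\<lambda>x. f x + g x)"
proof -
  have "integrable M (\<lambda>x. (f x)\<^sup>2 + (g x)\<^sup>2 + 2 * (f x * g x))"
    using assms sqint_mult[OF assms] by (simp add: sqint_def)
  moreover have "(\<lambda>x. (f x + g x)\<^sup>2) = (\<lambda>x. (f x)\<^sup>2 + (g x)\<^sup>2 + 2 * (f x * g x))"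
    by (auto simp: power2_sum)
  ultimately show ?thesis using assms by (auto simp: sqint_def)
qed

lemma sqint_diff:
  assumes "sqint M f" "sqint M g"
  shows "sqint M (\<lambda>x. f x - g x)"
  using sqint_add[OF assms(1) sqint_cmult[OF assms(2), of "-1"]] by simp

lemma sqint_bounded:
  assumes "finite_measure M" "f \<in> borel_measurable M" "\<And>x. \<bar>f x\<bar> \<le> B"
  shows "sqint M f"
proof -
  have "integrable M (\<lambda>x. (f x)\<^sup>2)"
  proof (rule finite_measure.integrable_const_bound[where B = "B\<^sup>2"])
    show "AE x in M. norm ((f x)\<^sup>2) \<le> B\<^sup>2"
      using assms(3) by (intro AE_I2) (simp add: abs_le_square_iff[symmetric] order_trans[OF _ abs_ge_self])
  qed (use assms in auto)
  then show ?thesis using assms by (simp add: sqint_def)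
qed

lemma sqint_integrable:
  assumes "finite_measure M" "sqint M f"
  shows "integrable M f"
proof -
  have "sqint M (\<lambda>_. 1)" using assms by (intro sqint_bounded[where B = 1]) auto
  from sqint_mult[OF assms(2) this] show ?thesis by simp
qed

lemma sqint_cong_AE:
  assumes "sqint M f" "g \<in> borel_measurable M" "AE x in M. f x = g x"
  shows "sqint M g"
proof -
  have "integrable M (\<lambda>x. (g x)\<^sup>2)"
    by (rule integrable_cong_AE_imp[OF sqint_integrable_square[OF assms(1)]])
       (use assms(2,3) in auto)
  then show ?thesis using assms(2) by (simp add: sqint_def)
qed

lemma integral_square_add_cmult:
  assumes "sqint M f" "sqint M g"
  shows "(\<integral>x. (f x + c * g x)\<^sup>2 \<partial>M) =
    (\<integral>x. (f x)\<^sup>2 \<partial>M) + 2 * c * (\<integral>x. f x * g x \<partial>M) + c\<^sup>2 * (\<integral>x. (g x)\<^sup>2 \<partial>M)"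
proof -
  have "(\<integral>x. (f x + c * g x)\<^sup>2 \<partial>M) = (\<integral>x. (f x)\<^sup>2 + 2 * c * (f x * g x) + c\<^sup>2 * (g x)\<^sup>2 \<partial>M)"
    by (intro Bochner_Integration.integral_cong refl) (simp add: power2_sum power_mult_distrib algebra_simps)
  then show ?thesis
    using assms sqint_mult[OF assms] by (simp add: sqint_def)
qed

lemma Cauchy_Schwarz_integral:
  assumes "sqint M f" "sqint M g"
  shows "(\<integral>x. f x * g x \<partial>M)\<^sup>2 \<le> (\<integral>x. (f x)\<^sup>2 \<partial>M) * (\<integral>x. (g x)\<^sup>2 \<partial>M)"
proof -
  define a b c where "a = (\<integral>x. (f x)\<^sup>2 \<partial>M)" and "b = (\<integral>x. f x * g x \<partial>M)" and "c = (\<integral>x. (g x)\<^sup>2 \<partial>M)"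
  have nn: "0 \<le> a + 2 * s * b + s\<^sup>2 * c" for s
    unfolding a_def b_def c_def integral_square_add_cmult[OF assms, symmetric]
    by (rule Bochner_Integration.integral_nonneg) simp
  have "c \<ge> 0" unfolding c_def by (rule Bochner_Integration.integral_nonneg) simp
  have "b\<^sup>2 \<le> a * c"
  proof (cases "c = 0")
    case True
    have "b = 0"
    proof (rule ccontr)
      assume "b \<noteq> 0"
      \<comment> \<open>For \<open>c = 0\<close> the quadratic is the affine function
        \<open>a + 2 * s * b\<close>; this \<open>s\<close> gives it the value -1.\<close>
      with nn[of "-(a + 1) / (2 * b)"] True show False by (simp add: field_simps)
    qed
    then show ?thesis using True by simp
  next
    case False
    with \<open>c \<ge> 0\<close> have "c > 0" by simp
    have "0 \<le> c * (a + 2 * (- b / c) * b + (- b / c)\<^sup>2 * c)"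
      using nn[of "- b / c"] \<open>c > 0\<close> by (intro mult_nonneg_nonneg) auto
    also have "\<dots> = a * c - b\<^sup>2" using \<open>c > 0\<close> by (simp add: field_simps power2_eq_square)
    finally show ?thesis by simp
  qed
  then show ?thesis by (simp add: a_def b_def c_def)
qed

lemma Cauchy_Schwarz_abs:
  assumes "sqint M f" "sqint M g"
  shows "\<bar>\<integral>x. f x * g x \<partial>M\<bar> \<le> sqrt (\<integral>x. (f x)\<^sup>2 \<partial>M) * sqrt (\<integral>x. (g x)\<^sup>2 \<partial>M)"
  using Cauchy_Schwarz_integral[OF assms] by (simp add: real_le_rsqrt flip: real_sqrt_mult)

lemma Minkowski_L2:
  assumes "sqint M f" "sqint M g"
  shows "sqrt (\<integral>x. (f x + g x)\<^sup>2 \<partial>M) \<le> sqrt (\<integral>x. (f x)\<^sup>2 \<partial>M) + sqrt (\<integral>x. (g x)\<^sup>2 \<partial>M)"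
proof (rule real_le_lsqrt)
  let ?a = "sqrt (\<integral>x. (f x)\<^sup>2 \<partial>M)" and ?b = "sqrt (\<integral>x. (g x)\<^sup>2 \<partial>M)"
  have sq: "?a\<^sup>2 = (\<integral>x. (f x)\<^sup>2 \<partial>M)" "?b\<^sup>2 = (\<integral>x. (g x)\<^sup>2 \<partial>M)" by auto
  have "(\<integral>x. (f x + g x)\<^sup>2 \<partial>M) = ?a\<^sup>2 + 2 * (\<integral>x. f x * g x \<partial>M) + ?b\<^sup>2"
    using integral_square_add_cmult[OF assms, of 1] unfolding sq by simp
  also have "\<dots> \<le> (?a + ?b)\<^sup>2"
    using Cauchy_Schwarz_abs[OF assms] unfolding power2_sum by linarith
  finally show "(\<integral>x. (f x + g x)\<^sup>2 \<partial>M) \<le> (?a + ?b)\<^sup>2" .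
qed (simp_all add: add_nonneg_nonneg)

lemma integral_square_add_le:
  assumes "sqint M f" "sqint M g"
  shows "(\<integral>x. (f x + g x)\<^sup>2 \<partial>M) \<le> 2 * (\<integral>x. (f x)\<^sup>2 \<partial>M) + 2 * (\<integral>x. (g x)\<^sup>2 \<partial>M)"
proof -
  have "(\<integral>x. (f x + g x)\<^sup>2 \<partial>M) \<le> (\<integral>x. 2 * (f x)\<^sup>2 + 2 * (g x)\<^sup>2 \<partial>M)"
  proof (rule integral_mono)
    fix x
    have "0 \<le> (f x - g x)\<^sup>2" by simp
    then show "(f x + g x)\<^sup>2 \<le> 2 * (f x)\<^sup>2 + 2 * (g x)\<^sup>2" by (simp add: power2_eq_square algebra_simps)
  qed (use assms sqint_add[OF assms] in \<open>auto simp: sqint_def\<close>)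
  also have "\<dots> = 2 * (\<integral>x. (f x)\<^sup>2 \<partial>M) + 2 * (\<integral>x. (g x)\<^sup>2 \<partial>M)"
    using assms by (simp add: sqint_def)
  finally show ?thesis .
qed

lemma integral_square_diff_le:
  assumes "sqint M f" "sqint M g"
  shows "(\<integral>x. (f x - g x)\<^sup>2 \<partial>M) \<le> 2 * (\<integral>x. (f x)\<^sup>2 \<partial>M) + 2 * (\<integral>x. (g x)\<^sup>2 \<partial>M)"
  using integral_square_add_le[OF assms(1) sqint_cmult[OF assms(2), of "-1"]] by simp

text \<open>The Riesz-Fischer argument: a subsequence with geometrically small steps converges
  almost everywhere, and Fatou's lemma turns the pointwise limit into an L2 limit of the whole
  sequence.\<close>

lemma L2_complete:
  fixes f :: "nat \<Rightarrow> 'a \<Rightarrow> real"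
  assumes f: "\<And>n. sqint M (f n)"
    and cauchy: "\<And>e. e > 0 \<Longrightarrow> \<exists>N. \<forall>m\<ge>N. \<forall>n\<ge>N. (\<integral>x. (f m x - f n x)\<^sup>2 \<partial>M) < e"
  obtains F where "sqint M F" "(\<lambda>n. \<integral>x. (f n x - F x)\<^sup>2 \<partial>M) \<longlonglongrightarrow> 0"
proof -
  have [measurable]: "f n \<in> borel_measurable M" for n using f by (simp add: sqint_def)
  have sd: "integrable M (\<lambda>x. (f m x - f n x)\<^sup>2)" for m n
    using sqint_diff[OF f f] by (simp add: sqint_def)
  have "\<exists>N. \<forall>k. (\<forall>m\<ge>N k. \<forall>n\<ge>N k. (\<integral>x. (f m x - f n x)\<^sup>2 \<partial>M) < (1/4)^k)"
    using cauchy[of "(1/4)^_"] by (intro choice) auto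
  then obtain N where N: "\<And>k m n. m \<ge> N k \<Longrightarrow> n \<ge> N k \<Longrightarrow> (\<integral>x. (f m x - f n x)\<^sup>2 \<partial>M) < (1/4)^k"
    by blast
  \<comment> \<open>Summing all earlier thresholds makes \<open>r k\<close> and
    \<open>r (Suc k)\<close> both at least \<open>N k\<close> without assuming \<open>N\<close>
    monotone; the summand \<open>k\<close> sends \<open>r\<close> to infinity.\<close>
  define r where "r k = (\<Sum>i\<le>k. N i) + k" for k
  have rN: "r k \<ge> N k" for k unfolding r_def
    by (rule trans_le_add1) (rule member_le_sum, auto)
  have r_Suc: "r (Suc k) \<ge> N k" for k using rN[of k] by (simp add: r_def)
  have rk: "r k \<ge> k" for k by (simp add: r_def)
  define d where "d k x = f (r (Suc k)) x - f (r k) x" for k x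
  have [measurable]: "d k \<in> borel_measurable M" for k unfolding d_def by measurable
  \<comment> \<open>The weight \<open>2^k\<close> still leaves a convergent series, so almost
    everywhere \<open>2^k * (d k x)\<^sup>2\<close> is bounded in \<open>k\<close> and the steps
    \<open>d k x\<close> decay geometrically.\<close>
  have d_int: "(\<integral>\<^sup>+x. ennreal (2^k * (d k x)\<^sup>2) \<partial>M) \<le> ennreal ((1/2)^k)" for k
  proof -
    have "(\<integral>\<^sup>+x. ennreal (2^k * (d k x)\<^sup>2) \<partial>M) = ennreal (\<integral>x. 2^k * (d k x)\<^sup>2 \<partial>M)"
      using sd by (intro nn_integral_eq_integral) (auto simp: d_def)
    also have "(\<integral>x. 2^k * (d k x)\<^sup>2 \<partial>M) \<le> 2^k * (1/4)^k"
      using N[of k "r (Suc k)" "r k"] rN r_Suc by (simp add: d_def)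
    also have "(2::real)^k * (1/4)^k = (1/2)^k"
      by (simp flip: power_mult_distrib)
    finally show ?thesis by (simp add: ennreal_leI)
  qed
  have "(\<integral>\<^sup>+x. (\<Sum>k. ennreal (2^k * (d k x)\<^sup>2)) \<partial>M) = (\<Sum>k. \<integral>\<^sup>+x. ennreal (2^k * (d k x)\<^sup>2) \<partial>M)"
    by (rule nn_integral_suminf) measurable
  also have "\<dots> \<le> (\<Sum>k. ennreal ((1/2)^k))"
    by (intro suminf_le d_int) auto
  also have "\<dots> = ennreal 2"
    by (subst suminf_ennreal_eq[where x = 2]) (use geometric_sums[of "1/2::real"] in auto)
  finally have "(\<integral>\<^sup>+x. (\<Sum>k. ennreal (2^k * (d k x)\<^sup>2)) \<partial>M) \<noteq> \<infinity>"
    by (auto simp: top_unique)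
  then have ae: "AE x in M. (\<Sum>k. ennreal (2^k * (d k x)\<^sup>2)) \<noteq> \<infinity>"
    by (intro nn_integral_PInf_AE) measurable
  have conv: "AE x in M. convergent (\<lambda>k. f (r k) x)"
    using ae
  proof eventually_elim
    case (elim x)
    have "summable (\<lambda>k. 2^k * (d k x)\<^sup>2)"
      using elim by (intro summable_suminf_not_top) auto
    then have "(\<lambda>k. 2^k * (d k x)\<^sup>2) \<longlonglongrightarrow> 0" by (rule summable_LIMSEQ_zero)
    then have "Bseq (\<lambda>k. 2^k * (d k x)\<^sup>2)" by (intro convergent_imp_Bseq convergentI)
    then obtain K where K: "K > 0" "\<And>k. norm (2^k * (d k x)\<^sup>2) \<le> K" by (rule BseqE) auto
    have bnd: "norm (d k x) \<le> sqrt K * (sqrt (1/2))^k" for k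
    proof -
      have "(d k x)\<^sup>2 \<le> K * (1/2)^k" using K(2)[of k] by (simp add: field_simps abs_mult)
      then have "sqrt ((d k x)\<^sup>2) \<le> sqrt (K * (1/2)^k)" by (rule real_sqrt_le_mono)
      moreover have "sqrt (K * (1/2)^k) = sqrt K * (sqrt (1/2))^k"
        by (simp only: real_sqrt_mult real_sqrt_power)
      ultimately show ?thesis by (simp only: real_sqrt_abs real_norm_def)
    qed
    have "summable (\<lambda>k. sqrt K * (sqrt (1/2))^k)"
      by (intro summable_mult summable_geometric) (simp add: real_sqrt_lt_1_iff)
    then have "summable (\<lambda>k. d k x)"
      by (rule summable_comparison_test'[where N = 0]) (rule bnd)
    then have "convergent (\<lambda>n. \<Sum>k<n. d k x)" by (simp add: summable_iff_convergent)
    moreover have "(\<Sum>k<n. d k x) = f (r n) x - f (r 0) x" for n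
      unfolding d_def by (rule sum_lessThan_telescope)
    ultimately have "convergent (\<lambda>n. f (r n) x - f (r 0) x)" by simp
    then have "convergent (\<lambda>n. (f (r n) x - f (r 0) x) + f (r 0) x)"
      by (intro convergent_add convergent_const)
    then show ?case by simp
  qed
  define F where "F x = lim (\<lambda>k. f (r k) x)" for x
  have [measurable]: "F \<in> borel_measurable M" unfolding F_def by measurable
  have lim: "AE x in M. (\<lambda>k. f (r k) x) \<longlonglongrightarrow> F x"
    using conv by eventually_elim (simp add: F_def convergent_LIMSEQ_iff)
  \<comment> \<open>Fatou in the second index gives this for every \<open>n\<close> past
    \<open>N k\<close>, not only along the subsequence \<open>r\<close>.\<close>
  have bound: "(\<integral>\<^sup>+x. ennreal ((f n x - F x)\<^sup>2) \<partial>M) \<le> ennreal ((1/4)^k)" if n: "n \<ge> N k" for n k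
  proof -
    have "(\<integral>\<^sup>+x. ennreal ((f n x - F x)\<^sup>2) \<partial>M) = (\<integral>\<^sup>+x. liminf (\<lambda>j. ennreal ((f n x - f (r j) x)\<^sup>2)) \<partial>M)"
    proof (intro nn_integral_cong_AE, use lim in eventually_elim)
      case (elim x)
      then have "(\<lambda>j. ennreal ((f n x - f (r j) x)\<^sup>2)) \<longlonglongrightarrow> ennreal ((f n x - F x)\<^sup>2)"
        by (intro tendsto_ennrealI tendsto_intros)
      then show ?case by (rule lim_imp_Liminf[OF sequentially_bot, symmetric])
    qed
    also have "\<dots> \<le> liminf (\<lambda>j. \<integral>\<^sup>+x. ennreal ((f n x - f (r j) x)\<^sup>2) \<partial>M)"
      by (intro nn_integral_liminf) measurable
    also have "\<dots> \<le> ennreal ((1/4)^k)"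
    proof (rule Liminf_le)
      show "\<forall>\<^sub>F j in sequentially. (\<integral>\<^sup>+x. ennreal ((f n x - f (r j) x)\<^sup>2) \<partial>M) \<le> ennreal ((1/4)^k)"
      proof (rule eventually_sequentiallyI[of "N k"])
        fix j assume "j \<ge> N k"
        then have "r j \<ge> N k" using rk[of j] by simp
        then have "(\<integral>x. (f n x - f (r j) x)\<^sup>2 \<partial>M) \<le> (1/4)^k" using N[OF n] by (simp add: less_imp_le)
        moreover have "(\<integral>\<^sup>+x. ennreal ((f n x - f (r j) x)\<^sup>2) \<partial>M) = ennreal (\<integral>x. (f n x - f (r j) x)\<^sup>2 \<partial>M)"
          by (intro nn_integral_eq_integral sd) auto
        ultimately show "(\<integral>\<^sup>+x. ennreal ((f n x - f (r j) x)\<^sup>2) \<partial>M) \<le> ennreal ((1/4)^k)"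
          by (simp add: ennreal_leI)
      qed
    qed simp
    finally show ?thesis .
  qed
  have int: "integrable M (\<lambda>x. (f n x - F x)\<^sup>2)" if "n \<ge> N k" for n k
  proof (rule integrableI_nonneg)
    show "(\<integral>\<^sup>+x. ennreal ((f n x - F x)\<^sup>2) \<partial>M) < \<infinity>"
      using bound[OF that] by (simp add: order.strict_trans1)
  qed auto
  have "sqint M (\<lambda>x. f (N 0) x - F x)" using int[of 0 "N 0"] by (simp add: sqint_def)
  from sqint_diff[OF f[of "N 0"] this] have "sqint M F" by simp
  moreover have "(\<lambda>n. \<integral>x. (f n x - F x)\<^sup>2 \<partial>M) \<longlonglongrightarrow> 0"
  proof (rule LIMSEQ_I)
    fix e :: real assume "e > 0"
    then obtain k where k: "(1/4::real)^k < e" using real_arch_pow_inv[of e "1/4"] by auto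
    have "norm ((\<integral>x. (f n x - F x)\<^sup>2 \<partial>M) - 0) < e" if n: "n \<ge> N k" for n
    proof -
      have "ennreal (\<integral>x. (f n x - F x)\<^sup>2 \<partial>M) \<le> ennreal ((1/4)^k)"
        using bound[OF n] nn_integral_eq_integral[OF int[OF n]] by simp
      then have "(\<integral>x. (f n x - F x)\<^sup>2 \<partial>M) \<le> (1/4)^k"
        by (subst (asm) ennreal_le_iff) auto
      then show ?thesis using k by simp
    qed
    then show "\<exists>no. \<forall>n\<ge>no. norm ((\<integral>x. (f n x - F x)\<^sup>2 \<partial>M) - 0) < e" by blast
  qed
  ultimately show ?thesis using that by blast
qed

section \<open>Integral kernels\<close>

text \<open>Kernels of integral operators with finite-dimensional range. The inductive form lets
  subsequences be extracted by rule induction, one rectangle at a time.\<close>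

inductive finite_rank :: "'a measure \<Rightarrow> 'b measure \<Rightarrow> ('a \<times> 'b \<Rightarrow> real) \<Rightarrow> bool" for M N where
  rectangle: "A \<in> sets M \<Longrightarrow> B \<in> sets N \<Longrightarrow>
    finite_rank M N (\<lambda>z. c * (indicator A (fst z) * indicator B (snd z)))"
| add: "finite_rank M N k \<Longrightarrow> finite_rank M N l \<Longrightarrow> finite_rank M N (\<lambda>z. k z + l z)"

lemma finite_rank_cmult: "finite_rank M N k \<Longrightarrow> finite_rank M N (\<lambda>z. a * k z)"
proof (induction rule: finite_rank.induct)
  case (rectangle A B c)
  then show ?case using finite_rank.rectangle[of A M B N "a * c"] by (simp add: mult.assoc)
next
  case (add k l)
  then show ?case using finite_rank.add by (simp add: distrib_left)
qed

lemma finite_rank_zero: "finite_rank M N (\<lambda>_. 0)"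
  using finite_rank.rectangle[of "{}" M "{}" N 0] by simp

lemma finite_rank_sum:
  "finite I \<Longrightarrow> (\<And>i. i \<in> I \<Longrightarrow> finite_rank M N (k i)) \<Longrightarrow> finite_rank M N (\<lambda>z. \<Sum>i\<in>I. k i z)"
  by (induction I rule: finite_induct) (auto intro: finite_rank_zero finite_rank.add)

lemma finite_rank_measurable [measurable_dest]:
  "finite_rank M N k \<Longrightarrow> k \<in> borel_measurable (M \<Otimes>\<^sub>M N)"
  by (induction rule: finite_rank.induct) auto

lemma finite_rank_bounded:
  "finite_rank M N k \<Longrightarrow> \<exists>B. \<forall>z. \<bar>k z\<bar> \<le> B"
proof (induction rule: finite_rank.induct)
  case (rectangle A B c)
  have "\<bar>c * (indicator A (fst z) * indicator B (snd z))\<bar> \<le> \<bar>c\<bar>" for z :: "'a \<times> 'b"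
    by (auto simp: indicator_def)
  then show ?case by blast
next
  case (add k l)
  then obtain B C where "\<And>z. \<bar>k z\<bar> \<le> B" "\<And>z. \<bar>l z\<bar> \<le> C" by auto
  then have "\<bar>k z + l z\<bar> \<le> B + C" for z
    using abs_triangle_ineq[of "k z" "l z"] add_mono order_trans by blast
  then show ?case by blast
qed

lemma sum_square_le:
  fixes a :: "'i \<Rightarrow> real"
  assumes "finite I"
  shows "(\<Sum>i\<in>I. a i)\<^sup>2 \<le> real (card I) * (\<Sum>i\<in>I. (a i)\<^sup>2)"
  using Cauchy_Schwarz_ineq_sum[of "\<lambda>_. 1" a I] by simp

locale finite_pair = M: finite_measure M + N: finite_measure N
  for M :: "'a measure" and N :: "'b measure"
begin

sublocale pair_sigma_finite M N ..

lemma finite_measure_pair: "finite_measure (M \<Otimes>\<^sub>M N)"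
  by (rule finite_measure_pair_measure) unfold_locales

lemma sqint_indicator: "E \<in> sets (M \<Otimes>\<^sub>M N) \<Longrightarrow> sqint (M \<Otimes>\<^sub>M N) (indicator E)"
  by (rule sqint_bounded[OF finite_measure_pair, where B = 1]) (auto simp: indicator_def)

lemma sqint_finite_rank: "finite_rank M N k \<Longrightarrow> sqint (M \<Otimes>\<^sub>M N) k"
  using finite_rank_bounded[of M N k] finite_rank_measurable[of M N k] sqint_bounded[OF finite_measure_pair]
  by metis

text \<open>Rectangles generate the product sigma-algebra and are stable under intersection, so it
  is enough that approximability passes to complements and to disjoint countable unions. For a union
  the tail is small by continuity of the finite measure, and finitely many approximants
  remain.\<close>

lemma indicator_approx_finite_rank:
  assumes "E \<in> sets (M \<Otimes>\<^sub>M N)" "\<delta> > 0"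
  shows "\<exists>k. finite_rank M N k \<and> (\<integral>z. (indicator E z - k z)\<^sup>2 \<partial>(M \<Otimes>\<^sub>M N)) < \<delta>"
proof -
  let ?P = "M \<Otimes>\<^sub>M N"
  interpret P: finite_measure ?P by (rule finite_measure_pair)
  let ?G = "{A \<times> B | A B. A \<in> sets M \<and> B \<in> sets N}"
  have "E \<in> sigma_sets (space M \<times> space N) ?G"
    using assms(1) by (simp add: sets_pair_measure)
  from Int_stable_pair_measure_generator pair_measure_closed this
  \<comment> \<open>The tolerance is quantified inside the induction because the union case uses the
    hypothesis at a smaller tolerance.\<close>
  have "\<forall>\<delta>>0. \<exists>k. finite_rank M N k \<and> (\<integral>z. (indicator E z - k z)\<^sup>2 \<partial>?P) < \<delta>"
  proof (induction rule: sigma_sets_induct_disjoint)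
    case (basic E)
    then obtain A B where AB: "E = A \<times> B" "A \<in> sets M" "B \<in> sets N" by auto
    have "finite_rank M N (\<lambda>z. 1 * (indicator A (fst z) * indicator B (snd z)))"
      using AB by (intro finite_rank.rectangle)
    moreover have "indicator E z = 1 * (indicator A (fst z) * indicator B (snd z) :: real)" for z
      by (cases z) (auto simp: AB indicator_def)
    ultimately show ?case by (metis (mono_tags, lifting) Bochner_Integration.integral_cong
        cancel_comm_monoid_add_class.diff_cancel integral_zero zero_power2)
  next
    case empty
    show ?case using finite_rank_zero[of M N] by (intro allI impI exI[of _ "\<lambda>_. 0"]) auto
  next
    case (compl E)
    show ?case
    proof (intro allI impI)
      fix \<delta> :: real assume "\<delta> > 0"
      with compl obtain k where k: "finite_rank M N k" "(\<integral>z. (indicator E z - k z)\<^sup>2 \<partial>?P) < \<delta>" by auto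
      \<comment> \<open>The kernel \<open>1 - k\<close>, whose error is that of \<open>k\<close>
        with the sign changed.\<close>
      define l where "l z = 1 * (indicator (space M) (fst z) * indicator (space N) (snd z)) + (-1) * k z" for z
      have "finite_rank M N l"
        unfolding l_def using k(1)
        by (intro finite_rank.add finite_rank_cmult finite_rank.rectangle) auto
      moreover have "(\<integral>z. (indicator (space M \<times> space N - E) z - l z)\<^sup>2 \<partial>?P) = (\<integral>z. (indicator E z - k z)\<^sup>2 \<partial>?P)"
      proof (rule Bochner_Integration.integral_cong)
        fix z assume "z \<in> space ?P"
        then have "indicator (space M \<times> space N - E) z - l z = - (indicator E z - k z)"
          by (auto simp: l_def space_pair_measure indicator_def)
        then show "(indicator (space M \<times> space N - E) z - l z)\<^sup>2 = (indicator E z - k z)\<^sup>2"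
          by (metis power2_minus)
      qed simp
      ultimately show "\<exists>k. finite_rank M N k \<and> (\<integral>z. (indicator (space M \<times> space N - E) z - k z)\<^sup>2 \<partial>?P) < \<delta>"
        using k by auto
    qed
  next
    case (union E)
    have E [measurable]: "E i \<in> sets ?P" for i
      using union(2) by (auto simp: sets_pair_measure)
    show ?case
    proof (intro allI impI)
      fix \<delta> :: real assume "\<delta> > 0"
      have "(\<lambda>n. measure ?P (\<Union>i<n. E i)) \<longlonglongrightarrow> measure ?P (\<Union>n. \<Union>i<n. E i)"
        by (intro P.finite_Lim_measure_incseq) (auto simp: incseq_def intro: less_le_trans)
      moreover have "(\<Union>n. \<Union>i<n. E i) = (\<Union>i. E i)" by auto
      ultimately have "(\<lambda>n. measure ?P (\<Union>i<n. E i)) \<longlonglongrightarrow> measure ?P (\<Union>i. E i)" by simp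
      then have "\<forall>\<^sub>F n in sequentially. measure ?P (\<Union>i. E i) - \<delta>/4 < measure ?P (\<Union>i<n. E i)"
        by (rule order_tendstoD) (use \<open>\<delta> > 0\<close> in simp)
      then obtain n where n: "measure ?P (\<Union>i. E i) - \<delta>/4 < measure ?P (\<Union>i<n. E i)"
        by (auto simp: eventually_sequentially)
      define R where "R = (\<Union>i. E i) - (\<Union>i<n. E i)"
      have [measurable]: "R \<in> sets ?P" by (auto simp: R_def)
      have R: "measure ?P R < \<delta>/4"
        unfolding R_def using n by (subst P.finite_measure_Diff) auto
      \<comment> \<open>The square of a sum of \<open>n\<close> errors is at most \<open>n\<close>
        times the sum of the squares, so the finite part costs
        \<open>2 * n\<^sup>2 * \<gamma>\<close>, which is less than \<open>\<delta> / 2\<close>; the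
        \<open>+ 1\<close> covers \<open>n = 0\<close>.\<close>
      define \<gamma> where "\<gamma> = \<delta> / (4 * (real n + 1)\<^sup>2)"
      have "\<gamma> > 0" using \<open>\<delta> > 0\<close> by (simp add: \<gamma>_def)
      with union(3) have "\<forall>i. \<exists>k. finite_rank M N k \<and> (\<integral>z. (indicator (E i) z - k z)\<^sup>2 \<partial>?P) < \<gamma>" by blast
      then obtain k where k: "\<And>i. finite_rank M N (k i)" "\<And>i. (\<integral>z. (indicator (E i) z - k i z)\<^sup>2 \<partial>?P) < \<gamma>"
        by metis
      define l where "l z = (\<Sum>i<n. k i z)" for z
      have l: "finite_rank M N l" unfolding l_def by (intro finite_rank_sum k) auto
      have ind: "indicator (\<Union>i. E i) z = indicator R z + (\<Sum>i<n. indicator (E i) z :: real)" for z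
      proof -
        have "indicator (\<Union>i<n. E i) z = (\<Sum>i<n. indicator (E i) z :: real)"
          by (rule indicator_UN_disjoint) (use union(1) in \<open>auto simp: disjoint_family_on_def\<close>)
        moreover have "indicator (\<Union>i. E i) z = indicator R z + (indicator (\<Union>i<n. E i) z :: real)"
          by (auto simp: R_def indicator_def)
        ultimately show ?thesis by simp
      qed
      have sq: "sqint ?P (\<lambda>z. indicator (E i) z - k i z)" for i
        by (intro sqint_diff sqint_indicator sqint_finite_rank k E)
      have "integrable ?P (\<lambda>z. 2 * (indicator R z)\<^sup>2 + 2 * (real n * (\<Sum>i<n. (indicator (E i) z - k i z)\<^sup>2)))"
        using sqint_indicator[of R] sq by (auto simp: sqint_def)
      then have "(\<integral>z. (indicator (\<Union>i. E i) z - l z)\<^sup>2 \<partial>?P)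
         \<le> (\<integral>z. 2 * (indicator R z)\<^sup>2 + 2 * (real n * (\<Sum>i<n. (indicator (E i) z - k i z)\<^sup>2)) \<partial>?P)"
      proof (rule integral_mono_AE'[OF _ AE_I2])
        fix z
        have "(indicator (\<Union>i. E i) z - l z)\<^sup>2 = (indicator R z + (\<Sum>i<n. indicator (E i) z - k i z))\<^sup>2"
          unfolding ind l_def sum_subtractf by (simp add: add_diff_eq)
        also have "\<dots> \<le> 2 * (indicator R z)\<^sup>2 + 2 * (\<Sum>i<n. indicator (E i) z - k i z)\<^sup>2"
          using zero_le_power2[of "indicator R z - (\<Sum>i<n. indicator (E i) z - k i z)"]
          unfolding power2_sum power2_diff by linarith
        also have "(\<Sum>i<n. indicator (E i) z - k i z)\<^sup>2 \<le> real n * (\<Sum>i<n. (indicator (E i) z - k i z)\<^sup>2)"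
          using sum_square_le[of "{..<n}"] by simp
        finally show "(indicator (\<Union>i. E i) z - l z)\<^sup>2
            \<le> 2 * (indicator R z)\<^sup>2 + 2 * (real n * (\<Sum>i<n. (indicator (E i) z - k i z)\<^sup>2))" by simp
      qed (auto intro!: AE_I2 add_nonneg_nonneg mult_nonneg_nonneg sum_nonneg)
      also have "\<dots> = 2 * measure ?P R + 2 * (real n * (\<Sum>i<n. (\<integral>z. (indicator (E i) z - k i z)\<^sup>2 \<partial>?P)))"
      proof -
        have [simp]: "(indicator R z :: real)\<^sup>2 = indicator R z" for z by (auto simp: indicator_def)
        have [simp]: "integrable ?P (indicator R :: _ \<Rightarrow> real)"
          using sqint_indicator[of R] by (intro sqint_integrable[OF finite_measure_pair]) auto
        have [simp]: "integrable ?P (\<lambda>z. (indicator (E i) z - k i z)\<^sup>2)" for i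
          by (rule sqint_integrable_square[OF sq])
        show ?thesis by (subst Bochner_Integration.integral_add) simp_all
      qed
      also have "\<dots> \<le> 2 * (\<delta>/4) + 2 * (real n * (\<Sum>i<n. \<gamma>))"
        using R k(2) by (intro add_mono mult_left_mono sum_mono) (auto intro: less_imp_le)
      also have "\<dots> = \<delta>/2 + \<delta>/2 * ((real n)\<^sup>2 / (real n + 1)\<^sup>2)"
        by (simp add: \<gamma>_def power2_eq_square)
      also have "\<dots> < \<delta>/2 + \<delta>/2 * 1"
      proof -
        have "(real n)\<^sup>2 < (real n + 1)\<^sup>2" by (intro power_strict_mono) auto
        then have "(real n)\<^sup>2 / (real n + 1)\<^sup>2 < 1" by simp
        then show ?thesis using \<open>\<delta> > 0\<close> by (intro add_strict_left_mono mult_strict_left_mono) auto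
      qed
      finally show "\<exists>k. finite_rank M N k \<and> (\<integral>z. (indicator (\<Union>(range E)) z - k z)\<^sup>2 \<partial>?P) < \<delta>"
        using l by auto
    qed
  qed
  then show ?thesis using assms(2) by blast
qed

section \<open>Tensor products and extraction of subsequences\<close>

lemma sqint_tensor:
  assumes "sqint M f" "sqint N g"
  shows "sqint (M \<Otimes>\<^sub>M N) (\<lambda>z. f (fst z) * g (snd z))"
    and "(\<integral>z. (f (fst z) * g (snd z))\<^sup>2 \<partial>(M \<Otimes>\<^sub>M N)) = (\<integral>x. (f x)\<^sup>2 \<partial>M) * (\<integral>y. (g y)\<^sup>2 \<partial>N)"
proof -
  have [measurable]: "f \<in> borel_measurable M" "g \<in> borel_measurable N" using assms by (simp_all add: sqint_def)
  have i: "integrable (M \<Otimes>\<^sub>M N) (\<lambda>z. (f (fst z) * g (snd z))\<^sup>2)"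
  proof (rule Fubini_integrable)
    show "integrable M (\<lambda>x. \<integral>y. norm ((f (fst (x, y)) * g (snd (x, y)))\<^sup>2) \<partial>N)"
      using assms by (simp add: power_mult_distrib sqint_def)
    show "AE x in M. integrable N (\<lambda>y. (f (fst (x, y)) * g (snd (x, y)))\<^sup>2)"
      using assms by (simp add: power_mult_distrib sqint_def)
  qed measurable
  then show "sqint (M \<Otimes>\<^sub>M N) (\<lambda>z. f (fst z) * g (snd z))" by (simp add: sqint_def)
  show "(\<integral>z. (f (fst z) * g (snd z))\<^sup>2 \<partial>(M \<Otimes>\<^sub>M N)) = (\<integral>x. (f x)\<^sup>2 \<partial>M) * (\<integral>y. (g y)\<^sup>2 \<partial>N)"
    using integral_fst'[OF i] by (simp add: power_mult_distrib)
qed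

lemma tensor_integral:
  assumes "sqint M f" "sqint N g"
  shows "integrable (M \<Otimes>\<^sub>M N) (\<lambda>z. f (fst z) * g (snd z))"
    and "(\<integral>z. f (fst z) * g (snd z) \<partial>(M \<Otimes>\<^sub>M N)) = (\<integral>x. f x \<partial>M) * (\<integral>y. g y \<partial>N)"
proof -
  show i: "integrable (M \<Otimes>\<^sub>M N) (\<lambda>z. f (fst z) * g (snd z))"
    by (rule sqint_integrable[OF finite_measure_pair sqint_tensor(1)[OF assms]])
  show "(\<integral>z. f (fst z) * g (snd z) \<partial>(M \<Otimes>\<^sub>M N)) = (\<integral>x. f x \<partial>M) * (\<integral>y. g y \<partial>N)"
    using integral_fst'[OF i] by simp
qed

lemma sqint_mult_indicator: "sqint L f \<Longrightarrow> A \<in> sets L \<Longrightarrow> sqint L (\<lambda>x. indicator A x * f x)"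
proof -
  assume f: "sqint L f" and A: "A \<in> sets L"
  have "integrable L (\<lambda>x. indicator A x *\<^sub>R (f x)\<^sup>2)"
    using f A by (intro integrable_mult_indicator) (auto simp: sqint_def)
  moreover have "(\<lambda>x. (indicator A x * f x)\<^sup>2) = (\<lambda>x. indicator A x *\<^sub>R (f x)\<^sup>2)"
    by (auto simp: indicator_def)
  ultimately show ?thesis using f A by (auto simp: sqint_def)
qed

text \<open>On a rectangle the double integral factors into two numbers, each bounded by
  Cauchy-Schwarz. Bolzano-Weierstrass makes the first one Cauchy along a subsequence, and
  boundedness of the second is then enough. The preliminary sequence \<open>s\<close> is general so
  that extractions can be nested in the sum case.\<close>

lemma finite_rank_Cauchy_subseq:
  fixes f :: "nat \<Rightarrow> 'a \<Rightarrow> real" and g :: "nat \<Rightarrow> 'b \<Rightarrow> real"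
  assumes f: "\<And>n. sqint M (f n)" "\<And>n. (\<integral>x. (f n x)\<^sup>2 \<partial>M) \<le> C"
    and g: "\<And>n. sqint N (g n)" "\<And>n. (\<integral>x. (g n x)\<^sup>2 \<partial>N) \<le> C"
  shows "finite_rank M N k \<Longrightarrow> strict_mono s \<Longrightarrow> \<exists>r. strict_mono (r :: nat \<Rightarrow> nat) \<and>
    (\<forall>e>0. \<exists>n0. \<forall>m\<ge>n0. \<forall>n\<ge>n0. \<bar>\<integral>z. k z * ((f (s (r m)) (fst z) - f (s (r n)) (fst z)) *
        (g (s (r m)) (snd z) - g (s (r n)) (snd z))) \<partial>(M \<Otimes>\<^sub>M N)\<bar> < e)"
proof (induction k arbitrary: s rule: finite_rank.induct)
  case (rectangle A B c)
  have bound: "\<bar>\<integral>x. indicator A x * h x \<partial>L\<bar> \<le> sqrt (measure L (space L)) * sqrt D"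
    if h: "sqint L h" "(\<integral>x. (h x)\<^sup>2 \<partial>L) \<le> D" and L: "finite_measure L" "A \<in> sets L"
    for h :: "'c \<Rightarrow> real" and D L A
  proof -
    interpret finite_measure L by fact
    have sq: "(\<lambda>x. (indicator A x :: real)\<^sup>2) = indicator A" by (auto simp: indicator_def)
    have i: "sqint L (indicator A)"
      using L by (intro sqint_bounded[where B = 1]) (auto simp: indicator_def)
    have "\<bar>\<integral>x. indicator A x * h x \<partial>L\<bar> \<le> sqrt (measure L A) * sqrt (\<integral>x. (h x)\<^sup>2 \<partial>L)"
      using Cauchy_Schwarz_abs[OF i h(1)] L by (simp add: sq)
    also have "\<dots> \<le> sqrt (measure L (space L)) * sqrt D"
      using h(2) L by (intro mult_mono real_sqrt_le_mono bounded_measure) auto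
    finally show ?thesis .
  qed
  define a where "a n = (\<integral>x. indicator A x * f (s n) x \<partial>M)" for n
  define b where "b n = (\<integral>x. indicator B x * g (s n) x \<partial>N)" for n
  have "bounded (range a)"
    unfolding a_def bounded_iff using bound[OF f M.finite_measure_axioms rectangle(1)] by auto
  then obtain l r where r: "strict_mono r" "(a \<circ> r) \<longlonglongrightarrow> l"
    using bounded_imp_convergent_subsequence[of a] by auto
  define Bd where "Bd = 2 * (sqrt (measure N (space N)) * sqrt C)"
  have b: "\<bar>b m - b n\<bar> \<le> Bd" for m n
    using bound[OF g[of "s m"] N.finite_measure_axioms rectangle(2)] bound[OF g[of "s n"] N.finite_measure_axioms rectangle(2)]
    unfolding b_def Bd_def by linarith
  have Bd: "Bd \<ge> 0" using b[of 0 0] by simp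
  have eq: "(\<integral>z. c * (indicator A (fst z) * indicator B (snd z)) * ((f (s (r m)) (fst z) - f (s (r n)) (fst z)) *
        (g (s (r m)) (snd z) - g (s (r n)) (snd z))) \<partial>(M \<Otimes>\<^sub>M N)) = c * ((a (r m) - a (r n)) * (b (r m) - b (r n)))" for m n
  proof -
    have fA: "sqint M (\<lambda>x. indicator A x * f i x)" for i by (intro sqint_mult_indicator f rectangle)
    have gB: "sqint N (\<lambda>x. indicator B x * g i x)" for i by (intro sqint_mult_indicator g rectangle)
    have "(\<integral>z. c * (indicator A (fst z) * indicator B (snd z)) * ((f (s (r m)) (fst z) - f (s (r n)) (fst z)) *
        (g (s (r m)) (snd z) - g (s (r n)) (snd z))) \<partial>(M \<Otimes>\<^sub>M N))
      = c * (\<integral>z. (indicator A (fst z) * f (s (r m)) (fst z) - indicator A (fst z) * f (s (r n)) (fst z)) *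
          (indicator B (snd z) * g (s (r m)) (snd z) - indicator B (snd z) * g (s (r n)) (snd z)) \<partial>(M \<Otimes>\<^sub>M N))"
      by (subst integral_mult_right_zero[symmetric]) (intro Bochner_Integration.integral_cong refl, simp add: algebra_simps)
    also have "\<dots> = c * ((a (r m) - a (r n)) * (b (r m) - b (r n)))"
      using tensor_integral(2)[OF sqint_diff[OF fA[of "s (r m)"] fA[of "s (r n)"]] sqint_diff[OF gB[of "s (r m)"] gB[of "s (r n)"]]]
        sqint_integrable[OF M.finite_measure_axioms fA] sqint_integrable[OF N.finite_measure_axioms gB]
      by (simp add: a_def b_def)
    finally show ?thesis .
  qed
  have C: "\<exists>n0. \<forall>m\<ge>n0. \<forall>n\<ge>n0. \<bar>c * ((a (r m) - a (r n)) * (b (r m) - b (r n)))\<bar> < e" if "e > 0" for e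
  proof -
    \<comment> \<open>The \<open>+ 1\<close> keeps the denominator positive when \<open>c\<close> or
      \<open>Bd\<close> vanishes and makes the final inequality strict.\<close>
    define d where "d = e / (\<bar>c\<bar> * Bd + 1)"
    have pos: "\<bar>c\<bar> * Bd + 1 > 0" using Bd by (simp add: add_nonneg_pos)
    have "d > 0" using that pos by (simp add: d_def)
    have "Cauchy (a \<circ> r)" using r by (intro LIMSEQ_imp_Cauchy)
    then obtain n0 where n0: "\<And>m n. m \<ge> n0 \<Longrightarrow> n \<ge> n0 \<Longrightarrow> \<bar>a (r m) - a (r n)\<bar> < d"
      using \<open>d > 0\<close> unfolding Cauchy_def dist_real_def comp_def by blast
    have "\<bar>c * ((a (r m) - a (r n)) * (b (r m) - b (r n)))\<bar> < e" if "m \<ge> n0" "n \<ge> n0" for m n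
    proof -
      have "\<bar>c * ((a (r m) - a (r n)) * (b (r m) - b (r n)))\<bar> = \<bar>c\<bar> * (\<bar>a (r m) - a (r n)\<bar> * \<bar>b (r m) - b (r n)\<bar>)"
        by (simp add: abs_mult)
      also have "\<dots> \<le> \<bar>c\<bar> * (d * Bd)"
        using n0[OF that] b[of "r m" "r n"] \<open>d > 0\<close> by (intro mult_left_mono mult_mono) auto
      also have "\<dots> < d * (\<bar>c\<bar> * Bd + 1)" using \<open>d > 0\<close> by (simp add: algebra_simps)
      also have "\<dots> = e" using pos by (simp add: d_def)
      finally show ?thesis .
    qed
    then show ?thesis by blast
  qed
  show ?case
    by (rule exI[of _ r], intro conjI allI impI r(1)) (unfold eq, rule C)
next
  case (add k l)
  let ?t = "\<lambda>m n z. (f m (fst z) - f n (fst z)) * (g m (snd z) - g n (snd z))"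
  from add.IH(1)[OF add.prems] obtain r :: "nat \<Rightarrow> nat" where r: "strict_mono r"
    "\<forall>e>0. \<exists>n0. \<forall>m\<ge>n0. \<forall>n\<ge>n0. \<bar>\<integral>z. k z * ?t (s (r m)) (s (r n)) z \<partial>(M \<Otimes>\<^sub>M N)\<bar> < e" by (elim exE conjE) (rule that; assumption)
  \<comment> \<open>The second kernel is treated along the subsequence already found for the first;
    the estimate for the first survives because \<open>q n \<ge> n\<close>.\<close>
  have "strict_mono (s \<circ> r)" using add.prems r(1) by (rule strict_mono_o)
  from add.IH(2)[OF this] obtain q :: "nat \<Rightarrow> nat" where q: "strict_mono q"
    "\<forall>e>0. \<exists>n0. \<forall>m\<ge>n0. \<forall>n\<ge>n0. \<bar>\<integral>z. l z * ?t (s (r (q m))) (s (r (q n))) z \<partial>(M \<Otimes>\<^sub>M N)\<bar> < e"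
    unfolding comp_def by (elim exE conjE) (rule that; assumption)
  have "\<exists>n0. \<forall>m\<ge>n0. \<forall>n\<ge>n0. \<bar>\<integral>z. (k z + l z) * ?t (s ((r \<circ> q) m)) (s ((r \<circ> q) n)) z \<partial>(M \<Otimes>\<^sub>M N)\<bar> < e" if "e > 0" for e
  proof -
    from r(2)[rule_format, of "e/2"] that obtain n1 where n1:
      "\<And>m n. m \<ge> n1 \<Longrightarrow> n \<ge> n1 \<Longrightarrow> \<bar>\<integral>z. k z * ?t (s (r m)) (s (r n)) z \<partial>(M \<Otimes>\<^sub>M N)\<bar> < e/2" by auto
    from q(2)[rule_format, of "e/2"] that obtain n2 where n2:
      "\<And>m n. m \<ge> n2 \<Longrightarrow> n \<ge> n2 \<Longrightarrow> \<bar>\<integral>z. l z * ?t (s (r (q m))) (s (r (q n))) z \<partial>(M \<Otimes>\<^sub>M N)\<bar> < e/2" by auto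
    have "\<bar>\<integral>z. (k z + l z) * ?t (s ((r \<circ> q) m)) (s ((r \<circ> q) n)) z \<partial>(M \<Otimes>\<^sub>M N)\<bar> < e"
      if mn: "m \<ge> max n1 n2" "n \<ge> max n1 n2" for m n
    proof -
      have t: "sqint (M \<Otimes>\<^sub>M N) (?t i j)" for i j
        using sqint_tensor(1)[OF sqint_diff[OF f(1) f(1)] sqint_diff[OF g(1) g(1)]] .
      have "(\<integral>z. (k z + l z) * ?t (s ((r \<circ> q) m)) (s ((r \<circ> q) n)) z \<partial>(M \<Otimes>\<^sub>M N)) =
        (\<integral>z. k z * ?t (s (r (q m))) (s (r (q n))) z \<partial>(M \<Otimes>\<^sub>M N)) + (\<integral>z. l z * ?t (s (r (q m))) (s (r (q n))) z \<partial>(M \<Otimes>\<^sub>M N))"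
        using sqint_mult[OF sqint_finite_rank[OF add.hyps(1)] t[of "s (r (q m))" "s (r (q n))"]]
          sqint_mult[OF sqint_finite_rank[OF add.hyps(2)] t[of "s (r (q m))" "s (r (q n))"]]
        by (simp add: distrib_right)
      moreover have "q m \<ge> m" "q n \<ge> n" using q(1) by (auto intro: strict_mono_imp_increasing)
      ultimately show ?thesis using n1[of "q m" "q n"] n2[of m n] mn by auto
    qed
    then show ?thesis by blast
  qed
  moreover have "strict_mono (r \<circ> q)" using r(1) q(1) by (rule strict_mono_o)
  ultimately show ?case by blast
qed

text \<open>Compactness of the cross term in quantitative form. The error of a finite rank
  approximation within \<open>e\<close> in L2 is at most \<open>e\<close> times the product of the
  two norms, hence at most \<open>e\<close> times the sum of their squares. The subsequence may
  depend on \<open>e\<close>: a single \<open>e\<close>, fixed by the coercivity constant, is used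
  later, so no diagonal sequence is taken.\<close>

lemma kernel_Cauchy_subseq:
  fixes f :: "nat \<Rightarrow> 'a \<Rightarrow> real" and g :: "nat \<Rightarrow> 'b \<Rightarrow> real"
  assumes f: "\<And>n. sqint M (f n)" "\<And>n. (\<integral>x. (f n x)\<^sup>2 \<partial>M) \<le> C"
    and g: "\<And>n. sqint N (g n)" "\<And>n. (\<integral>x. (g n x)\<^sup>2 \<partial>N) \<le> C"
    and E: "E \<in> sets (M \<Otimes>\<^sub>M N)" and e: "e > 0"
  shows "\<exists>r. strict_mono (r :: nat \<Rightarrow> nat) \<and> (\<forall>d>0. \<exists>n0. \<forall>m\<ge>n0. \<forall>n\<ge>n0.
     \<bar>\<integral>z. indicator E z * ((f (r m) (fst z) - f (r n) (fst z)) * (g (r m) (snd z) - g (r n) (snd z))) \<partial>(M \<Otimes>\<^sub>M N)\<bar>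
       < e * ((\<integral>x. (f (r m) x - f (r n) x)\<^sup>2 \<partial>M) + (\<integral>x. (g (r m) x - g (r n) x)\<^sup>2 \<partial>N)) + d)"
proof -
  let ?t = "\<lambda>m n z. (f m (fst z) - f n (fst z)) * (g m (snd z) - g n (snd z))"
  let ?F = "\<lambda>m n. \<integral>x. (f m x - f n x)\<^sup>2 \<partial>M" and ?H = "\<lambda>m n. \<integral>x. (g m x - g n x)\<^sup>2 \<partial>N"
  from indicator_approx_finite_rank[OF E, of "e\<^sup>2"] e obtain k where
    k: "finite_rank M N k" "(\<integral>z. (indicator E z - k z)\<^sup>2 \<partial>(M \<Otimes>\<^sub>M N)) < e\<^sup>2" by auto
  from finite_rank_Cauchy_subseq[where f = f and g = g and s = "\<lambda>n. n", OF f g k(1)] obtain r :: "nat \<Rightarrow> nat" where r: "strict_mono r"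
    "\<And>d. d > 0 \<Longrightarrow> \<exists>n0. \<forall>m\<ge>n0. \<forall>n\<ge>n0. \<bar>\<integral>z. k z * ?t (r m) (r n) z \<partial>(M \<Otimes>\<^sub>M N)\<bar> < d"
    by (auto simp: strict_mono_def)
  have main: "\<bar>\<integral>z. indicator E z * ?t m n z \<partial>(M \<Otimes>\<^sub>M N)\<bar>
      \<le> e * (?F m n + ?H m n) + \<bar>\<integral>z. k z * ?t m n z \<partial>(M \<Otimes>\<^sub>M N)\<bar>" for m n
  proof -
    have t: "sqint (M \<Otimes>\<^sub>M N) (?t m n)"
      using sqint_tensor(1)[OF sqint_diff[OF f(1) f(1)] sqint_diff[OF g(1) g(1)]] .
    have dk: "sqint (M \<Otimes>\<^sub>M N) (\<lambda>z. indicator E z - k z)"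
      by (intro sqint_diff sqint_indicator E sqint_finite_rank k)
    have "(\<integral>z. indicator E z * ?t m n z \<partial>(M \<Otimes>\<^sub>M N)) = (\<integral>z. (indicator E z - k z) * ?t m n z + k z * ?t m n z \<partial>(M \<Otimes>\<^sub>M N))"
      by (simp add: algebra_simps)
    also have "\<dots> = (\<integral>z. (indicator E z - k z) * ?t m n z \<partial>(M \<Otimes>\<^sub>M N)) + (\<integral>z. k z * ?t m n z \<partial>(M \<Otimes>\<^sub>M N))"
      by (intro Bochner_Integration.integral_add sqint_mult t dk sqint_finite_rank k)
    finally have split: "\<bar>\<integral>z. indicator E z * ?t m n z \<partial>(M \<Otimes>\<^sub>M N)\<bar> \<le>
      \<bar>\<integral>z. (indicator E z - k z) * ?t m n z \<partial>(M \<Otimes>\<^sub>M N)\<bar> + \<bar>\<integral>z. k z * ?t m n z \<partial>(M \<Otimes>\<^sub>M N)\<bar>" by linarith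
    have nn: "?F m n \<ge> 0" "?H m n \<ge> 0" by (simp_all add: Bochner_Integration.integral_nonneg)
    have "\<bar>\<integral>z. (indicator E z - k z) * ?t m n z \<partial>(M \<Otimes>\<^sub>M N)\<bar>
      \<le> sqrt (\<integral>z. (indicator E z - k z)\<^sup>2 \<partial>(M \<Otimes>\<^sub>M N)) * sqrt (?F m n * ?H m n)"
      using Cauchy_Schwarz_abs[OF dk t]
      unfolding sqint_tensor(2)[OF sqint_diff[OF f(1) f(1)] sqint_diff[OF g(1) g(1)]] .
    also have "\<dots> \<le> e * (?F m n + ?H m n)"
    proof (intro mult_mono)
      show "sqrt (\<integral>z. (indicator E z - k z)\<^sup>2 \<partial>(M \<Otimes>\<^sub>M N)) \<le> e"
        using k(2) e by (intro real_le_lsqrt) auto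
      show "sqrt (?F m n * ?H m n) \<le> ?F m n + ?H m n"
        by (rule order_trans[OF arith_geo_mean_sqrt[OF nn]]) (use nn in simp)
    qed (use e nn in auto)
    finally show ?thesis using split by linarith
  qed
  have "\<exists>n0. \<forall>m\<ge>n0. \<forall>n\<ge>n0. \<bar>\<integral>z. indicator E z * ?t (r m) (r n) z \<partial>(M \<Otimes>\<^sub>M N)\<bar>
      < e * (?F (r m) (r n) + ?H (r m) (r n)) + d" if "d > 0" for d
  proof -
    from r(2)[OF that] obtain n0 where "\<And>m n. m \<ge> n0 \<Longrightarrow> n \<ge> n0 \<Longrightarrow> \<bar>\<integral>z. k z * ?t (r m) (r n) z \<partial>(M \<Otimes>\<^sub>M N)\<bar> < d"
      by auto
    then show ?thesis using main by (meson add_le_less_mono le_less_trans order_refl)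
  qed
  then show ?thesis using r(1) by blast
qed

end

section \<open>Integrals of periodic functions\<close>

lemma fst_borel_measurable [measurable]: "fst \<in> borel_measurable (borel :: (real \<times> real) measure)"
  and snd_borel_measurable [measurable]: "snd \<in> borel_measurable (borel :: (real \<times> real) measure)"
  by (intro borel_measurable_continuous_onI continuous_intros)+

text \<open>One closed period as a measure on the whole line, so that periodic functions are
  integrated without a quotient; the doubled endpoint is a null set.\<close>

definition torus :: "real measure" where
  "torus = density lborel (\<lambda>x. ennreal (indicator {0..2 * pi} x))"

lemma sets_torus [simp, measurable_cong]: "sets torus = sets borel"
  and space_torus [simp]: "space torus = UNIV"
  by (simp_all add: torus_def)

lemma nn_integral_torus:
  "f \<in> borel_measurable borel \<Longrightarrow> (\<integral>\<^sup>+x. f x \<partial>torus) = (\<integral>\<^sup>+x. indicator {0..2 * pi} x * f x \<partial>lborel)"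
  by (simp add: torus_def nn_integral_density ennreal_indicator)

lemma emeasure_torus: "A \<in> sets borel \<Longrightarrow> emeasure torus A = emeasure lborel (A \<inter> {0..2 * pi})"
  by (simp add: torus_def emeasure_density ennreal_indicator indicator_inter_arith[symmetric] Int_commute)

lemma emeasure_torus_UNIV: "emeasure torus UNIV = ennreal (2 * pi)"
  by (simp add: emeasure_torus)

interpretation torus: finite_measure torus
  by standard (simp add: emeasure_torus_UNIV)

lemma measure_torus_UNIV [simp]: "measure torus UNIV = 2 * pi"
  by (simp add: measure_def emeasure_torus_UNIV)

lemma integral_torus:
  fixes f :: "real \<Rightarrow> real"
  shows "f \<in> borel_measurable borel \<Longrightarrow> (\<integral>x. f x \<partial>torus) = (LINT x:{0..2 * pi}|lborel. f x)"
  by (simp add: torus_def integral_density set_lebesgue_integral_def)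

lemma integrable_torus:
  fixes f :: "real \<Rightarrow> real"
  shows "f \<in> borel_measurable borel \<Longrightarrow> integrable torus f \<longleftrightarrow> set_integrable lborel {0..2 * pi} f"
  by (simp add: torus_def integrable_density set_integrable_def)

lemma AE_torus: "(AE x in torus. P x) \<longleftrightarrow> (AE x in lborel. x \<in> {0..2 * pi} \<longrightarrow> P x)"
  unfolding torus_def by (subst AE_density) (auto simp: indicator_def)

text \<open>Carries a change of variables proved for nonnegative integrals over to signed ones, by
  applying it to the positive and the negative part. Integrability is known on the side of
  \<open>g\<close> and obtained on the side of \<open>f\<close>.\<close>

lemma integral_transfer:
  fixes f :: "'a \<Rightarrow> real" and g :: "'b \<Rightarrow> real"
  assumes [measurable]: "f \<in> borel_measurable M" and g: "integrable N g"
    and eq: "(\<integral>\<^sup>+x. ennreal (f x) \<partial>M) = ennreal c * (\<integral>\<^sup>+x. ennreal (g x) \<partial>N)"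
      "(\<integral>\<^sup>+x. ennreal (- f x) \<partial>M) = ennreal c * (\<integral>\<^sup>+x. ennreal (- g x) \<partial>N)"
    and c: "c \<ge> 0"
  shows "integrable M f" "(\<integral>x. f x \<partial>M) = c * (\<integral>x. g x \<partial>N)"
proof -
  have fin: "(\<integral>\<^sup>+x. ennreal (g x) \<partial>N) \<noteq> \<infinity>" "(\<integral>\<^sup>+x. ennreal (- g x) \<partial>N) \<noteq> \<infinity>"
    using g unfolding real_integrable_def by auto
  then have fin': "(\<integral>\<^sup>+x. ennreal (f x) \<partial>M) \<noteq> \<infinity>" "(\<integral>\<^sup>+x. ennreal (- f x) \<partial>M) \<noteq> \<infinity>"
    unfolding eq by (auto simp: ennreal_mult_eq_top_iff)
  then show f: "integrable M f" unfolding real_integrable_def by simp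
  show "(\<integral>x. f x \<partial>M) = c * (\<integral>x. g x \<partial>N)"
    unfolding real_lebesgue_integral_def[OF f] real_lebesgue_integral_def[OF g] eq
    using c by (simp add: enn2real_mult right_diff_distrib)
qed

section \<open>Reduction modulo the period\<close>

lemma periodic_of_int:
  fixes p :: "real \<Rightarrow> 'a"
  assumes "\<And>x. p (x + 2 * pi) = p x"
  shows "p (x + 2 * pi * of_int k) = p x"
proof (induction k rule: int_induct[where k = 0])
  case (step1 i)
  then show ?case using assms[of "x + 2 * pi * of_int i"] by (simp add: algebra_simps)
next
  case (step2 i)
  then show ?case using assms[of "x + 2 * pi * of_int (i - 1)"] by (simp add: algebra_simps)
qed simp

text \<open>The values lie in the half-open period, so \<open>2 * pi\<close> is sent to 0; on the
  closed period \<open>wrap\<close> is the identity only almost everywhere.\<close>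

definition wrap :: "real \<Rightarrow> real" where
  "wrap x = x - 2 * pi * of_int \<lfloor>x / (2 * pi)\<rfloor>"

lemma wrap_bounds: "0 \<le> wrap x" "wrap x < 2 * pi"
proof -
  have "of_int \<lfloor>x / (2 * pi)\<rfloor> \<le> x / (2 * pi)" "x / (2 * pi) < of_int \<lfloor>x / (2 * pi)\<rfloor> + 1"
    by linarith+
  then have "of_int \<lfloor>x / (2 * pi)\<rfloor> * (2 * pi) \<le> x" "x < (of_int \<lfloor>x / (2 * pi)\<rfloor> + 1) * (2 * pi)"
    by (simp_all only: pos_le_divide_eq pos_divide_less_eq pi_gt_zero zero_less_mult_iff zero_less_numeral simp_thms)
  then show "0 \<le> wrap x" "wrap x < 2 * pi" by (simp_all add: wrap_def algebra_simps)
qed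

lemma wrap_mem: "wrap x \<in> {0..2 * pi}"
  using wrap_bounds[of x] by simp

lemma wrap_shift: "wrap (x + 2 * pi) = wrap x"
proof -
  have "(x + 2 * pi) / (2 * pi) = x / (2 * pi) + 1" by (simp add: field_simps)
  then have "\<lfloor>(x + 2 * pi) / (2 * pi)\<rfloor> = \<lfloor>x / (2 * pi)\<rfloor> + 1" by simp
  then show ?thesis by (simp add: wrap_def algebra_simps)
qed

lemma wrap_eq: "0 \<le> x \<Longrightarrow> x < 2 * pi \<Longrightarrow> wrap x = x"
proof -
  assume "0 \<le> x" "x < 2 * pi"
  then have "\<lfloor>x / (2 * pi)\<rfloor> = 0" by (simp add: floor_eq_iff)
  then show ?thesis by (simp add: wrap_def)
qed

lemma wrap_measurable [measurable]: "wrap \<in> borel_measurable borel"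
  unfolding wrap_def by measurable

lemma periodic_wrap:
  fixes p :: "real \<Rightarrow> 'a"
  assumes "\<And>x. p (x + 2 * pi) = p x"
  shows "p (wrap x) = p x"
  using periodic_of_int[of p "wrap x" "\<lfloor>x / (2 * pi)\<rfloor>", OF assms] by (simp add: wrap_def)

text \<open>Each \<open>wrap x\<close> is one of countably many translates of \<open>x\<close>, and
  each translate avoids the exceptional set for almost every \<open>x\<close>.\<close>

lemma AE_wrap:
  assumes [measurable]: "Measurable.pred borel P" and "AE x in lborel. x \<in> {0..2 * pi} \<longrightarrow> P x"
  shows "AE x in lborel. P (wrap x)"
proof -
  have "AE x in lborel. \<forall>k::int. (- 2 * pi * of_int k + 1 * x \<in> {0..2 * pi}) \<longrightarrow> P (- 2 * pi * of_int k + 1 * x)"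
    unfolding AE_all_countable by (intro allI AE_borel_affine assms(2)) auto
  then show ?thesis
  proof eventually_elim
    case (elim x)
    have "- 2 * pi * of_int \<lfloor>x / (2 * pi)\<rfloor> + 1 * x = wrap x" by (simp add: wrap_def)
    then show ?case using elim[rule_format, of "\<lfloor>x / (2 * pi)\<rfloor>"] wrap_mem[of x] by simp
  qed
qed

lemma AE_torus_wrap: "AE x in torus. wrap x = x"
proof -
  have "AE x in lborel. x \<noteq> 2 * pi" by (rule AE_lborel_singleton)
  then show ?thesis unfolding AE_torus by eventually_elim (auto intro: wrap_eq)
qed

text \<open>A Borel version of \<open>f\<close> is periodic only up to a null set. Composing it with
  \<open>wrap\<close> makes the periodicity exact, at the price of pulling the null set back by
  \<open>wrap\<close>.\<close>

lemma periodic_borel_version: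
  assumes "f \<in> borel_measurable lebesgue" "periodic f"
  obtains g where "g \<in> borel_measurable borel" "periodic g" "AE x in lborel. f x = g x"
proof -
  obtain h where [measurable]: "h \<in> borel_measurable lborel" and h: "AE x in lborel. f x = h x"
    using completion_ex_borel_measurable_real[OF assms(1)] by auto
  from h obtain N where N: "{x \<in> space lborel. \<not> f x = h x} \<subseteq> N" "emeasure lborel N = 0" "N \<in> sets lborel"
    by (rule AE_E)
  have [measurable]: "N \<in> sets borel" using N(3) by simp
  have "AE x in lborel. x \<notin> N" using N by (intro AE_not_in) auto
  then have "AE x in lborel. wrap x \<notin> N" by (intro AE_wrap) auto
  then have "AE x in lborel. f x = h (wrap x)"
  proof eventually_elim
    case (elim x)
    then have "f (wrap x) = h (wrap x)" using N(1) by auto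
    then show ?case using periodic_wrap[of f x] assms(2) by (simp add: periodic_def)
  qed
  then show ?thesis
    by (intro that[of "\<lambda>x. h (wrap x)"]) (auto simp: periodic_def wrap_shift)
qed

text \<open>Modulo the period the shift is some \<open>r\<close> in the half-open period; the window
  from \<open>r\<close> to \<open>r + 2 * pi\<close> is cut at \<open>2 * pi\<close> and its right
  part moved back by one period.\<close>

lemma nn_integral_torus_shift:
  fixes p :: "real \<Rightarrow> ennreal"
  assumes [measurable]: "p \<in> borel_measurable borel" and p: "\<And>x. p (x + 2 * pi) = p x"
  shows "(\<integral>\<^sup>+x. p (x + s) \<partial>torus) = (\<integral>\<^sup>+x. p x \<partial>torus)"
proof -
  define r where "r = wrap s"
  have r: "0 \<le> r" "r < 2 * pi" using wrap_bounds by (auto simp: r_def)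
  have "p (x + s) = p (x + r)" for x
    using periodic_of_int[of p "x + r" "\<lfloor>s / (2 * pi)\<rfloor>", OF p] by (simp add: r_def wrap_def)
  then have "(\<integral>\<^sup>+x. p (x + s) \<partial>torus) = (\<integral>\<^sup>+x. indicator {0..2 * pi} x * p (x + r) \<partial>lborel)"
    by (simp add: nn_integral_torus)
  also have "\<dots> = (\<integral>\<^sup>+x. indicator {r..r + 2 * pi} x * p x \<partial>lborel)"
    by (subst nn_integral_real_affine[where c = 1 and t = r and f = "\<lambda>x. indicator {r..r + 2 * pi} x * p x"])
       (auto intro!: nn_integral_cong simp: indicator_def add_ac)
  also have "\<dots> = (\<integral>\<^sup>+x. indicator {r..2 * pi} x * p x + indicator {2 * pi<..r + 2 * pi} x * p x \<partial>lborel)"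
    using r by (intro nn_integral_cong) (auto simp: indicator_def)
  also have "\<dots> = (\<integral>\<^sup>+x. indicator {r..2 * pi} x * p x \<partial>lborel) + (\<integral>\<^sup>+x. indicator {2 * pi<..r + 2 * pi} x * p x \<partial>lborel)"
    by (rule nn_integral_add) auto
  also have "(\<integral>\<^sup>+x. indicator {2 * pi<..r + 2 * pi} x * p x \<partial>lborel) = (\<integral>\<^sup>+x. indicator {0<..r} x * p x \<partial>lborel)"
    by (subst nn_integral_real_affine[where c = 1 and t = "2 * pi"])
       (auto intro!: nn_integral_cong simp: indicator_def p[of "_", unfolded add.commute[of _ "2 * pi"]])
  also have "\<dots> = (\<integral>\<^sup>+x. indicator {0..<r} x * p x \<partial>lborel)"
  proof (rule nn_integral_cong_AE)
    have "AE x in lborel. x \<noteq> 0" "AE x in lborel. x \<noteq> r" by (rule AE_lborel_singleton)+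
    then show "AE x in lborel. indicator {0<..r} x * p x = indicator {0..<r} x * p x"
      by eventually_elim (auto simp: indicator_def)
  qed
  also have "(\<integral>\<^sup>+x. indicator {r..2 * pi} x * p x \<partial>lborel) + \<dots>
      = (\<integral>\<^sup>+x. indicator {r..2 * pi} x * p x + indicator {0..<r} x * p x \<partial>lborel)"
    by (rule nn_integral_add[symmetric]) auto
  also have "\<dots> = (\<integral>\<^sup>+x. indicator {0..2 * pi} x * p x \<partial>lborel)"
    using r by (intro nn_integral_cong) (auto simp: indicator_def)
  finally show ?thesis by (simp add: nn_integral_torus)
qed

lemma integral_torus_shift:
  fixes p :: "real \<Rightarrow> real"
  assumes [measurable]: "p \<in> borel_measurable borel" and p: "periodic p" and i: "integrable torus p"
  shows "integrable torus (\<lambda>x. p (x + s))" "(\<integral>x. p (x + s) \<partial>torus) = (\<integral>x. p x \<partial>torus)"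
proof -
  have eq: "(\<integral>\<^sup>+x. ennreal (p (x + s)) \<partial>torus) = ennreal 1 * (\<integral>\<^sup>+x. ennreal (p x) \<partial>torus)"
     "(\<integral>\<^sup>+x. ennreal (- p (x + s)) \<partial>torus) = ennreal 1 * (\<integral>\<^sup>+x. ennreal (- p x) \<partial>torus)"
    using p nn_integral_torus_shift[of "\<lambda>x. ennreal (p x)" s] nn_integral_torus_shift[of "\<lambda>x. ennreal (- p x)" s]
    by (auto simp: periodic_def)
  have [measurable]: "(\<lambda>x. p (x + s)) \<in> borel_measurable torus" by measurable
  show "integrable torus (\<lambda>x. p (x + s))" "(\<integral>x. p (x + s) \<partial>torus) = (\<integral>x. p x \<partial>torus)"
    using integral_transfer[OF _ i eq] by simp_all
qed

text \<open>A finite measure on \<open>2 * n\<close> periods: in characteristic coordinates the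
  observation set leaves a single period, while the kernel lemmas need finite measures.\<close>

definition wide :: "nat \<Rightarrow> real measure" where
  "wide n = density lborel (\<lambda>x. ennreal (indicator {- 2 * pi * real n..2 * pi * real n} x))"

lemma sets_wide [simp, measurable_cong]: "sets (wide n) = sets borel"
  and space_wide [simp]: "space (wide n) = UNIV"
  by (simp_all add: wide_def)

lemma nn_integral_wide:
  "f \<in> borel_measurable borel \<Longrightarrow>
    (\<integral>\<^sup>+x. f x \<partial>wide n) = (\<integral>\<^sup>+x. indicator {- 2 * pi * real n..2 * pi * real n} x * f x \<partial>lborel)"
  by (simp add: wide_def nn_integral_density ennreal_indicator)

lemma finite_measure_wide: "finite_measure (wide n)"
proof
  have "emeasure (wide n) (space (wide n)) = (\<integral>\<^sup>+x. 1 \<partial>wide n)" by simp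
  also have "\<dots> = emeasure lborel {- 2 * pi * real n..2 * pi * real n}" by (subst nn_integral_wide) auto
  also have "\<dots> < \<infinity>" by simp
  finally show "emeasure (wide n) (space (wide n)) \<noteq> \<infinity>" by simp
qed

lemma nn_integral_wide_le:
  fixes p :: "real \<Rightarrow> ennreal"
  assumes [measurable]: "p \<in> borel_measurable borel" and p: "\<And>x. p (x + 2 * pi) = p x"
  shows "(\<integral>\<^sup>+x. p x \<partial>wide n) \<le> ennreal (2 * real n + 1) * (\<integral>\<^sup>+x. p x \<partial>torus)"
proof -
  \<comment> \<open>The range of the floor of \<open>x / (2 * pi)\<close>; the value
    \<open>n\<close> occurs only at the right endpoint, which turns the factor \<open>2 * n\<close>
    into \<open>2 * n + 1\<close>.\<close>
  let ?K = "{- int n..int n}"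
  have "(\<integral>\<^sup>+x. p x \<partial>wide n) \<le> (\<integral>\<^sup>+x. (\<Sum>k\<in>?K. indicator {0..2 * pi} (x - 2 * pi * of_int k) * p x) \<partial>lborel)"
    unfolding nn_integral_wide[OF assms(1)]
  proof (rule nn_integral_mono)
    fix x :: real
    show "indicator {- 2 * pi * real n..2 * pi * real n} x * p x
      \<le> (\<Sum>k\<in>?K. indicator {0..2 * pi} (x - 2 * pi * of_int k) * p x)"
    proof (cases "x \<in> {- 2 * pi * real n..2 * pi * real n}")
      case True
      let ?k = "\<lfloor>x / (2 * pi)\<rfloor>"
      have "- real n \<le> x / (2 * pi)" "x / (2 * pi) \<le> real n" using True by (auto simp: field_simps)
      then have k: "?k \<in> ?K" by (auto simp: le_floor_iff floor_le_iff)
      have "p x = indicator {0..2 * pi} (x - 2 * pi * of_int ?k) * p x"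
        using wrap_mem[of x] by (simp add: wrap_def)
      also have "\<dots> \<le> (\<Sum>k\<in>?K. indicator {0..2 * pi} (x - 2 * pi * of_int k) * p x)"
        using k by (intro member_le_sum) auto
      finally show ?thesis using True by simp
    qed simp
  qed
  also have "\<dots> = (\<Sum>k\<in>?K. \<integral>\<^sup>+x. indicator {0..2 * pi} (x - 2 * pi * of_int k) * p x \<partial>lborel)"
    by (rule nn_integral_sum) measurable
  also have "\<dots> = (\<Sum>k\<in>?K. \<integral>\<^sup>+x. p x \<partial>torus)"
  proof (rule sum.cong[OF refl])
    fix k
    have "p (2 * pi * of_int k + x) = p x" for x
      using periodic_of_int[of p x k, OF p] by (simp add: add.commute)
    then show "(\<integral>\<^sup>+x. indicator {0..2 * pi} (x - 2 * pi * of_int k) * p x \<partial>lborel) = (\<integral>\<^sup>+x. p x \<partial>torus)"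
      by (subst nn_integral_real_affine[where c = 1 and t = "2 * pi * of_int k"]) (auto simp: nn_integral_torus)
  qed
  also have "\<dots> = ennreal (2 * real n + 1) * (\<integral>\<^sup>+x. p x \<partial>torus)"
  proof -
    have "of_nat (card ?K) = ennreal (2 * real n + 1)"
      by (simp add: ennreal_of_nat_eq_real_of_nat)
    then show ?thesis by simp
  qed
  finally show ?thesis .
qed

section \<open>Changes of variables in the plane\<close>

lemma nn_integral_plane:
  fixes H :: "real \<times> real \<Rightarrow> ennreal"
  assumes [measurable]: "H \<in> borel_measurable borel"
  shows "(\<integral>\<^sup>+z. H z \<partial>lborel) = (\<integral>\<^sup>+t. \<integral>\<^sup>+x. H (t, x) \<partial>lborel \<partial>lborel)"
  using lborel.nn_integral_fst[of H lborel] by (simp add: lborel_prod)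

text \<open>\<open>y\<close> labels the characteristic \<open>x - \<sigma> * t = y\<close> and
  \<open>s\<close> is the time on it; each time slice is translated and the order of integration
  exchanged.\<close>

lemma nn_integral_shear:
  fixes H :: "real \<times> real \<Rightarrow> ennreal"
  assumes [measurable]: "H \<in> borel_measurable borel"
  shows "(\<integral>\<^sup>+z. H z \<partial>lborel) = (\<integral>\<^sup>+y. \<integral>\<^sup>+s. H (s, y + \<sigma> * s) \<partial>lborel \<partial>lborel)"
proof -
  have "(\<integral>\<^sup>+z. H z \<partial>lborel) = (\<integral>\<^sup>+s. \<integral>\<^sup>+y. H (s, y + \<sigma> * s) \<partial>lborel \<partial>lborel)"
    unfolding nn_integral_plane[OF assms]
  proof (rule nn_integral_cong)
    fix s :: real
    show "(\<integral>\<^sup>+x. H (s, x) \<partial>lborel) = (\<integral>\<^sup>+y. H (s, y + \<sigma> * s) \<partial>lborel)"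
      by (subst nn_integral_real_affine[where c = 1 and t = "\<sigma> * s"]) (auto simp: add.commute)
  qed
  also have "\<dots> = (\<integral>\<^sup>+y. \<integral>\<^sup>+s. H (s, y + \<sigma> * s) \<partial>lborel \<partial>lborel)"
    by (rule lborel_pair.Fubini'[symmetric]) measurable
  finally show ?thesis .
qed

lemma AE_shear:
  assumes "AE x in lborel. P x"
  shows "AE z in (lborel :: (real \<times> real) measure). P (snd z - \<sigma> * fst z)"
proof -
  from assms obtain N where N: "{x \<in> space lborel. \<not> P x} \<subseteq> N" "emeasure lborel N = 0" "N \<in> sets lborel"
    by (rule AE_E)
  have [measurable]: "N \<in> sets borel" using N(3) by simp
  have "emeasure lborel {z :: real \<times> real. snd z - \<sigma> * fst z \<in> N} = (\<integral>\<^sup>+z. indicator N (snd z - \<sigma> * fst z) \<partial>lborel)"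
  proof -
    have "(\<integral>\<^sup>+z. indicator N (snd z - \<sigma> * fst z) \<partial>lborel) = (\<integral>\<^sup>+z. indicator {z :: real \<times> real. snd z - \<sigma> * fst z \<in> N} z \<partial>lborel)"
      by (intro nn_integral_cong) (auto split: split_indicator)
    then show ?thesis by simp
  qed
  also have "\<dots> = (\<integral>\<^sup>+y. \<integral>\<^sup>+s. indicator N (y::real) \<partial>(lborel :: real measure) \<partial>lborel)"
    by (subst nn_integral_shear[where \<sigma> = \<sigma>]) auto
  also have "\<dots> = (\<integral>\<^sup>+y. 0 \<partial>(lborel :: real measure))"
  proof (rule nn_integral_cong_AE)
    have "AE x in lborel. x \<notin> N" using N by (intro AE_not_in) auto
    then show "AE y in lborel. (\<integral>\<^sup>+s. indicator N (y::real) \<partial>(lborel :: real measure)) = 0"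
      by eventually_elim auto
  qed
  finally have "{z :: real \<times> real. snd z - \<sigma> * fst z \<in> N} \<in> null_sets lborel" by (auto simp: null_sets_def)
  then show ?thesis
    by (rule AE_I') (use N(1) in auto)
qed

lemma null_set_shear:
  fixes N :: "(real \<times> real) set"
  assumes "N \<in> null_sets lborel"
  shows "AE y in lborel. emeasure lborel {s. (s, y + \<sigma> * s) \<in> N} = 0"
proof -
  have [measurable]: "N \<in> sets borel" using assms by auto
  have "(\<integral>\<^sup>+y. \<integral>\<^sup>+s. indicator N (s, y + \<sigma> * s) \<partial>lborel \<partial>lborel) = (\<integral>\<^sup>+z. indicator N z \<partial>lborel)"
    by (rule nn_integral_shear[symmetric]) auto
  also have "\<dots> = 0" using assms by auto
  finally have "AE y in lborel. (\<integral>\<^sup>+s. indicator N (s, y + \<sigma> * s) \<partial>lborel) = 0"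
    by (subst (asm) nn_integral_0_iff_AE) auto
  then show ?thesis
  proof eventually_elim
    case (elim y)
    have "(\<integral>\<^sup>+s. indicator N (s, y + \<sigma> * s) \<partial>lborel) = (\<integral>\<^sup>+s. indicator {s. (s, y + \<sigma> * s) \<in> N} s \<partial>lborel)"
      by (intro nn_integral_cong) (auto simp: indicator_def)
    also have "\<dots> = emeasure lborel {s. (s, y + \<sigma> * s) \<in> N}" by (intro nn_integral_indicator) auto
    finally show ?case using elim by simp
  qed
qed

text \<open>On the right \<open>z\<close> holds the characteristic coordinates \<open>x + t\<close>
  and \<open>x - t\<close>, and 1/2 is the Jacobian. The map is a shear followed by a scaling in one
  variable.\<close>

lemma nn_integral_rotate:
  fixes H :: "real \<times> real \<Rightarrow> ennreal"
  assumes [measurable]: "H \<in> borel_measurable borel"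
  shows "(\<integral>\<^sup>+z. H z \<partial>lborel) = ennreal (1/2) * (\<integral>\<^sup>+z. H ((fst z - snd z) / 2, (fst z + snd z) / 2) \<partial>lborel)"
proof -
  have "(\<integral>\<^sup>+z. H z \<partial>lborel) = (\<integral>\<^sup>+y. \<integral>\<^sup>+s. H (s, y + 1 * s) \<partial>lborel \<partial>lborel)"
    by (rule nn_integral_shear) measurable
  also have "\<dots> = (\<integral>\<^sup>+y. ennreal (1/2) * (\<integral>\<^sup>+x. H ((x - y) / 2, (x + y) / 2) \<partial>lborel) \<partial>lborel)"
  proof (rule nn_integral_cong)
    fix y :: real
    have eq: "(- y / 2 + 1/2 * x, y + 1 * (- y / 2 + 1/2 * x)) = ((x - y) / 2, (x + y) / 2)" for x
      by (simp add: field_simps)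
    have "(\<integral>\<^sup>+s. H (s, y + 1 * s) \<partial>lborel) =
      ennreal \<bar>1/2\<bar> * (\<integral>\<^sup>+x. H (- y / 2 + 1/2 * x, y + 1 * (- y / 2 + 1/2 * x)) \<partial>lborel)"
      by (rule nn_integral_real_affine) auto
    then show "(\<integral>\<^sup>+s. H (s, y + 1 * s) \<partial>lborel) = ennreal (1/2) * (\<integral>\<^sup>+x. H ((x - y) / 2, (x + y) / 2) \<partial>lborel)"
      unfolding eq by simp
  qed
  also have "\<dots> = ennreal (1/2) * (\<integral>\<^sup>+y. \<integral>\<^sup>+x. H ((x - y) / 2, (x + y) / 2) \<partial>lborel \<partial>lborel)"
    by (rule nn_integral_cmult) measurable
  also have "(\<integral>\<^sup>+y. \<integral>\<^sup>+x. H ((x - y) / 2, (x + y) / 2) \<partial>lborel \<partial>lborel) =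
    (\<integral>\<^sup>+x. \<integral>\<^sup>+y. H ((x - y) / 2, (x + y) / 2) \<partial>lborel \<partial>lborel)"
    by (rule lborel_pair.Fubini') measurable
  also have "\<dots> = (\<integral>\<^sup>+z. H ((fst z - snd z) / 2, (fst z + snd z) / 2) \<partial>lborel)"
    by (subst nn_integral_plane) auto
  finally show ?thesis .
qed

section \<open>Periodised sets and time spent on characteristics\<close>

lemma periodize_measurable [measurable]: "G \<in> sets borel \<Longrightarrow> periodize G \<in> sets borel"
proof -
  assume [measurable]: "G \<in> sets borel"
  have "periodize G = {z. \<exists>k::int. (fst z, snd z + 2 * pi * of_int k) \<in> G}"
    by (auto simp: periodize_def)
  also have "\<dots> \<in> sets borel" by measurable
  finally show ?thesis .
qed

lemma periodize_shift: "(t, x + 2 * pi) \<in> periodize G \<longleftrightarrow> (t, x) \<in> periodize G"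
proof
  assume "(t, x + 2 * pi) \<in> periodize G"
  then obtain k :: int where "(t, x + 2 * pi + 2 * pi * of_int k) \<in> G" by (auto simp: periodize_def)
  then have "(t, x + 2 * pi * of_int (k + 1)) \<in> G" by (simp add: algebra_simps)
  then show "(t, x) \<in> periodize G" unfolding periodize_def by blast
next
  assume "(t, x) \<in> periodize G"
  then obtain k :: int where "(t, x + 2 * pi * of_int k) \<in> G" by (auto simp: periodize_def)
  then have "(t, x + 2 * pi + 2 * pi * of_int (k - 1)) \<in> G" by (simp add: algebra_simps)
  then show "(t, x + 2 * pi) \<in> periodize G" unfolding periodize_def by blast
qed

lemma periodize_interior:
  assumes "G \<subseteq> {0..T} \<times> {0..2 * pi}" "0 < x" "x < 2 * pi"
  shows "(t, x) \<in> periodize G \<longleftrightarrow> (t, x) \<in> G"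
proof
  assume "(t, x) \<in> periodize G"
  then obtain k :: int where k: "(t, x + 2 * pi * of_int k) \<in> G" by (auto simp: periodize_def)
  then have "0 \<le> x + 2 * pi * of_int k" "x + 2 * pi * of_int k \<le> 2 * pi" using assms(1) by auto
  then have "2 * pi * (-1) < 2 * pi * (of_int k :: real)" "2 * pi * of_int k < 2 * pi * (1::real)" using assms(2,3) by linarith+
  then have "-1 < (of_int k :: real)" "of_int k < (1::real)"
    by (simp_all only: mult_less_cancel_left_pos zero_less_mult_iff pi_gt_zero zero_less_numeral simp_thms)
  then have "k = 0" by linarith
  then show "(t, x) \<in> G" using k by simp
next
  assume "(t, x) \<in> G"
  then show "(t, x) \<in> periodize G" by (auto simp: periodize_def intro: exI[of _ 0])
qed

text \<open>Integrating a function of the characteristic label over \<open>G\<close> weighs the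
  label \<open>y\<close> by the time that its characteristic spends in \<open>G\<close>. This is how
  (GCC) enters the energy estimates.\<close>

lemma nn_integral_characteristics:
  fixes h :: "real \<Rightarrow> ennreal"
  assumes [measurable]: "G \<in> sets borel" and G: "G \<subseteq> {0..T} \<times> {0..2 * pi}"
    and [measurable]: "h \<in> borel_measurable borel" and h: "\<And>x. h (x + 2 * pi) = h x"
  shows "(\<integral>\<^sup>+z. indicator G z * h (snd z - \<sigma> * fst z) \<partial>lborel) =
    (\<integral>\<^sup>+y. h y * emeasure lborel {s \<in> {0..T}. (s, y + \<sigma> * s) \<in> periodize G} \<partial>torus)"
proof -
  have [measurable]: "periodize G \<in> sets borel" by measurable
  have "(\<integral>\<^sup>+z. indicator G z * h (snd z - \<sigma> * fst z) \<partial>lborel) =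
    (\<integral>\<^sup>+t. \<integral>\<^sup>+x. indicator G (t, x) * h (x - \<sigma> * t) \<partial>lborel \<partial>lborel)"
    by (subst nn_integral_plane) auto
  also have "\<dots> = (\<integral>\<^sup>+t. \<integral>\<^sup>+y. indicator {0..T} t * (indicator {0..2 * pi} y *
      (indicator (periodize G) (t, y + \<sigma> * t) * h y)) \<partial>lborel \<partial>lborel)"
  proof (rule nn_integral_cong)
    fix t :: real
    have "(\<integral>\<^sup>+x. indicator G (t, x) * h (x - \<sigma> * t) \<partial>lborel) =
      (\<integral>\<^sup>+x. indicator {0..T} t * (indicator {0..2 * pi} x * (indicator (periodize G) (t, x) * h (x - \<sigma> * t))) \<partial>lborel)"
    proof (rule nn_integral_cong_AE)
      \<comment> \<open>At the two endpoints \<open>periodize G\<close> may be larger than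
        \<open>G\<close>, since 0 and \<open>2 * pi\<close> are identified.\<close>
      have "AE x in lborel. x \<noteq> 0" "AE x in lborel. x \<noteq> 2 * pi" by (rule AE_lborel_singleton)+
      then show "AE x in lborel. indicator G (t, x) * h (x - \<sigma> * t) =
        indicator {0..T} t * (indicator {0..2 * pi} x * (indicator (periodize G) (t, x) * h (x - \<sigma> * t)))"
      proof eventually_elim
        case (elim x)
        show ?case
        proof (cases "t \<in> {0..T} \<and> x \<in> {0..2 * pi}")
          case True
          with elim have "0 < x" "x < 2 * pi" by auto
          from periodize_interior[OF G this, of t] True show ?thesis by (auto simp: indicator_def)
        next
          case False
          then show ?thesis using G by (auto simp: indicator_def)
        qed
      qed
    qed
    also have "\<dots> = indicator {0..T} t * (\<integral>\<^sup>+x. indicator (periodize G) (t, x) * h (x - \<sigma> * t) \<partial>torus)"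
      by (subst nn_integral_cmult) (auto simp: nn_integral_torus)
    \<comment> \<open>The translation by \<open>\<sigma> * t\<close> leaves the period cell, so both
      factors must be periodic; hence the passage from \<open>G\<close> to
      \<open>periodize G\<close>.\<close>
    also have "(\<integral>\<^sup>+x. indicator (periodize G) (t, x) * h (x - \<sigma> * t) \<partial>torus) =
      (\<integral>\<^sup>+y. indicator (periodize G) (t, y + \<sigma> * t) * h (y + \<sigma> * t - \<sigma> * t) \<partial>torus)"
    proof (rule nn_integral_torus_shift[symmetric])
      fix x
      have "h (x + 2 * pi - \<sigma> * t) = h (x - \<sigma> * t)" using h[of "x - \<sigma> * t"] by (simp add: algebra_simps)
      then show "indicator (periodize G) (t, x + 2 * pi) * h (x + 2 * pi - \<sigma> * t) =
        indicator (periodize G) (t, x) * h (x - \<sigma> * t)"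
        by (simp add: indicator_def periodize_shift)
    qed measurable
    also have "indicator {0..T} t * \<dots> = (\<integral>\<^sup>+y. indicator {0..T} t * (indicator {0..2 * pi} y *
      (indicator (periodize G) (t, y + \<sigma> * t) * h y)) \<partial>lborel)"
      by (subst nn_integral_cmult) (auto simp: nn_integral_torus)
    finally show "(\<integral>\<^sup>+x. indicator G (t, x) * h (x - \<sigma> * t) \<partial>lborel) =
      (\<integral>\<^sup>+y. indicator {0..T} t * (indicator {0..2 * pi} y *
      (indicator (periodize G) (t, y + \<sigma> * t) * h y)) \<partial>lborel)" .
  qed
  also have "\<dots> = (\<integral>\<^sup>+y. \<integral>\<^sup>+t. indicator {0..T} t * (indicator {0..2 * pi} y *
      (indicator (periodize G) (t, y + \<sigma> * t) * h y)) \<partial>lborel \<partial>lborel)"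
    by (rule lborel_pair.Fubini'[symmetric]) measurable
  also have "\<dots> = (\<integral>\<^sup>+y. indicator {0..2 * pi} y * (h y *
      emeasure lborel {s \<in> {0..T}. (s, y + \<sigma> * s) \<in> periodize G}) \<partial>lborel)"
  proof (rule nn_integral_cong)
    fix y :: real
    have "(\<integral>\<^sup>+t. indicator {0..T} t * (indicator {0..2 * pi} y *
      (indicator (periodize G) (t, y + \<sigma> * t) * h y)) \<partial>lborel) =
      (\<integral>\<^sup>+t. (indicator {0..2 * pi} y * h y) * indicator {s \<in> {0..T}. (s, y + \<sigma> * s) \<in> periodize G} t \<partial>lborel)"
      by (intro nn_integral_cong) (auto simp: indicator_def)
    also have "\<dots> = (indicator {0..2 * pi} y * h y) * emeasure lborel {s \<in> {0..T}. (s, y + \<sigma> * s) \<in> periodize G}"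
      by (subst nn_integral_cmult_indicator) auto
    finally show "(\<integral>\<^sup>+t. indicator {0..T} t * (indicator {0..2 * pi} y *
      (indicator (periodize G) (t, y + \<sigma> * t) * h y)) \<partial>lborel) = indicator {0..2 * pi} y * (h y *
      emeasure lborel {s \<in> {0..T}. (s, y + \<sigma> * s) \<in> periodize G})" by (simp add: mult.assoc)
  qed
  also have "\<dots> = (\<integral>\<^sup>+y. h y * emeasure lborel {s \<in> {0..T}. (s, y + \<sigma> * s) \<in> periodize G} \<partial>torus)"
    by (rule nn_integral_torus[symmetric]) measurable
  finally show ?thesis .
qed

section \<open>Coercivity of the observed energy\<close>

text \<open>The working class: exactly periodic Borel representatives of the elements of
  \<open>L2_torus\<close>.\<close>

definition periodic_L2 :: "(real \<Rightarrow> real) \<Rightarrow> bool" where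
  "periodic_L2 f \<longleftrightarrow> f \<in> borel_measurable borel \<and> periodic f \<and> integrable torus (\<lambda>x. (f x)\<^sup>2)"

lemma periodic_L2_measurable [measurable_dest]: "periodic_L2 f \<Longrightarrow> f \<in> borel_measurable borel"
  and periodic_L2_sqint: "periodic_L2 f \<Longrightarrow> sqint torus f"
  by (auto simp: periodic_L2_def sqint_def)

lemma periodic_L2_diff: "periodic_L2 f \<Longrightarrow> periodic_L2 g \<Longrightarrow> periodic_L2 (\<lambda>x. f x - g x)"
  using sqint_diff[of torus f g] by (auto simp: periodic_L2_def sqint_def periodic_def)

lemma periodic_L2_cmult: "periodic_L2 f \<Longrightarrow> periodic_L2 (\<lambda>x. c * f x)"
  using sqint_cmult[of torus f c] by (auto simp: periodic_L2_def sqint_def periodic_def)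

lemma periodic_L2_bounded:
  assumes "f \<in> borel_measurable borel" "periodic f" "\<And>x. \<bar>f x\<bar> \<le> B"
  shows "periodic_L2 f"
  using sqint_bounded[OF torus.finite_measure_axioms, of f B] assms
  by (auto simp: periodic_L2_def sqint_def)

text \<open>Time measure instead of arclength, hence without the factor \<open>sqrt 2\<close> of
  \<open>char_meas\<close>.\<close>

definition char_emeasure :: "real \<Rightarrow> (real \<times> real) set \<Rightarrow> real \<Rightarrow> real \<Rightarrow> ennreal" where
  "char_emeasure T G \<sigma> y = emeasure lborel {s \<in> {0..T}. (s, y + \<sigma> * s) \<in> periodize G}"

definition on_set :: "(real \<times> real) set \<Rightarrow> (real \<times> real) measure" where
  "on_set G = density lborel (\<lambda>z. ennreal (indicator G z))"

lemma sets_on_set [simp, measurable_cong]: "sets (on_set G) = sets borel"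
  and space_on_set [simp]: "space (on_set G) = UNIV"
  by (simp_all add: on_set_def)

lemma nn_integral_on_set:
  "G \<in> sets borel \<Longrightarrow> f \<in> borel_measurable borel \<Longrightarrow>
    (\<integral>\<^sup>+z. f z \<partial>on_set G) = (\<integral>\<^sup>+z. indicator G z * f z \<partial>lborel)"
  by (simp add: on_set_def nn_integral_density ennreal_indicator)

lemma AE_on_set: "G \<in> sets borel \<Longrightarrow> (AE z in on_set G. P z) \<longleftrightarrow> (AE z in lborel. z \<in> G \<longrightarrow> P z)"
  unfolding on_set_def by (subst AE_density) (auto simp: indicator_def)

lemma sets_wide_pair: "sets (wide n \<Otimes>\<^sub>M wide n) = sets borel"
proof -
  have "sets (wide n \<Otimes>\<^sub>M wide n) = sets (borel \<Otimes>\<^sub>M borel :: (real \<times> real) measure)"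
    by (intro sets_pair_measure_cong) auto
  then show ?thesis unfolding borel_prod .
qed

lemma nn_integral_wide_pair:
  fixes H :: "real \<times> real \<Rightarrow> ennreal"
  defines "J n \<equiv> {- 2 * pi * real n..2 * pi * real n}"
  assumes [measurable]: "H \<in> borel_measurable borel"
  shows "(\<integral>\<^sup>+z. H z \<partial>(wide n \<Otimes>\<^sub>M wide n)) = (\<integral>\<^sup>+z. indicator (J n \<times> J n) z * H z \<partial>lborel)"
proof -
  interpret finite_measure "wide n" by (rule finite_measure_wide)
  have [measurable]: "J n \<times> J n \<in> sets borel"
    unfolding J_def by (intro borel_closed closed_Times) auto
  have "H \<in> borel_measurable (wide n \<Otimes>\<^sub>M wide n)"
    using assms(2) measurable_cong_sets[OF sets_wide_pair refl] by blast
  then have "(\<integral>\<^sup>+z. H z \<partial>(wide n \<Otimes>\<^sub>M wide n)) = (\<integral>\<^sup>+x. \<integral>\<^sup>+y. H (x, y) \<partial>wide n \<partial>wide n)"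
    by (rule nn_integral_fst[symmetric])
  also have "\<dots> = (\<integral>\<^sup>+x. indicator (J n) x * (\<integral>\<^sup>+y. indicator (J n) y * H (x, y) \<partial>lborel) \<partial>lborel)"
    by (simp add: nn_integral_wide J_def)
  also have "\<dots> = (\<integral>\<^sup>+x. \<integral>\<^sup>+y. indicator (J n \<times> J n) (x, y) * H (x, y) \<partial>lborel \<partial>lborel)"
    by (intro nn_integral_cong) (simp add: J_def indicator_times mult.assoc flip: nn_integral_cmult)
  also have "\<dots> = (\<integral>\<^sup>+z. indicator (J n \<times> J n) z * H z \<partial>lborel)"
    by (rule nn_integral_plane[symmetric]) measurable
  finally show ?thesis .
qed

locale observation_set =
  fixes T :: real and G :: "(real \<times> real) set"
  assumes T: "T > 0" and G_sub: "G \<subseteq> {0..T} \<times> {0..2 * pi}" and G_borel [measurable]: "G \<in> sets borel"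
begin

lemma nn_integral_on_set_characteristics:
  assumes "h \<in> borel_measurable borel" "\<And>x. h (x + 2 * pi) = h x"
  shows "(\<integral>\<^sup>+z. h (snd z - \<sigma> * fst z) \<partial>on_set G) = (\<integral>\<^sup>+y. h y * char_emeasure T G \<sigma> y \<partial>torus)"
  using nn_integral_characteristics[OF G_borel G_sub assms, of \<sigma>] assms(1)
  by (simp add: nn_integral_on_set char_emeasure_def)

lemma char_emeasure_measurable [measurable]: "char_emeasure T G \<sigma> \<in> borel_measurable borel"
proof -
  have [measurable]: "periodize G \<in> sets borel" by measurable
  have "char_emeasure T G \<sigma> = (\<lambda>y. \<integral>\<^sup>+s. indicator {0..T} s * indicator (periodize G) (s, y + \<sigma> * s) \<partial>lborel)"
  proof
    fix y :: real
    have "(\<integral>\<^sup>+s. indicator {0..T} s * indicator (periodize G) (s, y + \<sigma> * s) \<partial>lborel) =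
      (\<integral>\<^sup>+s. indicator {s \<in> {0..T}. (s, y + \<sigma> * s) \<in> periodize G} s \<partial>lborel)"
      by (intro nn_integral_cong) (auto split: split_indicator)
    also have "\<dots> = char_emeasure T G \<sigma> y"
      unfolding char_emeasure_def by (rule nn_integral_indicator) measurable
    finally show "char_emeasure T G \<sigma> y = (\<integral>\<^sup>+s. indicator {0..T} s * indicator (periodize G) (s, y + \<sigma> * s) \<partial>lborel)" ..
  qed
  then show ?thesis by simp
qed

lemma char_emeasure_le: "char_emeasure T G \<sigma> y \<le> ennreal T"
proof -
  have "char_emeasure T G \<sigma> y \<le> emeasure lborel {0..T}"
    unfolding char_emeasure_def by (intro emeasure_mono) auto
  then show ?thesis using T by simp
qed

text \<open>The integral over \<open>G\<close> is that of \<open>f\<^sup>2\<close> with weight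
  \<open>char_emeasure\<close>; this weight is at most \<open>T\<close>, and at least
  \<open>c\<close> under (GCC).\<close>

lemma sqint_on_set:
  assumes f: "periodic_L2 f"
  shows "sqint (on_set G) (\<lambda>z. f (snd z - \<sigma> * fst z))"
    and "(\<integral>z. (f (snd z - \<sigma> * fst z))\<^sup>2 \<partial>on_set G) \<le> T * (\<integral>y. (f y)\<^sup>2 \<partial>torus)"
    and "\<And>c. c \<ge> 0 \<Longrightarrow> (AE y in torus. ennreal c \<le> char_emeasure T G \<sigma> y) \<Longrightarrow>
      c * (\<integral>y. (f y)\<^sup>2 \<partial>torus) \<le> (\<integral>z. (f (snd z - \<sigma> * fst z))\<^sup>2 \<partial>on_set G)"
proof -
  note [measurable] = periodic_L2_measurable[OF f]
  have int: "integrable torus (\<lambda>y. (f y)\<^sup>2)" using f by (simp add: periodic_L2_def)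
  have eq: "(\<integral>\<^sup>+z. ennreal ((f (snd z - \<sigma> * fst z))\<^sup>2) \<partial>on_set G) =
      (\<integral>\<^sup>+y. ennreal ((f y)\<^sup>2) * char_emeasure T G \<sigma> y \<partial>torus)"
    using f by (intro nn_integral_on_set_characteristics) (auto simp: periodic_L2_def periodic_def)
  also have "\<dots> \<le> (\<integral>\<^sup>+y. ennreal ((f y)\<^sup>2) * ennreal T \<partial>torus)"
    by (intro nn_integral_mono mult_left_mono char_emeasure_le) auto
  also have "\<dots> = (\<integral>\<^sup>+y. ennreal ((f y)\<^sup>2) \<partial>torus) * ennreal T"
    by (rule nn_integral_multc) measurable
  also have "(\<integral>\<^sup>+y. ennreal ((f y)\<^sup>2) \<partial>torus) = ennreal (\<integral>y. (f y)\<^sup>2 \<partial>torus)"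
    by (intro nn_integral_eq_integral int) auto
  also have "\<dots> * ennreal T = ennreal (T * (\<integral>y. (f y)\<^sup>2 \<partial>torus))"
    using T by (subst ennreal_mult[symmetric]) (auto simp: mult.commute Bochner_Integration.integral_nonneg)
  finally have le: "(\<integral>\<^sup>+z. ennreal ((f (snd z - \<sigma> * fst z))\<^sup>2) \<partial>on_set G) \<le> ennreal (T * (\<integral>y. (f y)\<^sup>2 \<partial>torus))" .
  have int': "integrable (on_set G) (\<lambda>z. (f (snd z - \<sigma> * fst z))\<^sup>2)"
    by (rule integrableI_nonneg) (use le in \<open>auto simp: order.strict_trans1\<close>)
  then show "sqint (on_set G) (\<lambda>z. f (snd z - \<sigma> * fst z))" by (simp add: sqint_def)
  have nn: "(\<integral>\<^sup>+z. ennreal ((f (snd z - \<sigma> * fst z))\<^sup>2) \<partial>on_set G) = ennreal (\<integral>z. (f (snd z - \<sigma> * fst z))\<^sup>2 \<partial>on_set G)"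
    by (intro nn_integral_eq_integral int') auto
  have pos: "0 \<le> T * (\<integral>y. (f y)\<^sup>2 \<partial>torus)"
    using T by (intro mult_nonneg_nonneg Bochner_Integration.integral_nonneg) auto
  show "(\<integral>z. (f (snd z - \<sigma> * fst z))\<^sup>2 \<partial>on_set G) \<le> T * (\<integral>y. (f y)\<^sup>2 \<partial>torus)"
    using le pos unfolding nn by simp
  fix c :: real assume c: "c \<ge> 0" and ae: "AE y in torus. ennreal c \<le> char_emeasure T G \<sigma> y"
  have "ennreal (c * (\<integral>y. (f y)\<^sup>2 \<partial>torus)) = ennreal (\<integral>y. (f y)\<^sup>2 * c \<partial>torus)"
    by (simp add: mult.commute)
  also have "\<dots> = (\<integral>\<^sup>+y. ennreal ((f y)\<^sup>2 * c) \<partial>torus)"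
    using int c by (intro nn_integral_eq_integral[symmetric]) auto
  also have "\<dots> \<le> (\<integral>\<^sup>+y. ennreal ((f y)\<^sup>2) * char_emeasure T G \<sigma> y \<partial>torus)"
    by (rule nn_integral_mono_AE, use ae in eventually_elim) (simp add: ennreal_mult c mult_left_mono)
  also have "\<dots> = ennreal (\<integral>z. (f (snd z - \<sigma> * fst z))\<^sup>2 \<partial>on_set G)" using eq nn by simp
  finally show "c * (\<integral>y. (f y)\<^sup>2 \<partial>torus) \<le> (\<integral>z. (f (snd z - \<sigma> * fst z))\<^sup>2 \<partial>on_set G)"
    by (subst (asm) ennreal_le_iff) (auto intro: Bochner_Integration.integral_nonneg)
qed

lemma sqint_forward:
  assumes "periodic_L2 f"
  shows "sqint (on_set G) (\<lambda>z. f (snd z + fst z))"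
    and "(\<integral>z. (f (snd z + fst z))\<^sup>2 \<partial>on_set G) \<le> T * (\<integral>y. (f y)\<^sup>2 \<partial>torus)"
  using sqint_on_set(1,2)[OF assms, of "-1"] by simp_all

lemma sqint_backward:
  assumes "periodic_L2 f"
  shows "sqint (on_set G) (\<lambda>z. f (snd z - fst z))"
    and "(\<integral>z. (f (snd z - fst z))\<^sup>2 \<partial>on_set G) \<le> T * (\<integral>y. (f y)\<^sup>2 \<partial>torus)"
  using sqint_on_set(1,2)[OF assms, of 1] by simp_all

text \<open>The form \<open>Q(f,g)\<close> of the overview, that is, the observed energy of the wave
  with \<open>\<partial>\<^sub>t u = f(x + t) + g(x - t)\<close>.\<close>

definition observed :: "(real \<Rightarrow> real) \<Rightarrow> (real \<Rightarrow> real) \<Rightarrow> real" where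
  "observed f g = (\<integral>z. (f (snd z + fst z) + g (snd z - fst z))\<^sup>2 \<partial>on_set G)"

lemma observed_nonneg: "observed f g \<ge> 0"
  unfolding observed_def by (rule Bochner_Integration.integral_nonneg) simp

lemma observed_le:
  assumes "periodic_L2 f" "periodic_L2 g"
  shows "observed f g \<le> 2 * T * ((\<integral>y. (f y)\<^sup>2 \<partial>torus) + (\<integral>y. (g y)\<^sup>2 \<partial>torus))"
  using integral_square_add_le[OF sqint_forward(1)[OF assms(1)] sqint_backward(1)[OF assms(2)]]
    sqint_forward(2)[OF assms(1)] sqint_backward(2)[OF assms(2)]
  unfolding observed_def by (simp add: algebra_simps)

lemma observed_diff_le:
  assumes "periodic_L2 f" "periodic_L2 g" "periodic_L2 f'" "periodic_L2 g'"
  shows "observed (\<lambda>x. f x - f' x) (\<lambda>x. g x - g' x) \<le> 2 * observed f g + 2 * observed f' g'"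
proof -
  note sq = sqint_add[OF sqint_forward(1) sqint_backward(1)]
  show ?thesis
    using integral_square_diff_le[OF sq[OF assms(1,2)] sq[OF assms(3,4)]]
    unfolding observed_def by (simp add: algebra_simps)
qed

lemma observed_cmult: "observed (\<lambda>x. c * f x) (\<lambda>x. c * g x) = c\<^sup>2 * observed f g"
proof -
  have "(c * a + c * b)\<^sup>2 = c\<^sup>2 * (a + b)\<^sup>2" for a b :: real
    by (simp add: power_mult_distrib flip: distrib_left)
  then show ?thesis unfolding observed_def by simp
qed

definition rotated :: "(real \<times> real) set" where
  "rotated = {z. ((fst z - snd z) / 2, (fst z + snd z) / 2) \<in> G}"

lemma rotated_borel [measurable]: "rotated \<in> sets borel"
  unfolding rotated_def by measurable

text \<open>In the coordinates \<open>x + t\<close>, \<open>x - t\<close> the factors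
  \<open>f\<close> and \<open>g\<close> depend on different variables, so the cross term is a
  bilinear form with kernel \<open>indicator rotated\<close>. The condition on \<open>n\<close>
  makes room for \<open>rotated\<close>.\<close>

lemma integral_product_rotated:
  assumes f: "periodic_L2 f" and g: "periodic_L2 g" and n: "T + 2 * pi \<le> 2 * pi * real n"
  shows "(\<integral>z. f (snd z + fst z) * g (snd z - fst z) \<partial>on_set G) =
    1/2 * (\<integral>z. indicator rotated z * (f (fst z) * g (snd z)) \<partial>(wide n \<Otimes>\<^sub>M wide n))"
proof -
  note [measurable] = periodic_L2_measurable[OF f] periodic_L2_measurable[OF g]
  let ?J = "{- 2 * pi * real n..2 * pi * real n}"
  let ?k = "\<lambda>z. f (snd z + fst z) * g (snd z - fst z)"
  let ?l = "\<lambda>z. indicator rotated z * (f (fst z) * g (snd z)) :: real"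
  have l_meas: "?l \<in> borel_measurable (wide n \<Otimes>\<^sub>M wide n)"
    by (subst measurable_cong_sets[OF sets_wide_pair refl]) measurable
  have sub: "rotated \<subseteq> ?J \<times> ?J"
  proof
    fix z assume "z \<in> rotated"
    then have "0 \<le> (fst z - snd z) / 2" "(fst z - snd z) / 2 \<le> T" "0 \<le> (fst z + snd z) / 2" "(fst z + snd z) / 2 \<le> 2 * pi"
      using G_sub by (auto simp: rotated_def)
    then have "0 \<le> fst z" "fst z \<le> T + 2 * pi" "- T \<le> snd z" "snd z \<le> 2 * pi" by (simp_all add: field_simps)
    moreover have "- 2 * pi * real n \<le> - T" using n pi_gt_zero by linarith
    ultimately have "- 2 * pi * real n \<le> fst z" "fst z \<le> 2 * pi * real n" "- 2 * pi * real n \<le> snd z" "snd z \<le> 2 * pi * real n"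
      using n T by linarith+
    then have "fst z \<in> ?J" "snd z \<in> ?J" by simp_all
    then show "z \<in> ?J \<times> ?J" by (cases z) auto
  qed
  have eq: "(\<integral>\<^sup>+z. ennreal (s * ?k z) \<partial>on_set G) = ennreal (1/2) * (\<integral>\<^sup>+z. ennreal (s * ?l z) \<partial>(wide n \<Otimes>\<^sub>M wide n))" for s
  proof -
    have "(\<integral>\<^sup>+z. ennreal (s * ?k z) \<partial>on_set G) = (\<integral>\<^sup>+z. indicator G z * ennreal (s * ?k z) \<partial>lborel)"
      by (rule nn_integral_on_set) measurable
    also have "\<dots> = ennreal (1/2) * (\<integral>\<^sup>+z. indicator rotated z * ennreal (s * (f (fst z) * g (snd z))) \<partial>lborel)"
    proof (subst nn_integral_rotate)
      have "snd ((a - b) / 2, (a + b) / 2) + fst ((a - b) / 2, (a + b) / 2) = (a::real)"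
        "snd ((a - b) / 2, (a + b) / 2) - fst ((a - b) / 2, (a + b) / 2) = b" for a b
        by (simp_all add: field_simps)
      then show "ennreal (1 / 2) * (\<integral>\<^sup>+z. indicator G ((fst z - snd z) / 2, (fst z + snd z) / 2) *
          ennreal (s * ?k ((fst z - snd z) / 2, (fst z + snd z) / 2)) \<partial>lborel) =
        ennreal (1/2) * (\<integral>\<^sup>+z. indicator rotated z * ennreal (s * (f (fst z) * g (snd z))) \<partial>lborel)"
        by (intro arg_cong2[where f = "(*)"] nn_integral_cong refl) (auto simp: indicator_def rotated_def)
    qed measurable
    also have "(\<integral>\<^sup>+z. indicator rotated z * ennreal (s * (f (fst z) * g (snd z))) \<partial>lborel) =
      (\<integral>\<^sup>+z. indicator (?J \<times> ?J) z * ennreal (s * ?l z) \<partial>lborel)"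
      using sub by (intro nn_integral_cong) (auto simp: indicator_def)
    also have "\<dots> = (\<integral>\<^sup>+z. ennreal (s * ?l z) \<partial>(wide n \<Otimes>\<^sub>M wide n))"
      by (rule nn_integral_wide_pair[symmetric]) measurable
    finally show ?thesis .
  qed
  have k: "integrable (on_set G) ?k"
    by (rule sqint_mult[OF sqint_forward(1)[OF f] sqint_backward(1)[OF g]])
  \<comment> \<open>The identity is inverted because integrability is known on
    \<open>on_set G\<close> and has to be carried to the product measure.\<close>
  have eq': "(\<integral>\<^sup>+z. ennreal (s * ?l z) \<partial>(wide n \<Otimes>\<^sub>M wide n)) = ennreal 2 * (\<integral>\<^sup>+z. ennreal (s * ?k z) \<partial>on_set G)" for s
    unfolding eq by (subst mult.assoc[symmetric], subst ennreal_mult[symmetric]) auto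
  show ?thesis
    using integral_transfer(2)[OF l_meas k, of 2] eq'[of 1] eq'[of "-1"] by simp
qed

text \<open>Expansion of the square: the factor 2 of the cross term cancels the Jacobian 1/2. The
  wave \<open>f(x + t)\<close> runs along lines of slope -1 and \<open>g(x - t)\<close> along slope
  1, so each uses its own half of (GCC).\<close>

lemma observed_ge:
  assumes f: "periodic_L2 f" and g: "periodic_L2 g" and n: "T + 2 * pi \<le> 2 * pi * real n" and c: "c \<ge> 0"
    and gcc: "AE y in torus. ennreal c \<le> char_emeasure T G 1 y" "AE y in torus. ennreal c \<le> char_emeasure T G (-1) y"
  shows "c * ((\<integral>y. (f y)\<^sup>2 \<partial>torus) + (\<integral>y. (g y)\<^sup>2 \<partial>torus)) \<le> observed f g +
    \<bar>\<integral>z. indicator rotated z * (f (fst z) * g (snd z)) \<partial>(wide n \<Otimes>\<^sub>M wide n)\<bar>"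
proof -
  have "observed f g = (\<integral>z. (f (snd z + fst z))\<^sup>2 \<partial>on_set G) + (\<integral>z. (g (snd z - fst z))\<^sup>2 \<partial>on_set G) +
    (\<integral>z. indicator rotated z * (f (fst z) * g (snd z)) \<partial>(wide n \<Otimes>\<^sub>M wide n))"
    using integral_square_add_cmult[OF sqint_forward(1)[OF f] sqint_backward(1)[OF g], of 1]
    unfolding integral_product_rotated[OF f g n] observed_def by simp
  moreover have "c * (\<integral>y. (f y)\<^sup>2 \<partial>torus) \<le> (\<integral>z. (f (snd z + fst z))\<^sup>2 \<partial>on_set G)"
    using sqint_on_set(3)[OF f c gcc(2)] by simp
  moreover have "c * (\<integral>y. (g y)\<^sup>2 \<partial>torus) \<le> (\<integral>z. (g (snd z - fst z))\<^sup>2 \<partial>on_set G)"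
    using sqint_on_set(3)[OF g c gcc(1)] by simp
  ultimately show ?thesis by (simp add: distrib_left)
qed

end

lemma sqint_wide:
  assumes "periodic_L2 f"
  shows "sqint (wide n) f" "(\<integral>x. (f x)\<^sup>2 \<partial>wide n) \<le> (2 * real n + 1) * (\<integral>x. (f x)\<^sup>2 \<partial>torus)"
proof -
  note [measurable] = periodic_L2_measurable[OF assms]
  have int: "integrable torus (\<lambda>x. (f x)\<^sup>2)" using assms by (simp add: periodic_L2_def)
  have "(\<integral>\<^sup>+x. ennreal ((f x)\<^sup>2) \<partial>wide n) \<le> ennreal (2 * real n + 1) * (\<integral>\<^sup>+x. ennreal ((f x)\<^sup>2) \<partial>torus)"
    using assms by (intro nn_integral_wide_le) (auto simp: periodic_L2_def periodic_def)
  also have "(\<integral>\<^sup>+x. ennreal ((f x)\<^sup>2) \<partial>torus) = ennreal (\<integral>x. (f x)\<^sup>2 \<partial>torus)"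
    by (intro nn_integral_eq_integral int) auto
  also have "ennreal (2 * real n + 1) * \<dots> = ennreal ((2 * real n + 1) * (\<integral>x. (f x)\<^sup>2 \<partial>torus))"
    by (subst ennreal_mult) (auto intro: Bochner_Integration.integral_nonneg)
  finally have le: "(\<integral>\<^sup>+x. ennreal ((f x)\<^sup>2) \<partial>wide n) \<le> ennreal ((2 * real n + 1) * (\<integral>x. (f x)\<^sup>2 \<partial>torus))" .
  have int': "integrable (wide n) (\<lambda>x. (f x)\<^sup>2)"
    by (rule integrableI_nonneg) (use le in \<open>auto simp: order.strict_trans1\<close>)
  then show "sqint (wide n) f" by (simp add: sqint_def)
  have "(\<integral>\<^sup>+x. ennreal ((f x)\<^sup>2) \<partial>wide n) = ennreal (\<integral>x. (f x)\<^sup>2 \<partial>wide n)"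
    by (intro nn_integral_eq_integral int') auto
  with le show "(\<integral>x. (f x)\<^sup>2 \<partial>wide n) \<le> (2 * real n + 1) * (\<integral>x. (f x)\<^sup>2 \<partial>torus)"
    by (simp add: mult_nonneg_nonneg Bochner_Integration.integral_nonneg)
qed

text \<open>The L2 limit is determined on one period only; composing it with \<open>wrap\<close>
  makes it periodic and changes it on a null set of the torus.\<close>

lemma periodic_L2_limit:
  assumes f: "\<And>n. periodic_L2 (f n)"
    and cauchy: "\<And>e. e > 0 \<Longrightarrow> \<exists>N. \<forall>m\<ge>N. \<forall>n\<ge>N. (\<integral>x. (f m x - f n x)\<^sup>2 \<partial>torus) < e"
  obtains F where "periodic_L2 F" "(\<lambda>n. \<integral>x. (f n x - F x)\<^sup>2 \<partial>torus) \<longlonglongrightarrow> 0"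
proof -
  obtain F where F: "sqint torus F" "(\<lambda>n. \<integral>x. (f n x - F x)\<^sup>2 \<partial>torus) \<longlonglongrightarrow> 0"
    using L2_complete[of torus f, OF periodic_L2_sqint[OF f] cauchy] by blast
  have [measurable]: "F \<in> borel_measurable borel" "\<And>n. f n \<in> borel_measurable borel"
    using F(1) f by (auto simp: sqint_def periodic_L2_def)
  define H where "H x = F (wrap x)" for x
  have [measurable]: "H \<in> borel_measurable borel" unfolding H_def by measurable
  have ae: "AE x in torus. F x = H x" using AE_torus_wrap by eventually_elim (simp add: H_def)
  have "sqint torus H" by (rule sqint_cong_AE[OF F(1) _ ae]) simp
  moreover have "periodic H" by (simp add: H_def periodic_def wrap_shift)
  ultimately have "periodic_L2 H" by (simp add: periodic_L2_def sqint_def)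
  moreover have "(\<integral>x. (f n x - F x)\<^sup>2 \<partial>torus) = (\<integral>x. (f n x - H x)\<^sup>2 \<partial>torus)" for n
    by (intro integral_cong_AE) (use ae in auto)
  ultimately show ?thesis using F(2) that[of H] by simp
qed

section \<open>Uniqueness, compactness and coercivity\<close>

context observation_set
begin

text \<open>Zero observation means \<open>f(x + t) = - g(x - t)\<close> almost everywhere on
  \<open>G\<close>, so positivity of \<open>f\<close> at one label is positivity of
  \<open>- g\<close> at the other. If this pair is trivial, \<open>f\<close> and \<open>g\<close>
  have opposite weak signs almost everywhere, and equal integrals leave only zero.\<close>

lemma unique_continuation:
  assumes osc: "\<And>A B. A \<in> sets borel \<Longrightarrow> B \<in> sets borel \<Longrightarrow> A \<subseteq> {0..<2 * pi} \<Longrightarrow> B \<subseteq> {0..<2 * pi} \<Longrightarrow>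
      (AE z in on_set G. wrap (snd z + fst z) \<in> A \<longleftrightarrow> wrap (snd z - fst z) \<in> B) \<Longrightarrow>
      (AE x in torus. x \<notin> A) \<and> (AE x in torus. x \<notin> B) \<or> (AE x in torus. x \<in> A) \<and> (AE x in torus. x \<in> B)"
    and f: "periodic_L2 f" and g: "periodic_L2 g"
    and mean: "(\<integral>x. f x \<partial>torus) = (\<integral>x. g x \<partial>torus)"
    and zero: "observed f g = 0"
  shows "AE x in torus. f x = 0" "AE x in torus. g x = 0"
proof -
  note [measurable] = periodic_L2_measurable[OF f] periodic_L2_measurable[OF g]
  define A where "A = {x \<in> {0..<2 * pi}. f x > 0}"
  define B where "B = {x \<in> {0..<2 * pi}. - g x > 0}"
  have fi: "integrable torus f" and gi: "integrable torus g"
    by (intro sqint_integrable[OF torus.finite_measure_axioms] periodic_L2_sqint f g)+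
  have wrap: "f (wrap x) = f x" "g (wrap x) = g x" for x
    using periodic_wrap f g by (auto simp: periodic_L2_def periodic_def)
  have "AE z in on_set G. (f (snd z + fst z) + g (snd z - fst z))\<^sup>2 = 0"
  proof (subst integral_nonneg_eq_0_iff_AE[symmetric])
    show "integrable (on_set G) (\<lambda>z. (f (snd z + fst z) + g (snd z - fst z))\<^sup>2)"
      by (intro sqint_integrable_square sqint_add sqint_forward(1) sqint_backward(1) f g)
  qed (use zero in \<open>auto simp: observed_def\<close>)
  then have "AE z in on_set G. wrap (snd z + fst z) \<in> A \<longleftrightarrow> wrap (snd z - fst z) \<in> B"
    by eventually_elim (use wrap_bounds in \<open>auto simp: A_def B_def wrap\<close>)
  moreover have "A \<in> sets borel" "B \<in> sets borel" "A \<subseteq> {0..<2 * pi}" "B \<subseteq> {0..<2 * pi}"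
    unfolding A_def B_def by (measurable, auto)
  ultimately consider "AE x in torus. x \<notin> A" "AE x in torus. x \<notin> B" | "AE x in torus. x \<in> A" "AE x in torus. x \<in> B"
    using osc[of A B] by blast
  then have "(AE x in torus. f x = 0) \<and> (AE x in torus. g x = 0)"
  proof cases
    case 1
    have f0: "AE x in torus. 0 \<le> - f x" using 1(1) AE_torus_wrap
    proof eventually_elim
      case (elim x)
      then show ?case using wrap_bounds[of x] by (simp add: A_def)
    qed
    have g0: "AE x in torus. 0 \<le> g x" using 1(2) AE_torus_wrap
    proof eventually_elim
      case (elim x)
      then show ?case using wrap_bounds[of x] by (simp add: B_def)
    qed
    have "(\<integral>x. - f x \<partial>torus) \<ge> 0" "(\<integral>x. g x \<partial>torus) \<ge> 0"
      by (intro integral_nonneg_AE f0 g0)+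
    then have z: "(\<integral>x. - f x \<partial>torus) = 0" "(\<integral>x. g x \<partial>torus) = 0" using mean by simp_all
    have "AE x in torus. - f x = 0"
      using z(1) f0 fi by (subst integral_nonneg_eq_0_iff_AE[symmetric]) auto
    moreover have "AE x in torus. g x = 0"
      using z(2) g0 gi by (subst integral_nonneg_eq_0_iff_AE[symmetric]) auto
    ultimately show ?thesis by simp
  next
    case 2
    have f0: "AE x in torus. 0 \<le> f x" using 2(1) by eventually_elim (simp add: A_def)
    have g0: "AE x in torus. 0 \<le> - g x" using 2(2) by eventually_elim (simp add: B_def)
    have "(\<integral>x. f x \<partial>torus) \<ge> 0" "(\<integral>x. - g x \<partial>torus) \<ge> 0"
      by (intro integral_nonneg_AE f0 g0)+
    then have z: "(\<integral>x. f x \<partial>torus) = 0" "(\<integral>x. - g x \<partial>torus) = 0" using mean by simp_all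
    have "AE x in torus. f x = 0"
      using z(1) f0 fi by (subst integral_nonneg_eq_0_iff_AE[symmetric]) auto
    moreover have "AE x in torus. - g x = 0"
      using z(2) g0 gi by (subst integral_nonneg_eq_0_iff_AE[symmetric]) auto
    ultimately show ?thesis by simp
  qed
  then show "AE x in torus. f x = 0" "AE x in torus. g x = 0" by simp_all
qed

text \<open>
  The cross term of the observed energy has a bounded kernel with compact support, hence is weakly
  continuous; on a sequence of observed energies tending to zero, the geometric control condition
  therefore upgrades weak to strong convergence.
\<close>

lemma observed_Cauchy_subseq:
  assumes f: "\<And>n. periodic_L2 (f n)" and g: "\<And>n. periodic_L2 (g n)"
    and norm: "\<And>n. (\<integral>y. (f n y)\<^sup>2 \<partial>torus) + (\<integral>y. (g n y)\<^sup>2 \<partial>torus) \<le> 1"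
    and lim: "(\<lambda>n. observed (f n) (g n)) \<longlonglongrightarrow> 0"
    and c: "c > 0" and gcc: "AE y in torus. ennreal c \<le> char_emeasure T G 1 y"
      "AE y in torus. ennreal c \<le> char_emeasure T G (-1) y"
  obtains r :: "nat \<Rightarrow> nat" where "strict_mono r"
    "\<And>e. e > 0 \<Longrightarrow> \<exists>N. \<forall>m\<ge>N. \<forall>n\<ge>N.
      (\<integral>y. (f (r m) y - f (r n) y)\<^sup>2 \<partial>torus) + (\<integral>y. (g (r m) y - g (r n) y)\<^sup>2 \<partial>torus) < e"
proof -
  obtain k where k: "T + 2 * pi \<le> 2 * pi * real k"
    using real_arch_simple[of "(T + 2 * pi) / (2 * pi)"] by (auto simp: field_simps)
  define W where "W = 2 * real k + 1"
  have W: "W > 0" by (simp add: W_def add_nonneg_pos)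
  interpret finite_pair "wide k" "wide k"
    by (simp add: finite_pair_def finite_measure_wide)
  have nn: "(\<integral>y. (h y)\<^sup>2 \<partial>torus) \<ge> 0" for h :: "real \<Rightarrow> real" by (simp add: Bochner_Integration.integral_nonneg)
  have bound: "(\<integral>x. (f n x)\<^sup>2 \<partial>wide k) \<le> W" "(\<integral>x. (g n x)\<^sup>2 \<partial>wide k) \<le> W" for n
  proof -
    have "(\<integral>y. (f n y)\<^sup>2 \<partial>torus) \<le> 1" "(\<integral>y. (g n y)\<^sup>2 \<partial>torus) \<le> 1"
      using norm[of n] nn[of "f n"] nn[of "g n"] by linarith+
    then have "W * (\<integral>y. (f n y)\<^sup>2 \<partial>torus) \<le> W * 1" "W * (\<integral>y. (g n y)\<^sup>2 \<partial>torus) \<le> W * 1"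
      using W by (intro mult_left_mono; simp)+
    then show "(\<integral>x. (f n x)\<^sup>2 \<partial>wide k) \<le> W" "(\<integral>x. (g n x)\<^sup>2 \<partial>wide k) \<le> W"
      using sqint_wide(2)[OF f, of k n, folded W_def] sqint_wide(2)[OF g, of k n, folded W_def] by simp_all
  qed
  have rot: "rotated \<in> sets (wide k \<Otimes>\<^sub>M wide k)" unfolding sets_wide_pair by simp
  \<comment> \<open>\<open>W\<close> compares norms on \<open>wide k\<close> with norms on one
    period, so \<open>e0\<close> times the wide norms is at most \<open>c / 2\<close> times the
    torus norms: half of the coercive term absorbs it.\<close>
  define e0 where "e0 = c / (2 * W)"
  have e0: "e0 > 0" using c W by (simp add: e0_def)
  let ?K = "\<lambda>m n. \<integral>z. indicator rotated z * ((f m (fst z) - f n (fst z)) * (g m (snd z) - g n (snd z))) \<partial>(wide k \<Otimes>\<^sub>M wide k)"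
  let ?W = "\<lambda>m n. (\<integral>x. (f m x - f n x)\<^sup>2 \<partial>wide k) + (\<integral>x. (g m x - g n x)\<^sup>2 \<partial>wide k)"
  let ?D = "\<lambda>m n. (\<integral>y. (f m y - f n y)\<^sup>2 \<partial>torus) + (\<integral>y. (g m y - g n y)\<^sup>2 \<partial>torus)"
  obtain r :: "nat \<Rightarrow> nat" where r: "strict_mono r"
    "\<And>d. d > 0 \<Longrightarrow> \<exists>n0. \<forall>m\<ge>n0. \<forall>n\<ge>n0. \<bar>?K (r m) (r n)\<bar> < e0 * ?W (r m) (r n) + d"
    using kernel_Cauchy_subseq[where f = f and g = g, OF sqint_wide(1)[OF f] bound(1) sqint_wide(1)[OF g] bound(2) rot e0] by blast
  have key: "c / 2 * ?D m n \<le> 2 * observed (f m) (g m) + 2 * observed (f n) (g n) + (\<bar>?K m n\<bar> - e0 * ?W m n)" for m n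
  proof -
    have fd: "periodic_L2 (\<lambda>y. f m y - f n y)" and gd: "periodic_L2 (\<lambda>y. g m y - g n y)"
      by (intro periodic_L2_diff f g)+
    have "?W m n \<le> W * ?D m n"
      using sqint_wide(2)[OF fd, of k] sqint_wide(2)[OF gd, of k] unfolding W_def distrib_left by linarith
    then have "e0 * ?W m n \<le> e0 * (W * ?D m n)" using e0 by (intro mult_left_mono) auto
    also have "\<dots> = c / 2 * ?D m n" using W by (simp add: e0_def)
    finally have *: "e0 * ?W m n \<le> c / 2 * ?D m n" .
    have "c * ?D m n \<le> observed (\<lambda>y. f m y - f n y) (\<lambda>y. g m y - g n y) + \<bar>?K m n\<bar>"
      using observed_ge[OF fd gd k _ gcc] c by simp
    also have "observed (\<lambda>y. f m y - f n y) (\<lambda>y. g m y - g n y) \<le> 2 * observed (f m) (g m) + 2 * observed (f n) (g n)"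
      by (rule observed_diff_le[OF f g f g])
    finally have "c * ?D m n \<le> 2 * observed (f m) (g m) + 2 * observed (f n) (g n) + \<bar>?K m n\<bar>" by simp
    then show ?thesis using * by (simp add: field_simps)
  qed
  have "\<exists>N. \<forall>m\<ge>N. \<forall>n\<ge>N. ?D (r m) (r n) < e" if e: "e > 0" for e
  proof -
    \<comment> \<open>Five shares in \<open>key\<close>: two from each of the two observed energies
      and one from the kernel.\<close>
    define d where "d = c / 2 * e / 5"
    have d: "d > 0" using c e by (simp add: d_def)
    from r(2)[OF d] obtain n1 where n1: "\<And>m n. m \<ge> n1 \<Longrightarrow> n \<ge> n1 \<Longrightarrow> \<bar>?K (r m) (r n)\<bar> < e0 * ?W (r m) (r n) + d" by blast
    have "\<forall>\<^sub>F n in sequentially. observed (f n) (g n) < d" using lim d by (rule order_tendstoD)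
    then obtain n2 where n2: "\<And>n. n \<ge> n2 \<Longrightarrow> observed (f n) (g n) < d" by (auto simp: eventually_sequentially)
    have "?D (r m) (r n) < e" if "m \<ge> max n1 n2" "n \<ge> max n1 n2" for m n
    proof -
      have "r m \<ge> m" "r n \<ge> n" using r(1) by (auto intro: strict_mono_imp_increasing)
      then have "c / 2 * ?D (r m) (r n) < 5 * d"
        using key[of "r m" "r n"] n1[of m n] n2[of "r m"] n2[of "r n"] that by linarith
      also have "\<dots> = c / 2 * e" by (simp add: d_def)
      finally show ?thesis using c by (simp only: mult_less_cancel_left_pos half_gt_zero)
    qed
    then show ?thesis by blast
  qed
  with r(1) show ?thesis by (rule that)
qed

lemma coercive:
  assumes osc: "\<And>A B. A \<in> sets borel \<Longrightarrow> B \<in> sets borel \<Longrightarrow> A \<subseteq> {0..<2 * pi} \<Longrightarrow> B \<subseteq> {0..<2 * pi} \<Longrightarrow>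
      (AE z in on_set G. wrap (snd z + fst z) \<in> A \<longleftrightarrow> wrap (snd z - fst z) \<in> B) \<Longrightarrow>
      (AE x in torus. x \<notin> A) \<and> (AE x in torus. x \<notin> B) \<or> (AE x in torus. x \<in> A) \<and> (AE x in torus. x \<in> B)"
    and c: "c > 0" and gcc: "AE y in torus. ennreal c \<le> char_emeasure T G 1 y"
      "AE y in torus. ennreal c \<le> char_emeasure T G (-1) y"
  shows "\<exists>C>0. \<forall>f g. periodic_L2 f \<longrightarrow> periodic_L2 g \<longrightarrow> (\<integral>x. f x \<partial>torus) = (\<integral>x. g x \<partial>torus) \<longrightarrow>
     (\<integral>x. (f x)\<^sup>2 \<partial>torus) + (\<integral>x. (g x)\<^sup>2 \<partial>torus) \<le> C * observed f g"
proof (rule ccontr)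
  let ?N = "\<lambda>f g. (\<integral>x. (f x)\<^sup>2 \<partial>torus) + (\<integral>x. (g x)\<^sup>2 \<partial>torus)"
  assume contra: "\<not> ?thesis"
  have "\<exists>f g. periodic_L2 f \<and> periodic_L2 g \<and> (\<integral>x. f x \<partial>torus) = (\<integral>x. g x \<partial>torus) \<and>
      ?N f g = 1 \<and> observed f g \<le> inverse (real (Suc n))" for n
  proof -
    from contra[unfolded not_ex, rule_format, of "real (Suc n)"] obtain f g where
      fg: "periodic_L2 f" "periodic_L2 g" "(\<integral>x. f x \<partial>torus) = (\<integral>x. g x \<partial>torus)" "?N f g > real (Suc n) * observed f g"
      by (auto simp: not_le)
    have "?N f g > 0" using fg(4) observed_nonneg[of f g] by (smt (verit) mult_nonneg_nonneg of_nat_0_le_iff)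
    define s where "s = inverse (sqrt (?N f g))"
    have s2: "s\<^sup>2 * ?N f g = 1" using \<open>?N f g > 0\<close> by (simp add: s_def power_inverse)
    have "real (Suc n) * (s\<^sup>2 * observed f g) \<le> s\<^sup>2 * ?N f g"
      using mult_left_mono[OF less_imp_le[OF fg(4)], of "s\<^sup>2"] by (simp only: mult.left_commute) simp
    then have "s\<^sup>2 * observed f g \<le> inverse (real (Suc n))" unfolding s2 by (simp add: field_simps)
    moreover have "?N (\<lambda>x. s * f x) (\<lambda>x. s * g x) = 1"
      using s2 by (simp add: power_mult_distrib distrib_left)
    ultimately show ?thesis
      using fg by (intro exI[of _ "\<lambda>x. s * f x"] exI[of _ "\<lambda>x. s * g x"])
        (auto simp: observed_cmult intro: periodic_L2_cmult)
  qed
  then obtain f g where f: "\<And>n. periodic_L2 (f n)" and g: "\<And>n. periodic_L2 (g n)"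
    and mean: "\<And>n. (\<integral>x. f n x \<partial>torus) = (\<integral>x. g n x \<partial>torus)" and norm: "\<And>n. ?N (f n) (g n) = 1"
    and obs: "\<And>n. observed (f n) (g n) \<le> inverse (real (Suc n))" by metis
  have obs_lim: "(\<lambda>n. observed (f n) (g n)) \<longlonglongrightarrow> 0"
    by (rule tendsto_sandwich[OF _ _ tendsto_const LIMSEQ_inverse_real_of_nat])
       (use obs observed_nonneg in auto)
  obtain r :: "nat \<Rightarrow> nat" where r: "strict_mono r" and
    cauchy: "\<And>e. e > 0 \<Longrightarrow> \<exists>N. \<forall>m\<ge>N. \<forall>n\<ge>N. ?N (\<lambda>y. f (r m) y - f (r n) y) (\<lambda>y. g (r m) y - g (r n) y) < e"
    using observed_Cauchy_subseq[OF f g eq_refl[OF norm] obs_lim c gcc] by blast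
  have nn: "(\<integral>y. (h y)\<^sup>2 \<partial>torus) \<ge> 0" for h :: "real \<Rightarrow> real" by (simp add: Bochner_Integration.integral_nonneg)
  have cf: "\<exists>N. \<forall>m\<ge>N. \<forall>n\<ge>N. (\<integral>x. (f (r m) x - f (r n) x)\<^sup>2 \<partial>torus) < e" if "e > 0" for e
    using cauchy[OF that] nn by (meson le_add_same_cancel1 le_less_trans)
  have cg: "\<exists>N. \<forall>m\<ge>N. \<forall>n\<ge>N. (\<integral>x. (g (r m) x - g (r n) x)\<^sup>2 \<partial>torus) < e" if "e > 0" for e
    using cauchy[OF that] nn by (meson le_add_same_cancel2 le_less_trans)
  obtain F where F: "periodic_L2 F" "(\<lambda>n. \<integral>x. (f (r n) x - F x)\<^sup>2 \<partial>torus) \<longlonglongrightarrow> 0"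
    using periodic_L2_limit[of "\<lambda>n. f (r n)", OF f cf] by blast
  obtain H where H: "periodic_L2 H" "(\<lambda>n. \<integral>x. (g (r n) x - H x)\<^sup>2 \<partial>torus) \<longlonglongrightarrow> 0"
    using periodic_L2_limit[of "\<lambda>n. g (r n)", OF g cg] by blast
  define d where "d n = ?N (\<lambda>x. f (r n) x - F x) (\<lambda>x. g (r n) x - H x)" for n
  have d: "d \<longlonglongrightarrow> 0" unfolding d_def using tendsto_add[OF F(2) H(2)] by simp
  \<comment> \<open>Every passage to the limit below has this shape: \<open>d n\<close> and the
    observed energies tend to zero, so a constant bounded by their combinations is nonpositive. It
    is applied to the observation of the limit, to the difference of the means, and to the
    normalisation.\<close>
  have small: "a \<le> 0" if "\<And>n. a \<le> b * d n + 2 * observed (f (r n)) (g (r n))" for a b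
  proof -
    have "(\<lambda>n. b * d n + 2 * observed (f (r n)) (g (r n))) \<longlonglongrightarrow> b * 0 + 2 * 0"
      using LIMSEQ_subseq_LIMSEQ[OF obs_lim r] d by (intro tendsto_intros) (auto simp: comp_def)
    then show ?thesis using that by (intro LIMSEQ_le_const) auto
  qed
  note sq = periodic_L2_sqint
  have "observed F H \<le> 0"
  proof (rule small)
    fix n
    have "observed F H = observed (\<lambda>x. f (r n) x - (f (r n) x - F x)) (\<lambda>x. g (r n) x - (g (r n) x - H x))" by simp
    also have "\<dots> \<le> 2 * observed (f (r n)) (g (r n)) + 2 * observed (\<lambda>x. f (r n) x - F x) (\<lambda>x. g (r n) x - H x)"
      by (intro observed_diff_le periodic_L2_diff f g F H)
    also have "observed (\<lambda>x. f (r n) x - F x) (\<lambda>x. g (r n) x - H x) \<le> 2 * T * d n"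
      unfolding d_def by (intro observed_le periodic_L2_diff f g F H)
    finally show "observed F H \<le> (4 * T) * d n + 2 * observed (f (r n)) (g (r n))" by simp
  qed
  then have zero: "observed F H = 0" using observed_nonneg[of F H] by simp
  have "((\<integral>x. F x \<partial>torus) - (\<integral>x. H x \<partial>torus))\<^sup>2 \<le> 0"
  proof (rule small)
    fix n
    \<comment> \<open>Cauchy-Schwarz against 1: means are continuous in L2, so equality of the means
      survives in the limit.\<close>
    have one: "sqint torus (\<lambda>_. 1)" by (rule sqint_bounded[OF torus.finite_measure_axioms, where B = 1]) auto
    have cs: "(\<integral>x. h x \<partial>torus)\<^sup>2 \<le> 2 * pi * (\<integral>x. (h x)\<^sup>2 \<partial>torus)" if "periodic_L2 h" for h
      using Cauchy_Schwarz_integral[OF sq[OF that] one] by (simp add: mult.commute)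
    have int: "integrable torus h" if "periodic_L2 h" for h
      by (rule sqint_integrable[OF torus.finite_measure_axioms sq[OF that]])
    let ?a = "\<integral>x. f (r n) x - F x \<partial>torus" and ?b = "\<integral>x. g (r n) x - H x \<partial>torus"
    have "(\<integral>x. F x \<partial>torus) - (\<integral>x. H x \<partial>torus) = ?b - ?a"
      using mean[of "r n"] int[OF f] int[OF g] int[OF F(1)] int[OF H(1)] by simp
    also have "(?b - ?a)\<^sup>2 \<le> 2 * ?a\<^sup>2 + 2 * ?b\<^sup>2"
      using zero_le_power2[of "?a + ?b"] by (simp add: power2_eq_square algebra_simps)
    also have "\<dots> \<le> 2 * (2 * pi * (\<integral>x. (f (r n) x - F x)\<^sup>2 \<partial>torus)) + 2 * (2 * pi * (\<integral>x. (g (r n) x - H x)\<^sup>2 \<partial>torus))"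
      by (intro add_mono mult_left_mono cs periodic_L2_diff f g F H) auto
    also have "\<dots> = (4 * pi) * d n" by (simp add: d_def algebra_simps)
    finally show "((\<integral>x. F x \<partial>torus) - (\<integral>x. H x \<partial>torus))\<^sup>2 \<le> (4 * pi) * d n + 2 * observed (f (r n)) (g (r n))"
      using observed_nonneg[of "f (r n)" "g (r n)"] by simp
  qed
  then have "(\<integral>x. F x \<partial>torus) = (\<integral>x. H x \<partial>torus)" by simp
  from unique_continuation[OF osc F(1) H(1) this zero]
  have F0: "AE x in torus. F x = 0" and H0: "AE x in torus. H x = 0" by blast+
  have "(\<integral>x. (F x)\<^sup>2 \<partial>torus) = 0" "(\<integral>x. (H x)\<^sup>2 \<partial>torus) = 0"
    using F0 H0 by (auto intro!: integral_eq_zero_AE)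
  \<comment> \<open>The limit keeps at least half of the squared norm 1, which contradicts
    \<open>F = H = 0\<close> almost everywhere.\<close>
  moreover have "1 - 2 * ?N F H \<le> 0"
  proof (rule small)
    fix n
    have "(\<integral>x. (f (r n) x)\<^sup>2 \<partial>torus) \<le> 2 * (\<integral>x. (f (r n) x - F x)\<^sup>2 \<partial>torus) + 2 * (\<integral>x. (F x)\<^sup>2 \<partial>torus)"
      using integral_square_add_le[OF sq[OF periodic_L2_diff[OF f F(1)]] sq[OF F(1)], of "r n"] by simp
    moreover have "(\<integral>x. (g (r n) x)\<^sup>2 \<partial>torus) \<le> 2 * (\<integral>x. (g (r n) x - H x)\<^sup>2 \<partial>torus) + 2 * (\<integral>x. (H x)\<^sup>2 \<partial>torus)"
      using integral_square_add_le[OF sq[OF periodic_L2_diff[OF g H(1)]] sq[OF H(1)], of "r n"] by simp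
    moreover have "1 - 2 * (b + d') \<le> 2 * (a + c) + 2 * e"
      if "A \<le> 2 * a + 2 * b" "B \<le> 2 * c + 2 * d'" "A + B = 1" "0 \<le> e" for A B a b c d' e :: real
      using that by simp
    ultimately show "1 - 2 * ?N F H \<le> 2 * d n + 2 * observed (f (r n)) (g (r n))"
      using norm[of "r n"] observed_nonneg[of "f (r n)" "g (r n)"] unfolding d_def by blast
  qed
  ultimately show False by simp
qed

end

section \<open>Trigonometric polynomials\<close>

text \<open>Arbitrary phases make the class closed under derivatives and translations by plain rule
  induction: differentiating a cosine adds \<open>pi / 2\<close> to its phase, and the sine has
  phase \<open>- (pi / 2)\<close>.\<close>

inductive trig_poly :: "(real \<Rightarrow> real) \<Rightarrow> bool" where
  const: "trig_poly (\<lambda>x. c)"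
| cos: "trig_poly (\<lambda>x. cos (x + a))"
| add: "trig_poly f \<Longrightarrow> trig_poly g \<Longrightarrow> trig_poly (\<lambda>x. f x + g x)"
| mult: "trig_poly f \<Longrightarrow> trig_poly g \<Longrightarrow> trig_poly (\<lambda>x. f x * g x)"

lemma trig_poly_sin: "trig_poly sin"
  using trig_poly.cos[of "- (pi / 2)"] by (simp add: cos_diff)

lemma trig_poly_cos: "trig_poly cos"
  using trig_poly.cos[of 0] by simp

lemma trig_poly_has_derivative:
  "trig_poly f \<Longrightarrow> \<exists>f'. trig_poly f' \<and> (\<forall>x. (f has_real_derivative f' x) (at x))"
proof (induction rule: trig_poly.induct)
  case (const c)
  show ?case by (rule exI[of _ "\<lambda>_. 0"]) (auto intro: trig_poly.const)
next
  case (cos a)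
  have "- sin (x + a) = cos (x + (a + pi / 2))" for x
    using minus_sin_cos_eq[of "x + a"] by (simp add: add.assoc)
  then have "((\<lambda>x. cos (x + a)) has_real_derivative cos (x + (a + pi / 2))) (at x)" for x
    by (auto intro!: derivative_eq_intros)
  then show ?case using trig_poly.cos by blast
next
  case (add f g)
  then obtain f' g' where "trig_poly f'" "\<And>x. (f has_real_derivative f' x) (at x)"
    "trig_poly g'" "\<And>x. (g has_real_derivative g' x) (at x)" by auto
  then show ?case
    by (intro exI[of _ "\<lambda>x. f' x + g' x"] conjI allI trig_poly.add DERIV_add)
next
  case (mult f g)
  then obtain f' g' where *: "trig_poly f'" "\<And>x. (f has_real_derivative f' x) (at x)"
    "trig_poly g'" "\<And>x. (g has_real_derivative g' x) (at x)" by auto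
  have "((\<lambda>x. f x * g x) has_real_derivative f' x * g x + f x * g' x) (at x)" for x
    using DERIV_mult[OF *(2,4)] by (simp add: mult.commute)
  then show ?case
    using mult.hyps * by (intro exI[of _ "\<lambda>x. f' x * g x + f x * g' x"]) (auto intro: trig_poly.intros)
qed

lemma trig_poly_deriv:
  assumes "trig_poly f"
  shows "trig_poly (deriv f)" "(f has_real_derivative deriv f x) (at x)"
proof -
  obtain f' where f': "trig_poly f'" "\<And>x. (f has_real_derivative f' x) (at x)"
    using trig_poly_has_derivative[OF assms] by auto
  then have "deriv f = f'" by (intro ext DERIV_imp_deriv)
  then show "trig_poly (deriv f)" "(f has_real_derivative deriv f x) (at x)" using f' by simp_all
qed

lemma trig_poly_continuous: "trig_poly f \<Longrightarrow> continuous_on S f"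
  by (meson DERIV_continuous_on DERIV_subset subset_UNIV trig_poly_deriv(2) has_field_derivative_at_within)

lemma trig_poly_measurable [measurable_dest]: "trig_poly f \<Longrightarrow> f \<in> borel_measurable borel"
  by (intro borel_measurable_continuous_onI trig_poly_continuous)

lemma trig_poly_periodic: "trig_poly f \<Longrightarrow> periodic f"
proof (induction rule: trig_poly.induct)
  case (cos a)
  have "cos (x + 2 * pi + a) = cos (x + a)" for x
    using cos_periodic[of "x + a"] by (simp add: add_ac)
  then show ?case by (simp add: periodic_def)
qed (simp_all add: periodic_def)

lemma trig_poly_bounded: "trig_poly f \<Longrightarrow> \<exists>B\<ge>0. \<forall>x. \<bar>f x\<bar> \<le> B"
proof (induction rule: trig_poly.induct)
  case (const c)
  show ?case by (rule exI[of _ "\<bar>c\<bar>"]) simp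
next
  case (cos a)
  show ?case by (rule exI[of _ 1]) simp
next
  case (add f g)
  then obtain B C where "B \<ge> 0" "C \<ge> 0" "\<And>x. \<bar>f x\<bar> \<le> B" "\<And>x. \<bar>g x\<bar> \<le> C" by auto
  then show ?case by (intro exI[of _ "B + C"]) (auto intro: order_trans[OF abs_triangle_ineq] add_mono)
next
  case (mult f g)
  then obtain B C where "B \<ge> 0" "C \<ge> 0" "\<And>x. \<bar>f x\<bar> \<le> B" "\<And>x. \<bar>g x\<bar> \<le> C" by auto
  then show ?case by (intro exI[of _ "B * C"]) (auto simp: abs_mult intro: mult_mono)
qed

lemma trig_poly_shift: "trig_poly f \<Longrightarrow> trig_poly (\<lambda>x. f (x + s))"
proof (induction rule: trig_poly.induct)
  case (cos a)
  show ?case using trig_poly.cos[of "s + a"] by (simp add: add.assoc)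
qed (auto intro: trig_poly.intros)

lemma trig_poly_smooth_torus: "trig_poly f \<Longrightarrow> smooth_torus f"
proof -
  assume f: "trig_poly f"
  have "trig_poly ((deriv ^^ n) f)" for n
    by (induction n) (auto simp: f trig_poly_deriv)
  then have "(deriv ^^ n) f differentiable at x" for n x
    using trig_poly_deriv(2) real_differentiable_def by blast
  then show ?thesis using trig_poly_periodic[OF f] by (simp add: smooth_torus_def)
qed

text \<open>Real polynomial functions are generated by real-linear functionals, and on the unit
  circle such a functional is a combination of cosine and sine.\<close>

lemma trig_poly_cis:
  "real_polynomial_function g \<Longrightarrow> trig_poly (\<lambda>x. g (cis x))"
proof (induction g rule: real_polynomial_function.induct)
  case (linear f)
  interpret bounded_linear f by fact
  have "f (cis x) = cos x * f 1 + sin x * f \<i>" for x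
  proof -
    have "cis x = cos x *\<^sub>R 1 + sin x *\<^sub>R \<i>" by (simp add: complex_eq_iff)
    then show ?thesis by (simp add: add scaleR)
  qed
  then show ?case
    by (simp add: trig_poly.add trig_poly.mult trig_poly.const trig_poly_cos trig_poly_sin)
qed (auto intro: trig_poly.intros)

text \<open>Stone-Weierstrass on the unit circle: \<open>h\<close> is transported by
  \<open>cis\<close>, and real polynomials restricted to the circle are trigonometric
  polynomials.\<close>

lemma trig_poly_dense:
  fixes h :: "real \<Rightarrow> real"
  assumes h: "continuous_on {0..2 * pi} h" "h 0 = h (2 * pi)" and e: "e > 0"
  obtains p where "trig_poly p" "\<And>x. x \<in> {0..2 * pi} \<Longrightarrow> \<bar>h x - p x\<bar> < e"
proof -
  let ?I = "{0..2 * pi}"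
  let ?K = "cis ` ?I"
  \<comment> \<open>The choice is harmless: two preimages in the closed period differ only if they
    are 0 and \<open>2 * pi\<close>, where \<open>h\<close> takes equal values.\<close>
  define H where "H z = h (SOME x. x \<in> ?I \<and> cis x = z)" for z
  have H: "H (cis x) = h x" if x: "x \<in> ?I" for x
  proof -
    define y where "y = (SOME y. y \<in> ?I \<and> cis y = cis x)"
    have y: "y \<in> ?I" "cis y = cis x"
      using someI[of "\<lambda>y. y \<in> ?I \<and> cis y = cis x" x] x by (auto simp: y_def)
    then have "sin y = sin x \<and> cos y = cos x" by (simp add: complex_eq_iff)
    then obtain n :: int where n: "y = x + 2 * pi * of_int n" by (auto simp: sin_cos_eq_iff)
    have "2 * pi * (-1) \<le> 2 * pi * (of_int n :: real)" "2 * pi * of_int n \<le> 2 * pi * (1::real)"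
      using x y(1) n unfolding atLeastAtMost_iff by linarith+
    then have "-1 \<le> (of_int n :: real)" "of_int n \<le> (1::real)"
      by (simp_all only: mult_le_cancel_left_pos zero_less_mult_iff pi_gt_zero zero_less_numeral simp_thms)
    then have "n = -1 \<or> n = 0 \<or> n = 1" by linarith
    then have "h y = h x"
    proof (elim disjE)
      assume "n = -1"
      then have "x = 2 * pi" "y = 0" using n x y(1) by auto
      then show ?thesis using h(2) by simp
    next
      assume "n = 1"
      then have "y = 2 * pi" "x = 0" using n x y(1) by auto
      then show ?thesis using h(2) by simp
    qed (use n in simp)
    then show ?thesis by (simp add: H_def y_def)
  qed
  have K: "compact ?K" by (intro compact_continuous_image continuous_on_cis continuous_on_id) auto
  have "continuous_on ?K H"
    \<comment> \<open>\<open>H\<close> is continuous because \<open>cis\<close> maps the compact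
      preimages under \<open>h\<close> of closed sets to compact, hence closed, sets.\<close>
    unfolding continuous_on_closed_vimage[OF compact_imp_closed[OF K]]
  proof (intro allI impI)
    fix B :: "real set" assume "closed B"
    then have "closed (?I \<inter> h -` B)" using h(1) by (intro continuous_closed_preimage) auto
    then have "compact (?I \<inter> (?I \<inter> h -` B))" by (intro compact_Int_closed) auto
    then have "compact (cis ` (?I \<inter> h -` B))"
      by (intro compact_continuous_image continuous_on_cis continuous_on_id) (simp add: Int_assoc[symmetric])
    moreover have "H -` B \<inter> ?K = cis ` (?I \<inter> h -` B)" using H by auto
    ultimately show "closed (H -` B \<inter> ?K)" by (simp add: compact_imp_closed)
  qed
  from Stone_Weierstrass_real_polynomial_function[OF K this e] obtain g where
    g: "real_polynomial_function g" "\<And>z. z \<in> ?K \<Longrightarrow> \<bar>H z - g z\<bar> < e" by blast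
  have "\<bar>h x - g (cis x)\<bar> < e" if "x \<in> ?I" for x using g(2)[of "cis x"] H[OF that] that by auto
  with trig_poly_cis[OF g(1)] show ?thesis by (rule that)
qed

text \<open>Measurability supplies continuous functions converging to \<open>f\<close> almost
  everywhere; made bounded and vanishing at both ends of the period, they converge in L2 by
  dominated convergence and can then be approximated uniformly.\<close>

lemma trig_poly_L2_dense:
  fixes f :: "real \<Rightarrow> real"
  assumes [measurable]: "f \<in> borel_measurable borel" and B: "\<And>x. \<bar>f x\<bar> \<le> B" and e: "e > 0"
  obtains p where "trig_poly p" "(\<integral>x. (f x - p x)\<^sup>2 \<partial>torus) < e"
proof -
  have "B \<ge> 0" using B[of 0] by simp
  have "f \<in> borel_measurable lebesgue" by (intro measurable_completion) simp
  then have "f measurable_on UNIV" by (simp add: measurable_on_iff_borel_measurable)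
  then obtain N g where N: "negligible N" and g: "\<And>n::nat. continuous_on UNIV (g n)"
    and lim: "\<And>x. x \<notin> N \<Longrightarrow> (\<lambda>n. g n x) \<longlonglongrightarrow> f x"
    by (auto simp: measurable_on_def)
  \<comment> \<open>Clamping to the bounds of \<open>f\<close> gives the dominating function; the
    two ramps vanish at 0 and at \<open>2 * pi\<close> and tend to 1 in between, so the endpoint
    values agree.\<close>
  define h where "h n x = max (- B) (min B (g n x)) * (max 0 (min 1 (real n * x)) * max 0 (min 1 (real n * (2 * pi - x))))" for n x
  have h_cont: "continuous_on UNIV (h n)" for n
    unfolding h_def by (intro continuous_intros g)
  have [measurable]: "h n \<in> borel_measurable borel" for n
    using h_cont by (rule borel_measurable_continuous_onI)
  have h_bound: "\<bar>h n x\<bar> \<le> B" for n x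
  proof -
    have "\<bar>h n x\<bar> \<le> B * (1 * 1)"
      unfolding h_def abs_mult using \<open>B \<ge> 0\<close> by (intro mult_mono) auto
    then show ?thesis by simp
  qed
  have AE_N: "AE x in lborel. x \<notin> N"
  proof -
    have "AE x in lebesgue. x \<notin> N" using N by (intro AE_not_in) (simp add: negligible_iff_null_sets)
    then show ?thesis by (simp add: AE_completion_iff)
  qed
  have lim_h: "AE x in torus. (\<lambda>n. (f x - h n x)\<^sup>2) \<longlonglongrightarrow> 0"
    unfolding AE_torus
  proof -
    have "AE x in lborel. x \<noteq> 0" "AE x in lborel. x \<noteq> 2 * pi" by (rule AE_lborel_singleton)+
    with AE_N show "AE x in lborel. x \<in> {0..2 * pi} \<longrightarrow> (\<lambda>n. (f x - h n x)\<^sup>2) \<longlonglongrightarrow> 0"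
    proof eventually_elim
      case (elim x)
      show ?case
      proof
        assume "x \<in> {0..2 * pi}"
        with elim have x: "0 < x" "x < 2 * pi" by auto
        have cut: "(\<lambda>n. max 0 (min 1 (real n * y))) \<longlonglongrightarrow> 1" if "y > 0" for y :: real
        proof (rule tendsto_eventually)
          obtain k where k: "real k > 1 / y" using reals_Archimedean2 by auto
          show "\<forall>\<^sub>F n in sequentially. max 0 (min 1 (real n * y)) = 1"
          proof (rule eventually_sequentiallyI[of k])
            fix n assume "k \<le> n"
            then have "real n > 1 / y" using k by linarith
            then show "max 0 (min 1 (real n * y)) = 1" using that by (simp add: field_simps)
          qed
        qed
        have "(\<lambda>n. (f x - h n x)\<^sup>2) \<longlonglongrightarrow> (f x - max (- B) (min B (f x)) * (1 * 1))\<^sup>2"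
          unfolding h_def using x by (intro tendsto_intros lim elim(1) cut) auto
        moreover have "max (- B) (min B (f x)) = f x" using B[of x] by auto
        ultimately show "(\<lambda>n. (f x - h n x)\<^sup>2) \<longlonglongrightarrow> 0" by simp
      qed
    qed
  qed
  have "(\<lambda>n. \<integral>x. (f x - h n x)\<^sup>2 \<partial>torus) \<longlonglongrightarrow> (\<integral>x. 0 \<partial>torus)"
  proof (rule integral_dominated_convergence[where w = "\<lambda>x. (2 * B)\<^sup>2"])
    show "AE x in torus. norm ((f x - h n x)\<^sup>2) \<le> (2 * B)\<^sup>2" for n
    proof (rule AE_I2)
      fix x
      have "\<bar>f x - h n x\<bar> \<le> \<bar>2 * B\<bar>" using B[of x] h_bound[of n x] by linarith
      then show "norm ((f x - h n x)\<^sup>2) \<le> (2 * B)\<^sup>2"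
        unfolding abs_le_square_iff by simp
    qed
  qed (use lim_h in auto)
  then have "\<forall>\<^sub>F n in sequentially. (\<integral>x. (f x - h n x)\<^sup>2 \<partial>torus) < e / 4"
    by (rule order_tendstoD) (use e in simp)
  then obtain n where n: "(\<integral>x. (f x - h n x)\<^sup>2 \<partial>torus) < e / 4" by (auto simp: eventually_sequentially)
  \<comment> \<open>A uniform error \<open>d\<close> costs \<open>2 * pi * d\<^sup>2 = e / 4\<close>
    in the squared L2 norm, the same share as the continuous approximation; the triangle inequality
    doubles both.\<close>
  define d where "d = sqrt (e / (8 * pi))"
  have d: "d > 0" "d\<^sup>2 = e / (8 * pi)" using e by (simp_all add: d_def)
  have "h n 0 = h n (2 * pi)" by (simp add: h_def)
  then obtain p where p: "trig_poly p" "\<And>x. x \<in> {0..2 * pi} \<Longrightarrow> \<bar>h n x - p x\<bar> < d"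
    using trig_poly_dense[of "h n" d] continuous_on_subset[OF h_cont] d(1) by blast
  note [measurable] = trig_poly_measurable[OF p(1)]
  obtain C where C: "\<And>x. \<bar>p x\<bar> \<le> C" using trig_poly_bounded[OF p(1)] by auto
  have sq: "sqint torus f" "sqint torus (h n)" "sqint torus p"
    by (rule sqint_bounded[OF torus.finite_measure_axioms _ B] sqint_bounded[OF torus.finite_measure_axioms _ h_bound]
      sqint_bounded[OF torus.finite_measure_axioms _ C], simp)+
  have "(\<integral>x. (h n x - p x)\<^sup>2 \<partial>torus) \<le> (\<integral>x. d\<^sup>2 \<partial>torus)"
  proof (rule integral_mono_AE)
    show "AE x in torus. (h n x - p x)\<^sup>2 \<le> d\<^sup>2"
      unfolding AE_torus
    proof (intro AE_I2 impI)
      fix x assume "x \<in> {0..2 * pi}"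
      then have "\<bar>h n x - p x\<bar> \<le> \<bar>d\<bar>" using p(2)[of x] by linarith
      then show "(h n x - p x)\<^sup>2 \<le> d\<^sup>2" by (simp add: abs_le_square_iff)
    qed
  qed (use sqint_diff[OF sq(2,3)] in \<open>auto simp: sqint_def\<close>)
  also have "\<dots> = e / 4" using d(2) by simp
  finally have "(\<integral>x. (h n x - p x)\<^sup>2 \<partial>torus) \<le> e / 4" .
  moreover have "(\<integral>x. (f x - p x)\<^sup>2 \<partial>torus) \<le> 2 * (\<integral>x. (f x - h n x)\<^sup>2 \<partial>torus) + 2 * (\<integral>x. (h n x - p x)\<^sup>2 \<partial>torus)"
    using integral_square_add_le[OF sqint_diff[OF sq(1,2)] sqint_diff[OF sq(2,3)]] by simp
  ultimately have "(\<integral>x. (f x - p x)\<^sup>2 \<partial>torus) < e" using n by simp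
  with p(1) show ?thesis by (rule that)
qed

text \<open>Density is available for bounded functions, so \<open>sgn (w x)\<close> is approximated
  instead of \<open>w\<close>; orthogonality then makes the integral of the absolute value of
  \<open>w\<close> vanish.\<close>

lemma trig_poly_orthogonal_zero:
  assumes w: "sqint torus w" and orth: "\<And>p. trig_poly p \<Longrightarrow> (\<integral>x. w x * p x \<partial>torus) = 0"
  shows "AE x in torus. w x = 0"
proof -
  have [measurable]: "w \<in> borel_measurable borel" using w by (auto simp: sqint_def)
  define s where "s x = sgn (w x)" for x
  have s: "\<bar>s x\<bar> \<le> 1" "w x * s x = \<bar>w x\<bar>" for x by (auto simp: s_def sgn_real_def)
  have [measurable]: "s \<in> borel_measurable borel" unfolding s_def by measurable
  have sq: "sqint torus s" by (rule sqint_bounded[OF torus.finite_measure_axioms _ s(1)]) simp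
  define A where "A = (\<integral>x. \<bar>w x\<bar> \<partial>torus)"
  define W where "W = (\<integral>x. (w x)\<^sup>2 \<partial>torus)"
  have W: "W \<ge> 0" unfolding W_def by (rule Bochner_Integration.integral_nonneg) simp
  have "A\<^sup>2 \<le> 0 + e" if "e > 0" for e
  proof -
    have "e / (W + 1) > 0" using that W by simp
    then obtain p where p: "trig_poly p" "(\<integral>x. (s x - p x)\<^sup>2 \<partial>torus) < e / (W + 1)"
      using trig_poly_L2_dense[of s 1 "e / (W + 1)"] s(1) by auto
    note [measurable] = trig_poly_measurable[OF p(1)]
    obtain C where "\<And>x. \<bar>p x\<bar> \<le> C" using trig_poly_bounded[OF p(1)] by auto
    then have sp: "sqint torus p" by (intro sqint_bounded[OF torus.finite_measure_axioms]) auto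
    have "A = (\<integral>x. w x * s x \<partial>torus) - (\<integral>x. w x * p x \<partial>torus)" by (simp add: A_def s(2) orth[OF p(1)])
    also have "\<dots> = (\<integral>x. w x * (s x - p x) \<partial>torus)"
      using sqint_mult[OF w sq] sqint_mult[OF w sp] by (simp add: right_diff_distrib)
    finally have "A\<^sup>2 \<le> W * (\<integral>x. (s x - p x)\<^sup>2 \<partial>torus)"
      using Cauchy_Schwarz_integral[OF w sqint_diff[OF sq sp]] by (simp add: W_def)
    also have "\<dots> \<le> W * (e / (W + 1))" using p(2) W by (intro mult_left_mono) auto
    also have "\<dots> \<le> e" using W that by (simp add: field_simps)
    finally show ?thesis by simp
  qed
  then have "A\<^sup>2 \<le> 0" by (rule field_le_epsilon)
  then have "A = 0" by simp
  moreover have "integrable torus (\<lambda>x. \<bar>w x\<bar>)"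
    using sqint_integrable[OF torus.finite_measure_axioms w] by simp
  ultimately have "AE x in torus. \<bar>w x\<bar> = 0"
    unfolding A_def by (subst (asm) integral_nonneg_eq_0_iff_AE) auto
  then show ?thesis by simp
qed

section \<open>Lebesgue representatives\<close>

text \<open>The bridge from the Lebesgue integrals in the definitions to Borel functions integrated
  over \<open>torus\<close>.\<close>

lemma lebesgue_integral_torus:
  fixes F :: "real \<Rightarrow> real"
  assumes F: "F \<in> borel_measurable lebesgue" and [measurable]: "F' \<in> borel_measurable borel"
    and eq: "AE x in lborel. F x = F' x"
  shows "(LINT x:{0..2 * pi}|lebesgue. F x) = (\<integral>x. F' x \<partial>torus)"
    "set_integrable lebesgue {0..2 * pi} F \<longleftrightarrow> integrable torus F'"
proof -
  have m: "(\<lambda>x. indicator {0..2 * pi} x *\<^sub>R F' x) \<in> borel_measurable lborel" by measurable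
  have m': "(\<lambda>x. indicator {0..2 * pi} x *\<^sub>R F' x) \<in> borel_measurable lebesgue"
    using m by (rule measurable_completion)
  have m'': "(\<lambda>x. indicator {0..2 * pi} x *\<^sub>R F x) \<in> borel_measurable lebesgue"
    using F by (intro borel_measurable_scaleR borel_measurable_indicator) auto
  have ae: "AE x in lebesgue. indicator {0..2 * pi} x *\<^sub>R F x = indicator {0..2 * pi} x *\<^sub>R F' x"
    using AE_completion[OF eq] by eventually_elim simp
  have "(LINT x:{0..2 * pi}|lebesgue. F x) = (LINT x:{0..2 * pi}|lebesgue. F' x)"
    unfolding set_lebesgue_integral_def by (rule integral_cong_AE[OF m'' m' ae])
  also have "\<dots> = (LINT x:{0..2 * pi}|lborel. F' x)"
    unfolding set_lebesgue_integral_def by (rule integral_completion[OF m])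
  finally show "(LINT x:{0..2 * pi}|lebesgue. F x) = (\<integral>x. F' x \<partial>torus)" by (simp add: integral_torus)
  have "set_integrable lebesgue {0..2 * pi} F \<longleftrightarrow> set_integrable lebesgue {0..2 * pi} F'"
    unfolding set_integrable_def by (rule integrable_cong_AE[OF m'' m' ae])
  also have "\<dots> \<longleftrightarrow> set_integrable lborel {0..2 * pi} F'"
    unfolding set_integrable_def by (rule integrable_completion[OF m])
  finally show "set_integrable lebesgue {0..2 * pi} F \<longleftrightarrow> integrable torus F'" by (simp add: integrable_torus)
qed

lemma L2_torus_measurable: "f \<in> L2_torus \<Longrightarrow> f \<in> borel_measurable lebesgue"
  by (simp add: L2_torus_def)

lemma L2_torus_version:
  assumes "f \<in> L2_torus"
  obtains f' where "periodic_L2 f'" "AE x in lborel. f x = f' x"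
proof -
  have f: "f \<in> borel_measurable lebesgue" "periodic f" "set_integrable lebesgue {0..2 * pi} (\<lambda>x. (f x)\<^sup>2)"
    using assms by (auto simp: L2_torus_def)
  obtain f' where f': "f' \<in> borel_measurable borel" "periodic f'" and ae: "AE x in lborel. f x = f' x"
    using periodic_borel_version[OF f(1,2)] by blast
  have "AE x in lborel. (f x)\<^sup>2 = (f' x)\<^sup>2" using ae by eventually_elim simp
  then have "integrable torus (\<lambda>x. (f' x)\<^sup>2)"
    using lebesgue_integral_torus(2)[of "\<lambda>x. (f x)\<^sup>2" "\<lambda>x. (f' x)\<^sup>2"] f f'(1) by auto
  then show ?thesis using that f' ae by (simp add: periodic_L2_def)
qed

lemma L2_torus_AE_eq:
  assumes "periodic_L2 f'" "AE x in lborel. f x = f' x" "f \<in> borel_measurable lebesgue"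
  shows "(L2_norm f)\<^sup>2 = (\<integral>x. (f' x)\<^sup>2 \<partial>torus)" "L2_norm f = sqrt (\<integral>x. (f' x)\<^sup>2 \<partial>torus)"
    "set_integrable lebesgue {0..2 * pi} (\<lambda>x. (f x)\<^sup>2)"
proof -
  note [measurable] = periodic_L2_measurable[OF assms(1)]
  have "AE x in lborel. (f x)\<^sup>2 = (f' x)\<^sup>2" using assms(2) by eventually_elim simp
  note * = lebesgue_integral_torus[OF _ _ this]
  show n: "L2_norm f = sqrt (\<integral>x. (f' x)\<^sup>2 \<partial>torus)"
    using *(1) assms(3) by (simp add: L2_norm_def)
  show "(L2_norm f)\<^sup>2 = (\<integral>x. (f' x)\<^sup>2 \<partial>torus)"
    unfolding n by (simp add: Bochner_Integration.integral_nonneg)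
  show "set_integrable lebesgue {0..2 * pi} (\<lambda>x. (f x)\<^sup>2)"
    using *(2) assms by (simp add: periodic_L2_def)
qed

lemma borel_imp_lebesgue_measurable: "f \<in> borel_measurable borel \<Longrightarrow> f \<in> borel_measurable lebesgue"
  by (rule measurable_completion) simp

lemma periodic_L2_imp_L2_torus: "periodic_L2 f \<Longrightarrow> f \<in> L2_torus"
proof -
  assume f: "periodic_L2 f"
  then have m: "f \<in> borel_measurable lebesgue" and p: "periodic f"
    by (simp_all only: periodic_L2_def borel_imp_lebesgue_measurable)
  show ?thesis
    unfolding L2_torus_def using m p L2_torus_AE_eq(3)[OF f AE_I2[OF refl] m] by blast
qed

lemma lebesgue_integral_torus_mult:
  assumes "f \<in> L2_torus" "f' \<in> borel_measurable borel" "AE x in lborel. f x = f' x" "g \<in> borel_measurable borel"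
  shows "(LINT x:{0..2 * pi}|lebesgue. f x * g x) = (\<integral>x. f' x * g x \<partial>torus)"
proof (rule lebesgue_integral_torus)
  show "(\<lambda>x. f x * g x) \<in> borel_measurable lebesgue"
    by (intro borel_measurable_times L2_torus_measurable borel_imp_lebesgue_measurable assms)
qed (use assms in auto)

text \<open>Trigonometric polynomials are admissible test functions, so the difference of two weak
  derivatives is orthogonal to all of them. This controls the arbitrary choice in
  \<open>weak_deriv\<close>.\<close>

lemma weak_deriv_unique:
  assumes "has_weak_deriv f g" "has_weak_deriv f h"
  shows "AE x in lborel. g x = h x"
proof -
  have L: "g \<in> L2_torus" "h \<in> L2_torus" using assms by (auto simp: has_weak_deriv_def)
  obtain g' where g': "periodic_L2 g'" "AE x in lborel. g x = g' x" using L2_torus_version[OF L(1)] by blast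
  obtain h' where h': "periodic_L2 h'" "AE x in lborel. h x = h' x" using L2_torus_version[OF L(2)] by blast
  note [measurable] = periodic_L2_measurable[OF g'(1)] periodic_L2_measurable[OF h'(1)]
  have d: "periodic_L2 (\<lambda>x. g' x - h' x)" using g' h' by (intro periodic_L2_diff)
  have "AE x in torus. g' x - h' x = 0"
  proof (rule trig_poly_orthogonal_zero)
    show "sqint torus (\<lambda>x. g' x - h' x)" by (rule periodic_L2_sqint[OF d])
    fix p assume p: "trig_poly p"
    note [measurable] = trig_poly_measurable[OF p]
    obtain B where B: "\<And>x. \<bar>p x\<bar> \<le> B" using trig_poly_bounded[OF p] by auto
    have sp: "sqint torus p" by (rule sqint_bounded[OF torus.finite_measure_axioms _ B]) measurable
    have "(LINT x:{0..2 * pi}|lebesgue. g x * p x) = (LINT x:{0..2 * pi}|lebesgue. h x * p x)"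
      using assms trig_poly_smooth_torus[OF p] by (simp add: has_weak_deriv_def)
    then have "(\<integral>x. g' x * p x \<partial>torus) = (\<integral>x. h' x * p x \<partial>torus)"
      using lebesgue_integral_torus_mult[OF L(1) _ g'(2)] lebesgue_integral_torus_mult[OF L(2) _ h'(2)] by simp
    then show "(\<integral>x. (g' x - h' x) * p x \<partial>torus) = 0"
      using sqint_mult[OF periodic_L2_sqint[OF g'(1)] sp] sqint_mult[OF periodic_L2_sqint[OF h'(1)] sp]
      by (simp add: left_diff_distrib)
  qed
  then have "AE x in lborel. x \<in> {0..2 * pi} \<longrightarrow> g' x - h' x = 0" by (simp add: AE_torus)
  then have "AE x in lborel. g' (wrap x) - h' (wrap x) = 0" by (intro AE_wrap) auto
  then have "AE x in lborel. g' x = h' x"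
    using periodic_wrap[of g'] periodic_wrap[of h'] g'(1) h'(1) by (simp add: periodic_L2_def periodic_def)
  with g'(2) h'(2) show ?thesis by eventually_elim simp
qed

lemma weak_deriv_has: "f \<in> H1_torus \<Longrightarrow> has_weak_deriv f (weak_deriv f)"
  unfolding weak_deriv_def H1_torus_def by (simp add: some_eq_ex)

section \<open>Test functions\<close>

text \<open>The whole sequence of derivatives is the witness: a derivative shifts the sequence and
  an antiderivative prepends a term.\<close>

definition smooth_real :: "(real \<Rightarrow> real) \<Rightarrow> bool" where
  "smooth_real f \<longleftrightarrow> (\<exists>D::nat \<Rightarrow> real \<Rightarrow> real. D 0 = f \<and>
     (\<forall>n x. (D n has_real_derivative D (Suc n) x) (at x)))"

lemma smooth_real_deriv:
  assumes "smooth_real f"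
  obtains f' where "smooth_real f'" "\<And>x. (f has_real_derivative f' x) (at x)"
proof -
  obtain D :: "nat \<Rightarrow> real \<Rightarrow> real" where D: "D 0 = f" "\<And>n x. (D n has_real_derivative D (Suc n) x) (at x)"
    using assms by (auto simp: smooth_real_def)
  have "smooth_real (D 1)"
    unfolding smooth_real_def by (rule exI[of _ "\<lambda>n. D (Suc n)"]) (simp add: D(2))
  then show ?thesis using that D(2)[of 0] D(1) by auto
qed

lemma smooth_real_antideriv:
  assumes "smooth_real f'" "\<And>x. (f has_real_derivative f' x) (at x)"
  shows "smooth_real f"
proof -
  obtain D :: "nat \<Rightarrow> real \<Rightarrow> real" where D: "D 0 = f'" "\<And>n x. (D n has_real_derivative D (Suc n) x) (at x)"
    using assms(1) by (auto simp: smooth_real_def)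
  show ?thesis
    unfolding smooth_real_def
  proof (intro exI conjI allI)
    fix n x
    show "((case n of 0 \<Rightarrow> f | Suc k \<Rightarrow> D k) has_real_derivative (case Suc n of 0 \<Rightarrow> f | Suc k \<Rightarrow> D k) x) (at x)"
      using assms(2) D by (cases n) auto
  qed simp
qed

lemma smooth_real_continuous: "smooth_real f \<Longrightarrow> continuous_on S f"
  by (metis smooth_real_deriv DERIV_continuous_on has_field_derivative_at_within)

text \<open>The smallest convenient family that contains \<open>exp (- 1 / x)\<close> extended by
  zero and is closed under differentiation.\<close>

definition flat_exp :: "real poly \<Rightarrow> real \<Rightarrow> real" where
  "flat_exp p x = (if x > 0 then poly p (inverse x) * exp (- inverse x) else 0)"

lemma poly_times_exp_minus_tendsto: "((\<lambda>y. poly p y * exp (- y)) \<longlongrightarrow> (0::real)) at_top"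
proof (induction p)
  case 0
  show ?case by simp
next
  case (pCons a p)
  have pow: "((\<lambda>y. y ^ k * exp (- y)) \<longlongrightarrow> (0::real)) at_top" for k
    using tendsto_power_div_exp_0[of k] by (simp add: exp_minus field_simps)
  have "((\<lambda>y. \<Sum>i\<le>degree (pCons a p). coeff (pCons a p) i * (y ^ i * exp (- y))) \<longlongrightarrow>
      (\<Sum>i\<le>degree (pCons a p). coeff (pCons a p) i * 0)) at_top"
    by (intro tendsto_sum tendsto_mult tendsto_const pow)
  then show ?case by (simp only: poly_altdef sum_distrib_right mult.assoc mult_zero_right sum.neutral_const)
qed

lemma flat_exp_tendsto: "(flat_exp p \<longlongrightarrow> 0) (at 0)"
proof -
  have "((\<lambda>x. poly p (inverse x) * exp (- inverse x)) \<longlongrightarrow> 0) (at_right 0)"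
    by (rule filterlim_compose[OF poly_times_exp_minus_tendsto filterlim_inverse_at_top_right])
  then have "(flat_exp p \<longlongrightarrow> 0) (at_right 0)"
    by (rule Lim_transform_eventually) (auto simp: eventually_at_filter flat_exp_def)
  moreover have "(flat_exp p \<longlongrightarrow> 0) (at_left 0)"
    by (rule Lim_transform_eventually[OF tendsto_const]) (auto simp: eventually_at_filter flat_exp_def)
  ultimately show ?thesis by (simp add: filterlim_split_at)
qed

text \<open>In the variable \<open>y = 1 / x\<close> differentiation is \<open>- y\<^sup>2\<close>
  times the derivative in \<open>y\<close>, and it turns \<open>p\<close> into
  \<open>y\<^sup>2 * (p - p')\<close> in front of the same exponential.\<close>

lemma flat_exp_derivative:
  "(flat_exp p has_real_derivative flat_exp ([:0, 0, 1:] * (p - pderiv p)) x) (at x)"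
proof (cases x "0::real" rule: linorder_cases)
  case less
  have "((\<lambda>_. 0) has_real_derivative 0) (at x)" by simp
  then have "(flat_exp p has_real_derivative 0) (at x)"
    by (rule has_field_derivative_transform_within_open[of _ _ _ "{..<0}"]) (use less in \<open>auto simp: flat_exp_def\<close>)
  then show ?thesis using less by (simp add: flat_exp_def)
next
  case greater
  have "((\<lambda>x. poly p (inverse x) * exp (- inverse x)) has_real_derivative
     poly (pderiv p) (inverse x) * (- (inverse x * inverse x)) * exp (- inverse x) +
     exp (- inverse x) * (inverse x * inverse x) * poly p (inverse x)) (at x)"
    using greater
    by (auto intro!: derivative_eq_intros DERIV_chain2[OF poly_DERIV] simp: power2_eq_square)
  then have "(flat_exp p has_real_derivative
     poly (pderiv p) (inverse x) * (- (inverse x * inverse x)) * exp (- inverse x) +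
     exp (- inverse x) * (inverse x * inverse x) * poly p (inverse x)) (at x)"
    by (rule has_field_derivative_transform_within_open[of _ _ _ "{0<..}"]) (use greater in \<open>auto simp: flat_exp_def\<close>)
  then show ?thesis using greater by (simp add: flat_exp_def algebra_simps)
next
  case equal
  \<comment> \<open>The difference quotient at 0 multiplies \<open>p\<close> by
    \<open>y = 1 / h\<close>, so it is again in the family and tends to 0.\<close>
  have "(\<lambda>h. (flat_exp p (0 + h) - flat_exp p 0) / h) = flat_exp (pCons 0 p)"
    by (auto simp: flat_exp_def fun_eq_iff divide_inverse)
  then have "(flat_exp p has_real_derivative 0) (at 0)"
    using flat_exp_tendsto[of "pCons 0 p"] by (simp add: DERIV_def)
  then show ?thesis using equal by (simp add: flat_exp_def)
qed

text \<open>A class that contains the bump used below and its derivatives; closure under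
  differentiation yields all orders by dependent choice.\<close>

inductive bump :: "(real \<Rightarrow> real) \<Rightarrow> bool" where
  base: "bump (\<lambda>x. flat_exp p (a * x + b))"
| add: "bump f \<Longrightarrow> bump g \<Longrightarrow> bump (\<lambda>x. f x + g x)"
| mult: "bump f \<Longrightarrow> bump g \<Longrightarrow> bump (\<lambda>x. f x * g x)"

lemma bump_has_derivative: "bump f \<Longrightarrow> \<exists>f'. bump f' \<and> (\<forall>x. (f has_real_derivative f' x) (at x))"
proof (induction rule: bump.induct)
  case (base p a b)
  let ?q = "smult a ([:0, 0, 1:] * (p - pderiv p))"
  have "((\<lambda>x. flat_exp p (a * x + b)) has_real_derivative flat_exp ?q (a * x + b)) (at x)" for x
  proof -
    have "((\<lambda>x. a * x + b) has_real_derivative a) (at x)" by (auto intro!: derivative_eq_intros)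
    from DERIV_chain2[OF flat_exp_derivative this, of p]
    show ?thesis by (simp add: flat_exp_def mult_ac split: if_splits)
  qed
  then show ?case using bump.base by blast
next
  case (add f g)
  then obtain f' g' where "bump f'" "\<And>x. (f has_real_derivative f' x) (at x)"
    "bump g'" "\<And>x. (g has_real_derivative g' x) (at x)" by auto
  then show ?case
    by (intro exI[of _ "\<lambda>x. f' x + g' x"] conjI allI bump.add DERIV_add)
next
  case (mult f g)
  then obtain f' g' where *: "bump f'" "\<And>x. (f has_real_derivative f' x) (at x)"
    "bump g'" "\<And>x. (g has_real_derivative g' x) (at x)" by auto
  have "((\<lambda>x. f x * g x) has_real_derivative f' x * g x + f x * g' x) (at x)" for x
    using DERIV_mult[OF *(2,4)] by (simp add: mult.commute)
  then show ?case
    using mult.hyps * by (intro exI[of _ "\<lambda>x. f' x * g x + f x * g' x"]) (auto intro: bump.intros)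
qed

lemma bump_smooth: "bump f \<Longrightarrow> smooth_real f"
proof -
  assume f: "bump f"
  have "\<exists>D. \<forall>n. (bump (D n) \<and> (n = 0 \<longrightarrow> D n = f)) \<and> (\<forall>x. (D n has_real_derivative D (Suc n) x) (at x))"
    by (rule dependent_nat_choice) (use f bump_has_derivative in auto)
  then show ?thesis unfolding smooth_real_def by blast
qed

text \<open>\<open>b\<close> is a smooth bump on the unit interval and \<open>S\<close> its
  antiderivative vanishing to the left. The final height \<open>S 1\<close> is left unnormalised,
  since it cancels later.\<close>

lemma smooth_step:
  obtains S b :: "real \<Rightarrow> real"
  where "\<And>x. (S has_real_derivative b x) (at x)"
    "\<And>c d. smooth_real (\<lambda>x. b (c * x + d))" "\<And>x. b x \<ge> 0" "\<And>x. x \<notin> {0..1} \<Longrightarrow> b x = 0"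
    "\<And>x. x \<le> 0 \<Longrightarrow> S x = 0" "\<And>x. x \<ge> 1 \<Longrightarrow> S x = S 1" "S 1 > 0"
proof -
  define b where "b x = flat_exp 1 x * flat_exp 1 (1 - x)" for x :: real
  have bump_b: "bump (\<lambda>x. b (c * x + d))" for c d
    using bump.mult[OF bump.base[of 1 c d] bump.base[of 1 "- c" "1 - d"]] by (simp add: b_def algebra_simps)
  have cont: "continuous_on UNIV b"
    using smooth_real_continuous[OF bump_smooth[OF bump_b[of 1 0]]] by simp
  have "\<exists>F. \<forall>x. -\<infinity> < ereal x \<longrightarrow> ereal x < \<infinity> \<longrightarrow> (F has_vector_derivative b x) (at x)"
    using cont by (intro einterval_antiderivative) (auto simp: continuous_on_eq_continuous_at)
  then obtain F where F: "\<And>x. (F has_real_derivative b x) (at x)"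
    by (auto simp: has_real_derivative_iff_has_vector_derivative)
  define S where "S x = F x - F 0" for x
  have S: "(S has_real_derivative b x) (at x)" for x
    unfolding S_def by (auto intro!: derivative_eq_intros F)
  have S_cont: "continuous_on A S" for A
    by (rule DERIV_continuous_on[OF has_field_derivative_at_within[OF S]])
  have b0: "b x = 0" if "x \<le> 0 \<or> x \<ge> 1" for x using that by (auto simp: b_def flat_exp_def)
  have bpos: "b x > 0" if "0 < x" "x < 1" for x using that by (simp add: b_def flat_exp_def)
  have flat: "(S has_real_derivative 0) (at x)" if "x \<le> 0 \<or> x \<ge> 1" for x
    using S[of x] b0[OF that] by simp
  have S_le: "S x = 0" if "x \<le> 0" for x
  proof -
    have "S 0 = S (x - 1)"
      by (rule DERIV_isconst_end[OF _ S_cont flat]) (use that in simp_all)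
    moreover have "S x = S (x - 1)"
      by (rule DERIV_isconst_end[OF _ S_cont flat]) (use that in simp_all)
    ultimately show ?thesis by (simp add: S_def)
  qed
  have S_ge: "S x = S 1" if "x \<ge> 1" for x
  proof (cases "x = 1")
    case False
    show ?thesis
      by (rule DERIV_isconst_end[OF _ S_cont flat]) (use that False in simp_all)
  qed simp
  have "S 0 < S 1"
    by (rule DERIV_pos_imp_increasing_open[OF zero_less_one _ S_cont]) (use S bpos in blast)
  then have "S 1 > 0" using S_le[of 0] by simp
  moreover have "b x \<ge> 0" for x using bpos[of x] b0[of x] by (cases "0 < x \<and> x < 1") auto
  moreover have "b x = 0" if "x \<notin> {0..1}" for x using that by (intro b0) auto
  moreover have "smooth_real (\<lambda>x. b (c * x + d))" for c d by (rule bump_smooth[OF bump_b])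
  ultimately show ?thesis using that S S_le S_ge by blast
qed

lemma smooth_real_diff: "smooth_real f \<Longrightarrow> smooth_real g \<Longrightarrow> smooth_real (\<lambda>x. f x - g x)"
proof -
  assume "smooth_real f" "smooth_real g"
  then obtain D E :: "nat \<Rightarrow> real \<Rightarrow> real" where
    D: "D 0 = f" "\<And>n x. (D n has_real_derivative D (Suc n) x) (at x)" and
    E: "E 0 = g" "\<And>n x. (E n has_real_derivative E (Suc n) x) (at x)"
    by (auto simp: smooth_real_def)
  show ?thesis
    unfolding smooth_real_def using D E
    by (intro exI[of _ "\<lambda>n x. D n x - E n x"]) (auto intro!: DERIV_diff)
qed

text \<open>The lemma of du Bois-Reymond for a continuous \<open>Z\<close>. Tested against two bumps
  of equal mass at \<open>s1\<close> and \<open>s2\<close>, \<open>Z\<close> has equal local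
  averages there, because the difference of the bumps is the derivative of an admissible cutoff.
  Shrinking the bumps gives \<open>Z s1 = Z s2\<close>.\<close>

lemma constant_of_weak_derivative_zero:
  assumes T: "T > 0" and Z: "continuous_on {0..T} Z"
    and weak: "\<And>\<theta> \<theta>' a b. smooth_real \<theta> \<Longrightarrow> smooth_real \<theta>' \<Longrightarrow> (\<And>x. (\<theta> has_real_derivative \<theta>' x) (at x)) \<Longrightarrow>
      0 < a \<Longrightarrow> b < T \<Longrightarrow> (\<And>t. \<theta> t \<noteq> 0 \<Longrightarrow> a \<le> t \<and> t \<le> b) \<Longrightarrow> (LINT t:{0..T}|lborel. Z t * \<theta>' t) = (0::real)"
    and s: "s \<in> {0..T}"
  shows "Z s = Z 0"
proof -
  obtain S b :: "real \<Rightarrow> real" where S: "\<And>x. (S has_real_derivative b x) (at x)"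
    and b_smooth: "\<And>c d. smooth_real (\<lambda>x. b (c * x + d))" and b_nonneg: "\<And>x. b x \<ge> 0"
    and b_out: "\<And>x. x \<notin> {0..1} \<Longrightarrow> b x = 0" and S_le: "\<And>x. x \<le> 0 \<Longrightarrow> S x = 0"
    and S_ge: "\<And>x. x \<ge> 1 \<Longrightarrow> S x = S 1" and S1: "S 1 > 0"
    using smooth_step by blast
  have b_smooth': "smooth_real (\<lambda>t. b ((t - s) / e))" for s e
    using b_smooth[of "1 / e" "- s / e"] by (simp add: diff_divide_distrib)
  have deriv: "((\<lambda>t. e * S ((t - s) / e)) has_real_derivative b ((t - s) / e)) (at t)" if "e > 0" for e s t
  proof -
    have "((\<lambda>t. (t - s) / e) has_real_derivative 1 / e) (at t)"
      using that by (auto intro!: derivative_eq_intros)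
    from DERIV_cmult[OF DERIV_chain2[OF S this], of e]
    have "((\<lambda>t. e * S ((t - s) / e)) has_real_derivative e * (b ((t - s) / e) * (1 / e))) (at t)" .
    then show ?thesis using that by simp
  qed
  \<comment> \<open>A scaled bump has mass \<open>e * S 1\<close> on the window from
    \<open>s\<close> to \<open>s + e\<close>, where \<open>Z\<close> is within \<open>d\<close> of
    \<open>Z s\<close>.\<close>
  have mollify: "\<bar>(LINT t:{0..T}|lborel. Z t * b ((t - s) / e)) - Z s * (e * S 1)\<bar> \<le> d * (e * S 1)"
    "set_integrable lborel {0..T} (\<lambda>t. Z t * b ((t - s) / e))"
    if e: "e > 0" "0 < s" "s + e < T" and d: "\<And>t. s \<le> t \<Longrightarrow> t \<le> s + e \<Longrightarrow> \<bar>Z t - Z s\<bar> \<le> d" for e s d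
  proof -
    let ?b = "\<lambda>t. b ((t - s) / e)"
    have cb: "continuous_on {0..T} ?b" by (rule smooth_real_continuous[OF b_smooth'])
    show int: "set_integrable lborel {0..T} (\<lambda>t. Z t * ?b t)"
      by (intro borel_integrable_atLeastAtMost' continuous_on_mult Z cb)
    have intb: "set_integrable lborel {0..T} ?b"
      by (intro borel_integrable_atLeastAtMost' cb)
    have "(LINT t:{0..T}|lborel. ?b t) = e * S ((T - s) / e) - e * S ((0 - s) / e)"
      unfolding set_lebesgue_integral_def using T deriv[OF e(1)] cb
      by (intro integral_FTC_Icc) (auto simp: has_real_derivative_iff_has_vector_derivative[symmetric] has_field_derivative_at_within)
    moreover have "S ((T - s) / e) = S 1" using e by (intro S_ge) (simp add: field_simps)
    moreover have "S ((0 - s) / e) = 0" using e by (intro S_le) (simp add: field_simps)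
    ultimately have m: "(LINT t:{0..T}|lborel. ?b t) = e * S 1" by simp
    have "(LINT t:{0..T}|lborel. Z t * ?b t) - Z s * (e * S 1) = (LINT t:{0..T}|lborel. Z t * ?b t - Z s * ?b t)"
      using int intb unfolding m[symmetric] by simp
    then have "\<bar>(LINT t:{0..T}|lborel. Z t * ?b t) - Z s * (e * S 1)\<bar> = \<bar>LINT t:{0..T}|lborel. Z t * ?b t - Z s * ?b t\<bar>"
      by (rule arg_cong)
    also have "\<dots> \<le> (LINT t:{0..T}|lborel. \<bar>Z t * ?b t - Z s * ?b t\<bar>)"
      using int intb set_integral_norm_bound[of lborel "{0..T}" "\<lambda>t. Z t * ?b t - Z s * ?b t"] by simp
    also have "\<dots> \<le> (LINT t:{0..T}|lborel. d * ?b t)"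
    proof (rule set_integral_mono)
      fix t
      show "\<bar>Z t * ?b t - Z s * ?b t\<bar> \<le> d * ?b t"
      proof (cases "s \<le> t \<and> t \<le> s + e")
        case True
        then have "\<bar>Z t - Z s\<bar> * ?b t \<le> d * ?b t" using d b_nonneg by (intro mult_right_mono) auto
        then show ?thesis using b_nonneg by (simp add: abs_mult flip: left_diff_distrib)
      next
        case False
        then have "?b t = 0" using e(1) by (intro b_out) (auto simp: field_simps)
        then show ?thesis by simp
      qed
    qed (use int intb in \<open>auto intro!: set_integrable_abs\<close>)
    also have "\<dots> = d * (e * S 1)" by (simp add: m)
    finally show "\<bar>(LINT t:{0..T}|lborel. Z t * ?b t) - Z s * (e * S 1)\<bar> \<le> d * (e * S 1)" .
  qed
  have eq: "Z s1 = Z s2" if s12: "0 < s1" "s1 < s2" "s2 < T" for s1 s2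
  proof -
    have "\<bar>Z s1 - Z s2\<bar> \<le> 2 * d" if d: "d > 0" for d
    proof -
      have "\<exists>e>0. \<forall>t\<in>{0..T}. \<bar>t - s\<bar> < e \<longrightarrow> \<bar>Z t - Z s\<bar> < d" if "s \<in> {0..T}" for s
        using Z d that by (auto simp: continuous_on_iff dist_real_def)
      from this[of s1] this[of s2] s12 obtain e1 e2 where e12: "e1 > 0" "e2 > 0"
        "\<And>t. t \<in> {0..T} \<Longrightarrow> \<bar>t - s1\<bar> < e1 \<Longrightarrow> \<bar>Z t - Z s1\<bar> < d"
        "\<And>t. t \<in> {0..T} \<Longrightarrow> \<bar>t - s2\<bar> < e2 \<Longrightarrow> \<bar>Z t - Z s2\<bar> < d" by auto
      define e where "e = min (min e1 e2) (T - s2) / 2"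
      have m: "min (min e1 e2) (T - s2) > 0" "min (min e1 e2) (T - s2) \<le> e1"
        "min (min e1 e2) (T - s2) \<le> e2" "min (min e1 e2) (T - s2) \<le> T - s2"
        using e12(1,2) s12 by auto
      have "e = min (min e1 e2) (T - s2) / 2" by (simp add: e_def)
      then have e: "e > 0" "e < e1" "e < e2" "s2 + e < T" using m by linarith+
      have m1: "\<bar>(LINT t:{0..T}|lborel. Z t * b ((t - s1) / e)) - Z s1 * (e * S 1)\<bar> \<le> d * (e * S 1)"
        "set_integrable lborel {0..T} (\<lambda>t. Z t * b ((t - s1) / e))"
        using s12 e by (intro mollify[where d = d] less_imp_le[OF e12(3)]; auto)+
      have m2: "\<bar>(LINT t:{0..T}|lborel. Z t * b ((t - s2) / e)) - Z s2 * (e * S 1)\<bar> \<le> d * (e * S 1)"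
        "set_integrable lborel {0..T} (\<lambda>t. Z t * b ((t - s2) / e))"
        using s12 e by (intro mollify[where d = d] less_imp_le[OF e12(4)]; auto)+
      \<comment> \<open>Both steps rise by the same amount \<open>e * S 1\<close>, so their
        difference vanishes before \<open>s1\<close> and after \<open>s2 + e\<close>; this makes it
        an admissible cutoff.\<close>
      let ?\<theta> = "\<lambda>t. e * S ((t - s1) / e) - e * S ((t - s2) / e)"
      let ?\<theta>' = "\<lambda>t. b ((t - s1) / e) - b ((t - s2) / e)"
      have \<theta>': "smooth_real ?\<theta>'" by (intro smooth_real_diff b_smooth')
      have \<theta>: "(?\<theta> has_real_derivative ?\<theta>' t) (at t)" for t by (intro DERIV_diff deriv e)
      have supp: "s1 \<le> t \<and> t \<le> s2 + e" if "?\<theta> t \<noteq> 0" for t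
      proof (rule ccontr)
        assume "\<not> ?thesis"
        then consider "t < s1" | "t > s2 + e" by linarith
        then show False
        proof cases
          case 1
          then have "S ((t - s1) / e) = 0" "S ((t - s2) / e) = 0" using s12 e by (auto intro!: S_le simp: field_simps)
          then show False using that by simp
        next
          case 2
          then have "S ((t - s1) / e) = S 1" "S ((t - s2) / e) = S 1" using s12 e by (auto intro!: S_ge simp: field_simps)
          then show False using that by simp
        qed
      qed
      have "(LINT t:{0..T}|lborel. Z t * ?\<theta>' t) = 0"
        by (rule weak[OF smooth_real_antideriv[OF \<theta>' \<theta>] \<theta>' \<theta> s12(1) e(4) supp])
      then have "(LINT t:{0..T}|lborel. Z t * b ((t - s1) / e)) = (LINT t:{0..T}|lborel. Z t * b ((t - s2) / e))"
        using m1(2) m2(2) by (simp add: right_diff_distrib)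
      then have "\<bar>Z s1 * (e * S 1) - Z s2 * (e * S 1)\<bar> \<le> 2 * d * (e * S 1)"
        using m1(1) m2(1) by linarith
      then have "\<bar>Z s1 - Z s2\<bar> * (e * S 1) \<le> 2 * d * (e * S 1)"
        using e(1) S1 by (simp add: abs_mult flip: left_diff_distrib)
      then show ?thesis by (rule mult_right_le_imp_le) (use e(1) S1 in simp)
    qed
    from this[of "_ / 2"] have "\<bar>Z s1 - Z s2\<bar> \<le> 0 + e" if "e > 0" for e using that by simp
    then have "\<bar>Z s1 - Z s2\<bar> \<le> 0" by (rule field_le_epsilon)
    then show ?thesis by simp
  qed
  have inner: "Z t = Z (T / 2)" if "t \<in> {0<..<T}" for t
  proof (cases t "T / 2" rule: linorder_cases)
    case less
    with that T show ?thesis by (intro eq) auto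
  next
    case greater
    with that T show ?thesis by (intro eq[symmetric]) auto
  qed (rule arg_cong)
  \<comment> \<open>Cutoffs never reach the end times, so these are covered by continuity of
    \<open>Z\<close>.\<close>
  have cl: "closure {0<..<T} = {0..T}" using T by (simp add: closure_greaterThanLessThan)
  have all: "Z t = Z (T / 2)" if "t \<in> {0..T}" for t
    by (rule continuous_constant_on_closure[of "{0<..<T}" Z, unfolded cl, OF Z inner that])
  have "0 \<in> {0..T}" using T by simp
  from all[OF s] all[OF this] show ?thesis by (rule trans[OF _ sym])
qed

text \<open>Differentiating \<open>\<theta> t * e (x - \<sigma> * t)\<close> in time produces two
  such products, so sums are needed to make the class closed under both partial derivatives. The
  closure gives \<open>C_k\<close> for all \<open>k\<close> by induction.\<close>

inductive separated :: "real \<Rightarrow> (real \<Rightarrow> real \<Rightarrow> real) \<Rightarrow> bool" for \<sigma> where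
  prod: "smooth_real \<theta> \<Longrightarrow> trig_poly e \<Longrightarrow> separated \<sigma> (\<lambda>t x. \<theta> t * e (x - \<sigma> * t))"
| add: "separated \<sigma> \<phi> \<Longrightarrow> separated \<sigma> \<psi> \<Longrightarrow> separated \<sigma> (\<lambda>t x. \<phi> t x + \<psi> t x)"

lemma travelling_derivatives:
  assumes "(\<theta> has_real_derivative \<theta>') (at t)" "trig_poly e"
  shows "((\<lambda>s. \<theta> s * e (x - \<sigma> * s)) has_real_derivative
      \<theta>' * e (x - \<sigma> * t) + \<theta> t * (- \<sigma> * deriv e (x - \<sigma> * t))) (at t)"
    and "((\<lambda>y. \<theta> t * e (y - \<sigma> * t)) has_real_derivative \<theta> t * deriv e (x - \<sigma> * t)) (at x)"
proof -
  have "((\<lambda>s. x - \<sigma> * s) has_real_derivative - \<sigma>) (at t)" by (auto intro!: derivative_eq_intros)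
  from DERIV_mult[OF assms(1) DERIV_chain2[OF trig_poly_deriv(2)[OF assms(2)] this]]
  show "((\<lambda>s. \<theta> s * e (x - \<sigma> * s)) has_real_derivative
      \<theta>' * e (x - \<sigma> * t) + \<theta> t * (- \<sigma> * deriv e (x - \<sigma> * t))) (at t)" by (simp add: algebra_simps)
  have "((\<lambda>y. y - \<sigma> * t) has_real_derivative 1) (at x)" by (auto intro!: derivative_eq_intros)
  from DERIV_cmult[OF DERIV_chain2[OF trig_poly_deriv(2)[OF assms(2)] this], of "\<theta> t"]
  show "((\<lambda>y. \<theta> t * e (y - \<sigma> * t)) has_real_derivative \<theta> t * deriv e (x - \<sigma> * t)) (at x)" by simp
qed

lemma separated_derivatives:
  "separated \<sigma> \<phi> \<Longrightarrow> continuous_on UNIV (\<lambda>(t, x). \<phi> t x) \<and>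
    (\<exists>\<psi>. separated \<sigma> \<psi> \<and> (\<forall>t x. ((\<lambda>s. \<phi> s x) has_real_derivative \<psi> t x) (at t))) \<and>
    (\<exists>\<psi>. separated \<sigma> \<psi> \<and> (\<forall>t x. ((\<lambda>y. \<phi> t y) has_real_derivative \<psi> t x) (at x)))"
proof (induction rule: separated.induct)
  case (prod \<theta> e)
  obtain \<theta>' where \<theta>': "smooth_real \<theta>'" "\<And>t. (\<theta> has_real_derivative \<theta>' t) (at t)"
    using smooth_real_deriv[OF prod(1)] by blast
  have "continuous_on UNIV (\<lambda>z. \<theta> (fst z) * e (snd z - \<sigma> * fst z))"
    by (intro continuous_on_mult continuous_on_compose2[OF smooth_real_continuous[OF prod(1), of UNIV]]
          continuous_on_compose2[OF trig_poly_continuous[OF prod(2), of UNIV]] continuous_intros) auto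
  moreover have "separated \<sigma> (\<lambda>t x. \<theta>' t * e (x - \<sigma> * t) + \<theta> t * (- \<sigma> * deriv e (x - \<sigma> * t)))"
  proof (rule separated.add)
    show "separated \<sigma> (\<lambda>t x. \<theta>' t * e (x - \<sigma> * t))" by (rule separated.prod[OF \<theta>'(1) prod(2)])
    have "trig_poly (\<lambda>y. - \<sigma> * deriv e y)" by (intro trig_poly.mult trig_poly.const trig_poly_deriv(1) prod(2))
    from separated.prod[OF prod(1) this]
    show "separated \<sigma> (\<lambda>t x. \<theta> t * (- \<sigma> * deriv e (x - \<sigma> * t)))" .
  qed
  moreover have "separated \<sigma> (\<lambda>t x. \<theta> t * deriv e (x - \<sigma> * t))"
    by (rule separated.prod[OF prod(1) trig_poly_deriv(1)[OF prod(2)]])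
  ultimately show ?case
    using travelling_derivatives[OF \<theta>'(2) prod(2)] unfolding split_def by blast
next
  case (add \<phi> \<psi>)
  then obtain \<phi>1 \<psi>1 \<phi>2 \<psi>2 where
    1: "separated \<sigma> \<phi>1" "\<And>t x. ((\<lambda>s. \<phi> s x) has_real_derivative \<phi>1 t x) (at t)"
      "separated \<sigma> \<psi>1" "\<And>t x. ((\<lambda>s. \<psi> s x) has_real_derivative \<psi>1 t x) (at t)" and
    2: "separated \<sigma> \<phi>2" "\<And>t x. ((\<lambda>y. \<phi> t y) has_real_derivative \<phi>2 t x) (at x)"
      "separated \<sigma> \<psi>2" "\<And>t x. ((\<lambda>y. \<psi> t y) has_real_derivative \<psi>2 t x) (at x)" by auto
  have "continuous_on UNIV (\<lambda>z. (\<lambda>(t, x). \<phi> t x) z + (\<lambda>(t, x). \<psi> t x) z)"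
    using add by (intro continuous_on_add) auto
  then show ?case
    using separated.add[OF 1(1,3)] separated.add[OF 2(1,3)] DERIV_add[OF 1(2,4)] DERIV_add[OF 2(2,4)]
    unfolding split_def by blast
qed

lemma separated_C_k: "separated \<sigma> \<phi> \<Longrightarrow> C_k k \<phi>"
proof (induction k arbitrary: \<phi>)
  case (Suc k)
  from separated_derivatives[OF Suc.prems] obtain \<phi>1 \<phi>2 where
    c: "continuous_on UNIV (\<lambda>(t, x). \<phi> t x)" and
    1: "separated \<sigma> \<phi>1" "\<And>t x. ((\<lambda>s. \<phi> s x) has_real_derivative \<phi>1 t x) (at t)" and
    2: "separated \<sigma> \<phi>2" "\<And>t x. ((\<lambda>y. \<phi> t y) has_real_derivative \<phi>2 t x) (at x)" by blast
  have "dt \<phi> = \<phi>1" unfolding dt_def by (intro ext DERIV_imp_deriv 1)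
  moreover have "dx \<phi> = \<phi>2" unfolding dx_def by (intro ext DERIV_imp_deriv 2)
  moreover have "(\<lambda>s. \<phi> s x) differentiable at t" "(\<lambda>y. \<phi> t y) differentiable at x" for t x
    using 1(2) 2(2) real_differentiable_def by blast+
  ultimately show ?case using c 1(1) 2(1) Suc.IH by simp
qed (use separated_derivatives in auto)

lemma test_function_travelling:
  assumes "smooth_real \<theta>" "trig_poly e" "0 < a" "b < T" "\<And>t. \<theta> t \<noteq> 0 \<Longrightarrow> a \<le> t \<and> t \<le> b"
  shows "test_function T (\<lambda>t x. \<theta> t * e (x - \<sigma> * t))"
  unfolding test_function_def
proof (intro conjI allI)
  show "C_k k (\<lambda>t x. \<theta> t * e (x - \<sigma> * t))" for k
    by (rule separated_C_k[OF separated.prod[OF assms(1,2)]])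
  show "periodic (\<lambda>x. \<theta> t * e (x - \<sigma> * t))" for t
    using trig_poly_periodic[OF trig_poly_shift[OF assms(2), of "- \<sigma> * t"]] by (simp add: periodic_def)
  show "\<exists>a b. 0 < a \<and> b < T \<and> (\<forall>t x. \<theta> t * e (x - \<sigma> * t) \<noteq> 0 \<longrightarrow> a \<le> t \<and> t \<le> b)"
    using assms(3-5) by auto
qed

section \<open>Solutions of the wave equation\<close>

lemma L2_norm_nonneg: "L2_norm f \<ge> 0"
proof -
  have "(LINT x:{0..2 * pi}|lebesgue. (f x)\<^sup>2) \<ge> 0"
    unfolding set_lebesgue_integral_def by (rule Bochner_Integration.integral_nonneg) simp
  then show ?thesis by (simp add: L2_norm_def)
qed

lemma H1_curve_imp_L2_curve: "C_curve T H1_torus H1_norm w \<Longrightarrow> C_curve T L2_torus L2_norm w"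
  unfolding C_curve_def
proof (intro ballI conjI)
  fix s assume w: "\<forall>s\<in>{0..T}. w s \<in> H1_torus \<and> ((\<lambda>t. H1_norm (\<lambda>x. w t x - w s x)) \<longlongrightarrow> 0) (at s within {0..T})"
    and s: "s \<in> {0..T}"
  then show "w s \<in> L2_torus" by (auto simp: H1_torus_def)
  have le: "L2_norm f \<le> H1_norm f" for f
    unfolding H1_norm_def by (rule real_le_rsqrt) simp
  show "((\<lambda>t. L2_norm (\<lambda>x. w t x - w s x)) \<longlongrightarrow> 0) (at s within {0..T})"
    by (rule tendsto_sandwich[where f = "\<lambda>_. 0" and h = "\<lambda>t. H1_norm (\<lambda>x. w t x - w s x)"])
       (use w s le L2_norm_nonneg in auto)
qed

lemma L2_norm_diff_version:
  assumes "f \<in> L2_torus" "g \<in> L2_torus" "periodic_L2 f'" "AE x in lborel. f x = f' x"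
    "periodic_L2 g'" "AE x in lborel. g x = g' x"
  shows "L2_norm (\<lambda>x. f x - g x) = sqrt (\<integral>x. (f' x - g' x)\<^sup>2 \<partial>torus)"
proof (rule L2_torus_AE_eq(2))
  show "AE x in lborel. f x - g x = f' x - g' x" using assms(4,6) by eventually_elim simp
  show "(\<lambda>x. f x - g x) \<in> borel_measurable lebesgue"
    by (intro borel_measurable_diff L2_torus_measurable assms(1,2))
  show "periodic_L2 (\<lambda>x. f' x - g' x)" by (intro periodic_L2_diff assms)
qed

text \<open>The norm is continuous along the curve. The Borel versions are chosen at each time
  separately and need not be jointly measurable; only their norms enter.\<close>

lemma L2_curve_bounded:
  assumes "C_curve T L2_torus L2_norm w"
  obtains C where "\<And>t. t \<in> {0..T} \<Longrightarrow> L2_norm (w t) \<le> C"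
proof -
  have w: "w t \<in> L2_torus" if "t \<in> {0..T}" for t using assms that by (simp add: C_curve_def)
  have "\<exists>w'. periodic_L2 w' \<and> (AE x in lborel. w t x = w' x)" if "t \<in> {0..T}" for t
    using L2_torus_version[OF w[OF that]] by blast
  then obtain w' where w': "\<And>t. t \<in> {0..T} \<Longrightarrow> periodic_L2 (w' t)" "\<And>t. t \<in> {0..T} \<Longrightarrow> AE x in lborel. w t x = w' t x"
    by metis
  have n: "L2_norm (w t) = sqrt (\<integral>x. (w' t x)\<^sup>2 \<partial>torus)" if "t \<in> {0..T}" for t
    using L2_torus_AE_eq(2)[OF w' L2_torus_measurable[OF w]] that by blast
  have tri: "L2_norm (w t) \<le> L2_norm (w s) + L2_norm (\<lambda>x. w t x - w s x)" if "s \<in> {0..T}" "t \<in> {0..T}" for s t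
    using Minkowski_L2[OF periodic_L2_sqint[OF w'(1)[OF that(1)]] periodic_L2_sqint[OF periodic_L2_diff[OF w'(1)[OF that(2)] w'(1)[OF that(1)]]]]
    unfolding n[OF that(1)] n[OF that(2)] L2_norm_diff_version[OF w w w'(1) w'(2) w'(1) w'(2), OF that(2,1,2,2,1,1)] by simp
  have sym: "L2_norm (\<lambda>x. w s x - w t x) = L2_norm (\<lambda>x. w t x - w s x)" for s t
    by (simp add: L2_norm_def power2_commute)
  have "continuous_on {0..T} (\<lambda>t. L2_norm (w t))"
    unfolding continuous_on_def
  proof
    fix s assume s: "s \<in> {0..T}"
    have "((\<lambda>t. L2_norm (w t) - L2_norm (w s)) \<longlongrightarrow> 0) (at s within {0..T})"
    proof (rule Lim_null_comparison)
      show "((\<lambda>t. L2_norm (\<lambda>x. w t x - w s x)) \<longlongrightarrow> 0) (at s within {0..T})"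
        using assms s by (simp add: C_curve_def)
      have "norm (L2_norm (w t) - L2_norm (w s)) \<le> L2_norm (\<lambda>x. w t x - w s x)" if t: "t \<in> {0..T}" for t
        using tri[OF s t] tri[OF t s] unfolding sym[of s t] by (simp add: abs_le_iff)
      then show "\<forall>\<^sub>F t in at s within {0..T}. norm (L2_norm (w t) - L2_norm (w s)) \<le> L2_norm (\<lambda>x. w t x - w s x)"
        unfolding eventually_at_filter by (intro always_eventually allI impI)
    qed
    then show "((\<lambda>t. L2_norm (w t)) \<longlongrightarrow> L2_norm (w s)) (at s within {0..T})" by (rule LIM_zero_cancel)
  qed
  then have "compact ((\<lambda>t. L2_norm (w t)) ` {0..T})" by (intro compact_continuous_image) auto
  then have "bounded ((\<lambda>t. L2_norm (w t)) ` {0..T})" by (rule compact_imp_bounded)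
  then obtain C where C: "\<forall>x\<in>(\<lambda>t. L2_norm (w t)) ` {0..T}. norm x \<le> C" unfolding bounded_iff by blast
  have "L2_norm (w t) \<le> C" if "t \<in> {0..T}" for t
    using C[rule_format, OF imageI[OF that]] by simp
  then show ?thesis by (rule that)
qed

section \<open>Pairings with travelling trigonometric polynomials\<close>

lemma trig_poly_Lipschitz:
  assumes "trig_poly p"
  obtains L where "L \<ge> 0" "\<And>x y. \<bar>p x - p y\<bar> \<le> L * \<bar>x - y\<bar>"
proof -
  obtain L where L: "L \<ge> 0" "\<And>x. \<bar>deriv p x\<bar> \<le> L" using trig_poly_bounded[OF trig_poly_deriv(1)[OF assms]] by auto
  have "norm (p x - p y) \<le> L * norm (x - y)" for x y
    by (rule field_differentiable_bound[of UNIV p "deriv p"])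
       (use L trig_poly_deriv(2)[OF assms] in auto)
  then show ?thesis using L(1) that by simp
qed

text \<open>The moment of \<open>w t\<close> against \<open>p\<close> moved to time \<open>t\<close>
  with velocity \<open>\<sigma>\<close>.\<close>

definition pairing :: "real \<Rightarrow> (real \<Rightarrow> real \<Rightarrow> real) \<Rightarrow> (real \<Rightarrow> real) \<Rightarrow> real \<Rightarrow> real" where
  "pairing \<sigma> w p t = (LINT x:{0..2 * pi}|lebesgue. w t x * p (x - \<sigma> * t))"

lemma pairing_version:
  assumes "w t \<in> L2_torus" "periodic_L2 w'" "AE x in lborel. w t x = w' x" "trig_poly p"
  shows "pairing \<sigma> w p t = (\<integral>x. w' x * p (x - \<sigma> * t) \<partial>torus)"
  unfolding pairing_def
proof (rule lebesgue_integral_torus_mult[OF assms(1) _ assms(3)])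
  note [measurable] = trig_poly_measurable[OF assms(4)]
  show "(\<lambda>x. p (x - \<sigma> * t)) \<in> borel_measurable borel" by measurable
qed (use assms in \<open>simp add: periodic_L2_def\<close>)

lemma sqint_trig_shift:
  assumes "trig_poly p"
  shows "sqint torus (\<lambda>x. p (x - c))"
proof -
  note [measurable] = trig_poly_measurable[OF assms]
  obtain B where "\<And>x. \<bar>p x\<bar> \<le> B" using trig_poly_bounded[OF assms] by auto
  then show ?thesis by (intro sqint_bounded[OF torus.finite_measure_axioms]) auto
qed

lemma integral_square_torus_le:
  assumes "sqint torus f" "\<And>x. \<bar>f x\<bar> \<le> B"
  shows "sqrt (\<integral>x. (f x)\<^sup>2 \<partial>torus) \<le> sqrt (2 * pi) * \<bar>B\<bar>"
proof -
  have "(\<integral>x. (f x)\<^sup>2 \<partial>torus) \<le> (\<integral>x. B\<^sup>2 \<partial>torus)"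
  proof (rule integral_mono)
    fix x
    show "(f x)\<^sup>2 \<le> B\<^sup>2" using assms(2)[of x] by (intro abs_le_square_iff[THEN iffD1]) linarith
  qed (use assms(1) in \<open>auto simp: sqint_def\<close>)
  also have "\<dots> = 2 * pi * B\<^sup>2" by simp
  finally have "sqrt (\<integral>x. (f x)\<^sup>2 \<partial>torus) \<le> sqrt (2 * pi * B\<^sup>2)" by (rule real_sqrt_le_mono)
  then show ?thesis by (simp add: real_sqrt_mult)
qed

text \<open>The increment splits into \<open>w t - w s\<close> against a bounded function and
  \<open>w s\<close> against the increment of the Lipschitz function \<open>p\<close>.\<close>

lemma pairing_continuous:
  assumes w: "C_curve T L2_torus L2_norm w" and p: "trig_poly p"
  shows "continuous_on {0..T} (pairing \<sigma> w p)"
  unfolding continuous_on_def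
proof
  fix s assume s: "s \<in> {0..T}"
  have wL: "w t \<in> L2_torus" if "t \<in> {0..T}" for t using w that by (simp add: C_curve_def)
  obtain ws where ws: "periodic_L2 ws" "AE x in lborel. w s x = ws x" using L2_torus_version[OF wL[OF s]] by blast
  obtain B where B: "\<And>x. \<bar>p x\<bar> \<le> B" using trig_poly_bounded[OF p] by auto
  obtain L where L: "L \<ge> 0" "\<And>x y. \<bar>p x - p y\<bar> \<le> L * \<bar>x - y\<bar>" using trig_poly_Lipschitz[OF p] by blast
  define A where "A = sqrt (\<integral>x. (ws x)\<^sup>2 \<partial>torus)"
  have A: "A \<ge> 0" by (simp add: A_def Bochner_Integration.integral_nonneg)
  define R where "R t = L2_norm (\<lambda>x. w t x - w s x) * (sqrt (2 * pi) * \<bar>B\<bar>) + A * (sqrt (2 * pi) * (L * (\<bar>\<sigma>\<bar> * \<bar>t - s\<bar>)))" for t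
  have "((\<lambda>t. pairing \<sigma> w p t - pairing \<sigma> w p s) \<longlongrightarrow> 0) (at s within {0..T})"
  proof (rule Lim_null_comparison)
    have "((\<lambda>t. L2_norm (\<lambda>x. w t x - w s x)) \<longlongrightarrow> 0) (at s within {0..T})"
      using w s by (simp add: C_curve_def)
    moreover have "((\<lambda>t. t) \<longlongrightarrow> s) (at s within {0..T})" by (rule tendsto_ident_at)
    ultimately have "(R \<longlongrightarrow> 0 * (sqrt (2 * pi) * \<bar>B\<bar>) + A * (sqrt (2 * pi) * (L * (\<bar>\<sigma>\<bar> * \<bar>s - s\<bar>)))) (at s within {0..T})"
      unfolding R_def by (intro tendsto_intros)
    then show "(R \<longlongrightarrow> 0) (at s within {0..T})" by simp
    have "\<bar>pairing \<sigma> w p t - pairing \<sigma> w p s\<bar> \<le> R t" if t: "t \<in> {0..T}" for t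
    proof -
      obtain wt where wt: "periodic_L2 wt" "AE x in lborel. w t x = wt x" using L2_torus_version[OF wL[OF t]] by blast
      let ?pt = "\<lambda>x. p (x - \<sigma> * t)" and ?ps = "\<lambda>x. p (x - \<sigma> * s)"
      note sq = periodic_L2_sqint[OF wt(1)] periodic_L2_sqint[OF ws(1)] sqint_trig_shift[OF p, of "\<sigma> * t"] sqint_trig_shift[OF p, of "\<sigma> * s"]
      have "pairing \<sigma> w p t - pairing \<sigma> w p s = (\<integral>x. wt x * ?pt x \<partial>torus) - (\<integral>x. ws x * ?ps x \<partial>torus)"
        using pairing_version[where w = w, OF wL[OF t] wt p] pairing_version[where w = w, OF wL[OF s] ws p] by simp
      also have "\<dots> = (\<integral>x. wt x * ?pt x - ws x * ?ps x \<partial>torus)"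
        using sqint_mult[OF sq(1,3)] sqint_mult[OF sq(2,4)] by simp
      also have "\<dots> = (\<integral>x. (wt x - ws x) * ?pt x + ws x * (?pt x - ?ps x) \<partial>torus)"
        by (simp add: algebra_simps)
      also have "\<dots> = (\<integral>x. (wt x - ws x) * ?pt x \<partial>torus) + (\<integral>x. ws x * (?pt x - ?ps x) \<partial>torus)"
        by (intro Bochner_Integration.integral_add sqint_mult sqint_diff sq)
      finally have "\<bar>pairing \<sigma> w p t - pairing \<sigma> w p s\<bar> \<le>
          \<bar>\<integral>x. (wt x - ws x) * ?pt x \<partial>torus\<bar> + \<bar>\<integral>x. ws x * (?pt x - ?ps x) \<partial>torus\<bar>"
        by (simp only: abs_triangle_ineq)
      also have "\<dots> \<le> sqrt (\<integral>x. (wt x - ws x)\<^sup>2 \<partial>torus) * sqrt (\<integral>x. (?pt x)\<^sup>2 \<partial>torus)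
          + A * sqrt (\<integral>x. (?pt x - ?ps x)\<^sup>2 \<partial>torus)"
        unfolding A_def by (intro add_mono Cauchy_Schwarz_abs sqint_diff sq)
      also have "\<dots> \<le> L2_norm (\<lambda>x. w t x - w s x) * (sqrt (2 * pi) * \<bar>B\<bar>) + A * (sqrt (2 * pi) * \<bar>L * (\<bar>\<sigma>\<bar> * \<bar>t - s\<bar>)\<bar>)"
      proof (intro add_mono mult_mono mult_left_mono integral_square_torus_le sq sqint_diff B A)
        show "sqrt (\<integral>x. (wt x - ws x)\<^sup>2 \<partial>torus) \<le> L2_norm (\<lambda>x. w t x - w s x)"
          using L2_norm_diff_version[OF wL[OF t] wL[OF s] wt ws] by simp
        show "\<bar>?pt x - ?ps x\<bar> \<le> L * (\<bar>\<sigma>\<bar> * \<bar>t - s\<bar>)" for x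
        proof -
          have "\<bar>x - \<sigma> * t - (x - \<sigma> * s)\<bar> = \<bar>\<sigma>\<bar> * \<bar>t - s\<bar>"
            by (simp add: abs_mult[symmetric] right_diff_distrib abs_minus_commute)
          then show ?thesis using L(2)[of "x - \<sigma> * t" "x - \<sigma> * s"] by simp
        qed
      qed (auto simp: L2_norm_nonneg Bochner_Integration.integral_nonneg)
      also have "\<dots> = R t" using L(1) by (simp add: R_def)
      finally show ?thesis .
    qed
    then show "\<forall>\<^sub>F t in at s within {0..T}. norm (pairing \<sigma> w p t - pairing \<sigma> w p s) \<le> R t"
      unfolding eventually_at_filter real_norm_def by (intro always_eventually allI impI)
  qed
  then show "(pairing \<sigma> w p \<longlongrightarrow> pairing \<sigma> w p s) (at s within {0..T})" by (rule LIM_zero_cancel)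
qed

text \<open>Joint measurability is what ties the separately given slices \<open>w t\<close> to one
  Borel function of the plane, whose sections agree with them at almost every time.\<close>

lemma plane_version:
  fixes w :: "real \<Rightarrow> real \<Rightarrow> real"
  assumes "set_borel_measurable lebesgue ({0..T} \<times> UNIV) (\<lambda>(t, x). w t x)"
  obtains W where "W \<in> borel_measurable borel" "AE z in lborel. fst z \<in> {0..T} \<longrightarrow> w (fst z) (snd z) = W z"
    "AE t in lborel. t \<in> {0..T} \<longrightarrow> (AE x in lborel. w t x = W (t, x))"
proof -
  obtain W where W: "W \<in> borel_measurable lborel"
    "AE z in lborel. indicator ({0..T} \<times> UNIV) z *\<^sub>R (\<lambda>(t, x). w t x) z = W z"
    using completion_ex_borel_measurable_real assms unfolding set_borel_measurable_def by blast
  have ae: "AE z in lborel. fst z \<in> {0..T} \<longrightarrow> w (fst z) (snd z) = W z"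
    using W(2) by eventually_elim (auto simp: indicator_def)
  then have "AE z in (lborel \<Otimes>\<^sub>M lborel). fst z \<in> {0..T} \<longrightarrow> w (fst z) (snd z) = W z" unfolding lborel_prod .
  then have "AE t in lborel. AE x in lborel. t \<in> {0..T} \<longrightarrow> w t x = W (t, x)"
    using lborel_pair.AE_pair by fastforce
  then have "AE t in lborel. t \<in> {0..T} \<longrightarrow> (AE x in lborel. w t x = W (t, x))"
    by eventually_elim auto
  then show ?thesis using that W(1) ae by simp
qed

text \<open>Reduces a weak identity tested with travelling products to an integral over time of
  pairings. Two terms occur because differentiating such a product, in the time derivative as in the
  wave operator, leaves one term with \<open>e\<close> and one with \<open>deriv e\<close>.\<close>

lemma curve_Fubini:
  assumes w: "C_curve T L2_torus L2_norm w"
    and meas: "set_borel_measurable lebesgue ({0..T} \<times> UNIV) (\<lambda>(t, x). w t x)"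
    and \<alpha>: "continuous_on UNIV \<alpha>" and \<beta>: "continuous_on UNIV \<beta>" and p: "trig_poly p" and q: "trig_poly q"
  shows "set_lebesgue_integral lebesgue ({0..T} \<times> {0..2 * pi})
      (\<lambda>(t, x). w t x * (\<alpha> t * p (x - \<sigma> * t) + \<beta> t * q (x - \<sigma> * t))) =
    (LINT t:{0..T}|lborel. \<alpha> t * pairing \<sigma> w p t + \<beta> t * pairing \<sigma> w q t)"
proof -
  obtain W where [measurable]: "W \<in> borel_measurable borel"
    and ae: "AE z in lborel. fst z \<in> {0..T} \<longrightarrow> w (fst z) (snd z) = W z"
    and sec: "AE t in lborel. t \<in> {0..T} \<longrightarrow> (AE x in lborel. w t x = W (t, x))"
    using plane_version[OF meas] by blast
  note [measurable] = trig_poly_measurable[OF p] trig_poly_measurable[OF q]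
    borel_measurable_continuous_onI[OF \<alpha>] borel_measurable_continuous_onI[OF \<beta>]
  let ?J = "{0..T} \<times> {0..2 * pi} :: (real \<times> real) set"
  have [measurable]: "?J \<in> sets borel" by (intro borel_closed closed_Times) auto
  define k where "k z = \<alpha> (fst z) * p (snd z - \<sigma> * fst z) + \<beta> (fst z) * q (snd z - \<sigma> * fst z)" for z
  have [measurable]: "k \<in> borel_measurable borel" unfolding k_def by measurable
  obtain B1 B2 where B12: "B1 \<ge> 0" "B2 \<ge> 0" "\<And>x. \<bar>p x\<bar> \<le> B1" "\<And>x. \<bar>q x\<bar> \<le> B2"
    using trig_poly_bounded[OF p] trig_poly_bounded[OF q] by auto
  have "compact (\<alpha> ` {0..T})" "compact (\<beta> ` {0..T})"
    using \<alpha> \<beta> by (auto intro!: compact_continuous_image intro: continuous_on_subset)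
  then obtain A1 A2 where A12: "\<And>t. t \<in> {0..T} \<Longrightarrow> \<bar>\<alpha> t\<bar> \<le> A1" "\<And>t. t \<in> {0..T} \<Longrightarrow> \<bar>\<beta> t\<bar> \<le> A2"
    using compact_imp_bounded by (metis (no_types, lifting) bounded_iff image_eqI real_norm_def)
  define B where "B = \<bar>A1\<bar> * B1 + \<bar>A2\<bar> * B2"
  have kB: "\<bar>k (t, x)\<bar> \<le> B" if "t \<in> {0..T}" for t x
  proof -
    have "\<bar>k (t, x)\<bar> \<le> \<bar>\<alpha> t\<bar> * \<bar>p (x - \<sigma> * t)\<bar> + \<bar>\<beta> t\<bar> * \<bar>q (x - \<sigma> * t)\<bar>"
      unfolding k_def abs_mult[symmetric] by (simp add: abs_triangle_ineq)
    also have "\<dots> \<le> \<bar>A1\<bar> * B1 + \<bar>A2\<bar> * B2"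
      using A12[OF that] B12 by (intro add_mono mult_mono) auto
    finally show ?thesis by (simp add: B_def)
  qed
  have B: "B \<ge> 0" using B12 by (simp add: B_def)
  obtain C where C: "\<And>t. t \<in> {0..T} \<Longrightarrow> L2_norm (w t) \<le> C" using L2_curve_bounded[OF w] by blast
  have wL: "w t \<in> L2_torus" if "t \<in> {0..T}" for t using w that by (simp add: C_curve_def)
  define K where "K z = indicator ?J z * (W z * k z)" for z
  have [measurable]: "K \<in> borel_measurable borel" unfolding K_def by measurable
  have K_inner: "K (t, x) = indicator {0..T} t * (indicator {0..2 * pi} x * (W (t, x) * k (t, x)))" for t x
    by (simp add: K_def indicator_times)
  have sect: "sqint torus (\<lambda>x. W (t, x)) \<and> (\<integral>x. (W (t, x))\<^sup>2 \<partial>torus) \<le> C\<^sup>2 \<and>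
      (\<integral>x. W (t, x) * k (t, x) \<partial>torus) = \<alpha> t * pairing \<sigma> w p t + \<beta> t * pairing \<sigma> w q t"
    if t: "t \<in> {0..T}" and tx: "AE x in lborel. w t x = W (t, x)" for t
  proof -
    obtain w' where w': "periodic_L2 w'" "AE x in lborel. w t x = w' x" using L2_torus_version[OF wL[OF t]] by blast
    have "AE x in lborel. w' x = W (t, x)" using tx w'(2) by eventually_elim simp
    then have eq: "AE x in torus. w' x = W (t, x)" unfolding AE_torus by eventually_elim simp
    have [measurable]: "w' \<in> borel_measurable borel" using w'(1) by (rule periodic_L2_measurable)
    have sq: "sqint torus (\<lambda>x. W (t, x))"
      by (rule sqint_cong_AE[OF periodic_L2_sqint[OF w'(1)] _ eq]) measurable
    have "(\<integral>x. (W (t, x))\<^sup>2 \<partial>torus) = (\<integral>x. (w' x)\<^sup>2 \<partial>torus)"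
      by (rule integral_cong_AE) (use eq in auto)
    also have "\<dots> = (L2_norm (w t))\<^sup>2" using L2_torus_AE_eq(1)[OF w' L2_torus_measurable[OF wL[OF t]]] by simp
    also have "\<dots> \<le> C\<^sup>2" using C[OF t] L2_norm_nonneg by (intro power_mono)
    finally have le: "(\<integral>x. (W (t, x))\<^sup>2 \<partial>torus) \<le> C\<^sup>2" .
    have pr: "pairing \<sigma> w r t = (\<integral>x. W (t, x) * r (x - \<sigma> * t) \<partial>torus)" if r: "trig_poly r" for r
    proof -
      note [measurable] = trig_poly_measurable[OF r]
      show ?thesis
        unfolding pairing_version[where w = w, OF wL[OF t] w' r] by (rule integral_cong_AE) (use eq in auto)
    qed
    have "(\<integral>x. W (t, x) * k (t, x) \<partial>torus) =
      (\<integral>x. \<alpha> t * (W (t, x) * p (x - \<sigma> * t)) + \<beta> t * (W (t, x) * q (x - \<sigma> * t)) \<partial>torus)"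
      by (simp add: k_def algebra_simps)
    also have "\<dots> = \<alpha> t * pairing \<sigma> w p t + \<beta> t * pairing \<sigma> w q t"
      using sqint_mult[OF sq sqint_trig_shift[OF p, of "\<sigma> * t"]] sqint_mult[OF sq sqint_trig_shift[OF q, of "\<sigma> * t"]]
      by (simp add: pr[OF p] pr[OF q])
    finally show ?thesis using sq le by simp
  qed
  have [measurable]: "K \<in> borel_measurable (lborel \<Otimes>\<^sub>M lborel)"
    unfolding lborel_prod by measurable
  have K_int: "integrable (lborel \<Otimes>\<^sub>M lborel) K"
  proof (rule integrableI_bounded)
    have "(\<integral>\<^sup>+z. ennreal (norm (K z)) \<partial>(lborel \<Otimes>\<^sub>M lborel)) = (\<integral>\<^sup>+t. \<integral>\<^sup>+x. ennreal (norm (K (t, x))) \<partial>lborel \<partial>lborel)"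
      by (rule lborel.nn_integral_fst[symmetric]) measurable
    \<comment> \<open>Integrability over the strip: \<open>\<bar>W\<bar> \<le> 1 + W\<^sup>2\<close>
      together with the bound \<open>C\<close> on the L2 norms, uniform in time.\<close>
    also have "\<dots> \<le> (\<integral>\<^sup>+t. ennreal (B * (2 * pi + C\<^sup>2)) * indicator {0..T} t \<partial>lborel)"
    proof (rule nn_integral_mono_AE, use sec in eventually_elim)
      case (elim t)
      show ?case
      proof (cases "t \<in> {0..T}")
        case True
        then have s: "sqint torus (\<lambda>x. W (t, x))" "(\<integral>x. (W (t, x))\<^sup>2 \<partial>torus) \<le> C\<^sup>2" using sect elim by auto
        then have i: "integrable torus (\<lambda>x. B * (1 + (W (t, x))\<^sup>2))" by (simp add: sqint_def)
        have "(\<integral>\<^sup>+x. ennreal (norm (K (t, x))) \<partial>lborel) = (\<integral>\<^sup>+x. ennreal (norm (W (t, x) * k (t, x))) \<partial>torus)"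
          using True by (subst nn_integral_torus) (auto intro!: nn_integral_cong simp: K_inner indicator_def)
        also have "\<dots> \<le> (\<integral>\<^sup>+x. ennreal (B * (1 + (W (t, x))\<^sup>2)) \<partial>torus)"
        proof (intro nn_integral_mono ennreal_leI)
          fix x
          have "\<bar>W (t, x)\<bar> \<le> 1 + (W (t, x))\<^sup>2"
            using two_abs_mult_le[of "W (t, x)" 1] abs_ge_zero[of "W (t, x)"] by simp
          then have "\<bar>k (t, x)\<bar> * \<bar>W (t, x)\<bar> \<le> B * (1 + (W (t, x))\<^sup>2)"
            using kB[OF True] B by (intro mult_mono) auto
          then show "norm (W (t, x) * k (t, x)) \<le> B * (1 + (W (t, x))\<^sup>2)" by (simp add: abs_mult mult.commute)
        qed
        also have "\<dots> = ennreal (\<integral>x. B * (1 + (W (t, x))\<^sup>2) \<partial>torus)"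
          using i B by (intro nn_integral_eq_integral) auto
        also have "(\<integral>x. B * (1 + (W (t, x))\<^sup>2) \<partial>torus) = B * (2 * pi + (\<integral>x. (W (t, x))\<^sup>2 \<partial>torus))"
          using s(1) by (simp add: sqint_def)
        also have "ennreal \<dots> \<le> ennreal (B * (2 * pi + C\<^sup>2))"
          using s(2) B by (intro ennreal_leI mult_left_mono) auto
        finally show ?thesis using True by simp
      next
        case False
        then show ?thesis by (simp add: K_inner)
      qed
    qed
    also have "\<dots> < \<infinity>"
      using emeasure_lborel_Icc_eq[of 0 T] by (simp add: nn_integral_cmult_indicator ennreal_mult_less_top)
    finally show "(\<integral>\<^sup>+z. ennreal (norm (K z)) \<partial>(lborel \<Otimes>\<^sub>M lborel)) < \<infinity>" .
  qed measurable
  have "set_lebesgue_integral lebesgue ?J (\<lambda>(t, x). w t x * (\<alpha> t * p (x - \<sigma> * t) + \<beta> t * q (x - \<sigma> * t)))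
      = (\<integral>z. K z \<partial>lebesgue)"
    unfolding set_lebesgue_integral_def
  proof (rule integral_cong_AE)
    show "K \<in> borel_measurable lebesgue" by (rule measurable_completion) simp
    show "AE z in lebesgue. indicator ?J z *\<^sub>R (case z of (t, x) \<Rightarrow> w t x * (\<alpha> t * p (x - \<sigma> * t) + \<beta> t * q (x - \<sigma> * t))) = K z"
      using AE_completion[OF ae] by eventually_elim (auto simp: K_def k_def indicator_def)
    have kl: "(\<lambda>z. indicator ?J z * k z) \<in> borel_measurable lebesgue" by (rule measurable_completion) simp
    have "(\<lambda>z. (indicator ({0..T} \<times> UNIV) z *\<^sub>R (case z of (t, x) \<Rightarrow> w t x)) * (indicator ?J z * k z)) \<in> borel_measurable lebesgue"
      using meas unfolding set_borel_measurable_def by (rule borel_measurable_times[OF _ kl])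
    moreover have "(\<lambda>z. (indicator ({0..T} \<times> UNIV) z *\<^sub>R (case z of (t, x) \<Rightarrow> w t x)) * (indicator ?J z * k z)) =
      (\<lambda>z. indicator ?J z *\<^sub>R (case z of (t, x) \<Rightarrow> w t x * (\<alpha> t * p (x - \<sigma> * t) + \<beta> t * q (x - \<sigma> * t))))"
      by (auto simp: fun_eq_iff k_def indicator_def)
    ultimately show "(\<lambda>z. indicator ?J z *\<^sub>R (case z of (t, x) \<Rightarrow> w t x * (\<alpha> t * p (x - \<sigma> * t) + \<beta> t * q (x - \<sigma> * t)))) \<in> borel_measurable lebesgue" by simp
  qed
  also have "\<dots> = (\<integral>z. K z \<partial>lborel)" by (rule integral_completion) simp
  also have "\<dots> = (\<integral>t. \<integral>x. K (t, x) \<partial>lborel \<partial>lborel)"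
    using lborel_pair.integral_fst'[OF K_int] by (simp add: lborel_prod)
  also have "\<dots> = (\<integral>t. indicator {0..T} t *\<^sub>R (\<alpha> t * pairing \<sigma> w p t + \<beta> t * pairing \<sigma> w q t) \<partial>lborel)"
  proof (rule integral_cong_AE)
    show "(\<lambda>t. indicator {0..T} t *\<^sub>R (\<alpha> t * pairing \<sigma> w p t + \<beta> t * pairing \<sigma> w q t)) \<in> borel_measurable lborel"
    proof -
      have "continuous_on {0..T} (\<lambda>t. \<alpha> t * pairing \<sigma> w p t + \<beta> t * pairing \<sigma> w q t)"
        by (intro continuous_on_add continuous_on_mult pairing_continuous w p q
            continuous_on_subset[OF \<alpha>] continuous_on_subset[OF \<beta>]) auto
      from borel_integrable_atLeastAtMost'[OF this] show ?thesis
        unfolding set_integrable_def by (rule borel_measurable_integrable)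
    qed
    show "AE t in lborel. (\<integral>x. K (t, x) \<partial>lborel) = indicator {0..T} t *\<^sub>R (\<alpha> t * pairing \<sigma> w p t + \<beta> t * pairing \<sigma> w q t)"
      using sec
    proof eventually_elim
      case (elim t)
      have "(\<integral>x. K (t, x) \<partial>lborel) = indicator {0..T} t * (\<integral>x. W (t, x) * k (t, x) \<partial>torus)"
        by (simp add: K_inner integral_torus set_lebesgue_integral_def)
      then show ?case using sect elim by (cases "t \<in> {0..T}") auto
    qed
  qed measurable
  finally show ?thesis by (simp add: set_lebesgue_integral_def)
qed

lemma derivative_zero_outside_support:
  assumes "\<And>x. (\<theta> has_real_derivative \<theta>' x) (at x)" "\<And>t. \<theta> t \<noteq> 0 \<Longrightarrow> a \<le> t \<and> t \<le> b" "\<theta>' t \<noteq> 0"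
  shows "a \<le> t \<and> t \<le> b"
proof (rule ccontr)
  assume "\<not> ?thesis"
  then have t: "t \<in> - {a..b}" by auto
  have "((\<lambda>_. 0) has_real_derivative 0) (at t)" by simp
  then have "(\<theta> has_real_derivative 0) (at t)"
    by (rule has_field_derivative_transform_within_open[of _ _ _ "- {a..b}"]) (use t assms(2) in auto)
  then show False using assms(1)[of t] assms(3) DERIV_unique by blast
qed

lemma travelling_dt:
  assumes "\<And>x. (\<theta> has_real_derivative \<theta>' x) (at x)" "trig_poly e"
  shows "dt (\<lambda>t x. \<theta> t * e (x - \<sigma> * t)) =
    (\<lambda>t x. \<theta>' t * e (x - \<sigma> * t) + \<theta> t * (- \<sigma> * deriv e (x - \<sigma> * t)))"
  unfolding dt_def by (intro ext DERIV_imp_deriv travelling_derivatives(1) assms)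

lemma travelling_dx:
  assumes "trig_poly e"
  shows "dx (\<lambda>t x. \<theta> t * e (x - \<sigma> * t)) = (\<lambda>t x. \<theta> t * deriv e (x - \<sigma> * t))"
  unfolding dx_def
proof (intro ext DERIV_imp_deriv)
  fix t x :: real
  have "((\<lambda>s. \<theta> t) has_real_derivative 0) (at t)" by simp
  from travelling_derivatives(2)[OF this assms, of \<sigma> x]
  show "((\<lambda>y. \<theta> t * e (y - \<sigma> * t)) has_real_derivative \<theta> t * deriv e (x - \<sigma> * t)) (at x)" .
qed

text \<open>Along a characteristic of speed \<open>\<sigma>\<^sup>2 = 1\<close> the terms with the
  second derivative of \<open>e\<close> cancel; what remains is of first order in
  \<open>e\<close>.\<close>

lemma travelling_wave_operator:
  assumes "\<And>x. (\<theta> has_real_derivative \<theta>' x) (at x)" "\<And>x. (\<theta>' has_real_derivative \<theta>'' x) (at x)"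
    and e: "trig_poly e" and \<sigma>: "\<sigma>\<^sup>2 = 1"
  defines "\<phi> \<equiv> \<lambda>t x. \<theta> t * e (x - \<sigma> * t)"
  shows "dt (dt \<phi>) t x - dx (dx \<phi>) t x =
    \<theta>'' t * e (x - \<sigma> * t) + (- 2 * \<sigma> * \<theta>' t) * deriv e (x - \<sigma> * t)"
proof -
  have de: "trig_poly (deriv e)" by (rule trig_poly_deriv(1)[OF e])
  have e2: "trig_poly (\<lambda>y. - \<sigma> * deriv e y)" by (intro trig_poly.mult trig_poly.const de)
  have de2: "deriv (\<lambda>y. - \<sigma> * deriv e y) = (\<lambda>y. - \<sigma> * deriv (deriv e) y)"
    by (intro ext DERIV_imp_deriv DERIV_cmult trig_poly_deriv(2) de)
  have "dt \<phi> = (\<lambda>t x. \<theta>' t * e (x - \<sigma> * t) + \<theta> t * (- \<sigma> * deriv e (x - \<sigma> * t)))"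
    unfolding \<phi>_def by (rule travelling_dt[OF assms(1) e])
  then have "dt (dt \<phi>) t x = (\<theta>'' t * e (x - \<sigma> * t) + \<theta>' t * (- \<sigma> * deriv e (x - \<sigma> * t))) +
      (\<theta>' t * (- \<sigma> * deriv e (x - \<sigma> * t)) + \<theta> t * (- \<sigma> * (- \<sigma> * deriv (deriv e) (x - \<sigma> * t))))"
  proof -
    assume eq: "dt \<phi> = (\<lambda>t x. \<theta>' t * e (x - \<sigma> * t) + \<theta> t * (- \<sigma> * deriv e (x - \<sigma> * t)))"
    note h = DERIV_add[OF travelling_derivatives(1)[where x = x and \<sigma> = \<sigma> and t = t, OF assms(2) e]
        travelling_derivatives(1)[where x = x and \<sigma> = \<sigma> and t = t, OF assms(1) e2], unfolded de2]
    have "dt (dt \<phi>) t x = deriv (\<lambda>s. dt \<phi> s x) t" by (subst dt_def) (rule refl)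
    also have "\<dots> = deriv (\<lambda>s. \<theta>' s * e (x - \<sigma> * s) + \<theta> s * (- \<sigma> * deriv e (x - \<sigma> * s))) t"
      unfolding eq ..
    finally show ?thesis unfolding DERIV_imp_deriv[OF h] .
  qed
  moreover have "dx (dx \<phi>) t x = \<theta> t * deriv (deriv e) (x - \<sigma> * t)"
    unfolding \<phi>_def by (simp add: travelling_dx e de)
  moreover have "\<theta> t * (- \<sigma> * (- \<sigma> * c)) = \<theta> t * c" for c
    using \<sigma> by (simp add: power2_eq_square mult.assoc[symmetric])
  ultimately show ?thesis by simp
qed

text \<open>Formally the quantity is the integral of \<open>v - \<sigma>\<partial>\<^sub>x u\<close>
  against \<open>e (x - \<sigma> * t)\<close>, with the space derivative moved to \<open>e\<close>.
  Testing the wave equation with \<open>\<theta> t * e (x - \<sigma> * t)\<close>, and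
  \<open>v = \<partial>\<^sub>t u\<close> with \<open>\<theta>' t * e (x - \<sigma> * t)\<close>,
  shows that its derivative in time vanishes weakly.\<close>

lemma pairing_conserved:
  assumes T: "T > 0" and sol: "wave_solution T u0 u1 u v" and e: "trig_poly e" and \<sigma>: "\<sigma>\<^sup>2 = 1" and t: "t \<in> {0..T}"
  shows "pairing \<sigma> v e t + \<sigma> * pairing \<sigma> u (deriv e) t = pairing \<sigma> v e 0 + \<sigma> * pairing \<sigma> u (deriv e) 0"
proof -
  have cu: "C_curve T L2_torus L2_norm u" and cv: "C_curve T L2_torus L2_norm v"
    and mu: "set_borel_measurable lebesgue ({0..T} \<times> UNIV) (\<lambda>(t, x). u t x)"
    and mv: "set_borel_measurable lebesgue ({0..T} \<times> UNIV) (\<lambda>(t, x). v t x)"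
    and E1: "\<And>\<phi>. test_function T \<phi> \<Longrightarrow>
        set_lebesgue_integral lebesgue ({0..T} \<times> {0..2 * pi}) (\<lambda>(t, x). u t x * dt \<phi> t x) =
        - set_lebesgue_integral lebesgue ({0..T} \<times> {0..2 * pi}) (\<lambda>(t, x). v t x * \<phi> t x)"
    and E2: "\<And>\<phi>. test_function T \<phi> \<Longrightarrow> set_lebesgue_integral lebesgue ({0..T} \<times> {0..2 * pi})
          (\<lambda>(t, x). u t x * (dt (dt \<phi>) t x - dx (dx \<phi>) t x)) = 0"
    using sol H1_curve_imp_L2_curve unfolding wave_solution_def by blast+
  have de: "trig_poly (deriv e)" by (rule trig_poly_deriv(1)[OF e])
  let ?Z = "\<lambda>t. pairing \<sigma> v e t + \<sigma> * pairing \<sigma> u (deriv e) t"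
  have contU: "continuous_on {0..T} (pairing \<sigma> u q)" and contV: "continuous_on {0..T} (pairing \<sigma> v q)"
    if "trig_poly q" for q by (rule pairing_continuous[OF cu that] pairing_continuous[OF cv that])+
  show ?thesis
  proof (rule constant_of_weak_derivative_zero[OF T, where Z = ?Z])
    show "continuous_on {0..T} ?Z" by (intro continuous_intros contU contV e de)
    fix \<theta> \<theta>' a b
    assume \<theta>: "smooth_real \<theta>" "smooth_real \<theta>'" "\<And>x. (\<theta> has_real_derivative \<theta>' x) (at x)"
      and ab: "0 < a" "b < T" and supp: "\<And>t. \<theta> t \<noteq> 0 \<Longrightarrow> a \<le> t \<and> t \<le> b"
    obtain \<theta>'' where \<theta>'': "smooth_real \<theta>''" "\<And>x. (\<theta>' has_real_derivative \<theta>'' x) (at x)"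
      using smooth_real_deriv[OF \<theta>(2)] by blast
    have supp': "a \<le> t \<and> t \<le> b" if "\<theta>' t \<noteq> 0" for t
      by (rule derivative_zero_outside_support[OF \<theta>(3) supp that])
    note c = smooth_real_continuous[OF \<theta>(2), of UNIV] smooth_real_continuous[OF \<theta>''(1), of UNIV]
    have int: "set_integrable lborel {0..T} (\<lambda>t. f t * g t)"
      if "continuous_on UNIV f" "continuous_on {0..T} g" for f g :: "real \<Rightarrow> real"
      by (intro borel_integrable_atLeastAtMost' continuous_on_mult continuous_on_subset[OF that(1)] that(2)) auto
    note iA = int[OF c(2) contU[OF e]] and iB = int[OF c(1) contU[OF de]] and iC = int[OF c(1) contV[OF e]]
    define A B C where "A = (LINT t:{0..T}|lborel. \<theta>'' t * pairing \<sigma> u e t)"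
      and "B = (LINT t:{0..T}|lborel. \<theta>' t * pairing \<sigma> u (deriv e) t)"
      and "C = (LINT t:{0..T}|lborel. \<theta>' t * pairing \<sigma> v e t)"
    have "set_lebesgue_integral lebesgue ({0..T} \<times> {0..2 * pi})
       (\<lambda>(t, x). u t x * (\<theta>'' t * e (x - \<sigma> * t) + (- 2 * \<sigma> * \<theta>' t) * deriv e (x - \<sigma> * t))) = 0"
      using E2[OF test_function_travelling[OF \<theta>(1) e ab supp, of \<sigma>]]
      unfolding travelling_wave_operator[OF \<theta>(3) \<theta>''(2) e \<sigma>] .
    then have "(LINT t:{0..T}|lborel. \<theta>'' t * pairing \<sigma> u e t + (- 2 * \<sigma> * \<theta>' t) * pairing \<sigma> u (deriv e) t) = 0"
      by (subst (asm) curve_Fubini[OF cu mu]) (use c e de in \<open>auto intro!: continuous_intros\<close>)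
    moreover have "(LINT t:{0..T}|lborel. \<theta>'' t * pairing \<sigma> u e t + (- 2 * \<sigma> * \<theta>' t) * pairing \<sigma> u (deriv e) t) =
      (LINT t:{0..T}|lborel. \<theta>'' t * pairing \<sigma> u e t + (- 2 * \<sigma>) * (\<theta>' t * pairing \<sigma> u (deriv e) t))"
      by (simp only: mult.assoc)
    ultimately have 1: "A + (- 2 * \<sigma>) * B = 0"
      using iA iB by (simp add: A_def B_def)
    have "set_lebesgue_integral lebesgue ({0..T} \<times> {0..2 * pi})
        (\<lambda>(t, x). u t x * (\<theta>'' t * e (x - \<sigma> * t) + (- \<sigma> * \<theta>' t) * deriv e (x - \<sigma> * t))) =
      - set_lebesgue_integral lebesgue ({0..T} \<times> {0..2 * pi})
        (\<lambda>(t, x). v t x * (\<theta>' t * e (x - \<sigma> * t) + 0 * e (x - \<sigma> * t)))"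
      using E1[OF test_function_travelling[OF \<theta>(2) e ab supp', of \<sigma>]]
      unfolding travelling_dt[OF \<theta>''(2) e] by (simp add: mult_ac)
    then have "(LINT t:{0..T}|lborel. \<theta>'' t * pairing \<sigma> u e t + (- \<sigma> * \<theta>' t) * pairing \<sigma> u (deriv e) t) =
       - (LINT t:{0..T}|lborel. \<theta>' t * pairing \<sigma> v e t + 0 * pairing \<sigma> v e t)"
      using curve_Fubini[OF cu mu _ _ e de, of \<theta>'' "\<lambda>t. - \<sigma> * \<theta>' t" \<sigma>]
        curve_Fubini[OF cv mv _ _ e e, of \<theta>' "\<lambda>t. 0" \<sigma>] c by (simp add: continuous_on_minus continuous_on_mult)
    moreover have "(LINT t:{0..T}|lborel. \<theta>'' t * pairing \<sigma> u e t + (- \<sigma> * \<theta>' t) * pairing \<sigma> u (deriv e) t) =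
      (LINT t:{0..T}|lborel. \<theta>'' t * pairing \<sigma> u e t + (- \<sigma>) * (\<theta>' t * pairing \<sigma> u (deriv e) t))"
      by (simp only: mult.assoc)
    ultimately have 2: "A + (- \<sigma>) * B = - C"
      using iA iB by (simp add: A_def B_def C_def)
    have "(LINT t:{0..T}|lborel. ?Z t * \<theta>' t) = (LINT t:{0..T}|lborel. \<theta>' t * pairing \<sigma> v e t + \<sigma> * (\<theta>' t * pairing \<sigma> u (deriv e) t))"
      by (simp add: algebra_simps)
    also have "\<dots> = C + \<sigma> * B" using iB iC by (simp add: B_def C_def)
    \<comment> \<open>The two tests say \<open>A = 2 * \<sigma> * B\<close> and
      \<open>A = \<sigma> * B - C\<close>; eliminating \<open>A\<close> gives
      \<open>C + \<sigma> * B = 0\<close>.\<close>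
    also have "\<dots> = 0" using 1 2 by (simp add: mult.commute)
    finally show "(LINT t:{0..T}|lborel. ?Z t * \<theta>' t) = 0" .
  qed (fact t)
qed

lemma pairing_weak_deriv:
  assumes "w t \<in> H1_torus" "periodic_L2 w'" "AE x in lborel. weak_deriv (w t) x = w' x" "trig_poly e"
  shows "pairing \<sigma> w (deriv e) t = - (\<integral>x. w' x * e (x - \<sigma> * t) \<partial>torus)"
proof -
  have wd: "has_weak_deriv (w t) (weak_deriv (w t))" by (rule weak_deriv_has[OF assms(1)])
  have sh: "trig_poly (\<lambda>x. e (x - \<sigma> * t))" using trig_poly_shift[OF assms(4), of "- \<sigma> * t"] by simp
  note [measurable] = trig_poly_measurable[OF sh]
  have "deriv (\<lambda>x. e (x - \<sigma> * t)) = (\<lambda>x. deriv e (x - \<sigma> * t))"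
  proof (intro ext DERIV_imp_deriv)
    fix x
    have "((\<lambda>s. 1) has_real_derivative 0) (at t)" by simp
    from travelling_derivatives(2)[OF this assms(4), of \<sigma> x]
    show "((\<lambda>y. e (y - \<sigma> * t)) has_real_derivative deriv e (x - \<sigma> * t)) (at x)" by simp
  qed
  then have "pairing \<sigma> w (deriv e) t = (LINT x:{0..2 * pi}|lebesgue. w t x * deriv (\<lambda>x. e (x - \<sigma> * t)) x)"
    by (simp add: pairing_def)
  also have "\<dots> = - (LINT x:{0..2 * pi}|lebesgue. weak_deriv (w t) x * e (x - \<sigma> * t))"
    using wd trig_poly_smooth_torus[OF sh] by (simp add: has_weak_deriv_def)
  also have "(LINT x:{0..2 * pi}|lebesgue. weak_deriv (w t) x * e (x - \<sigma> * t)) = (\<integral>x. w' x * e (x - \<sigma> * t) \<partial>torus)"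
    using wd assms(2,3) by (intro lebesgue_integral_torus_mult) (auto simp: has_weak_deriv_def periodic_L2_def)
  finally show ?thesis .
qed

lemma periodic_L2_shift:
  assumes "periodic_L2 f"
  shows "periodic_L2 (\<lambda>x. f (x + s))"
proof -
  note [measurable] = periodic_L2_measurable[OF assms]
  have f: "f (x + 2 * pi) = f x" for x using assms by (simp add: periodic_L2_def periodic_def)
  have "integrable torus (\<lambda>x. (f (x + s))\<^sup>2)"
    using assms by (intro integral_torus_shift(1)) (auto simp: periodic_L2_def periodic_def)
  moreover have "f (x + 2 * pi + s) = f (x + s)" for x using f[of "x + s"] by (simp add: add_ac)
  ultimately show ?thesis by (simp add: periodic_L2_def periodic_def)
qed

lemma integral_torus_mult_trig_shift:
  assumes "periodic_L2 b" "trig_poly e"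
  shows "(\<integral>x. b x * e x \<partial>torus) = (\<integral>x. b (x - s) * e (x - s) \<partial>torus)"
proof -
  note [measurable] = periodic_L2_measurable[OF assms(1)] trig_poly_measurable[OF assms(2)]
  have "integrable torus (\<lambda>x. b x * e x)"
    using sqint_mult[OF periodic_L2_sqint[OF assms(1)] sqint_trig_shift[OF assms(2), of 0]] by simp
  moreover have "periodic (\<lambda>x. b x * e x)"
    using assms trig_poly_periodic[OF assms(2)] by (simp add: periodic_L2_def periodic_def)
  ultimately show ?thesis
    using integral_torus_shift(2)[of "\<lambda>x. b x * e x" "- s"] by simp
qed

lemma periodic_AE_torus_imp_lborel:
  assumes f: "periodic_L2 f" and g: "periodic_L2 g" and eq: "AE x in torus. f x = g x"
  shows "AE x in lborel. f x = g x"
proof -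
  note [measurable] = periodic_L2_measurable[OF f] periodic_L2_measurable[OF g]
  have "AE x in lborel. f (wrap x) = g (wrap x)"
    by (rule AE_wrap) (use eq in \<open>auto simp: AE_torus\<close>)
  then show ?thesis
    using periodic_wrap[of f] periodic_wrap[of g] f g by (simp add: periodic_L2_def periodic_def)
qed

text \<open>\<open>v - \<sigma>\<partial>\<^sub>x u\<close> is transported along the characteristics \<open>x - \<sigma>t = const\<close>; adding the two signs
  gives d'Alembert's formula for \<open>v\<close>.\<close>

lemma characteristic_transport:
  assumes T: "T > 0" and sol: "wave_solution T u0 u1 u v" and u0: "u0 \<in> H1_torus" and \<sigma>: "\<sigma>\<^sup>2 = 1" and t: "t \<in> {0..T}"
    and d: "periodic_L2 d" "AE x in lborel. weak_deriv u0 x = d x"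
    and c: "periodic_L2 c" "AE x in lborel. u1 x = c x"
    and dt: "periodic_L2 d'" "AE x in lborel. weak_deriv (u t) x = d' x"
    and ct: "periodic_L2 c'" "AE x in lborel. v t x = c' x"
  shows "AE x in lborel. c' x - \<sigma> * d' x = c (x - \<sigma> * t) - \<sigma> * d (x - \<sigma> * t)"
proof (rule periodic_AE_torus_imp_lborel)
  have uH: "u s \<in> H1_torus" and vL: "v s \<in> L2_torus" if "s \<in> {0..T}" for s
    using sol that by (auto simp: wave_solution_def C_curve_def)
  have init: "AE x in lebesgue. u 0 x = u0 x" "AE x in lebesgue. v 0 x = u1 x"
    using sol by (auto simp: wave_solution_def)
  have zero: "0 \<in> {0..T}" using T by simp
  show a: "periodic_L2 (\<lambda>x. c' x - \<sigma> * d' x)" by (intro periodic_L2_diff periodic_L2_cmult dt ct)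
  have b0: "periodic_L2 (\<lambda>x. c x - \<sigma> * d x)" by (intro periodic_L2_diff periodic_L2_cmult c d)
  show b: "periodic_L2 (\<lambda>x. c (x - \<sigma> * t) - \<sigma> * d (x - \<sigma> * t))"
    using periodic_L2_shift[OF b0, of "- (\<sigma> * t)"] by simp
  have "AE x in torus. (c' x - \<sigma> * d' x) - (c (x - \<sigma> * t) - \<sigma> * d (x - \<sigma> * t)) = 0"
  proof (rule trig_poly_orthogonal_zero)
    show "sqint torus (\<lambda>x. (c' x - \<sigma> * d' x) - (c (x - \<sigma> * t) - \<sigma> * d (x - \<sigma> * t)))"
      by (rule periodic_L2_sqint[OF periodic_L2_diff[OF a b]])
    fix p assume p: "trig_poly p"
    \<comment> \<open>Shifted back so that the travelling test function arrives at the prescribed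
      \<open>p\<close> at time \<open>t\<close>.\<close>
    define e where "e x = p (x + \<sigma> * t)" for x
    have e: "trig_poly e" unfolding e_def by (rule trig_poly_shift[OF p])
    have ep: "e (x - \<sigma> * t) = p x" for x by (simp add: e_def)
    note sqe = sqint_trig_shift[OF e, of 0, simplified] and sqp = sqint_trig_shift[OF p, of 0, simplified]
    have v0: "AE x in lborel. v 0 x = c x"
    proof -
      have "AE x in lborel. v 0 x = u1 x" using init(2) by (simp only: AE_completion_iff)
      with c(2) show ?thesis by eventually_elim simp
    qed
    have V0: "pairing \<sigma> v e 0 = (\<integral>x. c x * e x \<partial>torus)"
      using pairing_version[where w = v, OF vL[OF zero] c(1) v0 e] by simp
    have Vt: "pairing \<sigma> v e t = (\<integral>x. c' x * p x \<partial>torus)"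
      using pairing_version[where w = v, OF vL[OF t] ct e] by (simp add: ep)
    have Ut: "pairing \<sigma> u (deriv e) t = - (\<integral>x. d' x * p x \<partial>torus)"
      using pairing_weak_deriv[where w = u, OF uH[OF t] dt e] by (simp add: ep)
    \<comment> \<open>\<open>d\<close> represents the weak derivative chosen for \<open>u0\<close>,
      while \<open>u 0\<close> equals \<open>u0\<close> only almost everywhere; the pairing is
      therefore moved to \<open>u0\<close> before integrating by parts.\<close>
    have "pairing \<sigma> u (deriv e) 0 = pairing \<sigma> (\<lambda>_. u0) (deriv e) 0"
      unfolding pairing_def set_lebesgue_integral_def
    proof (rule integral_cong_AE)
      have m: "(\<lambda>x. indicator {0..2 * pi} x *\<^sub>R (f x * deriv e (x - \<sigma> * 0))) \<in> borel_measurable lebesgue"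
        if "f \<in> borel_measurable lebesgue" for f :: "real \<Rightarrow> real"
        using that borel_imp_lebesgue_measurable[OF trig_poly_measurable[OF trig_poly_deriv(1)[OF e]]]
        by (intro borel_measurable_scaleR borel_measurable_times borel_measurable_indicator) auto
      show "(\<lambda>x. indicator {0..2 * pi} x *\<^sub>R (u 0 x * deriv e (x - \<sigma> * 0))) \<in> borel_measurable lebesgue"
        using uH[OF zero] by (intro m) (auto simp: H1_torus_def L2_torus_def)
      show "(\<lambda>x. indicator {0..2 * pi} x *\<^sub>R (u0 x * deriv e (x - \<sigma> * 0))) \<in> borel_measurable lebesgue"
        using u0 by (intro m) (auto simp: H1_torus_def L2_torus_def)
      show "AE x in lebesgue. indicator {0..2 * pi} x *\<^sub>R (u 0 x * deriv e (x - \<sigma> * 0)) =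
          indicator {0..2 * pi} x *\<^sub>R (u0 x * deriv e (x - \<sigma> * 0))"
        using init(1) by eventually_elim simp
    qed
    also have "\<dots> = - (\<integral>x. d x * e x \<partial>torus)"
      using pairing_weak_deriv[where w = "\<lambda>_. u0" and t = 0, OF u0 d e] by simp
    finally have U0: "pairing \<sigma> u (deriv e) 0 = - (\<integral>x. d x * e x \<partial>torus)" .
    have "(\<integral>x. (c x - \<sigma> * d x) * e x \<partial>torus) = (\<integral>x. c x * e x - \<sigma> * (d x * e x) \<partial>torus)"
      by (simp add: algebra_simps)
    also have "\<dots> = (\<integral>x. c x * e x \<partial>torus) - \<sigma> * (\<integral>x. d x * e x \<partial>torus)"
      using sqint_mult[OF periodic_L2_sqint[OF c(1)] sqe] sqint_mult[OF periodic_L2_sqint[OF d(1)] sqe] by simp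
    also have "\<dots> = (\<integral>x. c' x * p x \<partial>torus) - \<sigma> * (\<integral>x. d' x * p x \<partial>torus)"
      using pairing_conserved[OF T sol e \<sigma> t] unfolding V0 Vt Ut U0 by simp
    also have "\<dots> = (\<integral>x. c' x * p x - \<sigma> * (d' x * p x) \<partial>torus)"
      using sqint_mult[OF periodic_L2_sqint[OF ct(1)] sqp] sqint_mult[OF periodic_L2_sqint[OF dt(1)] sqp] by simp
    also have "\<dots> = (\<integral>x. (c' x - \<sigma> * d' x) * p x \<partial>torus)" by (simp add: algebra_simps)
    finally have "(\<integral>x. (c x - \<sigma> * d x) * e x \<partial>torus) = (\<integral>x. (c' x - \<sigma> * d' x) * p x \<partial>torus)" .
    moreover have "(\<integral>x. (c x - \<sigma> * d x) * e x \<partial>torus) =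
        (\<integral>x. (c (x - \<sigma> * t) - \<sigma> * d (x - \<sigma> * t)) * p x \<partial>torus)"
      using integral_torus_mult_trig_shift[OF b0 e, of "\<sigma> * t"] by (simp add: ep)
    ultimately show "(\<integral>x. ((c' x - \<sigma> * d' x) - (c (x - \<sigma> * t) - \<sigma> * d (x - \<sigma> * t))) * p x \<partial>torus) = 0"
      using sqint_mult[OF periodic_L2_sqint[OF a] sqp] sqint_mult[OF periodic_L2_sqint[OF b] sqp]
      by (simp add: left_diff_distrib)
  qed
  then show "AE x in torus. c' x - \<sigma> * d' x = c (x - \<sigma> * t) - \<sigma> * d (x - \<sigma> * t)" by eventually_elim simp
qed

lemma dAlembert:
  assumes T: "T > 0" and sol: "wave_solution T u0 u1 u v" and u0: "u0 \<in> H1_torus" and t: "t \<in> {0..T}"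
    and d: "periodic_L2 d" "AE x in lborel. weak_deriv u0 x = d x"
    and c: "periodic_L2 c" "AE x in lborel. u1 x = c x"
  shows "AE x in lborel. v t x = (c (x + t) + d (x + t)) / 2 + (c (x - t) - d (x - t)) / 2"
proof -
  have uH: "u t \<in> H1_torus" and vL: "v t \<in> L2_torus"
    using sol t by (auto simp: wave_solution_def C_curve_def)
  have "weak_deriv (u t) \<in> L2_torus" using weak_deriv_has[OF uH] by (simp add: has_weak_deriv_def)
  then obtain d' where d': "periodic_L2 d'" "AE x in lborel. weak_deriv (u t) x = d' x"
    using L2_torus_version by blast
  obtain c' where c': "periodic_L2 c'" "AE x in lborel. v t x = c' x" using L2_torus_version[OF vL] by blast
  note tr = characteristic_transport[OF T sol u0 _ t d c d' c']
  have "AE x in lborel. c' x - d' x = c (x - t) - d (x - t)" using tr[of 1] by simp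
  moreover have "AE x in lborel. c' x + d' x = c (x + t) + d (x + t)" using tr[of "-1"] by simp
  ultimately show ?thesis using c'(2)
  proof eventually_elim
    case (elim x)
    then show ?case by (simp add: field_simps)
  qed
qed

text \<open>Testing with the constant 1. This is what gives the two d'Alembert components equal
  means.\<close>

lemma integral_weak_deriv_zero:
  assumes "f \<in> H1_torus" "periodic_L2 d" "AE x in lborel. weak_deriv f x = d x"
  shows "(\<integral>x. d x \<partial>torus) = 0"
  using pairing_weak_deriv[where w = "\<lambda>_. f" and t = 0 and \<sigma> = 1, OF assms trig_poly.const[of 1]]
  by (simp add: pairing_def)

section \<open>Primitives of bounded measurable functions\<close>

definition primitive :: "(real \<Rightarrow> real) \<Rightarrow> (real \<Rightarrow> real) \<Rightarrow> bool" where
  "primitive F w \<longleftrightarrow> (\<forall>a b. a \<le> b \<longrightarrow> F b - F a = (LINT y:{a..b}|lborel. w y))"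

text \<open>The regularity of the counterexamples; solutions are constructed for this class
  only.\<close>

definition bounded_borel :: "(real \<Rightarrow> real) \<Rightarrow> bool" where
  "bounded_borel w \<longleftrightarrow> w \<in> borel_measurable borel \<and> (\<exists>B. \<forall>x. \<bar>w x\<bar> \<le> B)"

lemma bounded_borel_measurable [measurable_dest]: "bounded_borel w \<Longrightarrow> w \<in> borel_measurable borel"
  by (simp add: bounded_borel_def)

lemma bounded_borel_const: "bounded_borel (\<lambda>x. c)"
  by (auto simp: bounded_borel_def)

lemma bounded_borel_add: "bounded_borel f \<Longrightarrow> bounded_borel g \<Longrightarrow> bounded_borel (\<lambda>x. f x + g x)"
  unfolding bounded_borel_def by (auto intro!: exI[of _ "_ + _"] order_trans[OF abs_triangle_ineq] add_mono)

lemma bounded_borel_minus: "bounded_borel f \<Longrightarrow> bounded_borel (\<lambda>x. - f x)"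
  by (auto simp: bounded_borel_def)

lemma bounded_borel_diff: "bounded_borel f \<Longrightarrow> bounded_borel g \<Longrightarrow> bounded_borel (\<lambda>x. f x - g x)"
  using bounded_borel_add[of f "\<lambda>x. - g x"] bounded_borel_minus[of g] by simp

lemma bounded_borel_affine: "bounded_borel f \<Longrightarrow> bounded_borel (\<lambda>x. f (a + c * x))"
proof -
  assume f: "bounded_borel f"
  then have [measurable]: "f \<in> borel_measurable borel" by (rule bounded_borel_measurable)
  show ?thesis using f unfolding bounded_borel_def by auto
qed

lemma bounded_borel_shift: "bounded_borel f \<Longrightarrow> bounded_borel (\<lambda>x. f (x + s))"
  using bounded_borel_affine[of f s 1] by (simp add: add.commute)

lemma bounded_borel_integrable:
  assumes "bounded_borel w"
  shows "set_integrable lborel {a..b} w"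
proof -
  obtain B where B: "\<And>x. \<bar>w x\<bar> \<le> B" using assms by (auto simp: bounded_borel_def)
  note [measurable] = bounded_borel_measurable[OF assms]
  have "set_integrable lborel {a..b} (\<lambda>x. B)"
    by (intro borel_integrable_atLeastAtMost') auto
  then show ?thesis
    unfolding set_integrable_def
    by (rule Bochner_Integration.integrable_bound) (use B in \<open>auto simp: indicator_def intro: order_trans[OF _ abs_ge_self]\<close>)
qed

lemma set_integral_Icc_split:
  fixes w :: "real \<Rightarrow> real"
  assumes w: "bounded_borel w" and "a \<le> b" "b \<le> c"
  shows "(LINT y:{a..c}|lborel. w y) = (LINT y:{a..b}|lborel. w y) + (LINT y:{b..c}|lborel. w y)"
proof -
  have "{a..c} = {a..b} \<union> {b..c}" using assms by auto
  moreover have "(LINT y:{a..b} \<union> {b..c}|lborel. w y) = (LINT y:{a..b}|lborel. w y) + (LINT y:{b..c}|lborel. w y)"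
  proof (rule set_integral_Un_AE)
    have "AE x in lborel. x \<noteq> b" by (rule AE_lborel_singleton)
    then show "AE x in lborel. \<not> (x \<in> {a..b} \<and> x \<in> {b..c})" by eventually_elim auto
  qed (auto intro: bounded_borel_integrable w)
  ultimately show ?thesis by simp
qed

lemma primitive_exists:
  assumes w: "bounded_borel w"
  obtains F where "primitive F w"
proof -
  \<comment> \<open>Of the two intervals one is empty unless \<open>x = 0\<close>, so the formula
    covers both signs.\<close>
  define F where "F x = (LINT y:{0..x}|lborel. w y) - (LINT y:{x..0}|lborel. w y)" for x
  have pt: "(LINT y:{x..x}|lborel. w y) = 0" for x
    using set_integral_Icc_split[OF w, of x x x] by simp
  have pos: "F x = (LINT y:{0..x}|lborel. w y)" if "x \<ge> 0" for x
    using that pt by (cases "x = 0") (auto simp: F_def set_lebesgue_integral_def)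
  have neg: "F x = - (LINT y:{x..0}|lborel. w y)" if "x \<le> 0" for x
    using that pt by (cases "x = 0") (auto simp: F_def set_lebesgue_integral_def)
  have "F b - F a = (LINT y:{a..b}|lborel. w y)" if "a \<le> b" for a b
  proof -
    consider "0 \<le> a" | "b \<le> 0" | "a \<le> 0" "0 \<le> b" by linarith
    then show ?thesis
    proof cases
      case 1
      then show ?thesis using set_integral_Icc_split[OF w 1 that] pos that by simp
    next
      case 2
      then show ?thesis using set_integral_Icc_split[OF w that 2] neg that by simp
    next
      case 3
      then show ?thesis using set_integral_Icc_split[OF w 3] pos neg by simp
    qed
  qed
  then have "primitive F w" by (simp add: primitive_def)
  then show ?thesis by (rule that)
qed

lemma primitive_shift:
  assumes "primitive F w"
  shows "primitive (\<lambda>x. F (x + s)) (\<lambda>x. w (x + s))"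
  unfolding primitive_def
proof (intro allI impI)
  fix a b :: real assume "a \<le> b"
  have "(LINT y:{a..b}|lborel. w (y + s)) = (LINT y:{a + s..b + s}|lborel. w y)"
    unfolding set_lebesgue_integral_def
    by (subst lborel_integral_real_affine[where c = 1 and t = s])
       (auto intro!: Bochner_Integration.integral_cong simp: indicator_def add.commute)
  then show "F (b + s) - F (a + s) = (LINT y:{a..b}|lborel. w (y + s))"
    using assms \<open>a \<le> b\<close> by (simp add: primitive_def)
qed

lemma primitive_reflect:
  assumes "primitive F w"
  shows "primitive (\<lambda>t. - F (x - t)) (\<lambda>t. w (x - t))"
  unfolding primitive_def
proof (intro allI impI)
  fix a b :: real assume "a \<le> b"
  have "(LINT t:{a..b}|lborel. w (x - t)) = (LINT y:{x - b..x - a}|lborel. w y)"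
    unfolding set_lebesgue_integral_def
    by (subst (2) lborel_integral_real_affine[where c = "-1" and t = x])
       (auto intro!: Bochner_Integration.integral_cong simp: indicator_def)
  then show "- F (x - b) - - F (x - a) = (LINT t:{a..b}|lborel. w (x - t))"
    using assms \<open>a \<le> b\<close> by (simp add: primitive_def)
qed

lemma primitive_diff:
  assumes "primitive F f" "primitive G g" "bounded_borel f" "bounded_borel g"
  shows "primitive (\<lambda>x. F x - G x) (\<lambda>x. f x - g x)"
  using assms bounded_borel_integrable[OF assms(3)] bounded_borel_integrable[OF assms(4)]
  unfolding primitive_def by (simp add: algebra_simps)

lemma primitive_add:
  assumes "primitive F f" "primitive G g" "bounded_borel f" "bounded_borel g"
  shows "primitive (\<lambda>x. F x + G x) (\<lambda>x. f x + g x)"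
  using assms bounded_borel_integrable[OF assms(3)] bounded_borel_integrable[OF assms(4)]
  unfolding primitive_def by (simp add: algebra_simps)

lemma primitive_Lipschitz:
  assumes F: "primitive F w" and w: "bounded_borel w"
  obtains L where "L \<ge> 0" "\<And>x y. \<bar>F x - F y\<bar> \<le> L * \<bar>x - y\<bar>"
proof -
  obtain B where B: "\<And>x. \<bar>w x\<bar> \<le> B" using w by (auto simp: bounded_borel_def)
  have le: "\<bar>F b - F a\<bar> \<le> B * (b - a)" if "a \<le> b" for a b
  proof -
    have "\<bar>F b - F a\<bar> = \<bar>LINT y:{a..b}|lborel. w y\<bar>" using F that by (simp add: primitive_def)
    also have "\<dots> \<le> (LINT y:{a..b}|lborel. \<bar>w y\<bar>)"
      using set_integral_norm_bound[OF bounded_borel_integrable[OF w], of a b] by simp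
    also have "\<dots> \<le> (LINT y:{a..b}|lborel. B)"
      using B by (intro set_integral_mono set_integrable_abs bounded_borel_integrable w bounded_borel_const)
    also have "\<dots> = B * (b - a)" using that by (simp add: set_lebesgue_integral_def)
    finally show ?thesis .
  qed
  have "B \<ge> 0" using B[of 0] by simp
  moreover have "\<bar>F x - F y\<bar> \<le> B * \<bar>x - y\<bar>" for x y
    using le[of x y] le[of y x] by (cases "x \<le> y") (auto simp: abs_minus_commute)
  ultimately show ?thesis by (rule that)
qed

lemma primitive_continuous:
  assumes F: "primitive F w" and w: "bounded_borel w"
  shows "continuous_on UNIV F"
proof -
  obtain L where L: "L \<ge> 0" "\<And>x y. \<bar>F x - F y\<bar> \<le> L * \<bar>x - y\<bar>" using primitive_Lipschitz[OF F w] by blast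
  have "L-lipschitz_on UNIV F" by (rule lipschitz_onI) (use L in \<open>auto simp: dist_real_def\<close>)
  then show ?thesis by (rule lipschitz_on_continuous_on)
qed

lemma integral_over_period:
  assumes "bounded_borel w" "periodic w"
  shows "(LINT y:{a..a + 2 * pi}|lborel. w y) = (\<integral>x. w x \<partial>torus)"
proof -
  note [measurable] = bounded_borel_measurable[OF assms(1)]
  have i: "integrable torus w"
    using bounded_borel_integrable[OF assms(1)] by (simp add: integrable_torus)
  have "(LINT y:{a..a + 2 * pi}|lborel. w y) = (LINT y:{0..2 * pi}|lborel. w (y + a))"
    unfolding set_lebesgue_integral_def
    by (subst lborel_integral_real_affine[where c = 1 and t = a])
       (auto intro!: Bochner_Integration.integral_cong simp: indicator_def add.commute)
  also have "\<dots> = (\<integral>x. w (x + a) \<partial>torus)" by (simp add: integral_torus)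
  also have "\<dots> = (\<integral>x. w x \<partial>torus)" by (rule integral_torus_shift(2)[OF _ assms(2) i]) simp
  finally show ?thesis .
qed

text \<open>\<open>F\<close> need not be differentiable, so the identity comes from Fubini on the
  triangle \<open>a \<le> y \<le> x \<le> b\<close> applied to
  \<open>w y * \<phi>' x\<close>.\<close>

lemma primitive_by_parts:
  assumes ab: "a \<le> b" and F: "primitive F w" and w: "bounded_borel w"
    and \<phi>: "\<And>x. (\<phi> has_real_derivative \<phi>' x) (at x)" "continuous_on UNIV \<phi>'"
  shows "(LINT x:{a..b}|lborel. F x * \<phi>' x) = F b * \<phi> b - F a * \<phi> a - (LINT x:{a..b}|lborel. w x * \<phi> x)"
proof -
  note [measurable] = bounded_borel_measurable[OF w] borel_measurable_continuous_onI[OF \<phi>(2)]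
  obtain B where B: "\<And>x. \<bar>w x\<bar> \<le> B" using w by (auto simp: bounded_borel_def)
  have "compact (\<phi>' ` {a..b})" using \<phi>(2) by (intro compact_continuous_image) (auto intro: continuous_on_subset)
  then obtain C where C: "\<And>x. x \<in> {a..b} \<Longrightarrow> \<bar>\<phi>' x\<bar> \<le> C"
    using compact_imp_bounded by (metis (no_types, lifting) bounded_iff image_eqI real_norm_def)
  have \<phi>_cont: "continuous_on S \<phi>" for S
    by (rule DERIV_continuous_on[OF has_field_derivative_at_within[OF \<phi>(1)]])
  note [measurable] = borel_measurable_continuous_onI[OF \<phi>_cont]
  have ftc: "(LINT x:{y..b}|lborel. \<phi>' x) = \<phi> b - \<phi> y" if "y \<le> b" for y
    unfolding set_lebesgue_integral_def using that \<phi> continuous_on_subset[OF \<phi>(2)]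
    by (intro integral_FTC_Icc) (auto simp: has_real_derivative_iff_has_vector_derivative[symmetric] has_field_derivative_at_within)
  let ?K = "\<lambda>x y. indicator {a..b} x * (indicator {a..x} y * (w y * \<phi>' x)) :: real"

  have int: "integrable (lborel \<Otimes>\<^sub>M lborel) (\<lambda>(x, y). ?K x y)"
  proof (rule Bochner_Integration.integrable_bound)
    have "{a..b} \<times> {a..b} = cbox (a, a) (b, b)" by auto
    then have "emeasure lborel ({a..b} \<times> {a..b}) < \<infinity>" by (metis emeasure_lborel_cbox_finite)
    moreover have "{a..b} \<times> {a..b} \<in> sets borel" by (intro borel_closed closed_Times) auto
    ultimately show "integrable (lborel \<Otimes>\<^sub>M lborel) (\<lambda>z. (B * C) * indicator ({a..b} \<times> {a..b}) z)"
      unfolding lborel_prod by (intro integrable_mult_right) (auto simp: integrable_indicator_iff)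
    have "(\<lambda>(x, y). ?K x y) = (\<lambda>(x, y). indicator {a..b} x * (indicator {a..} y * (if y \<le> x then w y * \<phi>' x else 0)))"
      by (auto simp: fun_eq_iff indicator_def)
    also have "\<dots> \<in> borel_measurable (lborel \<Otimes>\<^sub>M lborel)" by measurable
    finally show "(\<lambda>(x, y). ?K x y) \<in> borel_measurable (lborel \<Otimes>\<^sub>M lborel)" .
    show "AE z in lborel \<Otimes>\<^sub>M lborel. norm (case z of (x, y) \<Rightarrow> ?K x y) \<le> norm ((B * C) * indicator ({a..b} \<times> {a..b}) z)"
    proof (rule AE_I2)
      fix z :: "real \<times> real"
      obtain x y where z: "z = (x, y)" by (cases z)
      show "norm (case z of (x, y) \<Rightarrow> ?K x y) \<le> norm ((B * C) * indicator ({a..b} \<times> {a..b}) z)"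
      proof (cases "x \<in> {a..b} \<and> y \<in> {a..x}")
        case True
        then have "\<bar>w y\<bar> * \<bar>\<phi>' x\<bar> \<le> B * C" using B[of y] C[of x] by (intro mult_mono) auto
        also have "\<dots> \<le> \<bar>B\<bar> * \<bar>C\<bar>" unfolding abs_mult[symmetric] by (rule abs_ge_self)
        finally show ?thesis using True z by (auto simp: abs_mult)
      qed (auto simp: z)
    qed
  qed
  have 1: "(\<integral>y. ?K x y \<partial>lborel) = indicator {a..b} x * ((F x - F a) * \<phi>' x)" for x
  proof (cases "x \<in> {a..b}")
    case True
    then have "(\<integral>y. ?K x y \<partial>lborel) = (\<integral>y. (indicator {a..x} y * w y) * \<phi>' x \<partial>lborel)" by (simp add: mult.assoc)
    also have "\<dots> = (LINT y:{a..x}|lborel. w y) * \<phi>' x" by (simp add: set_lebesgue_integral_def)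
    finally show ?thesis using True F by (simp add: primitive_def)
  qed simp
  have 2: "(\<integral>x. ?K x y \<partial>lborel) = indicator {a..b} y * (w y * (\<phi> b - \<phi> y))" for y
  proof (cases "y \<in> {a..b}")
    case True
    then have "(\<integral>x. ?K x y \<partial>lborel) = (\<integral>x. w y * (indicator {y..b} x * \<phi>' x) \<partial>lborel)"
      by (intro Bochner_Integration.integral_cong) (auto simp: indicator_def)
    also have "\<dots> = w y * (LINT x:{y..b}|lborel. \<phi>' x)" by (simp add: set_lebesgue_integral_def)
    finally show ?thesis using True ftc by simp
  next
    case False
    then have "(\<lambda>x. ?K x y) = (\<lambda>x. 0)" by (auto simp: indicator_def)
    then show ?thesis using False by simp
  qed
  have w\<phi>: "set_integrable lborel {a..b} (\<lambda>y. w y * \<phi> y)"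
  proof -
    have "compact (\<phi> ` {a..b})" by (intro compact_continuous_image \<phi>_cont) auto
    then obtain D where D: "\<And>x. x \<in> {a..b} \<Longrightarrow> \<bar>\<phi> x\<bar> \<le> D"
      using compact_imp_bounded by (metis (no_types, lifting) bounded_iff image_eqI real_norm_def)
    have "set_integrable lborel {a..b} (\<lambda>x. B * D)" by (intro borel_integrable_atLeastAtMost') auto
    then show ?thesis
      unfolding set_integrable_def
    proof (rule Bochner_Integration.integrable_bound)
      show "AE x in lborel. norm (indicator {a..b} x *\<^sub>R (w x * \<phi> x)) \<le> norm (indicator {a..b} x *\<^sub>R (B * D))"
      proof (rule AE_I2)
        fix x
        have "\<bar>w x\<bar> * \<bar>\<phi> x\<bar> \<le> B * D" if "x \<in> {a..b}" using B[of x] D[OF that] by (intro mult_mono) auto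
        then show "norm (indicator {a..b} x *\<^sub>R (w x * \<phi> x)) \<le> norm (indicator {a..b} x *\<^sub>R (B * D))"
          using order_trans[OF _ abs_ge_self[of "B * D"]] by (auto simp: abs_mult indicator_def)
      qed
    qed measurable
  qed
  have F\<phi>: "set_integrable lborel {a..b} (\<lambda>x. F x * \<phi>' x)" "set_integrable lborel {a..b} \<phi>'"
    using \<phi>(2) primitive_continuous[OF F w] by (auto intro!: borel_integrable_atLeastAtMost' continuous_on_mult intro: continuous_on_subset)
  have "(LINT x:{a..b}|lborel. (F x - F a) * \<phi>' x) = (\<integral>x. \<integral>y. ?K x y \<partial>lborel \<partial>lborel)"
    unfolding 1 by (simp add: set_lebesgue_integral_def)
  also have "\<dots> = (\<integral>y. \<integral>x. ?K x y \<partial>lborel \<partial>lborel)" by (rule lborel_pair.Fubini_integral[OF int, symmetric])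
  also have "\<dots> = (LINT y:{a..b}|lborel. w y * \<phi> b - w y * \<phi> y)"
    unfolding 2 by (simp add: set_lebesgue_integral_def right_diff_distrib)
  also have "\<dots> = (F b - F a) * \<phi> b - (LINT y:{a..b}|lborel. w y * \<phi> y)"
    using bounded_borel_integrable[OF w, of a b] w\<phi> F ab by (simp add: primitive_def)
  finally have "(LINT x:{a..b}|lborel. F x * \<phi>' x - F a * \<phi>' x) = (F b - F a) * \<phi> b - (LINT y:{a..b}|lborel. w y * \<phi> y)"
    by (simp add: left_diff_distrib)
  moreover have "(LINT x:{a..b}|lborel. F x * \<phi>' x - F a * \<phi>' x) = (LINT x:{a..b}|lborel. F x * \<phi>' x) - F a * (\<phi> b - \<phi> a)"
    using F\<phi> ftc[OF ab] by simp
  ultimately show ?thesis by (simp add: algebra_simps)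
qed

lemma smooth_torus_deriv:
  assumes "smooth_torus \<phi>"
  shows "(\<phi> has_real_derivative deriv \<phi> x) (at x)" "continuous_on UNIV (deriv \<phi>)"
proof -
  have d: "(deriv ^^ n) \<phi> differentiable at x" for n x using assms by (simp add: smooth_torus_def)
  show "(\<phi> has_real_derivative deriv \<phi> x) (at x)"
    using d[of 0 x] by (simp add: DERIV_deriv_iff_real_differentiable)
  have "deriv \<phi> differentiable at x" for x using d[of 1 x] by simp
  then show "continuous_on UNIV (deriv \<phi>)"
    by (intro differentiable_imp_continuous_on) (auto simp: differentiable_on_def differentiable_at_withinI)
qed

lemma primitive_has_weak_deriv:
  assumes F: "primitive F w" and w: "bounded_borel w" "periodic w" and per: "periodic F"
  shows "has_weak_deriv F w" "F \<in> H1_torus"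
proof -
  note [measurable] = bounded_borel_measurable[OF w(1)]
  obtain B where B: "\<And>x. \<bar>w x\<bar> \<le> B" using w(1) by (auto simp: bounded_borel_def)
  have Fc: "continuous_on UNIV F" by (rule primitive_continuous[OF F w(1)])
  have [measurable]: "F \<in> borel_measurable borel" by (rule borel_measurable_continuous_onI[OF Fc])
  have wL: "w \<in> L2_torus" by (intro periodic_L2_imp_L2_torus periodic_L2_bounded[OF _ w(2) B]) simp
  have "integrable torus (\<lambda>x. (F x)\<^sup>2)"
    using Fc by (subst integrable_torus) (auto intro!: borel_integrable_atLeastAtMost' continuous_intros intro: continuous_on_subset)
  then have FL: "F \<in> L2_torus" using per by (intro periodic_L2_imp_L2_torus) (simp add: periodic_L2_def)
  show wd: "has_weak_deriv F w"
    unfolding has_weak_deriv_def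
  proof (intro conjI allI impI wL)
    fix \<phi> assume \<phi>: "smooth_torus \<phi>"
    note d = smooth_torus_deriv[OF \<phi>]
    have \<phi>_cont: "continuous_on UNIV \<phi>"
      by (rule DERIV_continuous_on[OF has_field_derivative_at_within[OF d(1)]])
    note [measurable] = borel_measurable_continuous_onI[OF d(2)] borel_measurable_continuous_onI[OF \<phi>_cont]
    have "F (2 * pi) = F 0" "\<phi> (2 * pi) = \<phi> 0"
      using per \<phi> by (auto simp: periodic_def smooth_torus_def dest: spec[of _ 0])
    then have "(LINT x:{0..2 * pi}|lborel. F x * deriv \<phi> x) = - (LINT x:{0..2 * pi}|lborel. w x * \<phi> x)"
      using primitive_by_parts[OF _ F w(1) d, of 0 "2 * pi"] by simp
    moreover have "(LINT x:{0..2 * pi}|lebesgue. F x * deriv \<phi> x) = (LINT x:{0..2 * pi}|lborel. F x * deriv \<phi> x)"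
      using lebesgue_integral_torus_mult[OF FL, of F "deriv \<phi>"] by (simp add: integral_torus)
    moreover have "(LINT x:{0..2 * pi}|lebesgue. w x * \<phi> x) = (LINT x:{0..2 * pi}|lborel. w x * \<phi> x)"
      using lebesgue_integral_torus_mult[OF wL, of w \<phi>] by (simp add: integral_torus)
    ultimately show "(LINT x:{0..2 * pi}|lebesgue. F x * deriv \<phi> x) = - (LINT x:{0..2 * pi}|lebesgue. w x * \<phi> x)"
      by simp
  qed
  show "F \<in> H1_torus" using FL wd by (auto simp: H1_torus_def)
qed

lemma L2_norm_periodic_L2: "periodic_L2 f \<Longrightarrow> L2_norm f = sqrt (\<integral>x. (f x)\<^sup>2 \<partial>torus)"
  by (rule L2_torus_AE_eq(2)) (auto intro: borel_imp_lebesgue_measurable periodic_L2_measurable)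

lemma L2_norm_weak_deriv:
  assumes "has_weak_deriv F w" "periodic_L2 w"
  shows "L2_norm (weak_deriv F) = sqrt (\<integral>x. (w x)\<^sup>2 \<partial>torus)"
proof (rule L2_torus_AE_eq(2)[OF assms(2)])
  have wd: "has_weak_deriv F (weak_deriv F)" unfolding weak_deriv_def by (rule someI[of "has_weak_deriv F", OF assms(1)])
  show "AE x in lborel. weak_deriv F x = w x" by (rule weak_deriv_unique[OF wd assms(1)])
  show "weak_deriv F \<in> borel_measurable lebesgue"
    using wd by (intro L2_torus_measurable) (simp add: has_weak_deriv_def)
qed

lemma bounded_borel_periodic_L2: "bounded_borel f \<Longrightarrow> periodic f \<Longrightarrow> periodic_L2 f"
  unfolding bounded_borel_def using periodic_L2_bounded by blast

text \<open>A three-term estimate: \<open>f\<close> is replaced by a trigonometric polynomial, whose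
  translates are Lipschitz in the shift, and the approximation error is invariant under
  translation.\<close>

lemma translation_continuous_L2:
  assumes f: "bounded_borel f" "periodic f"
  shows "((\<lambda>t. sqrt (\<integral>x. (f (x + \<sigma> * t) - f (x + \<sigma> * s))\<^sup>2 \<partial>torus)) \<longlongrightarrow> 0) (at s within S)"
proof (rule tendstoI)
  fix e :: real assume e: "e > 0"
  have fL: "periodic_L2 f" by (rule bounded_borel_periodic_L2[OF f])
  obtain B where B: "\<And>x. \<bar>f x\<bar> \<le> B" using f(1) by (auto simp: bounded_borel_def)
  obtain p where p: "trig_poly p" "(\<integral>x. (f x - p x)\<^sup>2 \<partial>torus) < (e / 3)\<^sup>2"
    using trig_poly_L2_dense[of f B "(e / 3)\<^sup>2"] f(1) B e by (auto simp: bounded_borel_def)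
  obtain C where C: "\<And>x. \<bar>p x\<bar> \<le> C" using trig_poly_bounded[OF p(1)] by auto
  have pL: "periodic_L2 p" by (rule periodic_L2_bounded[OF trig_poly_measurable[OF p(1)] trig_poly_periodic[OF p(1)] C])
  obtain L where L: "L \<ge> 0" "\<And>x y. \<bar>p x - p y\<bar> \<le> L * \<bar>x - y\<bar>" using trig_poly_Lipschitz[OF p(1)] by blast
  define K where "K = sqrt (2 * pi) * (L * \<bar>\<sigma>\<bar>)"
  have K: "K \<ge> 0" using L(1) by (simp add: K_def)
  have fp: "sqrt (\<integral>x. (f (x + c) - p (x + c))\<^sup>2 \<partial>torus) < e / 3" for c
  proof -
    have d: "periodic_L2 (\<lambda>x. f x - p x)" by (rule periodic_L2_diff[OF fL pL])
    have "(\<integral>x. (f (x + c) - p (x + c))\<^sup>2 \<partial>torus) = (\<integral>x. (f x - p x)\<^sup>2 \<partial>torus)"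
      using d by (intro integral_torus_shift(2)[of "\<lambda>x. (f x - p x)\<^sup>2"]) (auto simp: periodic_L2_def periodic_def)
    then show ?thesis using real_sqrt_less_mono[OF p(2)] e by simp
  qed
  have main: "sqrt (\<integral>x. (f (x + \<sigma> * t) - f (x + \<sigma> * s))\<^sup>2 \<partial>torus) < 2 * (e / 3) + K * \<bar>t - s\<bar>" for t
  proof -
    note sh = periodic_L2_sqint[OF periodic_L2_shift]
    let ?a = "\<lambda>x. f (x + \<sigma> * t) - p (x + \<sigma> * t)" and ?b = "\<lambda>x. p (x + \<sigma> * t) - p (x + \<sigma> * s)"
      and ?c = "\<lambda>x. p (x + \<sigma> * s) - f (x + \<sigma> * s)"
    have sq: "sqint torus ?a" "sqint torus ?b" "sqint torus ?c" by (intro sqint_diff sh fL pL)+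
    have "sqrt (\<integral>x. (f (x + \<sigma> * t) - f (x + \<sigma> * s))\<^sup>2 \<partial>torus) = sqrt (\<integral>x. ((?a x + ?b x) + ?c x)\<^sup>2 \<partial>torus)" by simp
    also have "\<dots> \<le> sqrt (\<integral>x. (?a x)\<^sup>2 \<partial>torus) + sqrt (\<integral>x. (?b x)\<^sup>2 \<partial>torus) + sqrt (\<integral>x. (?c x)\<^sup>2 \<partial>torus)"
      using Minkowski_L2[OF sqint_add[OF sq(1,2)] sq(3)] Minkowski_L2[OF sq(1,2)] by linarith
    also have "sqrt (\<integral>x. (?c x)\<^sup>2 \<partial>torus) < e / 3" using fp[of "\<sigma> * s"] by (simp add: power2_commute)
    also have "sqrt (\<integral>x. (?b x)\<^sup>2 \<partial>torus) \<le> sqrt (2 * pi) * \<bar>L * (\<bar>\<sigma>\<bar> * \<bar>t - s\<bar>)\<bar>"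
    proof (rule integral_square_torus_le[OF sq(2)])
      fix x
      show "\<bar>?b x\<bar> \<le> L * (\<bar>\<sigma>\<bar> * \<bar>t - s\<bar>)"
        using L(2)[of "x + \<sigma> * t" "x + \<sigma> * s"] by (simp add: abs_mult flip: right_diff_distrib)
    qed
    also have "\<dots> = K * \<bar>t - s\<bar>" using L(1) by (simp add: K_def)
    finally show ?thesis using fp[of "\<sigma> * t"] by linarith
  qed
  have "e / 3 / (K + 1) > 0" using e K by simp
  then have "\<forall>\<^sub>F t in at s within S. dist t s < e / 3 / (K + 1)" by (auto simp: eventually_at)
  then show "\<forall>\<^sub>F t in at s within S. dist (sqrt (\<integral>x. (f (x + \<sigma> * t) - f (x + \<sigma> * s))\<^sup>2 \<partial>torus)) 0 < e"
  proof eventually_elim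
    case (elim t)
    then have "(K + 1) * \<bar>t - s\<bar> \<le> e / 3" using K by (simp add: dist_real_def field_simps)
    moreover have "K * \<bar>t - s\<bar> \<le> (K + 1) * \<bar>t - s\<bar>" by (intro mult_right_mono) auto
    ultimately have "K * \<bar>t - s\<bar> \<le> e / 3" by linarith
    then have "sqrt (\<integral>x. (f (x + \<sigma> * t) - f (x + \<sigma> * s))\<^sup>2 \<partial>torus) < e" using main[of t] by linarith
    then show ?case by (simp add: Bochner_Integration.integral_nonneg)
  qed
qed

section \<open>Construction of solutions\<close>

lemma test_function_facts:
  assumes \<phi>: "test_function T \<phi>"
  shows test_function_continuous: "continuous_on UNIV (\<lambda>z. \<phi> (fst z) (snd z))"
    and test_function_dt_deriv: "((\<lambda>s. \<phi> s x) has_real_derivative dt \<phi> t x) (at t)"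
    and test_function_dx_deriv: "((\<lambda>y. \<phi> t y) has_real_derivative dx \<phi> t x) (at x)"
    and test_function_dt: "test_function T (dt \<phi>)"
    and test_function_dx: "test_function T (dx \<phi>)"
    and test_function_periodic: "periodic (\<phi> t)"
    and test_function_boundary: "\<phi> 0 x = 0" "\<phi> T x = 0"
proof -
  have C: "C_k k \<phi>" for k using \<phi> by (simp add: test_function_def)
  have per: "periodic (\<phi> t)" for t using \<phi> by (simp add: test_function_def)
  obtain a b where ab: "0 < a" "b < T" "\<And>t x. \<phi> t x \<noteq> 0 \<Longrightarrow> a \<le> t \<and> t \<le> b"
    using \<phi> unfolding test_function_def by blast
  show "continuous_on UNIV (\<lambda>z. \<phi> (fst z) (snd z))" using C[of 0] by (simp add: split_def)
  have dt: "((\<lambda>s. \<phi> s x) has_real_derivative dt \<phi> t x) (at t)" for t x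
    using C[of 1] by (simp add: dt_def DERIV_deriv_iff_real_differentiable)
  have dx: "((\<lambda>y. \<phi> t y) has_real_derivative dx \<phi> t x) (at x)" for t x
    using C[of 1] by (simp add: dx_def DERIV_deriv_iff_real_differentiable)
  show "((\<lambda>s. \<phi> s x) has_real_derivative dt \<phi> t x) (at t)" "((\<lambda>y. \<phi> t y) has_real_derivative dx \<phi> t x) (at x)"
    by (fact dt dx)+
  show "periodic (\<phi> t)" by (fact per)
  show "\<phi> 0 x = 0" "\<phi> T x = 0" using ab(3)[of 0 x] ab(3)[of T x] ab(1,2) by force+
  show "test_function T (dt \<phi>)"
    unfolding test_function_def
  proof (intro conjI allI exI impI)
    show "C_k k (dt \<phi>)" for k using C[of "Suc k"] by simp
    show "periodic (dt \<phi> t)" for t using per by (simp add: periodic_def dt_def)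
    fix t x assume "dt \<phi> t x \<noteq> 0"
    with derivative_zero_outside_support[of "\<lambda>s. \<phi> s x" "\<lambda>s. dt \<phi> s x" a b t, OF dt ab(3)]
    show "a \<le> t" "t \<le> b" by auto
  qed (fact ab)+
  show "test_function T (dx \<phi>)"
    unfolding test_function_def
  proof (intro conjI allI exI impI)
    show "C_k k (dx \<phi>)" for k using C[of "Suc k"] by simp
    show "periodic (dx \<phi> t)" for t
      unfolding periodic_def
    proof
      fix x
      have "((\<lambda>y. \<phi> t (y + 2 * pi)) has_real_derivative dx \<phi> t (x + 2 * pi) * 1) (at x)"
        by (rule DERIV_chain2[OF dx]) (auto intro!: derivative_eq_intros)
      moreover have "(\<lambda>y. \<phi> t (y + 2 * pi)) = \<phi> t" using per by (simp add: periodic_def)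
      ultimately have "(\<phi> t has_real_derivative dx \<phi> t (x + 2 * pi)) (at x)" by (simp only: mult_1_right)
      then show "dx \<phi> t (x + 2 * pi) = dx \<phi> t x" using dx by (rule DERIV_unique)
    qed
    fix t x assume nz: "dx \<phi> t x \<noteq> 0"
    have "\<exists>y. \<phi> t y \<noteq> 0"
    proof (rule ccontr)
      assume "\<not> (\<exists>y. \<phi> t y \<noteq> 0)"
      then have "\<phi> t = (\<lambda>y. 0)" by auto
      then show False using nz by (simp add: dx_def)
    qed
    then show "a \<le> t" "t \<le> b" using ab(3) by auto
  qed (fact ab)+
qed

text \<open>The chain rule needs total differentiability, which follows from the two partial
  derivatives and the continuity of \<open>dx \<phi>\<close>.\<close>

lemma test_function_along_line:
  assumes \<phi>: "test_function T \<phi>"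
  shows "((\<lambda>t. \<phi> t (y + \<sigma> * t)) has_real_derivative dt \<phi> t (y + \<sigma> * t) + \<sigma> * dx \<phi> t (y + \<sigma> * t)) (at t)"
proof -
  let ?x = "y + \<sigma> * t"
  have "((\<lambda>(t, x). \<phi> t x) has_derivative (\<lambda>(h, k). dt \<phi> t ?x * h + blinfun_mult_right (dx \<phi> t ?x) k)) (at (t, ?x) within UNIV \<times> UNIV)"
  proof (rule has_derivative_partialsI)
    show "((\<lambda>s. \<phi> s ?x) has_derivative (\<lambda>h. dt \<phi> t ?x * h)) (at t)"
      using test_function_dt_deriv[OF \<phi>] by (simp add: has_field_derivative_def)
    show "((\<lambda>x. \<phi> s x) has_derivative blinfun_apply (blinfun_mult_right (dx \<phi> s x))) (at x)" for s x
      using test_function_dx_deriv[OF \<phi>] by (simp add: has_field_derivative_def blinfun_mult_right.rep_eq)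
    have "continuous (at (t, ?x)) (\<lambda>z. dx \<phi> (fst z) (snd z))"
      using test_function_continuous[OF test_function_dx[OF \<phi>]] by (simp add: continuous_on_eq_continuous_at)
    then have "continuous (at (t, ?x)) (\<lambda>z. blinfun_mult_right (dx \<phi> (fst z) (snd z)))"
      by (rule bounded_linear.continuous[OF bounded_linear_blinfun_mult_right])
    then show "continuous (at (t, ?x) within UNIV \<times> UNIV) (\<lambda>(s, x). blinfun_mult_right (dx \<phi> s x))"
      by (simp add: split_def)
  qed auto
  then have d: "((\<lambda>(t, x). \<phi> t x) has_derivative (\<lambda>(h, k). dt \<phi> t ?x * h + dx \<phi> t ?x * k)) (at (t, ?x))"
    by (simp add: blinfun_mult_right.rep_eq)
  have "((\<lambda>t. (t, y + \<sigma> * t)) has_derivative (\<lambda>h. (h, \<sigma> * h))) (at t)"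
    by (auto intro!: derivative_eq_intros)
  from has_derivative_compose[OF this d]
  have "((\<lambda>t. \<phi> t (y + \<sigma> * t)) has_derivative (\<lambda>h. dt \<phi> t ?x * h + dx \<phi> t ?x * (\<sigma> * h))) (at t)" by simp
  moreover have "(\<lambda>h. dt \<phi> t ?x * h + dx \<phi> t ?x * (\<sigma> * h)) = (*) (dt \<phi> t ?x + \<sigma> * dx \<phi> t ?x)"
    by (simp add: fun_eq_iff algebra_simps)
  ultimately show ?thesis by (simp only: has_field_derivative_def)
qed

lemma plane_integral_bounded:
  fixes K :: "real \<times> real \<Rightarrow> real"
  assumes [measurable]: "K \<in> borel_measurable borel" and C': "\<forall>z\<in>{0..T} \<times> {0..2 * pi}. \<bar>K z\<bar> \<le> C"
  shows "set_integrable lebesgue ({0..T} \<times> {0..2 * pi}) K"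
    and "set_lebesgue_integral lebesgue ({0..T} \<times> {0..2 * pi}) K = (LINT t:{0..T}|lborel. \<integral>x. K (t, x) \<partial>torus)"
    and "set_lebesgue_integral lebesgue ({0..T} \<times> {0..2 * pi}) K = (\<integral>x. (LINT t:{0..T}|lborel. K (t, x)) \<partial>torus)"
proof -
  note C = C'[rule_format]
  let ?J = "{0..T} \<times> {0..2 * pi} :: (real \<times> real) set"
  have [measurable]: "?J \<in> sets borel" by (intro borel_closed closed_Times) auto
  define H where "H z = indicator ?J z * K z" for z
  have [measurable]: "H \<in> borel_measurable borel" unfolding H_def by measurable
  have int: "integrable lborel H"
  proof (rule Bochner_Integration.integrable_bound)
    have "?J = cbox (0, 0) (T, 2 * pi)" by auto
    then have "emeasure lborel ?J < \<infinity>" by (metis emeasure_lborel_cbox_finite)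
    then show "integrable lborel (\<lambda>z. C * indicator ?J z)"
      by (intro integrable_mult_right) (auto simp: integrable_indicator_iff)
    show "AE z in lborel. norm (H z) \<le> norm (C * indicator ?J z)"
      using C order_trans[OF C abs_ge_self] by (intro AE_I2) (auto simp: H_def indicator_def)
  qed measurable
  have Hl: "(\<lambda>z. indicator ?J z *\<^sub>R K z) = H" by (simp add: H_def fun_eq_iff)
  show "set_integrable lebesgue ?J K"
    unfolding set_integrable_def Hl using int by (subst integrable_completion) auto
  have "set_lebesgue_integral lebesgue ?J K = (\<integral>z. H z \<partial>lborel)"
    unfolding set_lebesgue_integral_def Hl by (rule integral_completion) simp
  then have eq: "set_lebesgue_integral lebesgue ?J K = (\<integral>z. H z \<partial>(lborel \<Otimes>\<^sub>M lborel))"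
    unfolding lborel_prod .
  have int': "integrable (lborel \<Otimes>\<^sub>M lborel) (\<lambda>(t, x). H (t, x))" using int by (simp add: lborel_prod)
  have "(\<integral>z. H z \<partial>(lborel \<Otimes>\<^sub>M lborel)) = (\<integral>t. \<integral>x. H (t, x) \<partial>lborel \<partial>lborel)"
    using lborel_pair.integral_fst'[of H] int' by simp
  also have "\<dots> = (\<integral>t. indicator {0..T} t * (\<integral>x. K (t, x) \<partial>torus) \<partial>lborel)"
    by (intro Bochner_Integration.integral_cong refl)
       (simp add: H_def indicator_times integral_torus set_lebesgue_integral_def mult.assoc)
  finally have 1: "(\<integral>z. H z \<partial>(lborel \<Otimes>\<^sub>M lborel)) = (LINT t:{0..T}|lborel. \<integral>x. K (t, x) \<partial>torus)"
    by (simp add: set_lebesgue_integral_def)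
  show "set_lebesgue_integral lebesgue ?J K = (LINT t:{0..T}|lborel. \<integral>x. K (t, x) \<partial>torus)"
    unfolding eq 1 ..
  have "(\<integral>z. H z \<partial>(lborel \<Otimes>\<^sub>M lborel)) = (\<integral>t. \<integral>x. H (t, x) \<partial>lborel \<partial>lborel)"
    using lborel_pair.integral_fst'[of H] int' by simp
  also have "\<dots> = (\<integral>x. \<integral>t. H (t, x) \<partial>lborel \<partial>lborel)" by (rule lborel_pair.Fubini_integral[OF int', symmetric])
  also have "\<dots> = (\<integral>x. indicator {0..2 * pi} x * (LINT t:{0..T}|lborel. K (t, x)) \<partial>lborel)"
  proof (intro Bochner_Integration.integral_cong refl)
    fix x
    show "(\<integral>t. H (t, x) \<partial>lborel) = indicator {0..2 * pi} x * (LINT t:{0..T}|lborel. K (t, x))"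
      by (cases "x \<in> {0..2 * pi}") (simp_all add: H_def indicator_times set_lebesgue_integral_def)
  qed
  also have "\<dots> = (\<integral>x. (LINT t:{0..T}|lborel. K (t, x)) \<partial>torus)"
    by (subst integral_torus) (auto simp: set_lebesgue_integral_def)
  finally show "set_lebesgue_integral lebesgue ?J K = (\<integral>x. (LINT t:{0..T}|lborel. K (t, x)) \<partial>torus)"
    unfolding eq .
qed

lemma test_function_bounded:
  assumes "test_function T \<phi>"
  obtains C where "\<And>t x. t \<in> {0..T} \<Longrightarrow> \<bar>\<phi> t x\<bar> \<le> C"
proof -
  have "compact ((\<lambda>z. \<phi> (fst z) (snd z)) ` ({0..T} \<times> {0..2 * pi}))"
    using test_function_continuous[OF assms]
    by (intro compact_continuous_image compact_Times) (auto intro: continuous_on_subset)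
  then have "bounded ((\<lambda>z. \<phi> (fst z) (snd z)) ` ({0..T} \<times> {0..2 * pi}))" by (rule compact_imp_bounded)
  then obtain C where C: "\<And>z. z \<in> {0..T} \<times> {0..2 * pi} \<Longrightarrow> norm (\<phi> (fst z) (snd z)) \<le> C"
    unfolding bounded_iff by blast
  have "\<bar>\<phi> t x\<bar> \<le> C" if "t \<in> {0..T}" for t x
  proof -
    have "\<phi> t (wrap x) = \<phi> t x"
      using test_function_periodic[OF assms] by (intro periodic_wrap) (simp add: periodic_def)
    then show ?thesis using C[of "(t, wrap x)"] that wrap_mem[of x] by simp
  qed
  then show ?thesis by (rule that)
qed

text \<open>\<open>h (x - \<sigma> * t)\<close> solves the transport equation weakly, with
  \<open>h\<close> merely bounded. In the variable \<open>y = x - \<sigma> * t\<close> the other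
  factor is the time derivative of \<open>\<phi>\<close> along the characteristic, and
  \<open>\<phi>\<close> vanishes at both end times.\<close>

lemma transport_weak:
  assumes h: "bounded_borel h" "periodic h" and \<phi>: "test_function T \<phi>" and T: "T > 0"
  shows "set_lebesgue_integral lebesgue ({0..T} \<times> {0..2 * pi})
    (\<lambda>(t, x). h (x - \<sigma> * t) * (dt \<phi> t x + \<sigma> * dx \<phi> t x)) = 0"
proof -
  note [measurable] = bounded_borel_measurable[OF h(1)]
    borel_measurable_continuous_onI[OF test_function_continuous[OF test_function_dt[OF \<phi>]]]
    borel_measurable_continuous_onI[OF test_function_continuous[OF test_function_dx[OF \<phi>]]]
  obtain B where B: "\<And>x. \<bar>h x\<bar> \<le> B" using h(1) by (auto simp: bounded_borel_def)
  obtain C1 C2 where C12: "\<And>t x. t \<in> {0..T} \<Longrightarrow> \<bar>dt \<phi> t x\<bar> \<le> C1" "\<And>t x. t \<in> {0..T} \<Longrightarrow> \<bar>dx \<phi> t x\<bar> \<le> C2"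
    using test_function_bounded[OF test_function_dt[OF \<phi>]] test_function_bounded[OF test_function_dx[OF \<phi>]] by metis
  define \<psi> where "\<psi> z = dt \<phi> (fst z) (snd z) + \<sigma> * dx \<phi> (fst z) (snd z)" for z
  have [measurable]: "\<psi> \<in> borel_measurable borel" unfolding \<psi>_def by measurable
  have \<psi>_bound: "\<bar>\<psi> (t, x)\<bar> \<le> C1 + \<bar>\<sigma>\<bar> * C2" if "t \<in> {0..T}" for t x
  proof -
    have "\<bar>\<psi> (t, x)\<bar> \<le> \<bar>dt \<phi> t x\<bar> + \<bar>\<sigma>\<bar> * \<bar>dx \<phi> t x\<bar>" by (simp add: \<psi>_def flip: abs_mult)
    also have "\<dots> \<le> C1 + \<bar>\<sigma>\<bar> * C2" using C12 that by (intro add_mono mult_left_mono) auto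
    finally show ?thesis .
  qed
  have bound: "\<bar>h y * \<psi> (t, x)\<bar> \<le> B * (C1 + \<bar>\<sigma>\<bar> * C2)" if "t \<in> {0..T}" for t x y
    unfolding abs_mult using B[of y] \<psi>_bound[OF that, of x] abs_ge_zero[of "h y"] by (intro mult_mono) auto
  have "set_lebesgue_integral lebesgue ({0..T} \<times> {0..2 * pi}) (\<lambda>(t, x). h (x - \<sigma> * t) * (dt \<phi> t x + \<sigma> * dx \<phi> t x)) =
    set_lebesgue_integral lebesgue ({0..T} \<times> {0..2 * pi}) (\<lambda>z. h (snd z - \<sigma> * fst z) * \<psi> z)"
    by (simp add: \<psi>_def split_def)
  also have "\<dots> = (LINT t:{0..T}|lborel. \<integral>x. h (x - \<sigma> * t) * \<psi> (t, x) \<partial>torus)"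
    using bound by (subst plane_integral_bounded(2)[where C = "B * (C1 + \<bar>\<sigma>\<bar> * C2)"]) auto
  also have "\<dots> = (LINT t:{0..T}|lborel. \<integral>y. h y * \<psi> (t, y + \<sigma> * t) \<partial>torus)"
  proof (rule set_lebesgue_integral_cong)
    show "\<forall>t. t \<in> {0..T} \<longrightarrow> (\<integral>x. h (x - \<sigma> * t) * \<psi> (t, x) \<partial>torus) = (\<integral>y. h y * \<psi> (t, y + \<sigma> * t) \<partial>torus)"
    proof (intro allI impI)
      fix t assume t: "t \<in> {0..T}"
      have "\<psi> (t, x + 2 * pi) = \<psi> (t, x)" for x
        using test_function_periodic[OF test_function_dt[OF \<phi>]] test_function_periodic[OF test_function_dx[OF \<phi>]]
        by (simp add: \<psi>_def periodic_def)
      moreover have "h (x + 2 * pi - \<sigma> * t) = h (x - \<sigma> * t)" for x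
        using h(2)[unfolded periodic_def, rule_format, of "x - \<sigma> * t"] by (simp add: algebra_simps)
      ultimately have "periodic (\<lambda>x. h (x - \<sigma> * t) * \<psi> (t, x))" by (simp add: periodic_def)
      moreover have "integrable torus (\<lambda>x. h (x - \<sigma> * t) * \<psi> (t, x))"
        by (rule torus.integrable_const_bound[where B = "B * (C1 + \<bar>\<sigma>\<bar> * C2)"]) (use bound[OF t] in auto)
      ultimately show "(\<integral>x. h (x - \<sigma> * t) * \<psi> (t, x) \<partial>torus) = (\<integral>y. h y * \<psi> (t, y + \<sigma> * t) \<partial>torus)"
        using integral_torus_shift(2)[of "\<lambda>x. h (x - \<sigma> * t) * \<psi> (t, x)" "\<sigma> * t"] by simp
    qed
  qed simp
  also have "\<dots> = set_lebesgue_integral lebesgue ({0..T} \<times> {0..2 * pi}) (\<lambda>z. h (snd z) * \<psi> (fst z, snd z + \<sigma> * fst z))"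
    using bound by (subst plane_integral_bounded(2)[where C = "B * (C1 + \<bar>\<sigma>\<bar> * C2)"]) auto
  also have "\<dots> = (\<integral>y. (LINT t:{0..T}|lborel. h y * \<psi> (t, y + \<sigma> * t)) \<partial>torus)"
    using bound by (subst plane_integral_bounded(3)[where C = "B * (C1 + \<bar>\<sigma>\<bar> * C2)"]) auto
  also have "\<dots> = (\<integral>y. 0 \<partial>torus)"
  proof (rule Bochner_Integration.integral_cong[OF refl])
    fix y
    have "(LINT t:{0..T}|lborel. \<psi> (t, y + \<sigma> * t)) = \<phi> T (y + \<sigma> * T) - \<phi> 0 (y + \<sigma> * 0)"
      unfolding set_lebesgue_integral_def
    proof (rule integral_FTC_Icc)
      fix t
      show "((\<lambda>t. \<phi> t (y + \<sigma> * t)) has_vector_derivative \<psi> (t, y + \<sigma> * t)) (at t within {0..T})"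
        using test_function_along_line[OF \<phi>, of y \<sigma> t]
        by (simp add: \<psi>_def has_real_derivative_iff_has_vector_derivative has_vector_derivative_at_within)
    next
      have "continuous_on UNIV \<psi>"
        unfolding \<psi>_def
        by (intro continuous_intros test_function_continuous[OF test_function_dt[OF \<phi>]]
            test_function_continuous[OF test_function_dx[OF \<phi>]])
      then show "continuous_on {0..T} (\<lambda>t. \<psi> (t, y + \<sigma> * t))"
        by (rule continuous_on_compose2) (auto intro!: continuous_intros)
    qed (use T in simp)
    then show "(LINT t:{0..T}|lborel. h y * \<psi> (t, y + \<sigma> * t)) = 0"
      using test_function_boundary[OF \<phi>] by simp
  qed
  finally show ?thesis by simp
qed

text \<open>The data of an explicit solution; \<open>mean\<close> is the condition under which it is
  periodic in space.\<close>

locale travelling_waves =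
  fixes T :: real and f g F H :: "real \<Rightarrow> real"
  assumes T: "T > 0" and f: "bounded_borel f" "periodic f" and g: "bounded_borel g" "periodic g"
    and mean: "(\<integral>x. f x \<partial>torus) = (\<integral>x. g x \<partial>torus)"
    and F: "primitive F f" and H: "primitive H g"
begin

text \<open>The minus sign in front of \<open>H\<close> makes the time derivative
  \<open>v = f(x + t) + g(x - t)\<close>; the space derivative is then \<open>w\<close>.\<close>

definition u :: "real \<Rightarrow> real \<Rightarrow> real" where "u t x = F (x + t) - H (x - t)"
definition v :: "real \<Rightarrow> real \<Rightarrow> real" where "v t x = f (x + t) + g (x - t)"
definition w :: "real \<Rightarrow> real \<Rightarrow> real" where "w t x = f (x + t) - g (x - t)"

lemma f_shift: "bounded_borel (\<lambda>x. f (x + t))" "periodic (\<lambda>x. f (x + t))"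
  and g_shift: "bounded_borel (\<lambda>x. g (x - t))" "periodic (\<lambda>x. g (x - t))"
proof -
  show "bounded_borel (\<lambda>x. f (x + t))" "bounded_borel (\<lambda>x. g (x - t))"
    using bounded_borel_shift[OF f(1), of t] bounded_borel_shift[OF g(1), of "- t"] by simp_all
  have "f (x + 2 * pi + t) = f (x + t)" "g (x + 2 * pi - t) = g (x - t)" for x
    using f(2)[unfolded periodic_def, rule_format, of "x + t"] g(2)[unfolded periodic_def, rule_format, of "x - t"]
    by (simp_all add: algebra_simps)
  then show "periodic (\<lambda>x. f (x + t))" "periodic (\<lambda>x. g (x - t))" by (simp_all add: periodic_def)
qed

lemma v_bounded: "bounded_borel (v t)" "periodic (v t)"
  and w_bounded: "bounded_borel (w t)" "periodic (w t)"
  unfolding v_def w_def using f_shift g_shift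
  by (auto intro!: bounded_borel_add bounded_borel_diff simp: periodic_def)

lemma u_primitive_x: "primitive (u t) (w t)"
  unfolding u_def w_def
  using primitive_diff[OF primitive_shift[OF F, of t] primitive_shift[OF H, of "- t"]] f_shift g_shift by simp

lemma u_primitive_t: "primitive (\<lambda>t. u t x) (\<lambda>t. v t x)"
proof -
  have "primitive (\<lambda>t. F (t + x) + - H (x - t)) (\<lambda>t. f (t + x) + g (x - t))"
    using bounded_borel_shift[OF f(1), of x] bounded_borel_affine[OF g(1), of x "-1"]
    by (intro primitive_add primitive_shift primitive_reflect F H) simp_all
  then show ?thesis by (simp add: u_def v_def add.commute)
qed

text \<open>The increment over a period is the integral of \<open>w\<close>, that is, the difference
  of the integrals of \<open>f\<close> and \<open>g\<close>.\<close>

lemma u_periodic: "periodic (u t)"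
  unfolding periodic_def
proof
  fix x
  have "u t (x + 2 * pi) - u t x = (LINT y:{x..x + 2 * pi}|lborel. w t y)"
    using u_primitive_x[of t] unfolding primitive_def by simp
  also have "\<dots> = (\<integral>y. w t y \<partial>torus)" by (rule integral_over_period[OF w_bounded])
  also have "\<dots> = (\<integral>y. f (y + t) \<partial>torus) - (\<integral>y. g (y - t) \<partial>torus)"
    unfolding w_def using f_shift[of t] g_shift[of t]
    by (intro Bochner_Integration.integral_diff sqint_integrable[OF torus.finite_measure_axioms] periodic_L2_sqint bounded_borel_periodic_L2)
  also have "\<dots> = 0"
  proof -
    have i: "integrable torus h" if "bounded_borel h" "periodic h" for h
      using that by (intro sqint_integrable[OF torus.finite_measure_axioms] periodic_L2_sqint bounded_borel_periodic_L2)
    have "(\<integral>y. f (y + t) \<partial>torus) = (\<integral>y. f y \<partial>torus)" "(\<integral>y. g (y + (- t)) \<partial>torus) = (\<integral>y. g y \<partial>torus)"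
      by (rule integral_torus_shift(2)[OF _ f(2) i[OF f]] integral_torus_shift(2)[OF _ g(2) i[OF g]];
          use f(1) g(1) in \<open>simp add: bounded_borel_def\<close>)+
    then show ?thesis using mean by simp
  qed
  finally show "u t (x + 2 * pi) = u t x" by simp
qed

lemma u_H1: "u t \<in> H1_torus" "has_weak_deriv (u t) (w t)"
  using primitive_has_weak_deriv[OF u_primitive_x w_bounded u_periodic] by auto

text \<open>\<open>c = 1\<close> serves the curve \<open>v\<close> and \<open>c = -1\<close> the
  space derivative \<open>w\<close>.\<close>

lemma sqrt_integral_two_translations:
  "((\<lambda>t. sqrt (\<integral>x. (f (x + t) + c * g (x - t) - (f (x + s) + c * g (x - s)))\<^sup>2 \<partial>torus)) \<longlongrightarrow> 0) (at s within S)"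
proof (rule tendsto_sandwich[OF _ _ tendsto_const])
  let ?a = "\<lambda>t. sqrt (\<integral>x. (f (x + t) - f (x + s))\<^sup>2 \<partial>torus)" and ?b = "\<lambda>t. sqrt (\<integral>x. (g (x - t) - g (x - s))\<^sup>2 \<partial>torus)"
  have "((\<lambda>t. ?a t + \<bar>c\<bar> * ?b t) \<longlongrightarrow> 0 + \<bar>c\<bar> * 0) (at s within S)"
    using translation_continuous_L2[OF f, of 1 s S] translation_continuous_L2[OF g, of "-1" s S]
    by (intro tendsto_intros) simp_all
  then show "((\<lambda>t. ?a t + \<bar>c\<bar> * ?b t) \<longlongrightarrow> 0) (at s within S)" by simp
  show "\<forall>\<^sub>F t in at s within S. sqrt (\<integral>x. (f (x + t) + c * g (x - t) - (f (x + s) + c * g (x - s)))\<^sup>2 \<partial>torus) \<le> ?a t + \<bar>c\<bar> * ?b t"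
  proof (intro always_eventually allI)
    fix t
    note sq = periodic_L2_sqint[OF bounded_borel_periodic_L2]
    have "sqrt (\<integral>x. (f (x + t) + c * g (x - t) - (f (x + s) + c * g (x - s)))\<^sup>2 \<partial>torus) =
      sqrt (\<integral>x. ((f (x + t) - f (x + s)) + c * (g (x - t) - g (x - s)))\<^sup>2 \<partial>torus)"
      by (simp add: algebra_simps)
    also have "\<dots> \<le> ?a t + sqrt (\<integral>x. (c * (g (x - t) - g (x - s)))\<^sup>2 \<partial>torus)"
      by (intro Minkowski_L2 sqint_cmult sqint_diff sq f_shift g_shift)
    also have "sqrt (\<integral>x. (c * (g (x - t) - g (x - s)))\<^sup>2 \<partial>torus) = \<bar>c\<bar> * ?b t"
      by (simp add: power_mult_distrib real_sqrt_mult)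
    finally show "sqrt (\<integral>x. (f (x + t) + c * g (x - t) - (f (x + s) + c * g (x - s)))\<^sup>2 \<partial>torus) \<le> ?a t + \<bar>c\<bar> * ?b t" .
  qed
qed (simp add: always_eventually Bochner_Integration.integral_nonneg)

lemma v_curve: "C_curve T L2_torus L2_norm v"
  unfolding C_curve_def
proof (intro ballI conjI)
  fix s
  have vL: "periodic_L2 (v t)" for t by (rule bounded_borel_periodic_L2[OF v_bounded])
  show "v s \<in> L2_torus" by (rule periodic_L2_imp_L2_torus[OF vL])
  have "L2_norm (\<lambda>x. v t x - v s x) = sqrt (\<integral>x. (f (x + t) + 1 * g (x - t) - (f (x + s) + 1 * g (x - s)))\<^sup>2 \<partial>torus)" for t
    using L2_norm_periodic_L2[OF periodic_L2_diff[OF vL[of t] vL[of s]]] by (simp add: v_def)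
  then show "((\<lambda>t. L2_norm (\<lambda>x. v t x - v s x)) \<longlongrightarrow> 0) (at s within {0..T})"
    using sqrt_integral_two_translations[of 1 s "{0..T}"] by simp
qed

lemma u_curve: "C_curve T H1_torus H1_norm u"
  unfolding C_curve_def
proof (intro ballI conjI u_H1(1))
  fix s assume s: "s \<in> {0..T}"
  obtain L1 where L1: "L1 \<ge> 0" "\<And>x y. \<bar>F x - F y\<bar> \<le> L1 * \<bar>x - y\<bar>" using primitive_Lipschitz[OF F f(1)] by blast
  obtain L2 where L2: "L2 \<ge> 0" "\<And>x y. \<bar>H x - H y\<bar> \<le> L2 * \<bar>x - y\<bar>" using primitive_Lipschitz[OF H g(1)] by blast
  have le: "\<bar>u t x - u s x\<bar> \<le> (L1 + L2) * \<bar>t - s\<bar>" for t x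
    using L1(2)[of "x + t" "x + s"] L2(2)[of "x - t" "x - s"] by (simp add: u_def distrib_right abs_minus_commute)
  have p: "primitive (\<lambda>x. u t x - u s x) (\<lambda>x. w t x - w s x)" for t
    by (intro primitive_diff u_primitive_x w_bounded)
  have wb: "bounded_borel (\<lambda>x. w t x - w s x)" "periodic (\<lambda>x. w t x - w s x)" for t
    using w_bounded[of t] w_bounded[of s] by (auto intro!: bounded_borel_diff simp: periodic_def)
  have uper: "periodic (\<lambda>x. u t x - u s x)" for t using u_periodic by (simp add: periodic_def)
  have uL: "periodic_L2 (\<lambda>x. u t x - u s x)" for t
    by (rule periodic_L2_bounded[OF borel_measurable_continuous_onI[OF primitive_continuous[OF p wb(1)]] uper le])
  let ?W = "\<lambda>t. sqrt (\<integral>x. (f (x + t) + (-1) * g (x - t) - (f (x + s) + (-1) * g (x - s)))\<^sup>2 \<partial>torus)"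
  have W: "L2_norm (weak_deriv (\<lambda>x. u t x - u s x)) = ?W t" for t
    using L2_norm_weak_deriv[OF primitive_has_weak_deriv(1)[OF p wb uper] bounded_borel_periodic_L2[OF wb]]
    by (simp add: w_def)
  have U: "L2_norm (\<lambda>x. u t x - u s x) \<le> sqrt (2 * pi) * \<bar>(L1 + L2) * \<bar>t - s\<bar>\<bar>" for t
    unfolding L2_norm_periodic_L2[OF uL] by (rule integral_square_torus_le[OF periodic_L2_sqint[OF uL] le])
  have "((\<lambda>t. sqrt (2 * pi) * \<bar>(L1 + L2) * \<bar>t - s\<bar>\<bar>) \<longlongrightarrow> sqrt (2 * pi) * \<bar>(L1 + L2) * \<bar>s - s\<bar>\<bar>) (at s within {0..T})"
    by (intro tendsto_intros)
  then have "((\<lambda>t. sqrt (2 * pi) * \<bar>(L1 + L2) * \<bar>t - s\<bar>\<bar>) \<longlongrightarrow> 0) (at s within {0..T})" by simp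
  then have U0: "((\<lambda>t. L2_norm (\<lambda>x. u t x - u s x)) \<longlongrightarrow> 0) (at s within {0..T})"
    by (rule tendsto_sandwich[where f = "\<lambda>_. 0", OF always_eventually always_eventually tendsto_const, rotated 2])
       (simp_all add: U L2_norm_nonneg)
  have "((\<lambda>t. sqrt ((L2_norm (\<lambda>x. u t x - u s x))\<^sup>2 + (?W t)\<^sup>2)) \<longlongrightarrow> sqrt (0\<^sup>2 + 0\<^sup>2)) (at s within {0..T})"
    by (intro tendsto_intros U0 sqrt_integral_two_translations)
  then show "((\<lambda>t. H1_norm (\<lambda>x. u t x - u s x)) \<longlongrightarrow> 0) (at s within {0..T})"
    unfolding H1_norm_def W by simp
qed

lemma u_continuous: "continuous_on UNIV (\<lambda>z. u (fst z) (snd z))"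
  unfolding u_def
  by (intro continuous_intros continuous_on_compose2[OF primitive_continuous[OF F f(1)]]
      continuous_on_compose2[OF primitive_continuous[OF H g(1)]]) auto

lemma measurable_waves [measurable]:
  "f \<in> borel_measurable borel" "g \<in> borel_measurable borel"
  "(\<lambda>z. u (fst z) (snd z)) \<in> borel_measurable borel" "(\<lambda>z. v (fst z) (snd z)) \<in> borel_measurable borel"
  "(\<lambda>z. w (fst z) (snd z)) \<in> borel_measurable borel"
proof -
  show [measurable]: "f \<in> borel_measurable borel" "g \<in> borel_measurable borel"
    using f(1) g(1) by (simp_all add: bounded_borel_def)
  show "(\<lambda>z. u (fst z) (snd z)) \<in> borel_measurable borel"
    by (rule borel_measurable_continuous_onI[OF u_continuous])
  show "(\<lambda>z. v (fst z) (snd z)) \<in> borel_measurable borel" "(\<lambda>z. w (fst z) (snd z)) \<in> borel_measurable borel"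
    unfolding v_def w_def by measurable
qed

lemma waves_bounded:
  obtains B where "\<forall>t x. \<bar>v t x\<bar> \<le> B" "\<forall>t x. \<bar>w t x\<bar> \<le> B"
    "\<forall>t\<in>{0..T}. \<forall>x. \<bar>u t x\<bar> \<le> B"
proof -
  obtain B1 B2 where B: "\<And>x. \<bar>f x\<bar> \<le> B1" "\<And>x. \<bar>g x\<bar> \<le> B2" using f(1) g(1) by (auto simp: bounded_borel_def)
  have "compact ((\<lambda>z. u (fst z) (snd z)) ` ({0..T} \<times> {0..2 * pi}))"
    using u_continuous by (intro compact_continuous_image compact_Times) (auto intro: continuous_on_subset)
  then have "bounded ((\<lambda>z. u (fst z) (snd z)) ` ({0..T} \<times> {0..2 * pi}))" by (rule compact_imp_bounded)
  then obtain C where C: "\<And>z. z \<in> {0..T} \<times> {0..2 * pi} \<Longrightarrow> norm (u (fst z) (snd z)) \<le> C"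
    unfolding bounded_iff by blast
  have "\<bar>u t x\<bar> \<le> C" if "t \<in> {0..T}" for t x
    using C[of "(t, wrap x)"] that wrap_mem[of x] periodic_wrap[of "u t" x] u_periodic[of t] by (simp add: periodic_def)
  moreover have "\<bar>v t x\<bar> \<le> B1 + B2" "\<bar>w t x\<bar> \<le> B1 + B2" for t x
    using B(1)[of "x + t"] B(2)[of "x - t"] unfolding v_def w_def by linarith+
  ultimately show ?thesis by (intro that[of "max C (B1 + B2)"]) (auto simp: le_max_iff_disj)
qed

lemma test_product:
  assumes \<phi>: "test_function T \<phi>" and m: "(\<lambda>z. h (fst z) (snd z)) \<in> borel_measurable borel"
    and B': "\<forall>t\<in>{0..T}. \<forall>x. \<bar>h t x\<bar> \<le> B"
  shows "(\<lambda>z. h (fst z) (snd z) * \<phi> (fst z) (snd z)) \<in> borel_measurable borel"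
    "\<exists>C. \<forall>z\<in>{0..T} \<times> {0..2 * pi}. \<bar>h (fst z) (snd z) * \<phi> (fst z) (snd z)\<bar> \<le> C"
proof -
  show "(\<lambda>z. h (fst z) (snd z) * \<phi> (fst z) (snd z)) \<in> borel_measurable borel"
    by (intro borel_measurable_times m borel_measurable_continuous_onI[OF test_function_continuous[OF \<phi>]])
  obtain C where C: "\<And>t x. t \<in> {0..T} \<Longrightarrow> \<bar>\<phi> t x\<bar> \<le> C" using test_function_bounded[OF \<phi>] by blast
  have "\<bar>h (fst z) (snd z) * \<phi> (fst z) (snd z)\<bar> \<le> B * C" if "z \<in> {0..T} \<times> {0..2 * pi}" for z
  proof -
    have t: "fst z \<in> {0..T}" using that by auto
    show ?thesis unfolding abs_mult
      using B'[rule_format, OF t, of "snd z"] C[OF t, of "snd z"] abs_ge_zero[of "h (fst z) (snd z)"] by (intro mult_mono) auto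
  qed
  then show "\<exists>C. \<forall>z\<in>{0..T} \<times> {0..2 * pi}. \<bar>h (fst z) (snd z) * \<phi> (fst z) (snd z)\<bar> \<le> C" by blast
qed

lemma weak_time_derivative:
  assumes \<phi>: "test_function T \<phi>"
  shows "set_lebesgue_integral lebesgue ({0..T} \<times> {0..2 * pi}) (\<lambda>z. u (fst z) (snd z) * dt \<phi> (fst z) (snd z)) =
    - set_lebesgue_integral lebesgue ({0..T} \<times> {0..2 * pi}) (\<lambda>z. v (fst z) (snd z) * \<phi> (fst z) (snd z))"
proof -
  obtain B where B: "\<forall>t x. \<bar>v t x\<bar> \<le> B" "\<forall>t x. \<bar>w t x\<bar> \<le> B" "\<forall>t\<in>{0..T}. \<forall>x. \<bar>u t x\<bar> \<le> B"
    using waves_bounded by blast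
  note p1 = test_product[OF test_function_dt[OF \<phi>] measurable_waves(3) B(3)]
  have "\<forall>t\<in>{0..T}. \<forall>x. \<bar>v t x\<bar> \<le> B" using B(1) by blast
  note p2 = test_product[OF \<phi> measurable_waves(4) this]
  obtain C1 where C1: "\<forall>z\<in>{0..T} \<times> {0..2 * pi}. \<bar>u (fst z) (snd z) * dt \<phi> (fst z) (snd z)\<bar> \<le> C1" using p1(2) by blast
  obtain C2 where C2: "\<forall>z\<in>{0..T} \<times> {0..2 * pi}. \<bar>v (fst z) (snd z) * \<phi> (fst z) (snd z)\<bar> \<le> C2" using p2(2) by blast
  have "(LINT t:{0..T}|lborel. u t x * dt \<phi> t x) = - (LINT t:{0..T}|lborel. v t x * \<phi> t x)" for x
  proof -
    have "bounded_borel (\<lambda>t. v t x)"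
      using measurable_compose[OF _ measurable_waves(4), of "\<lambda>t. (t, x)" borel] B(1) unfolding bounded_borel_def by auto
    moreover have "continuous_on UNIV (\<lambda>t. dt \<phi> t x)"
      using continuous_on_compose2[OF test_function_continuous[OF test_function_dt[OF \<phi>]], of UNIV "\<lambda>t. (t, x)"]
      by (simp add: continuous_on_Pair)
    ultimately show ?thesis
      using primitive_by_parts[OF _ u_primitive_t[of x] _ test_function_dt_deriv[OF \<phi>, of x], of 0 T] T
        test_function_boundary[OF \<phi>] by simp
  qed
  then show ?thesis
    unfolding plane_integral_bounded(3)[where T = T, OF p1(1) C1] plane_integral_bounded(3)[where T = T, OF p2(1) C2]
    by simp
qed

lemma weak_space_derivative:
  assumes \<phi>: "test_function T \<phi>"
  shows "set_lebesgue_integral lebesgue ({0..T} \<times> {0..2 * pi}) (\<lambda>z. u (fst z) (snd z) * dx \<phi> (fst z) (snd z)) =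
    - set_lebesgue_integral lebesgue ({0..T} \<times> {0..2 * pi}) (\<lambda>z. w (fst z) (snd z) * \<phi> (fst z) (snd z))"
proof -
  obtain B where B: "\<forall>t x. \<bar>v t x\<bar> \<le> B" "\<forall>t x. \<bar>w t x\<bar> \<le> B" "\<forall>t\<in>{0..T}. \<forall>x. \<bar>u t x\<bar> \<le> B"
    using waves_bounded by blast
  note p1 = test_product[OF test_function_dx[OF \<phi>] measurable_waves(3) B(3)]
  have "\<forall>t\<in>{0..T}. \<forall>x. \<bar>w t x\<bar> \<le> B" using B(2) by blast
  note p2 = test_product[OF \<phi> measurable_waves(5) this]
  obtain C1 where C1: "\<forall>z\<in>{0..T} \<times> {0..2 * pi}. \<bar>u (fst z) (snd z) * dx \<phi> (fst z) (snd z)\<bar> \<le> C1" using p1(2) by blast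
  obtain C2 where C2: "\<forall>z\<in>{0..T} \<times> {0..2 * pi}. \<bar>w (fst z) (snd z) * \<phi> (fst z) (snd z)\<bar> \<le> C2" using p2(2) by blast
  have "(\<integral>x. u t x * dx \<phi> t x \<partial>torus) = - (\<integral>x. w t x * \<phi> t x \<partial>torus)" for t
  proof -
    have ct: "continuous_on UNIV (\<lambda>x. \<psi> t x)" if "test_function T \<psi>" for \<psi>
      using continuous_on_compose2[OF test_function_continuous[OF that], of UNIV "\<lambda>x. (t, x)"]
      by (simp add: continuous_on_Pair)
    have "u t (2 * pi) = u t 0" "\<phi> t (2 * pi) = \<phi> t 0"
      using u_periodic[of t] test_function_periodic[OF \<phi>, of t] by (auto simp: periodic_def dest: spec[of _ 0])
    then have "(LINT x:{0..2 * pi}|lborel. u t x * dx \<phi> t x) = - (LINT x:{0..2 * pi}|lborel. w t x * \<phi> t x)"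
      using primitive_by_parts[OF _ u_primitive_x[of t] w_bounded(1) test_function_dx_deriv[OF \<phi>, of t] ct[OF test_function_dx[OF \<phi>]], of 0 "2 * pi"]
      by simp
    moreover have "(\<lambda>x. u t x * dx \<phi> t x) \<in> borel_measurable borel" "(\<lambda>x. w t x * \<phi> t x) \<in> borel_measurable borel"
      using measurable_compose[OF _ p1(1), of "\<lambda>x. (t, x)" borel] measurable_compose[OF _ p2(1), of "\<lambda>x. (t, x)" borel] by auto
    ultimately show ?thesis by (simp add: integral_torus)
  qed
  then show ?thesis
    unfolding plane_integral_bounded(2)[where T = T, OF p1(1) C1] plane_integral_bounded(2)[where T = T, OF p2(1) C2]
    by (simp add: set_lebesgue_integral_def)
qed

text \<open>\<open>v\<close> and \<open>w\<close> are merely bounded, so a second integration by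
  parts is not possible. One integration leaves \<open>w\<close> against \<open>dx \<phi>\<close>
  and \<open>v\<close> against \<open>dt \<phi>\<close>; split into \<open>f\<close> and
  \<open>g\<close>, these cancel by the transport equations of slope -1 and 1.\<close>

lemma weak_wave_equation:
  assumes \<phi>: "test_function T \<phi>"
  shows "set_lebesgue_integral lebesgue ({0..T} \<times> {0..2 * pi})
    (\<lambda>z. u (fst z) (snd z) * (dt (dt \<phi>) (fst z) (snd z) - dx (dx \<phi>) (fst z) (snd z))) = 0"
proof -
  let ?J = "{0..T} \<times> {0..2 * pi} :: (real \<times> real) set"
  let ?I = "\<lambda>h \<psi>. set_lebesgue_integral lebesgue ?J (\<lambda>z. h (fst z) (snd z) * \<psi> (fst z) (snd z))"
  obtain B where B: "\<forall>t x. \<bar>v t x\<bar> \<le> B" "\<forall>t x. \<bar>w t x\<bar> \<le> B" "\<forall>t\<in>{0..T}. \<forall>x. \<bar>u t x\<bar> \<le> B"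
    using waves_bounded by blast
  obtain B1 B2 where B12: "\<And>x. \<bar>f x\<bar> \<le> B1" "\<And>x. \<bar>g x\<bar> \<le> B2" using f(1) g(1) by (auto simp: bounded_borel_def)
  let ?f = "\<lambda>t x. f (x + t)" and ?g = "\<lambda>t x. g (x - t)"
  have Bf: "\<forall>t\<in>{0..T}. \<forall>x. \<bar>?f t x\<bar> \<le> B1" and Bg: "\<forall>t\<in>{0..T}. \<forall>x. \<bar>?g t x\<bar> \<le> B2" using B12 by blast+
  have int: "set_integrable lebesgue ?J (\<lambda>z. h (fst z) (snd z) * \<psi> (fst z) (snd z))"
    if "test_function T \<psi>" "(\<lambda>z. h (fst z) (snd z)) \<in> borel_measurable borel" "\<forall>t\<in>{0..T}. \<forall>x. \<bar>h t x\<bar> \<le> C"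
    for h \<psi> C
  proof -
    note hyps = that
    obtain D where D: "\<forall>z\<in>?J. \<bar>h (fst z) (snd z) * \<psi> (fst z) (snd z)\<bar> \<le> D"
      using test_product(2)[of \<psi> h C, OF hyps] by blast
    show ?thesis by (rule plane_integral_bounded(1)[OF test_product(1)[of \<psi> h C, OF hyps] D])
  qed
  note tt = test_function_dt[OF test_function_dt[OF \<phi>]] and xx = test_function_dx[OF test_function_dx[OF \<phi>]]
  note t = test_function_dt[OF \<phi>] and x = test_function_dx[OF \<phi>]
  have mf: "(\<lambda>z. f (snd z + fst z)) \<in> borel_measurable borel" and mg: "(\<lambda>z. g (snd z - fst z)) \<in> borel_measurable borel"
    by measurable
  have "set_lebesgue_integral lebesgue ?J (\<lambda>z. u (fst z) (snd z) * (dt (dt \<phi>) (fst z) (snd z) - dx (dx \<phi>) (fst z) (snd z))) =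
      ?I u (dt (dt \<phi>)) - ?I u (dx (dx \<phi>))"
    using int[OF tt measurable_waves(3) B(3)] int[OF xx measurable_waves(3) B(3)] by (simp add: right_diff_distrib)
  also have "\<dots> = ?I w (dx \<phi>) - ?I v (dt \<phi>)"
    using weak_time_derivative[OF t] weak_space_derivative[OF x] by simp
  also have "?I w (dx \<phi>) = ?I ?f (dx \<phi>) - ?I ?g (dx \<phi>)"
    using int[OF x mf Bf] int[OF x mg Bg] by (simp add: w_def left_diff_distrib)
  also have "?I v (dt \<phi>) = ?I ?f (dt \<phi>) + ?I ?g (dt \<phi>)"
    using int[OF t mf Bf] int[OF t mg Bg] by (simp add: v_def distrib_right)
  finally have eq: "set_lebesgue_integral lebesgue ?J (\<lambda>z. u (fst z) (snd z) * (dt (dt \<phi>) (fst z) (snd z) - dx (dx \<phi>) (fst z) (snd z))) =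
     ?I ?f (dx \<phi>) - ?I ?g (dx \<phi>) - (?I ?f (dt \<phi>) + ?I ?g (dt \<phi>))" .
  have "?I ?f (dt \<phi>) - ?I ?f (dx \<phi>) = set_lebesgue_integral lebesgue ?J (\<lambda>(t, x). f (x - (-1) * t) * (dt \<phi> t x + (-1) * dx \<phi> t x))"
    using int[OF t mf Bf] int[OF x mf Bf] by (simp add: split_def right_diff_distrib)
  then have 1: "?I ?f (dt \<phi>) = ?I ?f (dx \<phi>)"
    unfolding transport_weak[OF f \<phi> T] by simp
  have "?I ?g (dt \<phi>) + ?I ?g (dx \<phi>) = set_lebesgue_integral lebesgue ?J (\<lambda>(t, x). g (x - 1 * t) * (dt \<phi> t x + 1 * dx \<phi> t x))"
    using int[OF t mg Bg] int[OF x mg Bg] by (simp add: split_def distrib_left)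
  then have 2: "?I ?g (dt \<phi>) = - ?I ?g (dx \<phi>)"
    unfolding transport_weak[OF g \<phi> T] by simp
  show ?thesis unfolding eq 1 2 by simp
qed

lemma wave_solution: "wave_solution T (u 0) (v 0) u v"
  unfolding wave_solution_def
proof (intro conjI allI impI u_curve v_curve)
  have strip: "{0..T} \<times> (UNIV :: real set) \<in> sets borel" by (intro borel_closed closed_Times) auto
  have m: "set_borel_measurable lebesgue ({0..T} \<times> UNIV) (\<lambda>(t, x). h t x)"
    if "(\<lambda>z. h (fst z) (snd z)) \<in> borel_measurable borel" for h :: "real \<Rightarrow> real \<Rightarrow> real"
  proof -
    have "(\<lambda>z. indicator ({0..T} \<times> UNIV) z *\<^sub>R h (fst z) (snd z)) \<in> borel_measurable lborel"
      using that strip by simp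
    then show ?thesis unfolding set_borel_measurable_def split_def by (rule measurable_completion)
  qed
  show "set_borel_measurable lebesgue ({0..T} \<times> UNIV) (\<lambda>(t, x). u t x)"
    "set_borel_measurable lebesgue ({0..T} \<times> UNIV) (\<lambda>(t, x). v t x)"
    by (intro m measurable_waves)+
qed (use weak_time_derivative weak_wave_equation in \<open>auto simp: split_def\<close>)

text \<open>The parallelogram identity for \<open>f - g\<close> and \<open>f + g\<close>.\<close>

lemma energy:
  "(L2_norm (weak_deriv (u 0)))\<^sup>2 + (L2_norm (v 0))\<^sup>2 = 2 * ((\<integral>x. (f x)\<^sup>2 \<partial>torus) + (\<integral>x. (g x)\<^sup>2 \<partial>torus))"
proof -
  have sq: "sqint torus f" "sqint torus g" by (intro periodic_L2_sqint bounded_borel_periodic_L2 f g)+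
  have "(L2_norm (weak_deriv (u 0)))\<^sup>2 = (\<integral>x. (f x - g x)\<^sup>2 \<partial>torus)"
    using L2_norm_weak_deriv[OF u_H1(2) bounded_borel_periodic_L2[OF w_bounded], of 0]
    by (simp add: w_def Bochner_Integration.integral_nonneg)
  moreover have "(L2_norm (v 0))\<^sup>2 = (\<integral>x. (f x + g x)\<^sup>2 \<partial>torus)"
    using L2_norm_periodic_L2[OF bounded_borel_periodic_L2[OF v_bounded], of 0]
    by (simp add: v_def Bochner_Integration.integral_nonneg)
  ultimately show ?thesis
    using integral_square_add_cmult[OF sq, of 1] integral_square_add_cmult[OF sq, of "-1"] by simp
qed

end

section \<open>Observability and the geometric conditions\<close>

lemma AE_lborel_translate:
  fixes P :: "real \<Rightarrow> bool"
  assumes "AE x in lborel. P x"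
  shows "AE x in lborel. P (c + x)"
proof -
  from assms obtain N where N: "{x \<in> space lborel. \<not> P x} \<subseteq> N" "emeasure lborel N = 0" "N \<in> sets lborel"
    by (rule AE_E)
  have [measurable]: "N \<in> sets borel" using N(3) by simp
  have "AE x in lborel. x \<notin> N" using N by (intro AE_not_in) auto
  then have "AE x in lborel. c + 1 * x \<notin> N" by (intro AE_borel_affine) auto
  then show ?thesis by eventually_elim (use N(1) in auto)
qed

text \<open>Observability, (GCC) and (OSC) see \<open>G\<close> only up to null sets, so the
  analysis runs on a Borel subset \<open>S\<close> whose complement in \<open>G\<close> lies in a
  Borel null set \<open>N\<close>.\<close>

locale observation_representative = observation_set T S for T S +
  fixes G N :: "(real \<times> real) set"
  assumes S_G: "S \<subseteq> G" and G_diff: "G - S \<subseteq> N" and N_null: "N \<in> null_sets lborel"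
    and G_strip: "G \<subseteq> {0..T} \<times> {0..2 * pi}" and G_lebesgue: "G \<in> sets lebesgue"
begin

lemma AE_G_iff_S: "AE z in lborel. z \<in> G \<longleftrightarrow> z \<in> S"
  using AE_not_in[OF N_null] by eventually_elim (use S_G G_diff in auto)

lemma integral_G_eq_observed:
  assumes f: "periodic_L2 f" and g: "periodic_L2 g"
    and v: "set_borel_measurable lebesgue ({0..T} \<times> UNIV) (\<lambda>(t, x). v t x)"
    and eq: "AE z in lborel. fst z \<in> {0..T} \<longrightarrow> v (fst z) (snd z) = f (snd z + fst z) + g (snd z - fst z)"
  shows "set_lebesgue_integral lebesgue G (\<lambda>(t, x). (v t x)\<^sup>2) = observed f g"
proof -
  note [measurable] = periodic_L2_measurable[OF f] periodic_L2_measurable[OF g]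
  let ?h = "\<lambda>z. indicator S z * (f (snd z + fst z) + g (snd z - fst z))\<^sup>2 :: real"
  have h: "?h \<in> borel_measurable lborel" by measurable
  have "(\<lambda>z. indicator G z * (indicator ({0..T} \<times> UNIV) z *\<^sub>R (case z of (t, x) \<Rightarrow> v t x))\<^sup>2) \<in> borel_measurable lebesgue"
    using v unfolding set_borel_measurable_def
    by (intro borel_measurable_times borel_measurable_power borel_measurable_indicator G_lebesgue)
  moreover have "(\<lambda>z. indicator G z * (indicator ({0..T} \<times> UNIV) z *\<^sub>R (case z of (t, x) \<Rightarrow> v t x))\<^sup>2) =
    (\<lambda>z. indicator G z *\<^sub>R (case z of (t, x) \<Rightarrow> (v t x)\<^sup>2))"
    using G_strip by (auto simp: fun_eq_iff indicator_def)
  ultimately have m: "(\<lambda>z. indicator G z *\<^sub>R (case z of (t, x) \<Rightarrow> (v t x)\<^sup>2)) \<in> borel_measurable lebesgue" by simp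
  have "AE z in lborel. indicator G z *\<^sub>R (case z of (t, x) \<Rightarrow> (v t x)\<^sup>2) = ?h z"
    using eq AE_G_iff_S
  proof eventually_elim
    case (elim z)
    then show ?case using G_strip by (cases z) (auto simp: indicator_def)
  qed
  then have "set_lebesgue_integral lebesgue G (\<lambda>(t, x). (v t x)\<^sup>2) = (\<integral>z. ?h z \<partial>lebesgue)"
    unfolding set_lebesgue_integral_def
    by (intro integral_cong_AE m measurable_completion[OF h] AE_completion)
  also have "\<dots> = (\<integral>z. ?h z \<partial>lborel)" by (rule integral_completion[OF h])
  also have "\<dots> = observed f g"
    unfolding observed_def on_set_def by (subst integral_density) auto
  finally show ?thesis .
qed

text \<open>By Fubini in sheared coordinates a planar null set meets almost every characteristic in
  a null set; periodising adds countably many translates of it.\<close>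

lemma char_meas_eq: "AE y in lborel. char_meas T G \<sigma> y = sqrt 2 * enn2real (char_emeasure T S \<sigma> y)"
proof -
  have [measurable]: "N \<in> sets borel" "periodize S \<in> sets borel" using N_null by auto
  have "AE y in lborel. \<forall>k::int. emeasure lborel {s. (s, 2 * pi * of_int k + y + \<sigma> * s) \<in> N} = 0"
    unfolding AE_all_countable by (intro allI AE_lborel_translate null_set_shear[OF N_null])
  then show ?thesis
  proof eventually_elim
    case (elim y)
    let ?A = "{s \<in> {0..T}. (s, y + \<sigma> * s) \<in> periodize G}" and ?B = "{s \<in> {0..T}. (s, y + \<sigma> * s) \<in> periodize S}"
    let ?N = "\<Union>k::int. {s. (s, 2 * pi * of_int k + y + \<sigma> * s) \<in> N}"
    have "?N \<in> null_sets lborel"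
      by (rule null_sets_UN) (use elim in \<open>auto simp: null_sets_def\<close>)
    moreover have "?A - ?B \<subseteq> ?N"
    proof
      fix s assume s: "s \<in> ?A - ?B"
      then obtain k :: int where k: "(s, y + \<sigma> * s + 2 * pi * of_int k) \<in> G" by (auto simp: periodize_def)
      moreover have "(s, y + \<sigma> * s + 2 * pi * of_int k) \<notin> S" using s by (auto simp: periodize_def)
      ultimately have "(s, y + \<sigma> * s + 2 * pi * of_int k) \<in> N" using G_diff by auto
      then show "s \<in> ?N" by (auto simp: add_ac)
    qed
    ultimately have null: "?A - ?B \<in> null_sets lebesgue"
      by (intro null_sets_completion_subset[OF _ null_sets_completionI])
    have B: "?B \<in> sets lborel" by measurable
    have A: "?B \<union> (?A - ?B) = ?A" using S_G by (auto simp: periodize_def)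
    have "measure lebesgue (?B \<union> (?A - ?B)) = measure lebesgue ?B"
      using emeasure_Un_null_set[OF sets_completionI_sets[OF B] null] by (simp only: measure_def)
    then have "measure lebesgue ?A = measure lebesgue ?B" unfolding A .
    also have "\<dots> = enn2real (char_emeasure T S \<sigma> y)"
      unfolding measure_completion[OF B] by (simp only: char_emeasure_def measure_def)
    finally show ?case by (simp add: char_meas_def)
  qed
qed

lemma GCC_imp_char_emeasure:
  assumes "GCC T G"
  obtains c where "c > 0" "AE y in torus. ennreal c \<le> char_emeasure T S 1 y"
    "AE y in torus. ennreal c \<le> char_emeasure T S (-1) y"
proof -
  obtain c0 where c0: "c0 > 0" and ae: "AE x in lborel. x \<in> {0..2 * pi} \<longrightarrow> char_meas T G 1 x \<ge> c0 \<and> char_meas T G (-1) x \<ge> c0"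
    using assms by (auto simp: GCC_def AE_completion_iff)
  have conv: "ennreal (c0 / sqrt 2) \<le> m" if "c0 \<le> sqrt 2 * enn2real m" for m
  proof -
    have "c0 / sqrt 2 \<le> enn2real m" using that by (simp add: field_simps)
    then have "ennreal (c0 / sqrt 2) \<le> ennreal (enn2real m)" by (rule ennreal_leI)
    then show ?thesis by (auto simp: ennreal_enn2real_if split: if_splits)
  qed
  have "AE y in torus. ennreal (c0 / sqrt 2) \<le> char_emeasure T S 1 y"
    unfolding AE_torus using ae char_meas_eq[of 1] by eventually_elim (auto intro: conv)
  moreover have "AE y in torus. ennreal (c0 / sqrt 2) \<le> char_emeasure T S (-1) y"
    unfolding AE_torus using ae char_meas_eq[of "-1"] by eventually_elim (auto intro: conv)
  ultimately show ?thesis using that[of "c0 / sqrt 2"] c0 by simp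
qed

lemma char_emeasure_imp_GCC:
  assumes c: "c > 0" and "AE y in torus. ennreal c \<le> char_emeasure T S 1 y"
    "AE y in torus. ennreal c \<le> char_emeasure T S (-1) y"
  shows "GCC T G"
proof -
  have conv: "c * sqrt 2 \<le> sqrt 2 * enn2real (char_emeasure T S \<sigma> y)" if "ennreal c \<le> char_emeasure T S \<sigma> y" for \<sigma> y
  proof -
    \<comment> \<open>\<open>enn2real\<close> sends infinity to 0 and is monotone only below it, so
      the bound by \<open>T\<close> is needed.\<close>
    have "char_emeasure T S \<sigma> y < top" using char_emeasure_le[of \<sigma> y] by (simp add: order.strict_trans1)
    then have "enn2real (ennreal c) \<le> enn2real (char_emeasure T S \<sigma> y)" using that by (rule enn2real_mono[rotated])
    then show ?thesis using c by simp
  qed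
  have "AE x in lborel. x \<in> {0..2 * pi} \<longrightarrow> char_meas T G 1 x \<ge> c * sqrt 2 \<and> char_meas T G (-1) x \<ge> c * sqrt 2"
    using assms(2,3)[unfolded AE_torus] char_meas_eq[of 1] char_meas_eq[of "-1"]
    by eventually_elim (auto dest: conv)
  then show ?thesis
    unfolding GCC_def AE_completion_iff using c by (intro exI[of _ "c * sqrt 2"]) simp
qed

text \<open>The half-open period matters: a set containing \<open>2 * pi\<close> but not 0 would
  have translates that \<open>wrap\<close> does not detect.\<close>

lemma mem_L_xi_iff: "A \<subseteq> {0..<2 * pi} \<Longrightarrow> (t, x) \<in> G \<Longrightarrow> (t, x) \<in> L_xi T A \<longleftrightarrow> wrap (x + t) \<in> A"
  and mem_L_eta_iff: "A \<subseteq> {0..<2 * pi} \<Longrightarrow> (t, x) \<in> G \<Longrightarrow> (t, x) \<in> L_eta T A \<longleftrightarrow> wrap (x - t) \<in> A"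
proof -
  have *: "(\<exists>a\<in>A. \<exists>k::int. y = a + 2 * pi * of_int k) \<longleftrightarrow> wrap y \<in> A" if A: "A \<subseteq> {0..<2 * pi}" for A y
  proof
    assume "\<exists>a\<in>A. \<exists>k::int. y = a + 2 * pi * of_int k"
    then obtain a and k :: int where a: "a \<in> A" "y = a + 2 * pi * of_int k" by blast
    have "wrap y = wrap a" unfolding a(2) by (rule periodic_of_int) (rule wrap_shift)
    also have "\<dots> = a" using a(1) A by (intro wrap_eq) auto
    finally show "wrap y \<in> A" using a(1) by simp
  next
    assume "wrap y \<in> A"
    moreover have "y = wrap y + 2 * pi * of_int \<lfloor>y / (2 * pi)\<rfloor>" by (simp add: wrap_def)
    ultimately show "\<exists>a\<in>A. \<exists>k::int. y = a + 2 * pi * of_int k" by blast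
  qed
  show "A \<subseteq> {0..<2 * pi} \<Longrightarrow> (t, x) \<in> G \<Longrightarrow> (t, x) \<in> L_xi T A \<longleftrightarrow> wrap (x + t) \<in> A"
    using *[of A "x + t"] G_strip by (auto simp: L_xi_def)
  show "A \<subseteq> {0..<2 * pi} \<Longrightarrow> (t, x) \<in> G \<Longrightarrow> (t, x) \<in> L_eta T A \<longleftrightarrow> wrap (x - t) \<in> A"
    using *[of A "x - t"] G_strip by (auto simp: L_eta_def)
qed

text \<open>(OSC) in the form that \<open>unique_continuation\<close> asks for: Borel pairs in the
  half-open period, with symmetry and triviality stated almost everywhere.\<close>

lemma OSC_imp_trivial:
  assumes osc: "OSC T G" and A: "A \<in> sets borel" "A \<subseteq> {0..<2 * pi}" and B: "B \<in> sets borel" "B \<subseteq> {0..<2 * pi}"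
    and sym: "AE z in on_set S. wrap (snd z + fst z) \<in> A \<longleftrightarrow> wrap (snd z - fst z) \<in> B"
  shows "(AE x in torus. x \<notin> A) \<and> (AE x in torus. x \<notin> B) \<or> (AE x in torus. x \<in> A) \<and> (AE x in torus. x \<in> B)"
proof -
  have "AE z in lborel. z \<notin> sym_diff (G \<inter> L_xi T A) (G \<inter> L_eta T B)"
    using sym[unfolded AE_on_set[OF G_borel]] AE_G_iff_S
  proof eventually_elim
    case (elim z)
    obtain t x where z: "z = (t, x)" by (cases z)
    show ?case
      using elim mem_L_xi_iff[OF A(2), of t x] mem_L_eta_iff[OF B(2), of t x] unfolding z by auto
  qed
  then have "AE z in lebesgue. z \<notin> sym_diff (G \<inter> L_xi T A) (G \<inter> L_eta T B)" by (rule AE_completion)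
  then have "{z \<in> space lebesgue. \<not> z \<notin> sym_diff (G \<inter> L_xi T A) (G \<inter> L_eta T B)} \<in> null_sets lebesgue"
    by (simp only: completion.AE_iff_null_sets)
  moreover have "{z \<in> space lebesgue. \<not> z \<notin> X} = X" for X :: "(real \<times> real) set" by auto
  ultimately have "observable_symmetric T G A B"
    unfolding observable_symmetric_def by (simp only:)
  have "trivial_pair A B"
  proof -
    have "A \<in> sets lebesgue" "B \<in> sets lebesgue" using A(1) B(1) by simp_all
    moreover have "A \<subseteq> {0..2 * pi}" "B \<subseteq> {0..2 * pi}" using A(2) B(2) by auto
    ultimately show ?thesis using osc \<open>observable_symmetric T G A B\<close> unfolding OSC_def by blast
  qed
  moreover have null: "AE x in torus. x \<notin> C" if "C \<in> sets borel" "C \<subseteq> {0..<2 * pi}" "measure lebesgue C = 0" for C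
  proof -
    have C: "C \<subseteq> {0..2 * pi}" using that(2) by auto
    have "emeasure torus C = emeasure lborel C" using C that(1) by (simp add: emeasure_torus Int_absorb2)
    moreover have "measure lborel C = 0" using that by simp
    ultimately have "measure torus C = 0" by (simp add: measure_def)
    then have "emeasure torus C = 0" by (simp add: torus.emeasure_eq_measure)
    then show ?thesis using that(1) by (intro AE_not_in) auto
  qed
  moreover have full: "AE x in torus. x \<in> C" if "C \<in> sets borel" "C \<subseteq> {0..<2 * pi}" "measure lebesgue C = 2 * pi" for C
  proof -
    have C: "C \<subseteq> {0..2 * pi}" using that(2) by auto
    have "emeasure torus C = emeasure lborel C" using C that(1) by (simp add: emeasure_torus Int_absorb2)
    moreover have "measure lborel C = 2 * pi" using that by simp
    ultimately have "measure torus C = measure torus (space torus)"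
      unfolding space_torus measure_torus_UNIV by (simp add: measure_def)
    then have "measure torus (space torus - C) = 0"
      using that(1) by (subst torus.finite_measure_compl) simp_all
    then have "space torus - C \<in> null_sets torus"
      using that(1) by (simp add: null_sets_def torus.emeasure_eq_measure)
    then show ?thesis by (rule AE_not_in[THEN AE_mp]) simp
  qed
  ultimately show ?thesis
    unfolding trivial_pair_def using A B by blast
qed

lemma conditions_imp_observable:
  assumes osc: "OSC T G" and gcc: "GCC T G"
  shows "observable T G"
proof -
  obtain c where c: "c > 0" "AE y in torus. ennreal c \<le> char_emeasure T S 1 y"
    "AE y in torus. ennreal c \<le> char_emeasure T S (-1) y"
    using GCC_imp_char_emeasure[OF gcc] by blast
  have "\<exists>C>0. \<forall>f g. periodic_L2 f \<longrightarrow> periodic_L2 g \<longrightarrow> (\<integral>x. f x \<partial>torus) = (\<integral>x. g x \<partial>torus) \<longrightarrow>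
     (\<integral>x. (f x)\<^sup>2 \<partial>torus) + (\<integral>x. (g x)\<^sup>2 \<partial>torus) \<le> C * observed f g"
    by (rule coercive[OF _ c]) (rule OSC_imp_trivial[OF osc])
  then obtain C where C: "C > 0" "\<And>f g. periodic_L2 f \<Longrightarrow> periodic_L2 g \<Longrightarrow> (\<integral>x. f x \<partial>torus) = (\<integral>x. g x \<partial>torus) \<Longrightarrow>
     (\<integral>x. (f x)\<^sup>2 \<partial>torus) + (\<integral>x. (g x)\<^sup>2 \<partial>torus) \<le> C * observed f g" by blast
  have "(L2_norm (weak_deriv u0))\<^sup>2 + (L2_norm u1)\<^sup>2 \<le> 2 * C * set_lebesgue_integral lebesgue G (\<lambda>(t, x). (v t x)\<^sup>2)"
    if u0: "u0 \<in> H1_torus" and u1: "u1 \<in> L2_torus" and sol: "wave_solution T u0 u1 u v" for u0 u1 u v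
  proof -
    have wL: "weak_deriv u0 \<in> L2_torus" using weak_deriv_has[OF u0] by (simp add: has_weak_deriv_def)
    obtain d where d: "periodic_L2 d" "AE x in lborel. weak_deriv u0 x = d x" using L2_torus_version[OF wL] by blast
    obtain e where e: "periodic_L2 e" "AE x in lborel. u1 x = e x" using L2_torus_version[OF u1] by blast
    \<comment> \<open>The d'Alembert components for \<open>e = u1\<close> and
      \<open>d = \<partial>\<^sub>x u0\<close>; the sum is written as a difference so that the same
      closure lemma serves \<open>f\<close> and \<open>g\<close>.\<close>
    define f where "f x = 1/2 * (e x - (-1) * d x)" for x
    define g where "g x = 1/2 * (e x - d x)" for x
    have f: "periodic_L2 f" and g: "periodic_L2 g"
      unfolding f_def g_def by (intro periodic_L2_cmult periodic_L2_diff d e)+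
    note [measurable] = periodic_L2_measurable[OF f] periodic_L2_measurable[OF g]
    note sq = periodic_L2_sqint[OF e(1)] periodic_L2_sqint[OF d(1)]
    have de: "integrable torus d" "integrable torus e"
      by (intro sqint_integrable[OF torus.finite_measure_axioms] sq)+
    have mean: "(\<integral>x. f x \<partial>torus) = (\<integral>x. g x \<partial>torus)"
      using integral_weak_deriv_zero[OF u0 d] de by (simp add: f_def g_def)
    have "(\<integral>x. (f x)\<^sup>2 \<partial>torus) = 1/4 * (\<integral>x. (e x + 1 * d x)\<^sup>2 \<partial>torus)"
      "(\<integral>x. (g x)\<^sup>2 \<partial>torus) = 1/4 * (\<integral>x. (e x + (-1) * d x)\<^sup>2 \<partial>torus)"
      by (simp_all add: f_def g_def power_mult_distrib power_divide)
    then have "2 * ((\<integral>x. (f x)\<^sup>2 \<partial>torus) + (\<integral>x. (g x)\<^sup>2 \<partial>torus)) = (\<integral>x. (d x)\<^sup>2 \<partial>torus) + (\<integral>x. (e x)\<^sup>2 \<partial>torus)"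
      unfolding integral_square_add_cmult[OF sq] by simp
    then have energy: "(L2_norm (weak_deriv u0))\<^sup>2 + (L2_norm u1)\<^sup>2 = 2 * ((\<integral>x. (f x)\<^sup>2 \<partial>torus) + (\<integral>x. (g x)\<^sup>2 \<partial>torus))"
      using L2_torus_AE_eq(1)[OF d L2_torus_measurable[OF wL]] L2_torus_AE_eq(1)[OF e L2_torus_measurable[OF u1]] by simp
    have meas: "set_borel_measurable lebesgue ({0..T} \<times> UNIV) (\<lambda>(t, x). v t x)"
      using sol by (simp add: wave_solution_def)
    obtain W where [measurable]: "W \<in> borel_measurable borel"
      and W: "AE z in lborel. fst z \<in> {0..T} \<longrightarrow> v (fst z) (snd z) = W z"
      and sec: "AE t in lborel. t \<in> {0..T} \<longrightarrow> (AE x in lborel. v t x = W (t, x))"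
      using plane_version[OF meas] by blast
    \<comment> \<open>d'Alembert's formula holds at each time off a null set depending on that time.
      Passing to almost every point of the plane needs a measurable set, so \<open>v\<close> is
      first replaced by the Borel function \<open>W\<close>.\<close>
    have "AE t in lborel. AE x in lborel. fst (t, x) \<in> {0..T} \<longrightarrow> W (t, x) = f (snd (t, x) + fst (t, x)) + g (snd (t, x) - fst (t, x))"
      using sec
    proof eventually_elim
      case (elim t)
      show ?case
      proof (cases "t \<in> {0..T}")
        case True
        then have "AE x in lborel. v t x = W (t, x)" using elim by blast
        with dAlembert[OF T sol u0 True d e] show ?thesis
        proof eventually_elim
          case (elim x)
          then show ?case by (simp add: f_def g_def)
        qed
      next
        case False
        then show ?thesis by (intro AE_I2) auto
      qed
    qed
    moreover have "{z \<in> space (lborel \<Otimes>\<^sub>M lborel). fst z \<in> {0..T} \<longrightarrow> W z = f (snd z + fst z) + g (snd z - fst z)} \<in> sets (lborel \<Otimes>\<^sub>M lborel)"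
      unfolding lborel_prod by measurable
    ultimately have "AE z in lborel \<Otimes>\<^sub>M lborel. fst z \<in> {0..T} \<longrightarrow> W z = f (snd z + fst z) + g (snd z - fst z)"
      by (intro lborel_pair.AE_pair_measure)
    then have "AE z in lborel. fst z \<in> {0..T} \<longrightarrow> W z = f (snd z + fst z) + g (snd z - fst z)"
      unfolding lborel_prod .
    with W have "AE z in lborel. fst z \<in> {0..T} \<longrightarrow> v (fst z) (snd z) = f (snd z + fst z) + g (snd z - fst z)"
      by eventually_elim simp
    from integral_G_eq_observed[OF f g meas this] C(2)[OF f g mean] energy show ?thesis by simp
  qed
  then show ?thesis unfolding observable_def using C(1) by (intro exI[of _ "2 * C"]) simp
qed

section \<open>Necessity of (OSC) and (GCC)\<close>

lemma observable_imp_coercive: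
  assumes "observable T G"
  obtains C where "C > 0" "\<And>f g. bounded_borel f \<Longrightarrow> periodic f \<Longrightarrow> bounded_borel g \<Longrightarrow> periodic g \<Longrightarrow>
    (\<integral>x. f x \<partial>torus) = (\<integral>x. g x \<partial>torus) \<Longrightarrow>
    (\<integral>x. (f x)\<^sup>2 \<partial>torus) + (\<integral>x. (g x)\<^sup>2 \<partial>torus) \<le> C * observed f g"
proof -
  obtain C where C: "C > 0" "\<And>u0 u1 u v. u0 \<in> H1_torus \<Longrightarrow> u1 \<in> L2_torus \<Longrightarrow> wave_solution T u0 u1 u v \<Longrightarrow>
    (L2_norm (weak_deriv u0))\<^sup>2 + (L2_norm u1)\<^sup>2 \<le> C * set_lebesgue_integral lebesgue G (\<lambda>(t, x). (v t x)\<^sup>2)"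
    using assms unfolding observable_def by blast
  have "(\<integral>x. (f x)\<^sup>2 \<partial>torus) + (\<integral>x. (g x)\<^sup>2 \<partial>torus) \<le> C * observed f g"
    if fg: "bounded_borel f" "periodic f" "bounded_borel g" "periodic g" "(\<integral>x. f x \<partial>torus) = (\<integral>x. g x \<partial>torus)" for f g
  proof -
    \<comment> \<open>The initial data are read off from the explicit solution. Their energy is
      twice the squared norms of \<open>f\<close> and \<open>g\<close>, and this spare factor is
      dropped at the end.\<close>
    obtain F H where "primitive F f" "primitive H g" using primitive_exists fg(1,3) by metis
    then interpret W: travelling_waves T f g F H using T fg by unfold_locales
    have fL: "periodic_L2 f" "periodic_L2 g" using fg bounded_borel_periodic_L2 by auto
    have "set_lebesgue_integral lebesgue G (\<lambda>(t, x). (W.v t x)\<^sup>2) = observed f g"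
      using W.wave_solution by (intro integral_G_eq_observed fL) (auto simp: wave_solution_def W.v_def)
    moreover have "W.v 0 \<in> L2_torus"
      by (intro periodic_L2_imp_L2_torus bounded_borel_periodic_L2 W.v_bounded)
    ultimately have "2 * ((\<integral>x. (f x)\<^sup>2 \<partial>torus) + (\<integral>x. (g x)\<^sup>2 \<partial>torus)) \<le> C * observed f g"
      using C(2)[OF W.u_H1(1) _ W.wave_solution] W.energy by simp
    moreover have "(\<integral>x. (f x)\<^sup>2 \<partial>torus) \<ge> 0" "(\<integral>x. (g x)\<^sup>2 \<partial>torus) \<ge> 0"
      by (simp_all add: Bochner_Integration.integral_nonneg)
    ultimately show ?thesis by argo
  qed
  with C(1) show ?thesis by (rule that)
qed

lemma integral_wrap_indicator:
  assumes [measurable]: "A \<in> sets borel" and A: "A \<subseteq> {0..2 * pi}"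
  shows "(\<integral>x. indicator A (wrap x) \<partial>torus) = measure lborel A"
    "(\<integral>x. (indicator A (wrap x) - c)\<^sup>2 \<partial>torus) = measure lborel A * (1 - c)\<^sup>2 + (2 * pi - measure lborel A) * c\<^sup>2"
proof -
  have ind: "integrable torus (indicator A :: real \<Rightarrow> real)"
    by (rule torus.integrable_const_bound[where B = 1]) (auto simp: indicator_def)
  have m: "(\<integral>x. indicator A x \<partial>torus) = measure lborel A"
    using A by (simp add: measure_def emeasure_torus Int_absorb2)
  have "(\<integral>x. (indicator A (wrap x) :: real) \<partial>torus) = (\<integral>x. indicator A x \<partial>torus)"
    by (rule integral_cong_AE) (use AE_torus_wrap in auto)
  then show "(\<integral>x. indicator A (wrap x) \<partial>torus) = measure lborel A" using m by simp
  have "(\<integral>x. (indicator A (wrap x) - c)\<^sup>2 \<partial>torus) = (\<integral>x. ((1 - c)\<^sup>2 - c\<^sup>2) * indicator A x + c\<^sup>2 \<partial>torus)"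
  proof (rule integral_cong_AE)
    show "AE x in torus. (indicator A (wrap x) - c)\<^sup>2 = ((1 - c)\<^sup>2 - c\<^sup>2) * indicator A x + c\<^sup>2"
      using AE_torus_wrap by eventually_elim (auto simp: indicator_def)
  qed measurable
  also have "\<dots> = ((1 - c)\<^sup>2 - c\<^sup>2) * measure lborel A + 2 * pi * c\<^sup>2"
    using ind m by simp
  finally show "(\<integral>x. (indicator A (wrap x) - c)\<^sup>2 \<partial>torus) = measure lborel A * (1 - c)\<^sup>2 + (2 * pi - measure lborel A) * c\<^sup>2"
    by (simp add: algebra_simps)
qed

lemma wrap_indicator_bounded: "A \<in> sets borel \<Longrightarrow> bounded_borel (\<lambda>x. indicator A (wrap x))"
  unfolding bounded_borel_def by (auto intro!: exI[of _ 1] simp: indicator_def)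

lemma wrap_indicator_periodic: "periodic (\<lambda>x. indicator A (wrap x) :: real)"
  by (simp add: periodic_def wrap_shift)

text \<open>A Borel part of \<open>A\<close> describes its \<open>2 * pi\<close>-translates through
  \<open>wrap\<close>. The exceptional points are those wrapping into a null set, or to 0, where the
  endpoint \<open>2 * pi\<close> of \<open>A\<close> would be lost.\<close>

lemma lebesgue_set_representative:
  assumes A: "A \<in> sets lebesgue" "A \<subseteq> {0..2 * pi}"
  obtains A' where "A' \<in> sets borel" "A' \<subseteq> {0..2 * pi}" "measure lborel A' = measure lebesgue A"
    "AE y in lborel. (\<exists>a\<in>A. \<exists>k::int. y = a + 2 * pi * of_int k) \<longleftrightarrow> wrap y \<in> A'"
proof -
  obtain A' M M' where M: "A = A' \<union> M" "M \<subseteq> M'" "M' \<in> null_sets lborel" "A' \<in> sets lborel"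
    using A(1) by (rule sets_completionE)
  have [measurable]: "M' \<in> sets borel" "A' \<in> sets borel" using M by auto
  have "M \<in> null_sets lebesgue"
    by (rule null_sets_completion_subset[OF M(2) null_sets_completionI[OF M(3)]])
  then have "measure lebesgue A = measure lebesgue A'"
    using emeasure_Un_null_set[OF sets_completionI_sets[OF M(4)]] M(1) by (simp add: measure_def)
  then have meas: "measure lborel A' = measure lebesgue A" using M(4) by simp
  have ae: "AE y in lborel. (\<exists>a\<in>A. \<exists>k::int. y = a + 2 * pi * of_int k) \<longleftrightarrow> wrap y \<in> A'"
  proof -
    have "AE x in lborel. x \<notin> M'" "AE x in lborel. x \<noteq> (0::real)"
      by (rule AE_not_in[OF M(3)] AE_lborel_singleton)+
    then have "AE x in lborel. x \<in> {0..2 * pi} \<longrightarrow> x \<notin> M' \<and> x \<noteq> 0" by eventually_elim auto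
    then have "AE x in lborel. wrap x \<notin> M' \<and> wrap x \<noteq> 0" by (intro AE_wrap) auto
    then show ?thesis
    proof eventually_elim
      case (elim y)
      show ?case
      proof
        assume "\<exists>a\<in>A. \<exists>k::int. y = a + 2 * pi * of_int k"
        then obtain a and k :: int where a: "a \<in> A" "y = a + 2 * pi * of_int k" by blast
        have wa: "wrap y = wrap a" unfolding a(2) by (rule periodic_of_int) (rule wrap_shift)
        have "a \<noteq> 2 * pi"
        proof
          assume "a = 2 * pi"
          then have "wrap y = wrap (0 + 2 * pi)" using wa by simp
          also have "\<dots> = 0" unfolding wrap_shift by (simp add: wrap_eq)
          finally show False using elim by simp
        qed
        then have "wrap y = a" using wa a(1) A(2) wrap_eq[of a] by force
        then show "wrap y \<in> A'" using elim a(1) M(1,2) by auto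
      next
        assume "wrap y \<in> A'"
        moreover have "y = wrap y + 2 * pi * of_int \<lfloor>y / (2 * pi)\<rfloor>" by (simp add: wrap_def)
        ultimately show "\<exists>a\<in>A. \<exists>k::int. y = a + 2 * pi * of_int k" using M(1) by blast
      qed
    qed
  qed
  have sub: "A' \<subseteq> {0..2 * pi}" using A(2) M(1) by auto
  show ?thesis by (rule that[OF _ sub meas ae]) simp
qed

lemma observable_imp_OSC:
  assumes obs: "observable T G"
  shows "OSC T G"
  unfolding OSC_def
proof (intro allI impI notI, elim conjE)
  fix A B
  assume A: "A \<in> sets lebesgue" "A \<subseteq> {0..2 * pi}" and B: "B \<in> sets lebesgue" "B \<subseteq> {0..2 * pi}"
    and nontrivial: "\<not> trivial_pair A B" and sym: "observable_symmetric T G A B"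
  obtain C where C: "C > 0" "\<And>f g. bounded_borel f \<Longrightarrow> periodic f \<Longrightarrow> bounded_borel g \<Longrightarrow> periodic g \<Longrightarrow>
    (\<integral>x. f x \<partial>torus) = (\<integral>x. g x \<partial>torus) \<Longrightarrow>
    (\<integral>x. (f x)\<^sup>2 \<partial>torus) + (\<integral>x. (g x)\<^sup>2 \<partial>torus) \<le> C * observed f g"
    using observable_imp_coercive[OF obs] by blast
  obtain A' where A': "A' \<in> sets borel" "A' \<subseteq> {0..2 * pi}" "measure lborel A' = measure lebesgue A"
    "AE y in lborel. (\<exists>a\<in>A. \<exists>k::int. y = a + 2 * pi * of_int k) \<longleftrightarrow> wrap y \<in> A'"
    using lebesgue_set_representative[OF A] by blast
  obtain B' where B': "B' \<in> sets borel" "B' \<subseteq> {0..2 * pi}" "measure lborel B' = measure lebesgue B"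
    "AE y in lborel. (\<exists>a\<in>B. \<exists>k::int. y = a + 2 * pi * of_int k) \<longleftrightarrow> wrap y \<in> B'"
    using lebesgue_set_representative[OF B] by blast
  define \<alpha> \<beta> where "\<alpha> = measure lborel A'" and "\<beta> = measure lborel B'"
  \<comment> \<open>Solves \<open>\<alpha> - 2 * pi * c = - (\<beta> - 2 * pi * c)\<close>, the
    equality of the two means.\<close>
  define c where "c = (\<alpha> + \<beta>) / (4 * pi)"
  have le: "measure lborel E \<le> 2 * pi" if "E \<in> sets borel" "E \<subseteq> {0..2 * pi}" for E
  proof -
    have "measure lborel E = measure torus E" using that by (simp add: measure_def emeasure_torus Int_absorb2)
    also have "\<dots> \<le> 2 * pi" using torus.bounded_measure[of E] by simp
    finally show ?thesis .
  qed
  have \<alpha>: "0 \<le> \<alpha>" "\<alpha> \<le> 2 * pi" and \<beta>: "0 \<le> \<beta>" "\<beta> \<le> 2 * pi"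
    using le[OF A'(1,2)] le[OF B'(1,2)] by (simp_all add: \<alpha>_def \<beta>_def)
  define f g where "f x = indicator A' (wrap x) - c" and "g x = - (indicator B' (wrap x) - c)" for x
  have f: "bounded_borel f" "periodic f" and g: "bounded_borel g" "periodic g"
    unfolding f_def g_def
    using wrap_indicator_bounded[OF A'(1)] wrap_indicator_bounded[OF B'(1)]
    by (auto intro!: bounded_borel_minus bounded_borel_diff bounded_borel_const simp: periodic_def wrap_shift)
  have i: "integrable torus (\<lambda>x. indicator E (wrap x) :: real)" if "E \<in> sets borel" for E
    using wrap_indicator_bounded[OF that] wrap_indicator_periodic[of E]
    by (intro sqint_integrable[OF torus.finite_measure_axioms] periodic_L2_sqint bounded_borel_periodic_L2)
  have "(\<integral>x. f x \<partial>torus) = \<alpha> - 2 * pi * c" "(\<integral>x. g x \<partial>torus) = - (\<beta> - 2 * pi * c)"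
    using i[OF A'(1)] i[OF B'(1)] integral_wrap_indicator(1)[OF A'(1,2)] integral_wrap_indicator(1)[OF B'(1,2)]
    by (simp_all add: f_def g_def \<alpha>_def \<beta>_def)
  moreover have "4 * pi * c = \<alpha> + \<beta>" by (simp add: c_def)
  ultimately have mean: "(\<integral>x. f x \<partial>torus) = (\<integral>x. g x \<partial>torus)" by simp
  have "AE z in lebesgue. z \<notin> sym_diff (G \<inter> L_xi T A) (G \<inter> L_eta T B)"
    using sym unfolding observable_symmetric_def by (rule AE_not_in)
  then have "AE z in lborel. z \<notin> sym_diff (G \<inter> L_xi T A) (G \<inter> L_eta T B)" by (simp only: AE_completion_iff)
  with AE_shear[OF A'(4), of "-1"] AE_shear[OF B'(4), of 1]
  have "AE z in lborel. z \<in> S \<longrightarrow> f (snd z + fst z) + g (snd z - fst z) = 0"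
  proof eventually_elim
    case (elim z)
    show ?case
    proof
      assume z: "z \<in> S"
      then have G: "z \<in> G" and t: "fst z \<in> {0..T}" using S_G G_strip by auto
      have "wrap (snd z + fst z) \<in> A' \<longleftrightarrow> z \<in> L_xi T A"
        using elim(1) t by (cases z) (auto simp: L_xi_def)
      moreover have "wrap (snd z - fst z) \<in> B' \<longleftrightarrow> z \<in> L_eta T B"
        using elim(2) t by (cases z) (auto simp: L_eta_def)
      ultimately have "wrap (snd z + fst z) \<in> A' \<longleftrightarrow> wrap (snd z - fst z) \<in> B'" using elim(3) G by blast
      then show "f (snd z + fst z) + g (snd z - fst z) = 0" by (simp add: f_def g_def indicator_def)
    qed
  qed
  then have "AE z in on_set S. (f (snd z + fst z) + g (snd z - fst z))\<^sup>2 = 0"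
    unfolding AE_on_set[OF G_borel] by eventually_elim simp
  then have "observed f g = 0" unfolding observed_def by (rule integral_eq_zero_AE)
  then have "(\<integral>x. (f x)\<^sup>2 \<partial>torus) + (\<integral>x. (g x)\<^sup>2 \<partial>torus) \<le> 0" using C(2)[OF f g mean] by simp
  moreover have "(\<integral>x. (f x)\<^sup>2 \<partial>torus) = \<alpha> * (1 - c)\<^sup>2 + (2 * pi - \<alpha>) * c\<^sup>2"
    "(\<integral>x. (g x)\<^sup>2 \<partial>torus) = \<beta> * (1 - c)\<^sup>2 + (2 * pi - \<beta>) * c\<^sup>2"
    using integral_wrap_indicator(2)[OF A'(1,2)] integral_wrap_indicator(2)[OF B'(1,2)]
    by (simp_all add: f_def g_def \<alpha>_def \<beta>_def power2_commute)
  moreover have nn: "\<alpha> * (1 - c)\<^sup>2 \<ge> 0" "(2 * pi - \<alpha>) * c\<^sup>2 \<ge> 0" "\<beta> * (1 - c)\<^sup>2 \<ge> 0" "(2 * pi - \<beta>) * c\<^sup>2 \<ge> 0"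
    using \<alpha> \<beta> by simp_all
  ultimately have z: "\<alpha> * (1 - c)\<^sup>2 = 0" "(2 * pi - \<alpha>) * c\<^sup>2 = 0" "\<beta> * (1 - c)\<^sup>2 = 0" "(2 * pi - \<beta>) * c\<^sup>2 = 0"
    by linarith+
  \<comment> \<open>\<open>c = 0\<close> makes both measures vanish; otherwise the second and fourth
    equations force both to be \<open>2 * pi\<close>.\<close>
  have "(\<alpha> = 0 \<and> \<beta> = 0) \<or> (\<alpha> = 2 * pi \<and> \<beta> = 2 * pi)"
    using z by (cases "c = 0") (auto simp: c_def)
  then show False
    using nontrivial A'(3) B'(3) by (auto simp: trivial_pair_def \<alpha>_def \<beta>_def)
qed

text \<open>Countably many intervals of length \<open>d\<close> cover the line. The reduction is
  needed because the estimate behind (GCC) has a term quadratic in the measure of the set,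
  negligible only for small sets.\<close>

lemma null_set_small_pieces:
  fixes E :: "real set"
  assumes [measurable]: "E \<in> sets borel" and d: "d > 0"
    and pieces: "\<And>E'. E' \<in> sets borel \<Longrightarrow> E' \<subseteq> E \<Longrightarrow> measure lborel E' \<le> d \<Longrightarrow> emeasure lborel E' < \<infinity> \<Longrightarrow> measure lborel E' = 0"
  shows "E \<in> null_sets lborel"
proof -
  have "E \<inter> {of_int k * d..(of_int k + 1) * d} \<in> null_sets lborel" for k :: int
  proof -
    let ?I = "{of_int k * d..(of_int k + 1) * d}"
    have le: "emeasure lborel (E \<inter> ?I) \<le> emeasure lborel ?I" by (rule emeasure_mono) auto
    have I: "emeasure lborel ?I = ennreal d"
      using d by (subst emeasure_lborel_Icc) (auto simp: algebra_simps)
    have fin: "emeasure lborel (E \<inter> ?I) < \<infinity>" using le unfolding I by (simp add: order.strict_trans1)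
    have "measure lborel (E \<inter> ?I) \<le> d"
      using le d unfolding I measure_def by (metis enn2real_leI less_imp_le)
    then have "measure lborel (E \<inter> ?I) = 0" using fin by (intro pieces) auto
    then have "emeasure lborel (E \<inter> ?I) = 0"
      using fin by (auto simp: measure_def enn2real_eq_0_iff)
    then show ?thesis by (simp add: null_sets_def)
  qed
  then have "(\<Union>k::int. E \<inter> {of_int k * d..(of_int k + 1) * d}) \<in> null_sets lborel" by (intro null_sets_UN) auto
  moreover have "E = (\<Union>k::int. E \<inter> {of_int k * d..(of_int k + 1) * d})"
  proof -
    have "x \<in> {of_int \<lfloor>x / d\<rfloor> * d..(of_int \<lfloor>x / d\<rfloor> + 1) * d}" for x
      using d floor_divide_lower[OF d, of x] floor_divide_upper[OF d, of x] by simp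
    then show ?thesis by blast
  qed
  ultimately show ?thesis by simp
qed

lemma observable_imp_GCC:
  assumes obs: "observable T G"
  shows "GCC T G"
proof -
  obtain C where C: "C > 0" "\<And>f g. bounded_borel f \<Longrightarrow> periodic f \<Longrightarrow> bounded_borel g \<Longrightarrow> periodic g \<Longrightarrow>
    (\<integral>x. f x \<partial>torus) = (\<integral>x. g x \<partial>torus) \<Longrightarrow>
    (\<integral>x. (f x)\<^sup>2 \<partial>torus) + (\<integral>x. (g x)\<^sup>2 \<partial>torus) \<le> C * observed f g"
    using observable_imp_coercive[OF obs] by blast
  \<comment> \<open>The final estimate is \<open>e \<le> (C * T * e / pi + 2 * C * c) * e\<close>;
    \<open>c\<close> and the bound \<open>e \<le> d\<close> make each summand at most 1/4.\<close>
  define c where "c = 1 / (8 * C)"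
  define d where "d = pi / (4 * C * T)"
  have c: "c > 0" and d: "d > 0" using C(1) T by (simp_all add: c_def d_def)
  have "AE y in torus. ennreal c \<le> char_emeasure T S \<sigma> y" if \<sigma>: "\<sigma> = 1 \<or> \<sigma> = -1" for \<sigma>
  proof -
    define E where "E = {y \<in> {0..2 * pi}. char_emeasure T S \<sigma> y < ennreal c}"
    have E_borel [measurable]: "E \<in> sets borel" unfolding E_def by measurable
    have "E \<in> null_sets lborel"
    proof (rule null_set_small_pieces[OF E_borel d])
      fix E' assume [measurable]: "E' \<in> sets borel" and E': "E' \<subseteq> E" "measure lborel E' \<le> d"
      have sub: "E' \<subseteq> {0..2 * pi}" using E' by (auto simp: E_def)
      define e where "e = measure lborel E'"
      \<comment> \<open>The constant with the same mean as \<open>h\<close>; its observed energy is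
        of second order in \<open>e\<close>.\<close>
      define k where "k = e / (2 * pi)"
      define h where "h x = (indicator E' (wrap x) :: real)" for x
      have h: "bounded_borel h" "periodic h"
        unfolding h_def by (intro wrap_indicator_bounded wrap_indicator_periodic; simp)+
      have k: "bounded_borel (\<lambda>x. k)" "periodic (\<lambda>x. k)" by (simp_all add: bounded_borel_const periodic_def)
      have hL: "periodic_L2 h" and kL: "periodic_L2 (\<lambda>x. k)" using h k bounded_borel_periodic_L2 by auto
      note [measurable] = periodic_L2_measurable[OF hL]
      have int_h: "(\<integral>x. h x \<partial>torus) = e"
        unfolding h_def e_def by (rule integral_wrap_indicator(1)) (use sub in auto)
      have h2: "(h x)\<^sup>2 = h x" for x by (simp add: h_def indicator_def)
      have mean: "(\<integral>x. h x \<partial>torus) = (\<integral>x. k \<partial>torus)" unfolding int_h by (simp add: k_def)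
      have h_e: "(\<integral>x. (h x)\<^sup>2 \<partial>torus) = e" using int_h by (simp add: h2)
      have k0: "(\<integral>x. k\<^sup>2 \<partial>torus) \<ge> 0" by simp
      \<comment> \<open>\<open>Q\<close> is the observed energy with \<open>h\<close> in the
        component carried by the slope \<open>\<sigma>\<close> and the constant in the other; only
        this common bound is used, so both slopes are treated together.\<close>
      obtain Q where Q: "e \<le> C * Q"
        "Q \<le> 2 * (\<integral>z. k\<^sup>2 \<partial>on_set S) + 2 * (\<integral>z. (h (snd z - \<sigma> * fst z))\<^sup>2 \<partial>on_set S)"
      proof (cases "\<sigma> = 1")
        case True
        have "e \<le> C * observed (\<lambda>x. k) h"
          using C(2)[OF k h mean[symmetric]] k0 unfolding h_e by linarith
        moreover have "observed (\<lambda>x. k) h \<le> 2 * (\<integral>z. k\<^sup>2 \<partial>on_set S) + 2 * (\<integral>z. (h (snd z - \<sigma> * fst z))\<^sup>2 \<partial>on_set S)"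
          unfolding observed_def True mult_1
          by (rule integral_square_add_le[OF sqint_forward(1)[OF kL] sqint_backward(1)[OF hL]])
        ultimately show ?thesis by (rule that)
      next
        case False
        then have \<sigma>: "snd z - \<sigma> * fst z = snd z + fst z" for z :: "real \<times> real" using \<sigma> by simp
        have "e \<le> C * observed h (\<lambda>x. k)"
          using C(2)[OF h k mean] k0 unfolding h_e by linarith
        moreover have "observed h (\<lambda>x. k) \<le> 2 * (\<integral>z. (h (snd z + fst z))\<^sup>2 \<partial>on_set S) + 2 * (\<integral>z. k\<^sup>2 \<partial>on_set S)"
          unfolding observed_def
          by (rule integral_square_add_le[OF sqint_forward(1)[OF hL] sqint_backward(1)[OF kL]])
        ultimately show ?thesis unfolding \<sigma> by (intro that[of "observed h (\<lambda>x. k)"]) (simp_all only: \<sigma> add.commute)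
      qed
      have "(\<integral>z. k\<^sup>2 \<partial>on_set S) \<le> T * (\<integral>x. k\<^sup>2 \<partial>torus)" using sqint_forward(2)[OF kL] .
      also have "\<dots> = T * (e * e / (2 * pi))" by (simp add: k_def power2_eq_square)
      finally have 1: "(\<integral>z. k\<^sup>2 \<partial>on_set S) \<le> T * (e * e / (2 * pi))" .
      have "ennreal (\<integral>z. (h (snd z - \<sigma> * fst z))\<^sup>2 \<partial>on_set S) = (\<integral>\<^sup>+z. ennreal ((h (snd z - \<sigma> * fst z))\<^sup>2) \<partial>on_set S)"
        using sqint_on_set(1)[OF hL, of \<sigma>] by (intro nn_integral_eq_integral[symmetric]) (auto simp: sqint_def)
      also have "\<dots> = (\<integral>\<^sup>+y. ennreal ((h y)\<^sup>2) * char_emeasure T S \<sigma> y \<partial>torus)"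
        using h(2) by (intro nn_integral_on_set_characteristics) (auto simp: periodic_def)
      also have "\<dots> \<le> (\<integral>\<^sup>+y. ennreal (h y * c) \<partial>torus)"
      proof (rule nn_integral_mono_AE, use AE_torus_wrap in eventually_elim)
        case (elim y)
        have "char_emeasure T S \<sigma> y \<le> ennreal c" if "y \<in> E'" using that E'(1) by (auto simp: E_def)
        then show ?case using elim c by (auto simp: h_def indicator_def)
      qed
      also have "\<dots> = ennreal (\<integral>y. h y * c \<partial>torus)"
      proof (rule nn_integral_eq_integral)
        show "integrable torus (\<lambda>y. h y * c)"
          using sqint_integrable[OF torus.finite_measure_axioms periodic_L2_sqint[OF hL]] by simp
      qed (use c in \<open>simp add: h_def\<close>)
      also have "(\<integral>y. h y * c \<partial>torus) = c * e" using int_h by simp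
      finally have 2: "(\<integral>z. (h (snd z - \<sigma> * fst z))\<^sup>2 \<partial>on_set S) \<le> c * e"
        using c by (simp add: e_def)
      have "e \<ge> 0" "e \<le> d" using E'(2) by (simp_all add: e_def)
      have "e \<le> C * (2 * (T * (e * e / (2 * pi))) + 2 * (c * e))"
        using Q 1 2 C(1) by (meson add_mono mult_left_mono less_imp_le order_trans zero_le_numeral)
      also have "\<dots> = (C * T * e / pi + 2 * C * c) * e" using pi_gt_zero by (simp add: field_simps)
      also have "\<dots> \<le> (1/4 + 1/4) * e"
      proof (intro mult_right_mono add_mono)
        have "C * T * e / pi \<le> C * T * d / pi"
          using \<open>e \<le> d\<close> C(1) T by (intro divide_right_mono mult_left_mono) auto
        also have "\<dots> = 1/4" using C(1) T by (simp add: d_def)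
        finally show "C * T * e / pi \<le> 1/4" .
        show "2 * C * c \<le> 1/4" using C(1) by (simp add: c_def)
      qed fact
      finally have "e \<le> 0" by simp
      then show "measure lborel E' = 0" using \<open>e \<ge> 0\<close> unfolding e_def by (rule order.antisym)
    qed
    then have "AE y in lborel. y \<notin> E" by (rule AE_not_in)
    then show ?thesis unfolding AE_torus by eventually_elim (auto simp: E_def not_less)
  qed
  then show ?thesis by (intro char_emeasure_imp_GCC[OF c]) auto
qed

end

theorem theorem1p4:
  fixes T :: real and G :: "(real \<times> real) set"
  assumes "T > 0"
    and "G \<subseteq> {0..T} \<times> {0..2 * pi}"
    and "G \<in> sets lebesgue"
  shows "observable T G \<longleftrightarrow> OSC T G \<and> GCC T G"
proof -
  obtain S M N where S: "G = S \<union> M" "M \<subseteq> N" "N \<in> null_sets lborel" "S \<in> sets lborel"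
    using assms(3) by (rule sets_completionE)
  interpret observation_representative T S G N
    by unfold_locales (use assms S in auto)
  show ?thesis
    using conditions_imp_observable observable_imp_OSC observable_imp_GCC by blast
qed

end
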